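(* Consider the fixed step size case $\Delta t_n=\Delta t=T/N$, $t_n=n\Delta t$. Let $\Delta t$ satisfy $$\Delta t\Bigl(\frac1T+N^j\Bigr)\le\frac12,\qquad j=2,\ldots,n+1,$$ where $$N^j=4\Bigl(\tfrac12\|\nabla\boldsymbol s_h^{j}\|_\infty+\tfrac{9}{2\mu}\|\boldsymbol s_h^{j}\|_\infty^2+3\|\nabla\boldsymbol s_h^{j+1}\|_\infty+\tfrac32\|\nabla\boldsymbol s_h^{j+2}\|_\infty\Bigr)$$ (here the superscript $j$ in $N^j$ is an index, not a power, and terms $\|\nabla\boldsymbol s_h^{i}\|_\infty$ with $i>N$ are understood to be $0$). Then there exists a positive constant $h_0$ such that, for $h<h_0$, the error $\boldsymbol e_h^{n+1}=\boldsymbol s_h^{n+1}-\boldsymbol u_h^{n+1}$ of the semi-implicit method satisfies, for $1\le n\le N-1=T/\Delta t-1$, $$\|\boldsymbol e_h^{n+1}\|_0^2+\sum_{j=2}^{n+1}\nu\Delta t\|\nabla\boldsymbol e_h^j\|_0^2+\mu\sum_{j=2}^{n+1}\Delta t\|\nabla\cdot\boldsymbol e_h^j\|_0^2\le e^{8+2T\max_jN^j}\Bigl((C_0^2+TC_3^2)(\Delta t)^4+T(C_1^2h^{2k}+C_2^2h^{2l+2})\Bigr),$$ where $$C_0^2=C\bigl(\|\boldsymbol u_{tt}\|_{L^\infty(L^2)}^2+\|\boldsymbol u\|_{L^\infty(W^{1,\infty})}^2\|\boldsymbol u_t\|_{L^\infty(L^2)}^2+\|\boldsymbol u\|_{L^\infty(L^\infty)}^2\|\boldsymbol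 u_t\|_{L^\infty(H^1)}^2\bigr),$$ $$C_1^2=C\bigl(\|\boldsymbol u_t\|_{L^2(H^k)}^2+(\mu+T|\Omega|^{2/d}\|\boldsymbol u\|_{L^\infty(W^{1,\infty})}^2)\|\boldsymbol u\|_{L^\infty(H^{k+1})}^2\bigr),\qquad C_2^2=\frac{C}{\mu}\|p\|_{L^\infty(H^{l+1})}^2,$$ $$C_3^2=C\bigl(\|\boldsymbol u_{ttt}\|_{L^2(L^2)}^2+\|\boldsymbol u\|_{L^\infty(W^{1,\infty})}^2\|\boldsymbol u_{tt}\|_{L^2(L^2)}^2+\|\boldsymbol u\|_{L^\infty(L^\infty)}^2\|\boldsymbol u_{tt}\|_{L^2(H^1)}^2\bigr),$$ with $C$ a generic constant independent of $\nu$, $h$ and $\Delta t$.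
   Context: Problem. $\Omega\subset\mathbb R^d$, $d\in\{2,3\}$, is a bounded domain with polyhedral Lipschitz boundary, $T>0$, $\nu>0$, and $(\boldsymbol u,p)$ is a solution, smooth enough for all norms used to be finite, of $\partial_t\boldsymbol u-\nu\Delta\boldsymbol u+(\boldsymbol u\cdot\nabla)\boldsymbol u+\nabla p=\boldsymbol f$, $\nabla\cdot\boldsymbol u=0$ in $(0,T)\times\Omega$, $\boldsymbol u=\boldsymbol 0$ on $\partial\Omega$, $\boldsymbol u(0)=\boldsymbol u_0$. Notation: $(\cdot,\cdot)$ and $\|\cdot\|_0$ are the $L^2(\Omega)$ inner product and norm, $\|\cdot\|_s$ the $H^s(\Omega)$ norm, $\|\cdot\|_\infty$ the $L^\infty(\Omega)$ norm; $\|\cdot\|_{L^q(X)}$ is the norm of $L^q(0,T;X)$ with $X$ a space of functions on $\Omega$; $V=H_0^1(\Omega)^d$, $Q=L_0^2(\Omega)$ (zero-mean $L^2$ functions); superscript $n$ on a function of time means evaluation at $t_n$. Finite elements. $V_h\subset V$, $Q_h\subset Q$ are spaces of piecewise polynomials of degrees at most $k\ge1$ and $l$ on a quasi-uniform family of partitions of $\Omega$ of mesh size $h$, satisfying $\inf_{q_h\in Q_h}\sup_{\boldsymbol v_h\in V_h}\frac{(\nabla\cdot\boldsymbol v_h,q_h)}{\|\nabla\boldsymbol v_h\|_0\|q_h\|_0}\ge\beta_0>0$ with $\beta_0$ independent of $h$, and the usual inverse inequalities. The $L^2$ projection $\pi_h$ of $p$ onto $Q_h$ satisfies $\|p-\pi_h\|_m\le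 Ch^{l+1-m}\|p\|_{l+1}$, $0\le m\le1$. Projection. For each $t$, $(\boldsymbol s_h,l_h)\in V_h\times Q_h$ solves $\nu(\nabla\boldsymbol s_h,\nabla\boldsymbol v_h)-(\nabla\cdot\boldsymbol v_h,l_h)=(\boldsymbol g,\boldsymbol v_h)$, $(\nabla\cdot\boldsymbol s_h,q_h)=0$ for all $(\boldsymbol v_h,q_h)\in V_h\times Q_h$, where $\boldsymbol g=\boldsymbol f-\partial_t\boldsymbol u-(\boldsymbol u\cdot\nabla)\boldsymbol u-\nabla p$. The following bounds, recalled from the literature, are taken as available, with constants independent of $\nu$: $\|\boldsymbol u-\boldsymbol s_h\|_0+h\|\boldsymbol u-\boldsymbol s_h\|_1\le Ch^{k+1}\|\boldsymbol u\|_{k+1}$, estimates of the same form for time derivatives (in particular $\|\partial_t(\boldsymbol u-\boldsymbol s_h)\|_0\le Ch^k\|\partial_t\boldsymbol u\|_k$), $\|\boldsymbol u-\boldsymbol s_h\|_\infty\le C_\infty h(\log(|\Omega|^{1/d}/h))^{\bar r}\|\nabla\boldsymbol u\|_\infty$ ($\bar r=0$ for linear elements, $\bar r=1$ otherwise), $\|\nabla(\boldsymbol u-\boldsymbol s_h)\|_\infty\le C_\infty\|\nabla\boldsymbol u\|_\infty$. Semi-implicit method. Let $\mu>0$ be the grad-div parameter, $b(\boldsymbol u,\boldsymbol v,\boldsymbol w)=((\boldsymbol u\cdot\nabla)\boldsymbol v+\frac12(\nabla\cdot\boldsymbol u)\boldsymbol v,\boldsymbol w)$. For a sequence $(\boldsymbol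 v^n)$ (fixed step size) and $n\ge1$ put $\hat{\boldsymbol v}^n=2\boldsymbol v^n-\boldsymbol v^{n-1}$, $\mathcal D\boldsymbol v^{n+1}=\frac32\boldsymbol v^{n+1}-2\boldsymbol v^n+\frac12\boldsymbol v^{n-1}$. Set $\boldsymbol u_h^0=\boldsymbol s_h^0$. For $n=1,\ldots,N-1$, $(\boldsymbol u_h^{n+1},p_h^{n+1})\in V_h\times Q_h$ solves for all $(\boldsymbol v_h,q_h)\in V_h\times Q_h$ $$\Bigl(\tfrac1{\Delta t}\mathcal D\boldsymbol u_h^{n+1},\boldsymbol v_h\Bigr)+\nu(\nabla\boldsymbol u_h^{n+1},\nabla\boldsymbol v_h)+b(\hat{\boldsymbol u}_h^n,\boldsymbol u_h^{n+1},\boldsymbol v_h)-(p_h^{n+1},\nabla\cdot\boldsymbol v_h)+(\nabla\cdot\boldsymbol u_h^{n+1},q_h)+\mu(\nabla\cdot\boldsymbol u_h^{n+1},\nabla\cdot\boldsymbol v_h)=(\boldsymbol f^{n+1},\boldsymbol v_h).$$ The first step $\boldsymbol u_h^1$ is computed with the implicit-explicit Euler method, i.e. the same equation with $n=0$, $\mathcal D\boldsymbol u_h^1=\boldsymbol u_h^1-\boldsymbol u_h^0$ and nonlinear term $b(\boldsymbol u_h^0,\boldsymbol u_h^0,\boldsymbol v_h)$. *)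

theory Defs
  imports "HOL-Analysis.Analysis" "HOL-Probability.Essential_Supremum"
begin

text \<open>
  Function spaces are sets of representatives (functions on the whole type, of which only the
  values almost everywhere on the domain matter), each accompanied by a real-valued norm. A norm
  is meaningful only for members of its space: for instance the supremum norm of an essentially
  unbounded function is the junk value \<open>real_of_ereal \<infinity> = 0\<close>.
\<close>

subsection \<open>Lebesgue spaces\<close>

definition Lp_space ::
  "ereal \<Rightarrow> 'a::euclidean_space set \<Rightarrow> ('a \<Rightarrow> 'b::euclidean_space) set" where
  "Lp_space q \<Omega> = {f. f \<in> borel_measurable (lebesgue_on \<Omega>) \<and>
     (if q = \<infinity> then esssup (lebesgue_on \<Omega>) (\<lambda>x. ereal (norm (f x))) < \<infinity>
      else integrable (lebesgue_on \<Omega>) (\<lambda>x. norm (f x) powr real_of_ereal q))}"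

definition Lp_norm ::
  "ereal \<Rightarrow> 'a::euclidean_space set \<Rightarrow> ('a \<Rightarrow> 'b::euclidean_space) \<Rightarrow> real" where
  "Lp_norm q \<Omega> f =
     (if q = \<infinity> then real_of_ereal (esssup (lebesgue_on \<Omega>) (\<lambda>x. ereal (norm (f x))))
      else (LINT x|lebesgue_on \<Omega>. norm (f x) powr real_of_ereal q)
             powr (1 / real_of_ereal q))"

abbreviation L2_norm_on :: "'a::euclidean_space set \<Rightarrow> ('a \<Rightarrow> 'b::euclidean_space) \<Rightarrow> real" where
  "L2_norm_on \<equiv> Lp_norm 2"

abbreviation Linf_norm :: "'a::euclidean_space set \<Rightarrow> ('a \<Rightarrow> 'b::euclidean_space) \<Rightarrow> real" where
  "Linf_norm \<equiv> Lp_norm \<infinity>"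

definition L2_inner ::
  "'a::euclidean_space set \<Rightarrow> ('a \<Rightarrow> 'b::euclidean_space) \<Rightarrow> ('a \<Rightarrow> 'b) \<Rightarrow> real" where
  "L2_inner \<Omega> f g = (LINT x|lebesgue_on \<Omega>. f x \<bullet> g x)"

definition L2_mean_zero :: "'a::euclidean_space set \<Rightarrow> ('a \<Rightarrow> real) set" where
  "L2_mean_zero \<Omega> = {q \<in> Lp_space 2 \<Omega>. (LINT x|lebesgue_on \<Omega>. q x) = 0}"

subsection \<open>Weak derivatives and Sobolev spaces\<close>

definition partial_deriv ::
  "'d::finite \<Rightarrow> (real^'d \<Rightarrow> 'b::euclidean_space) \<Rightarrow> real^'d \<Rightarrow> 'b" where
  "partial_deriv i f x = frechet_derivative f (at x) (axis i 1)"

primrec iter_partial ::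
  "'d::finite list \<Rightarrow> (real^'d \<Rightarrow> 'b::euclidean_space) \<Rightarrow> real^'d \<Rightarrow> 'b" where
  "iter_partial [] f = f"
| "iter_partial (i # js) f = partial_deriv i (iter_partial js f)"

definition test_functions :: "(real^'d::finite) set \<Rightarrow> (real^'d \<Rightarrow> 'b::euclidean_space) set" where
  "test_functions \<Omega> = {\<phi>. (\<forall>js x. iter_partial js \<phi> differentiable (at x)) \<and>
     compact (closure {x. \<phi> x \<noteq> 0}) \<and> closure {x. \<phi> x \<noteq> 0} \<subseteq> \<Omega>}"

definition locally_integrable ::
  "'a::euclidean_space set \<Rightarrow> ('a \<Rightarrow> 'b::euclidean_space) \<Rightarrow> bool" where
  "locally_integrable \<Omega> f \<longleftrightarrow> (\<forall>K. compact K \<and> K \<subseteq> \<Omega> \<longrightarrow> f absolutely_integrable_on K)"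

text \<open>
  A multi-index is a function \<open>\<alpha> :: 'd \<Rightarrow> nat\<close>. The lists \<open>js\<close> below are the possible orders in
  which the derivatives making up \<open>\<alpha>\<close> can be taken; on test functions they all agree.
\<close>

abbreviation mi_order :: "('d::finite \<Rightarrow> nat) \<Rightarrow> nat" where
  "mi_order \<alpha> \<equiv> (\<Sum>i\<in>UNIV. \<alpha> i)"

definition weak_deriv ::
  "(real^'d::finite) set \<Rightarrow> ('d \<Rightarrow> nat) \<Rightarrow> (real^'d \<Rightarrow> 'b::euclidean_space) \<Rightarrow>
    (real^'d \<Rightarrow> 'b) \<Rightarrow> bool" where
  "weak_deriv \<Omega> \<alpha> f g \<longleftrightarrow> locally_integrable \<Omega> f \<and> locally_integrable \<Omega> g \<and>
     (\<forall>\<phi> :: real^'d \<Rightarrow> real. \<forall>js. \<phi> \<in> test_functions \<Omega> \<and> (\<forall>i. count_list js i = \<alpha> i) \<longrightarrow>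
        (LINT x|lebesgue_on \<Omega>. iter_partial js \<phi> x *\<^sub>R f x)
          = (-1) ^ mi_order \<alpha> *\<^sub>R (LINT x|lebesgue_on \<Omega>. \<phi> x *\<^sub>R g x))"

definition wD ::
  "(real^'d::finite) set \<Rightarrow> ('d \<Rightarrow> nat) \<Rightarrow> (real^'d \<Rightarrow> 'b::euclidean_space) \<Rightarrow> real^'d \<Rightarrow> 'b" where
  "wD \<Omega> \<alpha> f = (SOME g. weak_deriv \<Omega> \<alpha> f g)"

definition sobolev_space ::
  "nat \<Rightarrow> ereal \<Rightarrow> (real^'d::finite) set \<Rightarrow> (real^'d \<Rightarrow> 'b::euclidean_space) set" where
  "sobolev_space m q \<Omega> =
     {f. \<forall>\<alpha>. mi_order \<alpha> \<le> m \<longrightarrow> (\<exists>g. weak_deriv \<Omega> \<alpha> f g \<and> g \<in> Lp_space q \<Omega>)}"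

definition sobolev_norm ::
  "nat \<Rightarrow> ereal \<Rightarrow> (real^'d::finite) set \<Rightarrow> (real^'d \<Rightarrow> 'b::euclidean_space) \<Rightarrow> real" where
  "sobolev_norm m q \<Omega> f =
     (if q = \<infinity> then Max ((\<lambda>\<alpha>. Lp_norm \<infinity> \<Omega> (wD \<Omega> \<alpha> f)) ` {\<alpha>. mi_order \<alpha> \<le> m})
      else (\<Sum>\<alpha> | mi_order \<alpha> \<le> m. Lp_norm q \<Omega> (wD \<Omega> \<alpha> f) powr real_of_ereal q)
             powr (1 / real_of_ereal q))"

abbreviation H_space :: "nat \<Rightarrow> (real^'d::finite) set \<Rightarrow> (real^'d \<Rightarrow> 'b::euclidean_space) set" where
  "H_space m \<equiv> sobolev_space m 2"

abbreviation H_norm ::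
  "nat \<Rightarrow> (real^'d::finite) set \<Rightarrow> (real^'d \<Rightarrow> 'b::euclidean_space) \<Rightarrow> real" where
  "H_norm m \<equiv> sobolev_norm m 2"

definition H10_space :: "(real^'d::finite) set \<Rightarrow> (real^'d \<Rightarrow> 'b::euclidean_space) set" where
  "H10_space \<Omega> = {v \<in> H_space 1 \<Omega>.
     \<forall>\<epsilon>>0. \<exists>\<phi>\<in>test_functions \<Omega>. H_norm 1 \<Omega> (\<lambda>x. v x - \<phi> x) < \<epsilon>}"

definition unit_mi :: "'d \<Rightarrow> 'd \<Rightarrow> nat" where
  "unit_mi j = (\<lambda>i. if i = j then 1 else 0)"

definition grad_scalar :: "(real^'d::finite) set \<Rightarrow> (real^'d \<Rightarrow> real) \<Rightarrow> real^'d \<Rightarrow> real^'d" where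
  "grad_scalar \<Omega> q x = (\<chi> j. wD \<Omega> (unit_mi j) q x)"

text \<open>
  Row \<open>i\<close>, column \<open>j\<close> of the gradient of a vector field is the \<open>j\<close>-th partial derivative of the
  \<open>i\<close>-th component, so \<open>grad v x *v w x\<close> is \<open>((w \<cdot> \<nabla>) v) x\<close>. The norm and the inner product on
  matrices are those of Frobenius.
\<close>

definition grad :: "(real^'d::finite) set \<Rightarrow> (real^'d \<Rightarrow> real^'d) \<Rightarrow> real^'d \<Rightarrow> real^'d^'d" where
  "grad \<Omega> v x = (\<chi> i j. wD \<Omega> (unit_mi j) v x $ i)"

definition divg :: "(real^'d::finite) set \<Rightarrow> (real^'d \<Rightarrow> real^'d) \<Rightarrow> real^'d \<Rightarrow> real" where
  "divg \<Omega> v x = (\<Sum>i\<in>UNIV. wD \<Omega> (unit_mi i) v x $ i)"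

definition lapl :: "(real^'d::finite) set \<Rightarrow> (real^'d \<Rightarrow> real^'d) \<Rightarrow> real^'d \<Rightarrow> real^'d" where
  "lapl \<Omega> v x = (\<Sum>i\<in>UNIV. wD \<Omega> (\<lambda>j. 2 * unit_mi i j) v x)"

subsection \<open>Functions of time\<close>

text \<open>The spaces \<open>L\<^sup>q(0,T;X)\<close>, where the norm \<open>N\<close> goes with the space \<open>X\<close>.\<close>

definition time_space ::
  "ereal \<Rightarrow> real \<Rightarrow> ('a \<Rightarrow> 'b) set \<Rightarrow> (('a \<Rightarrow> 'b) \<Rightarrow> real) \<Rightarrow> (real \<Rightarrow> 'a \<Rightarrow> 'b) set" where
  "time_space q T X N = {w. (AE t in lebesgue_on {0<..<T}. w t \<in> X) \<and>
     (\<lambda>t. N (w t)) \<in> Lp_space q {0<..<T}}"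

definition time_norm ::
  "ereal \<Rightarrow> real \<Rightarrow> (('a \<Rightarrow> 'b) \<Rightarrow> real) \<Rightarrow> (real \<Rightarrow> 'a \<Rightarrow> 'b) \<Rightarrow> real" where
  "time_norm q T N w = Lp_norm q {0<..<T} (\<lambda>t. N (w t))"

text \<open>
  \<open>w \<in> W\<^sup>1\<^sup>,\<^sup>1(0,T;L\<^sup>2(\<Omega>))\<close> with derivative \<open>w'\<close>. Since functions of time are evaluated at the
  time levels, \<open>w\<close> has to be the absolutely continuous representative:
  \<open>w(t) - w(s) = \<integral>\<^sub>s\<^sup>t w'(r) dr\<close> in \<open>L\<^sup>2(\<Omega>)\<close> for all \<open>0 \<le> s \<le> t \<le> T\<close>.
\<close>

definition has_time_deriv ::
  "real \<Rightarrow> 'a::euclidean_space set \<Rightarrow> (real \<Rightarrow> 'a \<Rightarrow> 'b::euclidean_space) \<Rightarrow>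
    (real \<Rightarrow> 'a \<Rightarrow> 'b) \<Rightarrow> bool" where
  "has_time_deriv T \<Omega> w w' \<longleftrightarrow>
     (\<forall>t\<in>{0..T}. w t \<in> Lp_space 2 \<Omega>) \<and>
     (\<lambda>(t, x). w' t x) \<in> borel_measurable (lebesgue_on {0<..<T} \<Otimes>\<^sub>M lebesgue_on \<Omega>) \<and>
     w' \<in> time_space 1 T (Lp_space 2 \<Omega>) (L2_norm_on \<Omega>) \<and>
     (\<forall>s t. 0 \<le> s \<and> s \<le> t \<and> t \<le> T \<longrightarrow>
        (AE x in lebesgue_on \<Omega>. w t x - w s x = (LINT r|lebesgue_on {s..t}. w' r x)))"

definition time_continuous_L2 ::
  "real \<Rightarrow> 'a::euclidean_space set \<Rightarrow> (real \<Rightarrow> 'a \<Rightarrow> 'b::euclidean_space) \<Rightarrow> bool" where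
  "time_continuous_L2 T \<Omega> w \<longleftrightarrow> (\<forall>t\<in>{0..T}. w t \<in> Lp_space 2 \<Omega> \<and>
     ((\<lambda>s. L2_norm_on \<Omega> (\<lambda>x. w s x - w t x)) \<longlongrightarrow> 0) (at t within {0..T}))"

subsection \<open>The domain and the Navier--Stokes problem\<close>

definition lipschitz_boundary :: "'a::euclidean_space set \<Rightarrow> bool" where
  "lipschitz_boundary \<Omega> \<longleftrightarrow> (\<forall>x\<in>frontier \<Omega>. \<exists>r>0. \<exists>e \<gamma> L. norm e = 1 \<and>
     L-lipschitz_on UNIV \<gamma> \<and>
     \<Omega> \<inter> ball x r = {y \<in> ball x r. y \<bullet> e > (\<gamma> (y - (y \<bullet> e) *\<^sub>R e) :: real)})"

definition polyhedral_boundary :: "'a::euclidean_space set \<Rightarrow> bool" where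
  "polyhedral_boundary \<Omega> \<longleftrightarrow> (\<exists>F. finite F \<and> frontier \<Omega> = \<Union>F \<and>
     (\<forall>P\<in>F. polytope P \<and> aff_dim P = int DIM('a) - 1))"

definition polyhedral_lipschitz_domain :: "'a::euclidean_space set \<Rightarrow> bool" where
  "polyhedral_lipschitz_domain \<Omega> \<longleftrightarrow> \<Omega> \<noteq> {} \<and> open \<Omega> \<and> connected \<Omega> \<and> bounded \<Omega> \<and>
     polyhedral_boundary \<Omega> \<and> lipschitz_boundary \<Omega>"

definition navier_stokes ::
  "real \<Rightarrow> (real^'d::finite) set \<Rightarrow> real \<Rightarrow> (real \<Rightarrow> real^'d \<Rightarrow> real^'d) \<Rightarrow> (real^'d \<Rightarrow> real^'d) \<Rightarrow>
    (real \<Rightarrow> real^'d \<Rightarrow> real^'d) \<Rightarrow> (real \<Rightarrow> real^'d \<Rightarrow> real^'d) \<Rightarrow> (real \<Rightarrow> real^'d \<Rightarrow> real) \<Rightarrow>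
    bool" where
  "navier_stokes T \<Omega> \<nu> f u0 u ut p \<longleftrightarrow>
     (\<forall>t\<in>{0..T}. f t \<in> Lp_space 2 \<Omega>) \<and>
     (\<forall>t\<in>{0..T}. u t \<in> H10_space \<Omega>) \<and>
     (\<forall>t\<in>{0..T}. p t \<in> L2_mean_zero \<Omega>) \<and>
     has_time_deriv T \<Omega> u ut \<and>
     (\<forall>t\<in>{0<..<T}. AE x in lebesgue_on \<Omega>.
        ut t x - \<nu> *\<^sub>R lapl \<Omega> (u t) x + grad \<Omega> (u t) x *v u t x + grad_scalar \<Omega> (p t) x = f t x) \<and>
     (\<forall>t\<in>{0..T}. AE x in lebesgue_on \<Omega>. divg \<Omega> (u t) x = 0) \<and>
     (AE x in lebesgue_on \<Omega>. u 0 x = u0 x)"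

text \<open>The regularity that makes the norms used (in space, at every time, and in space-time) finite.\<close>

definition smooth_enough ::
  "real \<Rightarrow> (real^'d::finite) set \<Rightarrow> nat \<Rightarrow> nat \<Rightarrow> (real \<Rightarrow> real^'d \<Rightarrow> real^'d) \<Rightarrow>
    (real \<Rightarrow> real^'d \<Rightarrow> real^'d) \<Rightarrow> (real \<Rightarrow> real^'d \<Rightarrow> real^'d) \<Rightarrow> (real \<Rightarrow> real^'d \<Rightarrow> real^'d) \<Rightarrow>
    (real \<Rightarrow> real^'d \<Rightarrow> real) \<Rightarrow> bool" where
  "smooth_enough T \<Omega> k l u ut utt uttt p \<longleftrightarrow>
     has_time_deriv T \<Omega> u ut \<and> has_time_deriv T \<Omega> ut utt \<and> has_time_deriv T \<Omega> utt uttt \<and>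
     time_continuous_L2 T \<Omega> p \<and>
     (\<forall>t\<in>{0..T}. u t \<in> H_space (k + 1) \<Omega> \<inter> sobolev_space 1 \<infinity> \<Omega> \<and> p t \<in> H_space (l + 1) \<Omega>) \<and>
     u \<in> time_space \<infinity> T (H_space (k + 1) \<Omega>) (H_norm (k + 1) \<Omega>) \<and>
     u \<in> time_space \<infinity> T (sobolev_space 1 \<infinity> \<Omega>) (sobolev_norm 1 \<infinity> \<Omega>) \<and>
     u \<in> time_space \<infinity> T (Lp_space \<infinity> \<Omega>) (Linf_norm \<Omega>) \<and>
     ut \<in> time_space \<infinity> T (Lp_space 2 \<Omega>) (L2_norm_on \<Omega>) \<and>
     ut \<in> time_space \<infinity> T (H_space 1 \<Omega>) (H_norm 1 \<Omega>) \<and>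
     ut \<in> time_space 2 T (H_space k \<Omega>) (H_norm k \<Omega>) \<and>
     utt \<in> time_space \<infinity> T (Lp_space 2 \<Omega>) (L2_norm_on \<Omega>) \<and>
     utt \<in> time_space 2 T (Lp_space 2 \<Omega>) (L2_norm_on \<Omega>) \<and>
     utt \<in> time_space 2 T (H_space 1 \<Omega>) (H_norm 1 \<Omega>) \<and>
     uttt \<in> time_space 2 T (Lp_space 2 \<Omega>) (L2_norm_on \<Omega>) \<and>
     p \<in> time_space \<infinity> T (H_space (l + 1) \<Omega>) (H_norm (l + 1) \<Omega>)"

subsection \<open>Finite element spaces\<close>

definition mesh_partition :: "'a::euclidean_space set \<Rightarrow> 'a set set \<Rightarrow> bool" where
  "mesh_partition \<Omega> \<T> \<longleftrightarrow> finite \<T> \<and> \<Union>\<T> = closure \<Omega> \<and>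
     (\<forall>K\<in>\<T>. polytope K \<and> interior K \<noteq> {}) \<and>
     pairwise (\<lambda>K K'. interior K \<inter> interior K' = {}) \<T>"

definition mesh_size :: "'a::euclidean_space set set \<Rightarrow> real" where
  "mesh_size \<T> = Max (diameter ` \<T>)"

definition polynomial_fun :: "nat \<Rightarrow> (real^'d::finite \<Rightarrow> 'b::euclidean_space) \<Rightarrow> bool" where
  "polynomial_fun r v \<longleftrightarrow>
     (\<exists>c. \<forall>x. v x = (\<Sum>\<alpha> | mi_order \<alpha> \<le> r. (\<Prod>i\<in>UNIV. (x $ i) ^ \<alpha> i) *\<^sub>R c \<alpha>))"

definition piecewise_polynomial ::
  "(real^'d::finite) set set \<Rightarrow> nat \<Rightarrow> (real^'d \<Rightarrow> 'b::euclidean_space) \<Rightarrow> bool" where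
  "piecewise_polynomial \<T> r v \<longleftrightarrow>
     (\<forall>K\<in>\<T>. \<exists>w. polynomial_fun r w \<and> (\<forall>x\<in>interior K. v x = w x))"

definition function_subspace :: "('a \<Rightarrow> 'b::real_vector) set \<Rightarrow> bool" where
  "function_subspace W \<longleftrightarrow> (\<lambda>x. 0) \<in> W \<and>
     (\<forall>v\<in>W. \<forall>w\<in>W. (\<lambda>x. v x + w x) \<in> W) \<and> (\<forall>c. \<forall>v\<in>W. (\<lambda>x. c *\<^sub>R v x) \<in> W)"

definition inf_sup_const ::
  "(real^'d::finite) set \<Rightarrow> (real^'d \<Rightarrow> real^'d) set \<Rightarrow> (real^'d \<Rightarrow> real) set \<Rightarrow> ereal" where
  "inf_sup_const \<Omega> Vh Qh =
     (INF q\<in>{q \<in> Qh. L2_norm_on \<Omega> q \<noteq> 0}. SUP v\<in>{v \<in> Vh. L2_norm_on \<Omega> (grad \<Omega> v) \<noteq> 0}.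
        ereal (L2_inner \<Omega> (divg \<Omega> v) q / (L2_norm_on \<Omega> (grad \<Omega> v) * L2_norm_on \<Omega> q)))"

definition inverse_inequalities ::
  "(real^'d::finite) set set \<Rightarrow> (real^'d \<Rightarrow> real^'d) set \<Rightarrow> real \<Rightarrow> bool" where
  "inverse_inequalities \<T> Vh c_inv \<longleftrightarrow>
     (\<forall>v\<in>Vh. \<forall>K\<in>\<T>. \<forall>n m q q'. n \<le> m \<and> m \<le> 1 \<and> 1 \<le> q' \<and> q' \<le> q \<longrightarrow>
        sobolev_norm m q (interior K) v
          \<le> c_inv * diameter K powr (real n - real m
                - real CARD('d) * (real_of_ereal (1 / q') - real_of_ereal (1 / q)))
            * sobolev_norm n q' (interior K) v)"

text \<open>
  The family is indexed by the set \<open>H\<close> of mesh sizes. Quasi-uniformity: every cell of the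
  partition of mesh size \<open>h\<close> contains a ball of radius \<open>\<sigma> h\<close>. None of the constants \<open>\<sigma>\<close>, \<open>\<beta>\<^sub>0\<close>,
  \<open>c_inv\<close> depends on \<open>h\<close>.
\<close>

definition fe_family ::
  "(real^'d::finite) set \<Rightarrow> nat \<Rightarrow> nat \<Rightarrow> real set \<Rightarrow> (real \<Rightarrow> (real^'d) set set) \<Rightarrow>
    (real \<Rightarrow> (real^'d \<Rightarrow> real^'d) set) \<Rightarrow> (real \<Rightarrow> (real^'d \<Rightarrow> real) set) \<Rightarrow>
    real \<Rightarrow> real \<Rightarrow> real \<Rightarrow> bool" where
  "fe_family \<Omega> k l H \<T> V Q \<sigma> \<beta>\<^sub>0 c_inv \<longleftrightarrow> (\<forall>h\<in>H. h > 0 \<and>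
     mesh_partition \<Omega> (\<T> h) \<and> mesh_size (\<T> h) = h \<and>
     (\<forall>K\<in>\<T> h. \<exists>x. ball x (\<sigma> * h) \<subseteq> K) \<and>
     function_subspace (V h) \<and> V h \<subseteq> H10_space \<Omega> \<and>
     (\<forall>v\<in>V h. piecewise_polynomial (\<T> h) k v) \<and>
     function_subspace (Q h) \<and> Q h \<subseteq> L2_mean_zero \<Omega> \<and>
     (\<forall>q\<in>Q h. piecewise_polynomial (\<T> h) l q) \<and>
     inf_sup_const \<Omega> (V h) (Q h) \<ge> ereal \<beta>\<^sub>0 \<and>
     inverse_inequalities (\<T> h) (V h) c_inv)"

subsection \<open>Projections and their approximation properties\<close>

definition L2_projection ::
  "'a::euclidean_space set \<Rightarrow> ('a \<Rightarrow> real) set \<Rightarrow> ('a \<Rightarrow> real) \<Rightarrow> ('a \<Rightarrow> real) \<Rightarrow> bool" where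
  "L2_projection \<Omega> Qh p \<pi> \<longleftrightarrow> \<pi> \<in> Qh \<and> (\<forall>q\<in>Qh. L2_inner \<Omega> (\<lambda>x. p x - \<pi> x) q = 0)"

text \<open>
  Discrete pressures may be discontinuous across cells, so the \<open>H\<^sup>1\<close> norm of the projection error
  is taken cell by cell (for continuous pressures this is the \<open>H\<^sup>1(\<Omega>)\<close> norm).
\<close>

definition broken_H_norm ::
  "(real^'d::finite) set set \<Rightarrow> nat \<Rightarrow> (real^'d \<Rightarrow> 'b::euclidean_space) \<Rightarrow> real" where
  "broken_H_norm \<T> m q = sqrt (\<Sum>K\<in>\<T>. (H_norm m (interior K) q)\<^sup>2)"

definition pressure_projection ::
  "real \<Rightarrow> (real^'d::finite) set \<Rightarrow> nat \<Rightarrow> real set \<Rightarrow> (real \<Rightarrow> (real^'d) set set) \<Rightarrow>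
    (real \<Rightarrow> (real^'d \<Rightarrow> real) set) \<Rightarrow> real \<Rightarrow> (real \<Rightarrow> real^'d \<Rightarrow> real) \<Rightarrow>
    (real \<Rightarrow> real \<Rightarrow> real^'d \<Rightarrow> real) \<Rightarrow> bool" where
  "pressure_projection T \<Omega> l H \<T> Q c_pi p \<pi> \<longleftrightarrow>
     (\<forall>h\<in>H. \<forall>t\<in>{0..T}. L2_projection \<Omega> (Q h) (p t) (\<pi> h t) \<and>
        (\<forall>m\<le>1. broken_H_norm (\<T> h) m (\<lambda>x. p t x - \<pi> h t x)
                   \<le> c_pi * h ^ (l + 1 - m) * H_norm (l + 1) \<Omega> (p t)))"

definition discrete_stokes ::
  "(real^'d::finite) set \<Rightarrow> real \<Rightarrow> (real^'d \<Rightarrow> real^'d) set \<Rightarrow> (real^'d \<Rightarrow> real) set \<Rightarrow>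
    (real^'d \<Rightarrow> real^'d) \<Rightarrow> (real^'d \<Rightarrow> real^'d) \<Rightarrow> (real^'d \<Rightarrow> real) \<Rightarrow> bool" where
  "discrete_stokes \<Omega> \<nu> Vh Qh g sh lh \<longleftrightarrow> sh \<in> Vh \<and> lh \<in> Qh \<and>
     (\<forall>v\<in>Vh. \<nu> * L2_inner \<Omega> (grad \<Omega> sh) (grad \<Omega> v) - L2_inner \<Omega> (divg \<Omega> v) lh
                = L2_inner \<Omega> g v) \<and>
     (\<forall>q\<in>Qh. L2_inner \<Omega> (divg \<Omega> sh) q = 0)"

definition stokes_projection ::
  "real \<Rightarrow> (real^'d::finite) set \<Rightarrow> real \<Rightarrow> real set \<Rightarrow>
    (real \<Rightarrow> (real^'d \<Rightarrow> real^'d) set) \<Rightarrow> (real \<Rightarrow> (real^'d \<Rightarrow> real) set) \<Rightarrow>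
    (real \<Rightarrow> real^'d \<Rightarrow> real^'d) \<Rightarrow> (real \<Rightarrow> real^'d \<Rightarrow> real^'d) \<Rightarrow> (real \<Rightarrow> real^'d \<Rightarrow> real^'d) \<Rightarrow>
    (real \<Rightarrow> real^'d \<Rightarrow> real) \<Rightarrow>
    (real \<Rightarrow> real \<Rightarrow> real^'d \<Rightarrow> real^'d) \<Rightarrow> (real \<Rightarrow> real \<Rightarrow> real^'d \<Rightarrow> real) \<Rightarrow> bool" where
  "stokes_projection T \<Omega> \<nu> H V Q f u ut p s lh \<longleftrightarrow>
     (\<forall>h\<in>H. \<forall>t\<in>{0..T}. discrete_stokes \<Omega> \<nu> (V h) (Q h)
        (\<lambda>x. f t x - ut t x - grad \<Omega> (u t) x *v u t x - grad_scalar \<Omega> (p t) x) (s h t) (lh h t))"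

text \<open>
  The bound with the logarithm can only be expected for small \<open>h\<close> (the logarithm is negative
  for \<open>h > |\<Omega>|\<^sup>1\<^sup>/\<^sup>d\<close>), whence the threshold \<open>h\<^sub>1\<close>.
\<close>

definition stokes_projection_bounds ::
  "real \<Rightarrow> (real^'d::finite) set \<Rightarrow> nat \<Rightarrow> real set \<Rightarrow> real \<Rightarrow> real \<Rightarrow> real \<Rightarrow>
    (real \<Rightarrow> real^'d \<Rightarrow> real^'d) \<Rightarrow> (real \<Rightarrow> real^'d \<Rightarrow> real^'d) \<Rightarrow>
    (real \<Rightarrow> real \<Rightarrow> real^'d \<Rightarrow> real^'d) \<Rightarrow> bool" where
  "stokes_projection_bounds T \<Omega> k H c_s c_inf h\<^sub>1 u ut s \<longleftrightarrow> (\<forall>h\<in>H.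
     (\<forall>t\<in>{0..T}.
        L2_norm_on \<Omega> (\<lambda>x. u t x - s h t x) + h * H_norm 1 \<Omega> (\<lambda>x. u t x - s h t x)
          \<le> c_s * h ^ (k + 1) * H_norm (k + 1) \<Omega> (u t)) \<and>
     (\<exists>st. has_time_deriv T \<Omega> (s h) st \<and>
        (AE t in lebesgue_on {0<..<T}.
           L2_norm_on \<Omega> (\<lambda>x. ut t x - st t x) \<le> c_s * h ^ k * H_norm k \<Omega> (ut t))) \<and>
     (h < h\<^sub>1 \<longrightarrow> (\<forall>t\<in>{0..T}.
        Linf_norm \<Omega> (\<lambda>x. u t x - s h t x)
          \<le> c_inf * h * ln (measure lebesgue \<Omega> powr (1 / real CARD('d)) / h) ^ (if k = 1 then 0 else 1)
            * Linf_norm \<Omega> (grad \<Omega> (u t)))) \<and>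
     (\<forall>t\<in>{0..T}.
        Linf_norm \<Omega> (grad \<Omega> (\<lambda>x. u t x - s h t x)) \<le> c_inf * Linf_norm \<Omega> (grad \<Omega> (u t))))"

subsection \<open>The semi-implicit method\<close>

definition conv_form ::
  "(real^'d::finite) set \<Rightarrow> (real^'d \<Rightarrow> real^'d) \<Rightarrow> (real^'d \<Rightarrow> real^'d) \<Rightarrow>
    (real^'d \<Rightarrow> real^'d) \<Rightarrow> real" where
  "conv_form \<Omega> u v w =
     L2_inner \<Omega> (\<lambda>x. grad \<Omega> v x *v u x + ((1/2) * divg \<Omega> u x) *\<^sub>R v x) w"

definition extrap :: "(nat \<Rightarrow> 'a \<Rightarrow> 'b::real_vector) \<Rightarrow> nat \<Rightarrow> 'a \<Rightarrow> 'b" where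
  "extrap v n x = 2 *\<^sub>R v n x - v (n - 1) x"

definition time_diff :: "(nat \<Rightarrow> 'a \<Rightarrow> 'b::real_vector) \<Rightarrow> nat \<Rightarrow> 'a \<Rightarrow> 'b" where
  "time_diff v m x =
     (if m = 1 then v 1 x - v 0 x
      else (3/2) *\<^sub>R v m x - 2 *\<^sub>R v (m - 1) x + (1/2) *\<^sub>R v (m - 2) x)"

text \<open>
  \<open>uh\<close> and \<open>ph\<close> are computed with \<open>N\<close> steps of size \<open>\<Delta>t\<close>; the value \<open>ph 0\<close> plays no role. The
  case \<open>n = 0\<close> is the implicit-explicit Euler step.
\<close>

definition semi_implicit_method ::
  "(real^'d::finite) set \<Rightarrow> real \<Rightarrow> real \<Rightarrow> (real^'d \<Rightarrow> real^'d) set \<Rightarrow> (real^'d \<Rightarrow> real) set \<Rightarrow>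
    (real \<Rightarrow> real^'d \<Rightarrow> real^'d) \<Rightarrow> (real^'d \<Rightarrow> real^'d) \<Rightarrow> real \<Rightarrow> nat \<Rightarrow>
    (nat \<Rightarrow> real^'d \<Rightarrow> real^'d) \<Rightarrow> (nat \<Rightarrow> real^'d \<Rightarrow> real) \<Rightarrow> bool" where
  "semi_implicit_method \<Omega> \<nu> \<mu> Vh Qh f init \<Delta>t N uh ph \<longleftrightarrow>
     uh 0 = init \<and>
     (\<forall>n<N. uh (n + 1) \<in> Vh \<and> ph (n + 1) \<in> Qh \<and>
       (\<forall>v\<in>Vh. \<forall>q\<in>Qh.
          L2_inner \<Omega> (\<lambda>x. (1 / \<Delta>t) *\<^sub>R time_diff uh (n + 1) x) v
          + \<nu> * L2_inner \<Omega> (grad \<Omega> (uh (n + 1))) (grad \<Omega> v)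
          + (if n = 0 then conv_form \<Omega> (uh 0) (uh 0) v
             else conv_form \<Omega> (extrap uh n) (uh (n + 1)) v)
          - L2_inner \<Omega> (ph (n + 1)) (divg \<Omega> v)
          + L2_inner \<Omega> (divg \<Omega> (uh (n + 1))) q
          + \<mu> * L2_inner \<Omega> (divg \<Omega> (uh (n + 1))) (divg \<Omega> v)
          = L2_inner \<Omega> (f (real (n + 1) * \<Delta>t)) v))"

subsection \<open>Quantities in the error bound\<close>

text \<open>\<open>sn j\<close> is the Stokes projection at the \<open>j\<close>-th of \<open>N\<close> time levels.\<close>

definition stab_coeff ::
  "(real^'d::finite) set \<Rightarrow> real \<Rightarrow> nat \<Rightarrow> (nat \<Rightarrow> real^'d \<Rightarrow> real^'d) \<Rightarrow> nat \<Rightarrow> real" where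
  "stab_coeff \<Omega> \<mu> N sn j =
     (let G = (\<lambda>i. if i \<le> N then Linf_norm \<Omega> (grad \<Omega> (sn i)) else 0)
      in 4 * ((1/2) * G j + 9 / (2 * \<mu>) * (Linf_norm \<Omega> (sn j))\<^sup>2 + 3 * G (j + 1) + (3/2) * G (j + 2)))"

definition C0_sq ::
  "real \<Rightarrow> real \<Rightarrow> (real^'d::finite) set \<Rightarrow> (real \<Rightarrow> real^'d \<Rightarrow> real^'d) \<Rightarrow>
    (real \<Rightarrow> real^'d \<Rightarrow> real^'d) \<Rightarrow> (real \<Rightarrow> real^'d \<Rightarrow> real^'d) \<Rightarrow> real" where
  "C0_sq C T \<Omega> u ut utt = C * ((time_norm \<infinity> T (L2_norm_on \<Omega>) utt)\<^sup>2
     + (time_norm \<infinity> T (sobolev_norm 1 \<infinity> \<Omega>) u)\<^sup>2 * (time_norm \<infinity> T (L2_norm_on \<Omega>) ut)\<^sup>2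
     + (time_norm \<infinity> T (Linf_norm \<Omega>) u)\<^sup>2 * (time_norm \<infinity> T (H_norm 1 \<Omega>) ut)\<^sup>2)"

definition C1_sq ::
  "real \<Rightarrow> real \<Rightarrow> (real^'d::finite) set \<Rightarrow> nat \<Rightarrow> real \<Rightarrow> (real \<Rightarrow> real^'d \<Rightarrow> real^'d) \<Rightarrow>
    (real \<Rightarrow> real^'d \<Rightarrow> real^'d) \<Rightarrow> real" where
  "C1_sq C T \<Omega> k \<mu> u ut = C * ((time_norm 2 T (H_norm k \<Omega>) ut)\<^sup>2
     + (\<mu> + T * measure lebesgue \<Omega> powr (2 / real CARD('d))
              * (time_norm \<infinity> T (sobolev_norm 1 \<infinity> \<Omega>) u)\<^sup>2)
       * (time_norm \<infinity> T (H_norm (k + 1) \<Omega>) u)\<^sup>2)"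

definition C2_sq ::
  "real \<Rightarrow> real \<Rightarrow> (real^'d::finite) set \<Rightarrow> nat \<Rightarrow> real \<Rightarrow> (real \<Rightarrow> real^'d \<Rightarrow> real) \<Rightarrow> real" where
  "C2_sq C T \<Omega> l \<mu> p = C / \<mu> * (time_norm \<infinity> T (H_norm (l + 1) \<Omega>) p)\<^sup>2"

definition C3_sq ::
  "real \<Rightarrow> real \<Rightarrow> (real^'d::finite) set \<Rightarrow> (real \<Rightarrow> real^'d \<Rightarrow> real^'d) \<Rightarrow>
    (real \<Rightarrow> real^'d \<Rightarrow> real^'d) \<Rightarrow> (real \<Rightarrow> real^'d \<Rightarrow> real^'d) \<Rightarrow> real" where
  "C3_sq C T \<Omega> u utt uttt = C * ((time_norm 2 T (L2_norm_on \<Omega>) uttt)\<^sup>2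
     + (time_norm \<infinity> T (sobolev_norm 1 \<infinity> \<Omega>) u)\<^sup>2 * (time_norm 2 T (L2_norm_on \<Omega>) utt)\<^sup>2
     + (time_norm \<infinity> T (Linf_norm \<Omega>) u)\<^sup>2 * (time_norm 2 T (H_norm 1 \<Omega>) utt)\<^sup>2)"

end

theory Submission
  imports Defs "HOL-Computational_Algebra.Polynomial"
begin

text \<open>
  The error \<open>e = s - u\<^sub>h\<close> satisfies the scheme with a residual made of the time truncation error, the
  projection errors in the convective term, and the grad-div and pressure terms tested with
  \<open>\<nabla> \<cdot> e\<close>. Testing with \<open>e\<close> itself, the BDF2 difference is controlled by G-stability, the
  convective term with transporting field \<open>u\<^sub>h\<close> is skew-symmetric, and what remains of it,
  \<open>b(2 e\<^sup>n - e\<^sup>n\<^sup>-\<^sup>1, s, e\<^sup>n\<^sup>+\<^sup>1)\<close>, is estimated through \<open>\<parallel>\<nabla>s\<parallel>\<^sub>\<infinity>\<close>, \<open>\<parallel>s\<parallel>\<^sub>\<infinity>\<close> and the grad-div term, which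
  produces the coefficients \<open>N\<^sup>j\<close>; an implicit discrete Gronwall inequality sums up. In the
  first (Euler) step the gradient in \<open>((u\<^sup>1 \<cdot> \<nabla>)(u\<^sup>1 - u\<^sup>0), e\<^sup>1)\<close> is moved to \<open>e\<^sup>1\<close> by parts, so that
  \<open>u\<^sup>1 - u\<^sup>0\<close> can be written as the time integral of \<open>\<partial>\<^sub>tu\<close> in \<open>L\<^sup>2\<close>.

  Since the norms of \<open>u\<close> and \<open>p\<close> are only essentially bounded in time while the scheme evaluates
  at the time levels, the bounds at these levels come from lower semicontinuity of the norms along
  sequences of good times.
\<close>

subsection \<open>Lebesgue spaces\<close>

text \<open>Uniformity in \<nu> comes from the right-hand side \<open>g\<close> of the discrete
  Stokes problem: it expresses the forcing through \<nu> times the gradient of \<open>s\<close>, the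
  viscous terms of \<open>s\<close> and \<open>u\<^sub>h\<close> combine to \<nu> times the gradient
  of the error, and no viscous consistency term is left. Residuals that are only small in the
  divergence of the error are absorbed by the grad-div term.

  Time derivatives are known only through an integral identity at almost every point of \<Omega>.
  Every Taylor estimate is therefore proved for scalar functions of time \<open>ip (w t) z\<close>,
  and norm bounds come from choosing z as the remainder itself.

  C has to be fixed before T, \<nu>, \<mu> and the solution. Hence the estimates carry explicit
  numerical factors and keep the projection error as a parameter \<delta>; only at the end are they
  compared with one constant. In the exponent, the Gronwall rates are
  \<open>\<tau> * (1 / T + N)\<close>; the shares 1/T add up to at most 1 and contribute 2, and the
  stated 8 leaves room above it.\<close>

declare numeral_eq_ereal [simp del]

text \<open>The exponent of \<open>Lp_space\<close> is an extended real. With the expansion of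
  numerals switched off, the literal 2 survives simplification, so facts about
  \<open>L2_norm_on\<close> keep matching, and these two facts select the finite branch of the
  definitions.\<close>

lemma real_of_ereal_2: "real_of_ereal 2 = 2" and ereal_2_neq_infinity: "(2::ereal) \<noteq> \<infinity>"
  by (simp_all add: numeral_eq_ereal)

lemma Lp_space_2_iff:
  "f \<in> Lp_space 2 S \<longleftrightarrow>
     f \<in> borel_measurable (lebesgue_on S) \<and> integrable (lebesgue_on S) (\<lambda>x. (norm (f x))\<^sup>2)"
  by (simp add: Lp_space_def powr_numeral real_of_ereal_2 ereal_2_neq_infinity)

lemma L2_norm_sq: "(L2_norm_on S f)\<^sup>2 = (LINT x|lebesgue_on S. (norm (f x))\<^sup>2)"
proof -
  have "(LINT x|lebesgue_on S. (norm (f x))\<^sup>2) \<ge> 0" by (simp add: integral_nonneg_AE)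
  then show ?thesis by (simp add: Lp_norm_def powr_numeral powr_half_sqrt real_of_ereal_2 ereal_2_neq_infinity)
qed

lemma L2_norm_nonneg [simp]: "L2_norm_on S f \<ge> 0"
  by (simp add: Lp_norm_def ereal_2_neq_infinity)

lemma L2_norm_sq_inner: "(L2_norm_on S f)\<^sup>2 = L2_inner S f f"
  by (simp add: L2_norm_sq L2_inner_def power2_norm_eq_inner)

lemma Lp_space_2_measurable:
  "f \<in> Lp_space 2 S \<Longrightarrow> f \<in> borel_measurable (lebesgue_on S)"
  by (simp add: Lp_space_2_iff)

text \<open>One criterion for sums, differences and multiples alike: the square of the majorant
  \<open>a * norm (f x) + b * norm (g x)\<close> is at most twice the sum of the squares of its
  terms. The three functions may take values in different spaces.\<close>

lemma L2_dominated2: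
  fixes h :: "'a::euclidean_space \<Rightarrow> 'b::euclidean_space" and f :: "'a \<Rightarrow> 'c::euclidean_space"
    and g :: "'a \<Rightarrow> 'd::euclidean_space"
  assumes "f \<in> Lp_space 2 S" "g \<in> Lp_space 2 S" "h \<in> borel_measurable (lebesgue_on S)"
    and "AE x in lebesgue_on S. norm (h x) \<le> a * norm (f x) + b * norm (g x)"
  shows "h \<in> Lp_space 2 S"
proof -
  have "integrable (lebesgue_on S) (\<lambda>x. 2 * a\<^sup>2 * (norm (f x))\<^sup>2 + 2 * b\<^sup>2 * (norm (g x))\<^sup>2)"
    using assms by (auto simp: Lp_space_2_iff)
  moreover have "AE x in lebesgue_on S. norm ((norm (h x))\<^sup>2) \<le>
      norm (2 * a\<^sup>2 * (norm (f x))\<^sup>2 + 2 * b\<^sup>2 * (norm (g x))\<^sup>2)"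
    using assms(4)
  proof eventually_elim
    case (elim x)
    have "(norm (h x))\<^sup>2 \<le> (a * norm (f x) + b * norm (g x))\<^sup>2"
      using elim by (simp add: power_mono)
    also have "\<dots> \<le> 2 * (a * norm (f x))\<^sup>2 + 2 * (b * norm (g x))\<^sup>2"
      using zero_le_power2[of "a * norm (f x) - b * norm (g x)"] by (simp add: power2_sum power2_diff)
    finally show ?case by (simp add: power_mult_distrib)
  qed
  ultimately have "integrable (lebesgue_on S) (\<lambda>x. (norm (h x))\<^sup>2)"
    using assms(3) by (intro Bochner_Integration.integrable_bound[of _ _ "\<lambda>x. (norm (h x))\<^sup>2"]) auto
  with assms(3) show ?thesis by (simp add: Lp_space_2_iff)
qed

lemma L2_zero [simp]: "(\<lambda>x. 0) \<in> Lp_space 2 S"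
  by (simp add: Lp_space_2_iff)

lemma L2_add:
  assumes "f \<in> Lp_space 2 S" "g \<in> Lp_space 2 S" shows "(\<lambda>x. f x + g x) \<in> Lp_space 2 S"
  using assms by (intro L2_dominated2[OF assms, of _ 1 1])
     (auto simp: norm_triangle_ineq Lp_space_2_iff)

lemma L2_diff:
  assumes "f \<in> Lp_space 2 S" "g \<in> Lp_space 2 S" shows "(\<lambda>x. f x - g x) \<in> Lp_space 2 S"
  using assms by (intro L2_dominated2[OF assms, of _ 1 1])
     (auto simp: norm_triangle_ineq4 Lp_space_2_iff)

lemma L2_scaleR:
  assumes "f \<in> Lp_space 2 S" shows "(\<lambda>x. c *\<^sub>R f x) \<in> Lp_space 2 S"
  using assms by (intro L2_dominated2[OF assms assms, of _ "\<bar>c\<bar>" 0])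
     (auto simp: Lp_space_2_iff)

lemma L2_sum:
  assumes "\<And>i. i \<in> I \<Longrightarrow> f i \<in> Lp_space 2 S" shows "(\<lambda>x. \<Sum>i\<in>I. f i x) \<in> Lp_space 2 S"
  using assms by (induction I rule: infinite_finite_induct) (auto intro: L2_add)

lemma L2_inner_integrable:
  assumes "f \<in> Lp_space 2 S" "g \<in> Lp_space 2 S"
  shows "integrable (lebesgue_on S) (\<lambda>x. f x \<bullet> g x)"
proof -
  have *: "integrable (lebesgue_on S) (\<lambda>x. (norm (f x))\<^sup>2 + (norm (g x))\<^sup>2)"
    using assms by (auto simp: Lp_space_2_iff)
  have "norm (f x \<bullet> g x) \<le> norm ((norm (f x))\<^sup>2 + (norm (g x))\<^sup>2)" for x
  proof -
    have "\<bar>f x \<bullet> g x\<bar> \<le> norm (f x) * norm (g x)" by (rule Cauchy_Schwarz_ineq2)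
    also have "\<dots> \<le> (norm (f x))\<^sup>2 + (norm (g x))\<^sup>2"
      using sum_squares_bound[of "norm (f x)" "norm (g x)"] zero_le_mult_iff[of "norm (f x)" "norm (g x)"] norm_ge_zero[of "f x"] norm_ge_zero[of "g x"] by linarith
    finally show ?thesis by simp
  qed
  then show ?thesis
    using assms by (intro Bochner_Integration.integrable_bound[OF *]) (auto simp: Lp_space_2_iff)
qed

lemma L2_norm_product_integrable:
  assumes "f \<in> Lp_space 2 S" "g \<in> Lp_space 2 S"
  shows "integrable (lebesgue_on S) (\<lambda>x. norm (f x) * norm (g x))"
proof -
  have "(\<lambda>x. norm (f x)) \<in> Lp_space 2 S" "(\<lambda>x. norm (g x)) \<in> Lp_space 2 S"
    using assms by (auto simp: Lp_space_2_iff)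
  from L2_inner_integrable[OF this] show ?thesis by simp
qed

lemma L2_inner_commute: "L2_inner S f g = L2_inner S g f"
  by (simp add: L2_inner_def inner_commute)

lemma L2_inner_add_left:
  assumes "f \<in> Lp_space 2 S" "g \<in> Lp_space 2 S" "h \<in> Lp_space 2 S"
  shows "L2_inner S (\<lambda>x. f x + g x) h = L2_inner S f h + L2_inner S g h"
  using assms by (simp add: L2_inner_def inner_add_left L2_inner_integrable)

lemma L2_inner_diff_left:
  assumes "f \<in> Lp_space 2 S" "g \<in> Lp_space 2 S" "h \<in> Lp_space 2 S"
  shows "L2_inner S (\<lambda>x. f x - g x) h = L2_inner S f h - L2_inner S g h"
  using assms by (simp add: L2_inner_def inner_diff_left L2_inner_integrable)

lemma L2_inner_scaleR_left: "L2_inner S (\<lambda>x. c *\<^sub>R f x) h = c * L2_inner S f h"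
  by (simp add: L2_inner_def)

lemma L2_inner_sum_left:
  assumes "\<And>i. i \<in> I \<Longrightarrow> f i \<in> Lp_space 2 S" "h \<in> Lp_space 2 S"
  shows "L2_inner S (\<lambda>x. \<Sum>i\<in>I. f i x) h = (\<Sum>i\<in>I. L2_inner S (f i) h)"
  using assms by (simp add: L2_inner_def inner_sum_left L2_inner_integrable)

lemma L2_inner_add_right:
  assumes "f \<in> Lp_space 2 S" "g \<in> Lp_space 2 S" "h \<in> Lp_space 2 S"
  shows "L2_inner S h (\<lambda>x. f x + g x) = L2_inner S h f + L2_inner S h g"
  using L2_inner_add_left[OF assms] by (simp add: L2_inner_commute)

lemma L2_inner_diff_right:
  assumes "f \<in> Lp_space 2 S" "g \<in> Lp_space 2 S" "h \<in> Lp_space 2 S"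
  shows "L2_inner S h (\<lambda>x. f x - g x) = L2_inner S h f - L2_inner S h g"
  using L2_inner_diff_left[OF assms] by (simp add: L2_inner_commute)

lemma L2_norm_scaleR: "L2_norm_on S (\<lambda>x. c *\<^sub>R f x) = \<bar>c\<bar> * L2_norm_on S f"
proof (rule power2_eq_imp_eq)
  show "(L2_norm_on S (\<lambda>x. c *\<^sub>R f x))\<^sup>2 = (\<bar>c\<bar> * L2_norm_on S f)\<^sup>2"
    by (simp add: L2_norm_sq power_mult_distrib)
qed auto

lemma L2_norm_minus_commute:
  "L2_norm_on S (\<lambda>x. f x - g x) = L2_norm_on S (\<lambda>x. g x - f x)"
  by (simp add: Lp_norm_def norm_minus_commute)

text \<open>The inequality 2xy <= x^2 + y^2 is integrated with free weights s and t. Choosing s as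
  the norm of \<open>g\<close> and t as the norm of \<open>f\<close> balances the two squares and
  gives the product when both norms are positive.\<close>

lemma L2_Cauchy_Schwarz_norm:
  assumes "f \<in> Lp_space 2 S" "g \<in> Lp_space 2 S"
  shows "(LINT x|lebesgue_on S. norm (f x) * norm (g x)) \<le> L2_norm_on S f * L2_norm_on S g"
proof -
  let ?a = "L2_norm_on S f" and ?b = "L2_norm_on S g"
  let ?I = "LINT x|lebesgue_on S. norm (f x) * norm (g x)"
  have I: "2 * s * t * ?I \<le> s\<^sup>2 * ?a\<^sup>2 + t\<^sup>2 * ?b\<^sup>2" for s t :: real
  proof -
    have "(LINT x|lebesgue_on S. 2 * s * t * (norm (f x) * norm (g x)))
      \<le> (LINT x|lebesgue_on S. s\<^sup>2 * (norm (f x))\<^sup>2 + t\<^sup>2 * (norm (g x))\<^sup>2)"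
    proof (intro integral_mono)
      fix x
      show "2 * s * t * (norm (f x) * norm (g x)) \<le> s\<^sup>2 * (norm (f x))\<^sup>2 + t\<^sup>2 * (norm (g x))\<^sup>2"
        using sum_squares_bound[of "s * norm (f x)" "t * norm (g x)"]
        by (simp add: power_mult_distrib mult_ac)
    qed (use assms in \<open>auto simp: Lp_space_2_iff intro!: L2_norm_product_integrable integrable_mult_right\<close>)
    then show ?thesis
      using assms by (simp add: L2_norm_sq L2_norm_product_integrable Lp_space_2_iff)
  qed
  have a0: "?a \<ge> 0" and b0: "?b \<ge> 0" by auto
  show ?thesis
  proof (cases "?a = 0 \<or> ?b = 0")
    case False
    then have "?a > 0" "?b > 0" using a0 b0 by (auto simp: less_le)
    moreover have "2 * (?a * ?b) * ?I \<le> 2 * (?a * ?b) * (?a * ?b)"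
      using I[of ?b ?a] by (simp add: power2_eq_square algebra_simps)
    ultimately show ?thesis by (simp add: mult_le_cancel_left)
  next
    case True
    \<comment> \<open>If one norm vanishes, the weight on that function can be made so large that
      the weighted inequality contradicts \<open>?I > 0\<close>.\<close>
    have "?I \<le> 0"
    proof (rule ccontr)
      assume "\<not> ?I \<le> 0"
      then have Ip: "?I > 0" by simp
      show False
      proof (cases "?a = 0")
        case True
        have "2 * ((?b\<^sup>2 + 1) / ?I) * 1 * ?I \<le> ?b\<^sup>2" using I[of "(?b\<^sup>2 + 1) / ?I" 1] True by simp
        then show False using Ip by (simp add: power2_eq_square) (smt (verit) zero_le_square)
      next
        case False
        then have "?b = 0" using \<open>?a = 0 \<or> ?b = 0\<close> by simp
        have "2 * 1 * ((?a\<^sup>2 + 1) / ?I) * ?I \<le> ?a\<^sup>2" using I[of 1 "(?a\<^sup>2 + 1) / ?I"] \<open>?b = 0\<close> by simp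
        then show False using Ip by (simp add: power2_eq_square) (smt (verit) zero_le_square)
      qed
    qed
    with True show ?thesis by auto
  qed
qed

lemma L2_Cauchy_Schwarz:
  assumes "f \<in> Lp_space 2 S" "g \<in> Lp_space 2 S"
  shows "\<bar>L2_inner S f g\<bar> \<le> L2_norm_on S f * L2_norm_on S g"
proof -
  have "\<bar>L2_inner S f g\<bar> \<le> (LINT x|lebesgue_on S. \<bar>f x \<bullet> g x\<bar>)"
    unfolding L2_inner_def by (rule integral_abs_bound)
  also have "\<dots> \<le> (LINT x|lebesgue_on S. norm (f x) * norm (g x))"
    using assms by (intro integral_mono integrable_abs L2_inner_integrable L2_norm_product_integrable)
      (auto simp: Cauchy_Schwarz_ineq2)
  finally show ?thesis using L2_Cauchy_Schwarz_norm[OF assms] by simp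
qed

lemma L2_norm_triangle:
  assumes "f \<in> Lp_space 2 S" "g \<in> Lp_space 2 S"
  shows "L2_norm_on S (\<lambda>x. f x + g x) \<le> L2_norm_on S f + L2_norm_on S g"
proof (rule power2_le_imp_le)
  have "(L2_norm_on S (\<lambda>x. f x + g x))\<^sup>2 = (L2_norm_on S f)\<^sup>2 + 2 * L2_inner S f g + (L2_norm_on S g)\<^sup>2"
    using assms by (simp add: L2_norm_sq_inner L2_inner_add_left L2_inner_add_right L2_add
        L2_inner_commute[of S g f])
  also have "\<dots> \<le> (L2_norm_on S f)\<^sup>2 + 2 * (L2_norm_on S f * L2_norm_on S g) + (L2_norm_on S g)\<^sup>2"
    using L2_Cauchy_Schwarz[OF assms] by auto
  also have "\<dots> = (L2_norm_on S f + L2_norm_on S g)\<^sup>2" by (simp add: power2_sum)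
  finally show "(L2_norm_on S (\<lambda>x. f x + g x))\<^sup>2 \<le> \<dots>" .
qed auto

lemma L2_norm_triangle_diff:
  assumes "f \<in> Lp_space 2 S" "g \<in> Lp_space 2 S"
  shows "L2_norm_on S (\<lambda>x. f x - g x) \<le> L2_norm_on S f + L2_norm_on S g"
  using L2_norm_triangle[OF assms(1) L2_scaleR[OF assms(2), of "-1"]]
  by (simp add: L2_norm_scaleR[of S "-1", simplified])

lemma L2_norm_zero [simp]: "L2_norm_on S (\<lambda>x. 0) = 0"
  using L2_norm_sq[of S "\<lambda>x. 0"] by simp

lemma L2_norm_sum:
  assumes "finite I" "\<And>i. i \<in> I \<Longrightarrow> f i \<in> Lp_space 2 S"
  shows "L2_norm_on S (\<lambda>x. \<Sum>i\<in>I. f i x) \<le> (\<Sum>i\<in>I. L2_norm_on S (f i))"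
  using assms
proof (induction I rule: finite_induct)
  case (insert i I)
  have "L2_norm_on S (\<lambda>x. f i x + (\<Sum>i\<in>I. f i x)) \<le> L2_norm_on S (f i) + L2_norm_on S (\<lambda>x. \<Sum>i\<in>I. f i x)"
    using insert.prems by (intro L2_norm_triangle L2_sum) auto
  with insert show ?case by force
qed auto

lemma L2_norm_mono:
  fixes h :: "'a::euclidean_space \<Rightarrow> 'b::euclidean_space" and f :: "'a \<Rightarrow> 'c::euclidean_space"
  assumes "f \<in> Lp_space 2 S" "h \<in> borel_measurable (lebesgue_on S)" "M \<ge> 0"
    and "AE x in lebesgue_on S. norm (h x) \<le> M * norm (f x)"
  shows "h \<in> Lp_space 2 S" and "L2_norm_on S h \<le> M * L2_norm_on S f"
proof -
  show h: "h \<in> Lp_space 2 S"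
    using assms(4) by (intro L2_dominated2[OF assms(1) assms(1) assms(2), of M 0]) auto
  show "L2_norm_on S h \<le> M * L2_norm_on S f"
  proof (rule power2_le_imp_le)
    have "(L2_norm_on S h)\<^sup>2 \<le> (LINT x|lebesgue_on S. M\<^sup>2 * (norm (f x))\<^sup>2)"
      unfolding L2_norm_sq
    proof (rule integral_mono_AE)
      show "AE x in lebesgue_on S. (norm (h x))\<^sup>2 \<le> M\<^sup>2 * (norm (f x))\<^sup>2"
        using assms(4) by eventually_elim (metis norm_ge_zero power_mono power_mult_distrib)
    qed (use h assms in \<open>auto simp: Lp_space_2_iff\<close>)
    also have "\<dots> = (M * L2_norm_on S f)\<^sup>2" by (simp add: power_mult_distrib L2_norm_sq)
    finally show "(L2_norm_on S h)\<^sup>2 \<le> (M * L2_norm_on S f)\<^sup>2" .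
  qed (use assms in auto)
qed

text \<open>Completeness of Lebesgue measure: a change on a null set preserves measurability.
  Extension by zero transports the claim from \<open>lebesgue_on S\<close> to the whole
  space.\<close>

lemma borel_measurable_AE_on:
  fixes f :: "'a::euclidean_space \<Rightarrow> 'b::euclidean_space"
  assumes S: "S \<in> sets lebesgue" and f: "f \<in> borel_measurable (lebesgue_on S)"
    and ae: "AE x in lebesgue_on S. f x = g x"
  shows "g \<in> borel_measurable (lebesgue_on S)"
proof -
  have "AE x in lebesgue. (if x \<in> S then f x else 0) = (if x \<in> S then g x else 0)"
    using ae S by (auto simp: AE_restrict_space_iff)
  from borel_measurable_AE[OF _ this] show ?thesis
    using S f by (simp add: borel_measurable_if)
qed

lemma L2_cong_AE:
  fixes f :: "'a::euclidean_space \<Rightarrow> 'b::euclidean_space"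
  assumes S: "S \<in> sets lebesgue" and f: "f \<in> Lp_space 2 S"
    and ae: "AE x in lebesgue_on S. f x = g x"
  shows "g \<in> Lp_space 2 S" "L2_norm_on S g = L2_norm_on S f"
proof -
  have g: "g \<in> borel_measurable (lebesgue_on S)"
    using borel_measurable_AE_on[OF S Lp_space_2_measurable[OF f] ae] .
  have ae1: "AE x in lebesgue_on S. norm (g x) \<le> 1 * norm (f x)" using ae by auto
  show g2: "g \<in> Lp_space 2 S" using L2_norm_mono(1)[OF f g _ ae1] by simp
  have "L2_norm_on S g \<le> L2_norm_on S f" using L2_norm_mono(2)[OF f g _ ae1] by simp
  moreover have "L2_norm_on S f \<le> L2_norm_on S g"
  proof -
    have "AE x in lebesgue_on S. norm (f x) \<le> 1 * norm (g x)" using ae by auto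
    from L2_norm_mono(2)[OF g2 Lp_space_2_measurable[OF f] _ this] show ?thesis by simp
  qed
  ultimately show "L2_norm_on S g = L2_norm_on S f" by simp
qed

lemma L2_inner_eq_AE:
  assumes S: "S \<in> sets lebesgue" and "f \<in> borel_measurable (lebesgue_on S)"
    "h \<in> borel_measurable (lebesgue_on S)" and ae: "AE x in lebesgue_on S. f x = g x"
  shows "L2_inner S f h = L2_inner S g h"
  unfolding L2_inner_def
proof (rule integral_cong_AE)
  have "g \<in> borel_measurable (lebesgue_on S)" using borel_measurable_AE_on[OF S assms(2) ae] .
  then show "(\<lambda>x. g x \<bullet> h x) \<in> borel_measurable (lebesgue_on S)" using assms by auto
qed (use assms in auto)

lemma Linf_iff:
  fixes f :: "'a::euclidean_space \<Rightarrow> 'b::euclidean_space"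
  shows "f \<in> Lp_space \<infinity> S \<longleftrightarrow> f \<in> borel_measurable (lebesgue_on S) \<and>
     (\<exists>B. AE x in lebesgue_on S. norm (f x) \<le> B)"
proof (cases "f \<in> borel_measurable (lebesgue_on S)")
  case True
  let ?F = "\<lambda>x. ereal (norm (f x))"
  have m: "?F \<in> borel_measurable (lebesgue_on S)" using True by simp
  have "esssup (lebesgue_on S) ?F < \<infinity> \<longleftrightarrow> (\<exists>B. AE x in lebesgue_on S. norm (f x) \<le> B)"
  proof
    assume "esssup (lebesgue_on S) ?F < \<infinity>"
    then obtain B where B: "esssup (lebesgue_on S) ?F \<le> ereal B"
      by (cases "esssup (lebesgue_on S) ?F") auto
    have "AE x in lebesgue_on S. norm (f x) \<le> B"
      using esssup_AE[of ?F "lebesgue_on S"] by eventually_elim (use B in \<open>meson ereal_less_eq(3) order_trans\<close>)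
    then show "\<exists>B. AE x in lebesgue_on S. norm (f x) \<le> B" by blast
  next
    assume "\<exists>B. AE x in lebesgue_on S. norm (f x) \<le> B"
    then obtain B where "AE x in lebesgue_on S. norm (f x) \<le> B" by blast
    then have "AE x in lebesgue_on S. ?F x \<le> ereal B" by simp
    from esssup_I[OF m this] show "esssup (lebesgue_on S) ?F < \<infinity>"
      using le_less_trans less_ereal.simps(4) by (metis ereal_less_PInfty)
  qed
  with True show ?thesis by (simp add: Lp_space_def)
qed (simp add: Lp_space_def)

lemma Linf_AE:
  fixes f :: "'a::euclidean_space \<Rightarrow> 'b::euclidean_space"
  assumes "f \<in> Lp_space \<infinity> S"
  shows "AE x in lebesgue_on S. norm (f x) \<le> Linf_norm S f"
proof -
  let ?F = "\<lambda>x. ereal (norm (f x))"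
  have fin: "esssup (lebesgue_on S) ?F < \<infinity>" using assms by (simp add: Lp_space_def)
  show ?thesis using esssup_AE[of ?F "lebesgue_on S"]
  proof eventually_elim
    case (elim x)
    with fin obtain r where "esssup (lebesgue_on S) ?F = ereal r"
      by (cases "esssup (lebesgue_on S) ?F") auto
    with elim show ?case by (simp add: Lp_norm_def)
  qed
qed

lemma Linf_le:
  fixes f :: "'a::euclidean_space \<Rightarrow> 'b::euclidean_space"
  assumes "f \<in> borel_measurable (lebesgue_on S)" "AE x in lebesgue_on S. norm (f x) \<le> B" "B \<ge> 0"
  shows "f \<in> Lp_space \<infinity> S" "Linf_norm S f \<le> B"
proof -
  let ?F = "\<lambda>x. ereal (norm (f x))"
  show "f \<in> Lp_space \<infinity> S" using assms by (auto simp: Linf_iff)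
  have "AE x in lebesgue_on S. ?F x \<le> ereal B" using assms by simp
  then have "esssup (lebesgue_on S) ?F \<le> ereal B" using assms(1) by (intro esssup_I) auto
  then show "Linf_norm S f \<le> B"
    using assms(3) by (cases "esssup (lebesgue_on S) ?F") (auto simp: Lp_norm_def)
qed

text \<open>True for every function, because every junk value is harmless: the essential supremum is
  infinite for a non-measurable function and minus infinity on a null space, and
  \<open>real_of_ereal\<close> sends both to 0.\<close>

lemma Linf_norm_nonneg:
  fixes f :: "'a::euclidean_space \<Rightarrow> 'b::euclidean_space"
  shows "Linf_norm S f \<ge> 0"
proof -
  let ?M = "lebesgue_on S" and ?F = "\<lambda>x. ereal (norm (f x))"
  consider "?F \<notin> borel_measurable ?M" | "?F \<in> borel_measurable ?M" "emeasure ?M (space ?M) = 0"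
    | "emeasure ?M (space ?M) \<noteq> 0" by blast
  then have "real_of_ereal (esssup ?M ?F) \<ge> 0"
  proof cases
    case 1
    then show ?thesis by (simp add: esssup_non_measurable top_ereal_def)
  next
    case 2
    then show ?thesis by (simp add: esssup_zero_space)
  next
    case 3
    then have "ae_filter ?M \<noteq> bot" by (simp add: ae_filter_eq_bot_iff)
    then obtain x where "?F x \<le> esssup ?M ?F"
      using esssup_AE[of ?F ?M] eventually_happens by blast
    then have "esssup ?M ?F \<ge> 0" by (meson ereal_less_eq(5) norm_ge_zero order_trans)
    then show ?thesis by (rule real_of_ereal_pos)
  qed
  then show ?thesis by (simp add: Lp_norm_def)
qed

subsection \<open>Smooth functions and test functions\<close>

text \<open>A bounded order serves as induction parameter for the product rule. The recursion
  \<open>smooth_upto_Suc\<close> peels off the derivative taken first, which is the last entry of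
  the list, whereas \<open>iter_partial\<close> recurses on the one taken last.\<close>

definition smooth_upto :: "nat \<Rightarrow> (real^'d::finite \<Rightarrow> 'b::euclidean_space) \<Rightarrow> bool" where
  "smooth_upto n f \<longleftrightarrow> (\<forall>js x. length js \<le> n \<longrightarrow> iter_partial js f differentiable (at x))"

definition smooth :: "(real^'d::finite \<Rightarrow> 'b::euclidean_space) \<Rightarrow> bool" where
  "smooth f \<longleftrightarrow> (\<forall>js x. iter_partial js f differentiable (at x))"

lemma smooth_iff_upto: "smooth f \<longleftrightarrow> (\<forall>n. smooth_upto n f)"
  by (auto simp: smooth_def smooth_upto_def)

lemma iter_partial_append: "iter_partial (js @ [i]) f = iter_partial js (partial_deriv i f)"
  by (induction js) auto

lemma smooth_upto_0: "smooth_upto 0 f \<longleftrightarrow> (\<forall>x. f differentiable (at x))"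
  by (simp add: smooth_upto_def)

lemma smooth_upto_Suc:
  "smooth_upto (Suc n) f \<longleftrightarrow> (\<forall>x. f differentiable (at x)) \<and> (\<forall>i. smooth_upto n (partial_deriv i f))"
proof safe
  fix x assume "smooth_upto (Suc n) f"
  then have "iter_partial [] f differentiable (at x)" unfolding smooth_upto_def by (metis le0 list.size(3))
  then show "f differentiable (at x)" by simp
next
  fix i assume *: "smooth_upto (Suc n) f"
  show "smooth_upto n (partial_deriv i f)"
    unfolding smooth_upto_def
  proof safe
    fix js :: "'a list" and x assume "length js \<le> n"
    then have "iter_partial (js @ [i]) f differentiable (at x)"
      using * unfolding smooth_upto_def by (metis Suc_le_mono length_append_singleton)
    then show "iter_partial js (partial_deriv i f) differentiable (at x)"
      by (simp add: iter_partial_append)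
  qed
next
  assume *: "\<forall>x. f differentiable (at x)" "\<forall>i. smooth_upto n (partial_deriv i f)"
  show "smooth_upto (Suc n) f"
    unfolding smooth_upto_def
  proof safe
    fix js :: "'a list" and x assume l: "length js \<le> Suc n"
    show "iter_partial js f differentiable (at x)"
    proof (cases js rule: rev_cases)
      case (snoc ks i)
      then show ?thesis using * l by (auto simp: iter_partial_append smooth_upto_def)
    qed (use * in auto)
  qed
qed

lemma smooth_upto_differentiable: "smooth_upto n f \<Longrightarrow> f differentiable (at x)"
  by (cases n) (auto simp: smooth_upto_0 smooth_upto_Suc)

lemma smooth_upto_mono: "smooth_upto (Suc n) f \<Longrightarrow> smooth_upto n f"
  by (auto simp: smooth_upto_def)

lemma smooth_differentiable: "smooth f \<Longrightarrow> f differentiable (at x)"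
  using smooth_iff_upto smooth_upto_differentiable by blast

lemma smooth_partial: "smooth f \<Longrightarrow> smooth (partial_deriv i f)"
  using smooth_iff_upto smooth_upto_Suc by blast

lemma smooth_continuous_on: "smooth f \<Longrightarrow> continuous_on S f"
  by (intro continuous_at_imp_continuous_on ballI differentiable_imp_continuous_within smooth_differentiable)

lemma differentiable_bilinear:
  assumes "bounded_bilinear p" "f differentiable (at x)" "g differentiable (at x)"
  shows "(\<lambda>x. p (f x) (g x)) differentiable (at x)"
  using assms(2,3) bounded_bilinear.FDERIV[OF assms(1)] unfolding differentiable_def by fast

lemma differentiable_linear:
  assumes "bounded_linear L" "f differentiable (at x)"
  shows "(\<lambda>x. L (f x)) differentiable (at x)"
  using assms(2) bounded_linear.has_derivative[OF assms(1)] unfolding differentiable_def by fast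

lemma partial_derivI: "(f has_derivative f') (at x) \<Longrightarrow> partial_deriv i f x = f' (axis i 1)"
  by (simp add: partial_deriv_def frechet_derivative_at[symmetric])

lemma partial_deriv_const [simp]: "partial_deriv i (\<lambda>x. c) = (\<lambda>x. 0)"
  by (rule ext, subst partial_derivI[OF has_derivative_const]) auto

lemma partial_deriv_bilinear:
  assumes "bounded_bilinear p" "f differentiable (at x)" "g differentiable (at x)"
  shows "partial_deriv i (\<lambda>x. p (f x) (g x)) x = p (f x) (partial_deriv i g x) + p (partial_deriv i f x) (g x)"
proof -
  have "(f has_derivative frechet_derivative f (at x)) (at x)"
    "(g has_derivative frechet_derivative g (at x)) (at x)"
    using assms frechet_derivative_works by blast+
  from partial_derivI[OF bounded_bilinear.FDERIV[OF assms(1) this]]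
  show ?thesis by (simp add: partial_deriv_def)
qed

lemma partial_deriv_add:
  assumes "f differentiable (at x)" "g differentiable (at x)"
  shows "partial_deriv i (\<lambda>x. f x + g x) x = partial_deriv i f x + partial_deriv i g x"
proof -
  have "(f has_derivative frechet_derivative f (at x)) (at x)"
    "(g has_derivative frechet_derivative g (at x)) (at x)"
    using assms frechet_derivative_works by blast+
  from partial_derivI[OF has_derivative_add[OF this]] show ?thesis by (simp add: partial_deriv_def)
qed

lemma partial_deriv_linear:
  assumes "bounded_linear L" "f differentiable (at x)"
  shows "partial_deriv i (\<lambda>x. L (f x)) x = L (partial_deriv i f x)"
proof -
  have "(f has_derivative frechet_derivative f (at x)) (at x)"
    using assms frechet_derivative_works by blast
  from partial_derivI[OF bounded_linear.has_derivative[OF assms(1) this]]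
  show ?thesis by (simp add: partial_deriv_def)
qed

lemma smooth_upto_const: "smooth_upto n (\<lambda>x. c)"
  by (induction n arbitrary: c) (auto simp: smooth_upto_0 smooth_upto_Suc)

lemma smooth_upto_add:
  "smooth_upto n f \<Longrightarrow> smooth_upto n g \<Longrightarrow> smooth_upto n (\<lambda>x. f x + g x)"
proof (induction n arbitrary: f g)
  case 0
  then show ?case by (auto simp: smooth_upto_0)
next
  case (Suc n)
  have "partial_deriv i (\<lambda>x. f x + g x) = (\<lambda>x. partial_deriv i f x + partial_deriv i g x)" for i
    using Suc.prems by (auto simp: partial_deriv_add smooth_upto_Suc)
  with Suc show ?case by (auto simp: smooth_upto_Suc)
qed

text \<open>The product rule produces two products, each with one factor differentiated and the
  other untouched. So the induction hypothesis is applied to other pairs of functions, after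
  lowering the order of the untouched factor by one.\<close>

lemma smooth_upto_bilinear:
  assumes p: "bounded_bilinear p"
  shows "smooth_upto n f \<Longrightarrow> smooth_upto n g \<Longrightarrow> smooth_upto n (\<lambda>x. p (f x) (g x))"
proof (induction n arbitrary: f g)
  case 0
  then show ?case by (auto simp: smooth_upto_0 intro: differentiable_bilinear[OF p])
next
  case (Suc n)
  have d: "(\<lambda>x. p (f x) (g x)) differentiable (at x)" for x
    by (intro differentiable_bilinear[OF p] smooth_upto_differentiable[OF Suc.prems(1)] smooth_upto_differentiable[OF Suc.prems(2)])
  have "partial_deriv i (\<lambda>x. p (f x) (g x)) =
      (\<lambda>x. p (f x) (partial_deriv i g x) + p (partial_deriv i f x) (g x))" for i
    using Suc.prems by (auto simp: partial_deriv_bilinear[OF p] smooth_upto_Suc)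
  moreover have "smooth_upto n (\<lambda>x. p (f x) (partial_deriv i g x) + p (partial_deriv i f x) (g x))" for i
    using Suc.prems smooth_upto_mono[OF Suc.prems(1)] smooth_upto_mono[OF Suc.prems(2)]
    by (intro smooth_upto_add Suc.IH) (auto simp: smooth_upto_Suc)
  ultimately show ?case using d by (auto simp: smooth_upto_Suc)
qed

lemma smooth_upto_linear:
  assumes L: "bounded_linear L"
  shows "smooth_upto n f \<Longrightarrow> smooth_upto n (\<lambda>x. L (f x))"
proof (induction n arbitrary: f)
  case 0
  then show ?case by (auto simp: smooth_upto_0 intro: differentiable_linear[OF L])
next
  case (Suc n)
  have d: "(\<lambda>x. L (f x)) differentiable (at x)" for x
    by (intro differentiable_linear[OF L] smooth_upto_differentiable[OF Suc.prems(1)])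
  have "partial_deriv i (\<lambda>x. L (f x)) = (\<lambda>x. L (partial_deriv i f x))" for i
    using Suc.prems by (auto simp: partial_deriv_linear[OF L] smooth_upto_Suc)
  with Suc d show ?case by (auto simp: smooth_upto_Suc)
qed

lemma smooth_const: "smooth (\<lambda>x. c)"
  by (simp add: smooth_iff_upto smooth_upto_const)

lemma smooth_add: "smooth f \<Longrightarrow> smooth g \<Longrightarrow> smooth (\<lambda>x. f x + g x)"
  by (simp add: smooth_iff_upto smooth_upto_add)

lemma smooth_bilinear: "bounded_bilinear p \<Longrightarrow> smooth f \<Longrightarrow> smooth g \<Longrightarrow> smooth (\<lambda>x. p (f x) (g x))"
  by (simp add: smooth_iff_upto smooth_upto_bilinear)

lemma smooth_linear: "bounded_linear L \<Longrightarrow> smooth f \<Longrightarrow> smooth (\<lambda>x. L (f x))"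
  by (simp add: smooth_iff_upto smooth_upto_linear)

lemmas smooth_scaleR = smooth_bilinear[OF bounded_bilinear_scaleR]
lemmas smooth_mult = smooth_bilinear[OF bounded_bilinear_mult]

lemma smooth_diff: "smooth f \<Longrightarrow> smooth g \<Longrightarrow> smooth (\<lambda>x. f x - g x)"
  using smooth_add[of f "\<lambda>x. - g x"] smooth_linear[OF bounded_linear_minus[OF bounded_linear_ident], of g] by simp

lemma smooth_sum: "(\<And>i. i \<in> I \<Longrightarrow> smooth (f i)) \<Longrightarrow> smooth (\<lambda>x. \<Sum>i\<in>I. f i x)"
  by (induction I rule: infinite_finite_induct) (auto intro: smooth_const smooth_add)

lemma smooth_prod:
  "(\<And>i. i \<in> I \<Longrightarrow> smooth (f i)) \<Longrightarrow> smooth (\<lambda>x. (\<Prod>i\<in>I. f i x) :: real)"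
  by (induction I rule: infinite_finite_induct) (auto intro: smooth_const smooth_mult)

lemma smooth_power: "smooth f \<Longrightarrow> smooth (\<lambda>x. (f x :: real) ^ n)"
  by (induction n) (auto intro: smooth_const smooth_mult)

lemma smooth_component: "smooth (\<lambda>x::real^'d::finite. x $ i)"
proof -
  have d: "((\<lambda>x::real^'d. x $ i) has_derivative (\<lambda>x. x $ i)) (at x)" for x
    by (rule bounded_linear_imp_has_derivative[OF bounded_linear_vec_nth])
  have "smooth_upto n (\<lambda>x::real^'d. x $ i)" for n
  proof (cases n)
    case 0
    then show ?thesis using d by (auto simp: smooth_upto_0 differentiable_def)
  next
    case (Suc m)
    have "partial_deriv j (\<lambda>x::real^'d. x $ i) = (\<lambda>x. axis j 1 $ i)" for j
      using partial_derivI[OF d] by auto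
    then show ?thesis using d Suc by (auto simp: smooth_upto_Suc smooth_upto_const differentiable_def)
  qed
  then show ?thesis by (simp add: smooth_iff_upto)
qed

lemma zero_outside_support: "x \<notin> closure {x. f x \<noteq> 0} \<Longrightarrow> f x = 0"
  using closure_subset[of "{x. f x \<noteq> 0}"] by blast

text \<open>Any compact set off which the function vanishes may serve as witness: it contains the
  closure of the support, which is then compact itself.\<close>

lemma test_functionsI:
  assumes "smooth f" "compact K" "K \<subseteq> \<Omega>" "\<And>x. x \<notin> K \<Longrightarrow> f x = 0"
  shows "f \<in> test_functions \<Omega>"
proof -
  have "closure {x. f x \<noteq> 0} \<subseteq> K"
    using assms by (intro closure_minimal) (auto intro: compact_imp_closed)
  moreover from this have "compact (closure {x. f x \<noteq> 0})"
    using assms(2) by (meson bounded_subset compact_eq_bounded_closed closed_closure)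
  ultimately show ?thesis using assms by (auto simp: test_functions_def smooth_def)
qed

lemma test_functionsD:
  assumes "f \<in> test_functions \<Omega>"
  shows "smooth f" "compact (closure {x. f x \<noteq> 0})" "closure {x. f x \<noteq> 0} \<subseteq> \<Omega>"
  using assms by (auto simp: test_functions_def smooth_def)

lemma test_functions_zero_outside: "f \<in> test_functions \<Omega> \<Longrightarrow> x \<notin> \<Omega> \<Longrightarrow> f x = 0"
  using test_functionsD(3)[of f \<Omega>] zero_outside_support[of x f] by blast

lemma test_functions_mono: "f \<in> test_functions U \<Longrightarrow> U \<subseteq> \<Omega> \<Longrightarrow> f \<in> test_functions \<Omega>"
  by (auto simp: test_functions_def)

lemma test_functions_zero: "(\<lambda>x. 0) \<in> test_functions \<Omega>"
  by (rule test_functionsI[of _ "{}"]) (auto intro: smooth_const)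

lemma test_functions_add:
  assumes "f \<in> test_functions \<Omega>" "g \<in> test_functions \<Omega>"
  shows "(\<lambda>x. f x + g x) \<in> test_functions \<Omega>"
proof (rule test_functionsI)
  show "compact (closure {x. f x \<noteq> 0} \<union> closure {x. g x \<noteq> 0})"
    using assms test_functionsD by blast
  show "f x + g x = 0" if "x \<notin> closure {x. f x \<noteq> 0} \<union> closure {x. g x \<noteq> 0}" for x
    using that zero_outside_support[of x f] zero_outside_support[of x g] by auto
qed (use assms test_functionsD in \<open>blast intro: smooth_add\<close>)+

lemma test_functions_linear:
  assumes L: "bounded_linear L" and "f \<in> test_functions \<Omega>"
  shows "(\<lambda>x. L (f x)) \<in> test_functions \<Omega>"
proof (rule test_functionsI)
  show "L (f x) = 0" if "x \<notin> closure {x. f x \<noteq> 0}" for x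
    using zero_outside_support[OF that] linear_0[OF bounded_linear.linear[OF L]] by auto
qed (use assms test_functionsD in \<open>blast intro: smooth_linear\<close>)+

lemma test_functions_bilinear:
  assumes p: "bounded_bilinear p" and "f \<in> test_functions \<Omega>" "smooth g"
  shows "(\<lambda>x. p (f x) (g x)) \<in> test_functions \<Omega>"
proof (rule test_functionsI)
  show "p (f x) (g x) = 0" if "x \<notin> closure {x. f x \<noteq> 0}" for x
    using zero_outside_support[OF that] bounded_bilinear.zero_left[OF p] by auto
qed (use assms test_functionsD in \<open>blast intro: smooth_bilinear\<close>)+

lemmas test_functions_scaleR = test_functions_bilinear[OF bounded_bilinear_scaleR]

lemma test_functions_const_scaleR:
  "f \<in> test_functions \<Omega> \<Longrightarrow> (\<lambda>x. c *\<^sub>R f x) \<in> test_functions \<Omega>"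
  by (rule test_functions_linear[OF bounded_linear_scaleR_right])

lemma test_functions_scaleR_const:
  "f \<in> test_functions \<Omega> \<Longrightarrow> (\<lambda>x. f x *\<^sub>R c) \<in> test_functions \<Omega>"
  by (rule test_functions_linear[OF bounded_linear_scaleR_left])

lemma partial_deriv_eq_0_outside:
  assumes "x \<notin> closure {x. f x \<noteq> 0}"
  shows "partial_deriv i f x = 0"
proof -
  have "((\<lambda>x. 0) has_derivative (\<lambda>x. 0)) (at x)" by simp
  then have "(f has_derivative (\<lambda>x. 0)) (at x)"
  proof (rule has_derivative_transform_within_open)
    show "open (- closure {x. f x \<noteq> 0})" by (simp only: open_Compl closed_closure)
    show "0 = f y" if "y \<in> - closure {x. f x \<noteq> 0}" for y using that zero_outside_support[of y f] by simp
  qed (use assms in simp)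
  from partial_derivI[OF this] show ?thesis by simp
qed

lemma test_functions_partial:
  assumes "f \<in> test_functions \<Omega>" shows "partial_deriv i f \<in> test_functions \<Omega>"
  by (rule test_functionsI[OF smooth_partial[OF test_functionsD(1)[OF assms]]
        test_functionsD(2,3)[OF assms] partial_deriv_eq_0_outside])

lemma test_functions_bounded:
  assumes "f \<in> test_functions \<Omega>"
  obtains B where "B \<ge> 0" "\<And>x. norm (f x) \<le> B"
proof -
  have "compact (f ` closure {x. f x \<noteq> 0})"
    using assms test_functionsD by (intro compact_continuous_image smooth_continuous_on) auto
  then obtain B where B: "\<And>x. x \<in> closure {x. f x \<noteq> 0} \<Longrightarrow> norm (f x) \<le> B"
    by (meson bounded_iff compact_imp_bounded image_eqI)
  have "norm (f x) \<le> max B 0" for x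
    using B[of x] zero_outside_support[of x f] by (cases "f x = 0") (auto simp: le_max_iff_disj)
  then show ?thesis using that[of "max B 0"] by auto
qed

lemma smooth_borel: "smooth f \<Longrightarrow> f \<in> borel_measurable borel"
  by (intro borel_measurable_continuous_onI smooth_continuous_on)

lemma smooth_borel_lebesgue_on: "smooth f \<Longrightarrow> f \<in> borel_measurable (lebesgue_on S)"
  by (intro measurable_restrict_space1 measurable_completion) (simp add: smooth_borel)

subsection \<open>Approximation of indicator functions of open sets\<close>

text \<open>The flat function exp(-1/t), extended by zero, with a polynomial in 1/t as prefactor.
  The prefactor makes the family closed under differentiation, so that smoothness is an induction
  with \<open>p\<close> arbitrary.\<close>

definition expb :: "real poly \<Rightarrow> real \<Rightarrow> real" where
  "expb p t = (if t > 0 then poly p (1 / t) * exp (- (1 / t)) else 0)"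

lemma poly_exp_tendsto_0: "((\<lambda>s::real. poly q s * exp (- s)) \<longlongrightarrow> 0) at_top"
proof -
  have "((\<lambda>s::real. \<Sum>i\<le>degree q. coeff q i * (s ^ i / exp s)) \<longlongrightarrow> (\<Sum>i\<le>degree q. coeff q i * 0)) at_top"
    by (intro tendsto_intros tendsto_power_div_exp_0)
  then show ?thesis by (simp add: poly_altdef sum_distrib_right exp_minus divide_inverse mult.assoc)
qed

text \<open>With s = 1/t, the derivative of p(s) exp(-s) is s^2 (p(s) - p'(s)) exp(-s), and
  \<open>[:0, 0, 1:]\<close> is the polynomial s^2. At 0 both one-sided difference quotients tend to
  0.\<close>

lemma expb_deriv:
  "(expb p has_real_derivative expb ([:0, 0, 1:] * (p - pderiv p)) t) (at t)"
proof -
  consider "t < 0" | "t > 0" | "t = 0" by linarith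
  then show ?thesis
  proof cases
    case 1
    have "((\<lambda>t. 0) has_real_derivative 0) (at t)" by simp
    then have "(expb p has_real_derivative 0) (at t)"
      by (rule has_field_derivative_transform_within_open[of _ _ _ "{..<0}"]) (use 1 in \<open>auto simp: expb_def\<close>)
    with 1 show ?thesis by (simp add: expb_def)
  next
    case 2
    have "((\<lambda>t. poly p (1 / t) * exp (- (1 / t))) has_real_derivative
        expb ([:0, 0, 1:] * (p - pderiv p)) t) (at t)"
      using 2 by (auto intro!: derivative_eq_intros simp: expb_def field_simps power2_eq_square)
    then show ?thesis
      by (rule has_field_derivative_transform_within_open[of _ _ _ "{0<..}"]) (use 2 in \<open>auto simp: expb_def\<close>)
  next
    case 3
    have R: "((\<lambda>h. (expb p (0 + h) - expb p 0) / h) \<longlongrightarrow> 0) (at_right 0)"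
    proof -
      \<comment> \<open>Dividing by h multiplies the prefactor by s = 1/h, and s p(s) is
        \<open>pCons 0 p\<close>.\<close>
      have "((\<lambda>h. poly (pCons 0 p) (inverse h) * exp (- inverse h)) \<longlongrightarrow> 0) (at_right 0)"
        by (rule filterlim_compose[OF poly_exp_tendsto_0 filterlim_inverse_at_top_right])
      moreover have "\<forall>\<^sub>F h in at_right 0. poly (pCons 0 p) (inverse h) * exp (- inverse h)
          = (expb p (0 + h) - expb p 0) / h"
        using eventually_at_right_less[of 0]
        by eventually_elim (simp add: expb_def field_simps)
      ultimately show ?thesis by (rule Lim_transform_eventually)
    qed
    have L: "((\<lambda>h. (expb p (0 + h) - expb p 0) / h) \<longlongrightarrow> 0) (at_left 0)"
    proof -
      have "\<forall>\<^sub>F h in at_left 0. 0 = (expb p (0 + h) - expb p 0) / h"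
        by (simp add: eventually_at_left_field expb_def) (meson gt_ex neg_less_0_iff_less lt_ex)
      then show ?thesis by (rule Lim_transform_eventually[OF tendsto_const])
    qed
    from filterlim_split_at[OF L R] show ?thesis using 3 by (simp add: DERIV_def expb_def)
  qed
qed

lemma smooth_expb: fixes p :: "real poly" shows "smooth (\<lambda>x::real^'d::finite. expb p (c * x $ i + d))"
proof -
  have d: "((\<lambda>x::real^'d. expb p (c * x $ i + d)) has_derivative
      (\<lambda>y. expb ([:0, 0, 1:] * (p - pderiv p)) (c * x $ i + d) * (c * y $ i))) (at x)" for p x
  proof -
    have "((\<lambda>x::real^'d. c * x $ i + d) has_derivative (\<lambda>y. c * y $ i)) (at x)"
      by (auto intro!: derivative_eq_intros bounded_linear_imp_has_derivative[OF bounded_linear_vec_nth])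
    from DERIV_compose_FDERIV[OF expb_deriv this] show ?thesis by (simp add: mult_ac)
  qed
  then have diff: "(\<lambda>x::real^'d. expb p (c * x $ i + d)) differentiable (at x)" for p x
    unfolding differentiable_def by blast
  have "smooth_upto n (\<lambda>x::real^'d. expb p (c * x $ i + d))" for n
  proof (induction n arbitrary: p)
    case 0
    show ?case using diff by (simp add: smooth_upto_0)
  next
    case (Suc n)
    have "partial_deriv j (\<lambda>x::real^'d. expb p (c * x $ i + d)) =
       (\<lambda>x. (c * axis j 1 $ i) *\<^sub>R expb ([:0, 0, 1:] * (p - pderiv p)) (c * x $ i + d))" for j
      using partial_derivI[OF d] by auto
    moreover have "smooth_upto n (\<lambda>x::real^'d. (c * axis j 1 $ i) *\<^sub>R
        expb ([:0, 0, 1:] * (p - pderiv p)) (c * x $ i + d))" for j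
      by (rule smooth_upto_linear[OF bounded_linear_scaleR_right Suc])
    ultimately show ?case using diff by (simp add: smooth_upto_Suc)
  qed
  then show ?thesis by (simp add: smooth_iff_upto)
qed

lemma expb_one: "expb 1 t \<ge> 0" "expb 1 t \<le> 1" "expb 1 t > 0 \<longleftrightarrow> t > 0" "expb 1 t = 0 \<longleftrightarrow> t \<le> 0"
  by (auto simp: expb_def)

text \<open>The positivity set is exactly the open box, and the support stays in the closed one. No
  plateau of height 1 is asked for: \<open>open_indicator_approx\<close> reaches the value 1 by
  taking powers.\<close>

lemma box_bump:
  fixes a b :: "real^'d::finite"
  assumes "cbox a b \<subseteq> U"
  obtains \<phi> :: "real^'d \<Rightarrow> real" where "\<phi> \<in> test_functions U" "\<And>x. 0 \<le> \<phi> x" "\<And>x. \<phi> x \<le> 1"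
    "\<And>x. \<phi> x > 0 \<longleftrightarrow> x \<in> box a b"
proof -
  define \<phi> :: "real^'d \<Rightarrow> real" where
    "\<phi> x = (\<Prod>i\<in>UNIV. expb 1 (x $ i - a $ i) * expb 1 (b $ i - x $ i))" for x
  have 1: "0 \<le> \<phi> x" "\<phi> x \<le> 1" for x
    unfolding \<phi>_def by (auto intro!: prod_nonneg prod_le_1 mult_le_one simp: expb_one)
  have 2: "\<phi> x > 0 \<longleftrightarrow> x \<in> box a b" for x
  proof
    assume "x \<in> box a b"
    then show "\<phi> x > 0" unfolding \<phi>_def by (intro prod_pos) (auto simp: expb_one mem_box_cart)
  next
    assume p: "\<phi> x > 0"
    have "expb 1 (x $ i - a $ i) * expb 1 (b $ i - x $ i) \<noteq> 0" for i
      using p unfolding \<phi>_def by (metis (mono_tags, lifting) UNIV_I finite less_irrefl prod_zero)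
    then show "x \<in> box a b" by (auto simp: mem_box_cart expb_one not_le)
  qed
  have s: "smooth \<phi>"
    unfolding \<phi>_def
  proof (intro smooth_prod smooth_mult)
    fix i
    show "smooth (\<lambda>x::real^'d. expb 1 (x $ i - a $ i))" using smooth_expb[of 1 1 i "- a $ i"] by simp
    show "smooth (\<lambda>x::real^'d. expb 1 (b $ i - x $ i))" using smooth_expb[of 1 "-1" i "b $ i"] by simp
  qed
  have "\<phi> \<in> test_functions U"
    by (rule test_functionsI[OF s compact_cbox assms])
       (metis 1(1) 2 box_subset_cbox less_eq_real_def subsetD)
  with 1 2 that show ?thesis by blast
qed

text \<open>Countably many boxes with closure in U cover U. In the product of the powers
  \<open>(1 - \<psi> (e i) x) ^ n\<close> over i < n, a point of U meets a factor that tends to 0,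
  while off U all factors equal 1. Each product involves finitely many bumps, so compact support is
  kept.\<close>

lemma open_indicator_approx:
  fixes U :: "(real^'d::finite) set"
  assumes "open U"
  obtains \<phi> :: "nat \<Rightarrow> real^'d \<Rightarrow> real" where "\<And>n. \<phi> n \<in> test_functions U"
    "\<And>n x. 0 \<le> \<phi> n x" "\<And>n x. \<phi> n x \<le> 1" "\<And>x. (\<lambda>n. \<phi> n x) \<longlonglongrightarrow> indicator U x"
proof -
  define F where "F = {box a b | a b. cbox a b \<subseteq> U}"
  have FU: "\<Union>F = U"
  proof
    show "\<Union>F \<subseteq> U" unfolding F_def using box_subset_cbox by blast
    show "U \<subseteq> \<Union>F"
    proof
      fix x assume "x \<in> U"
      then obtain a b where "cbox a b \<subseteq> U" "x \<in> box a b" by (rule open_contains_cbox[OF assms])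
      then show "x \<in> \<Union>F" unfolding F_def by blast
    qed
  qed
  obtain F' where F': "F' \<subseteq> F" "countable F'" "\<Union>F' = \<Union>F"
    using Lindelof[of F] unfolding F_def by (auto simp: open_box)
  \<comment> \<open>The empty box keeps the index set nonempty even for empty U, as the enumeration
    by \<open>from_nat_into\<close> requires.\<close>
  define G where "G = insert {} F'"
  have "box 1 0 = ({} :: (real^'d) set)" "cbox 1 0 \<subseteq> U" by (auto simp: mem_box_cart dest!: spec[of _ undefined])
  then have "{} \<in> F" unfolding F_def by (metis (mono_tags, lifting) mem_Collect_eq)
  then have G: "G \<subseteq> F" "countable G" "\<Union>G = U" "G \<noteq> {}" using F' FU by (auto simp: G_def)
  have "\<exists>\<psi>::real^'d \<Rightarrow> real. \<psi> \<in> test_functions U \<and> (\<forall>x. 0 \<le> \<psi> x \<and> \<psi> x \<le> 1 \<and> (\<psi> x > 0 \<longleftrightarrow> x \<in> X))"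
    if X: "X \<in> G" for X
  proof -
    obtain a b where "X = box a b" "cbox a b \<subseteq> U" using X G(1) unfolding F_def by blast
    then show ?thesis using box_bump[of a b U] by metis
  qed
  then obtain \<psi> :: "(real^'d) set \<Rightarrow> real^'d \<Rightarrow> real" where \<psi>: "\<And>X. X \<in> G \<Longrightarrow> \<psi> X \<in> test_functions U"
    "\<And>X x. X \<in> G \<Longrightarrow> 0 \<le> \<psi> X x" "\<And>X x. X \<in> G \<Longrightarrow> \<psi> X x \<le> 1"
    "\<And>X x. X \<in> G \<Longrightarrow> \<psi> X x > 0 \<longleftrightarrow> x \<in> X" by metis
  define e where "e = from_nat_into G"
  have e: "e i \<in> G" for i unfolding e_def using G(4) by (rule from_nat_into)
  define \<phi> where "\<phi> n x = 1 - (\<Prod>i<n. (1 - \<psi> (e i) x) ^ n)" for n x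
  have p01: "0 \<le> (\<Prod>i<n. (1 - \<psi> (e i) x) ^ n)" "(\<Prod>i<n. (1 - \<psi> (e i) x) ^ n) \<le> 1" for n x
    using \<psi> e by (auto intro!: prod_nonneg prod_le_1 power_le_one)
  show ?thesis
  proof (rule that[of \<phi>])
    fix n
    show "\<phi> n \<in> test_functions U"
    proof (rule test_functionsI)
      show "smooth (\<phi> n)" unfolding \<phi>_def
        using \<psi>(1) e test_functionsD(1)
        by (intro smooth_diff smooth_const smooth_prod smooth_power) blast
      show "compact (\<Union>i<n. closure {x. \<psi> (e i) x \<noteq> 0})"
        using \<psi>(1) e test_functionsD(2) by (intro compact_UN) auto
      show "(\<Union>i<n. closure {x. \<psi> (e i) x \<noteq> 0}) \<subseteq> U"
        using \<psi>(1) e test_functionsD(3) by blast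
      fix x assume "x \<notin> (\<Union>i<n. closure {x. \<psi> (e i) x \<noteq> 0})"
      then have "\<psi> (e i) x = 0" if "i < n" for i
        using that zero_outside_support[of x "\<psi> (e i)"] by blast
      then show "\<phi> n x = 0" unfolding \<phi>_def by simp
    qed
    show "0 \<le> \<phi> n x" "\<phi> n x \<le> 1" for x using p01[where n=n and x=x] by (auto simp: \<phi>_def)
  next
    fix x
    show "(\<lambda>n. \<phi> n x) \<longlonglongrightarrow> indicator U x"
    proof (cases "x \<in> U")
      case False
      then have "\<psi> (e i) x = 0" for i using \<psi>(2,4)[OF e] G(3) e
        by (metis UnionI less_eq_real_def)
      then show ?thesis using False by (simp add: \<phi>_def)
    next
      case True
      then obtain i where i: "x \<in> e i" using G(3) from_nat_into_surj[OF G(2)] by (metis UnionE e_def)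
      then have p: "\<psi> (e i) x > 0" "\<psi> (e i) x \<le> 1" using \<psi>(3,4)[OF e] by auto
      have lim: "(\<lambda>n. (1 - \<psi> (e i) x) ^ n) \<longlonglongrightarrow> 0" using p by (intro LIMSEQ_realpow_zero) auto
      have "(\<lambda>n. \<Prod>i<n. (1 - \<psi> (e i) x) ^ n) \<longlonglongrightarrow> 0"
      proof (rule tendsto_sandwich[OF _ _ tendsto_const lim])
        show "\<forall>\<^sub>F n in sequentially. 0 \<le> (\<Prod>i<n. (1 - \<psi> (e i) x) ^ n)" using p01 by simp
        show "\<forall>\<^sub>F n in sequentially. (\<Prod>i<n. (1 - \<psi> (e i) x) ^ n) \<le> (1 - \<psi> (e i) x) ^ n"
          using eventually_gt_at_top[of i]
        proof eventually_elim
          case (elim n)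
          have "(\<Prod>j<n. (1 - \<psi> (e j) x) ^ n) = (1 - \<psi> (e i) x) ^ n * (\<Prod>j\<in>{..<n} - {i}. (1 - \<psi> (e j) x) ^ n)"
            using elim by (intro prod.remove) auto
          also have "\<dots> \<le> (1 - \<psi> (e i) x) ^ n * 1"
            using \<psi> e p by (intro mult_left_mono prod_le_1) (auto intro!: power_le_one)
          finally show ?case by simp
        qed
      qed
      from tendsto_diff[OF tendsto_const[of 1] this] show ?thesis using True by (simp add: \<phi>_def)
    qed
  qed
qed

section \<open>Functions with vanishing integrals and the fundamental lemma of the calculus of
  variations\<close>

lemma borel_induct_open [consumes 1, case_names opens compl union]:
  fixes A :: "'a::topological_space set"
  assumes "A \<in> sets borel"
    and "\<And>U. open U \<Longrightarrow> P U"
    and compl: "\<And>A. A \<in> sets borel \<Longrightarrow> P A \<Longrightarrow> P (- A)"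
    and union: "\<And>A. disjoint_family A \<Longrightarrow> range A \<subseteq> sets borel \<Longrightarrow> (\<And>i. P (A i)) \<Longrightarrow> P (\<Union>i::nat. A i)"
  shows "P A"
proof -
  \<comment> \<open>Dynkin's theorem: the open sets generate the Borel sets and are stable under
    intersection, so complements and disjoint unions suffice.\<close>
  have I: "Int_stable {S :: 'a set. open S}" by (auto simp: Int_stable_def)
  have "A \<in> sigma_sets UNIV {S. open S}" using assms(1) by (simp add: sets_borel)
  from sigma_sets_induct_disjoint[OF I _ this, of P] show ?thesis
    using assms by (auto simp: sets_borel Compl_eq_Diff_UNIV)
qed

lemma lebesgue_AE_borel:
  assumes "A \<in> sets lebesgue"
  obtains B where "B \<in> sets borel" "AE x in lebesgue. x \<in> A \<longleftrightarrow> x \<in> B"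
proof -
  obtain S N N' where *: "A = S \<union> N" "N \<subseteq> N'" "N' \<in> null_sets lborel" "S \<in> sets lborel"
    using sets_completionE[OF assms] by blast
  have "N' \<in> null_sets lebesgue" using *(3) by (simp add: null_sets_completionI)
  then have "AE x in lebesgue. x \<notin> N'" by (rule AE_not_in)
  then have "AE x in lebesgue. x \<in> A \<longleftrightarrow> x \<in> S" by eventually_elim (use * in auto)
  with * that show ?thesis by simp
qed

lemma AE_lebesgue_on_subset:
  assumes "AE x in lebesgue. P x" "S \<in> sets lebesgue" shows "AE x in lebesgue_on S. P x"
  using assms by (auto simp: AE_restrict_space_iff elim: eventually_mono)

text \<open>The integrals over Borel sets vanish by induction from the open sets, those over
  Lebesgue sets because each differs from a Borel set by a null set; a function all of whose set
  integrals vanish is zero almost everywhere.\<close>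

lemma AE_zero_if_open_integrals_zero:
  fixes g :: "'a::euclidean_space \<Rightarrow> 'b::euclidean_space"
  assumes S: "S \<in> lmeasurable" and g: "integrable (lebesgue_on S) g"
    and 0: "\<And>U. open U \<Longrightarrow> (LINT x|lebesgue_on S. indicat_real U x *\<^sub>R g x) = 0"
  shows "AE x in lebesgue_on S. g x = 0"
proof -
  have SL: "S \<in> sets lebesgue" using S by (simp add: fmeasurableD)
  have mb: "A \<in> sets borel \<Longrightarrow> indicat_real A \<in> borel_measurable (lebesgue_on S)" for A :: "'a set"
    by (intro measurable_restrict_space1 measurable_completion) simp
  have gi: "integrable (lebesgue_on S) (\<lambda>x. indicat_real A x *\<^sub>R g x)" if "A \<in> sets borel" for A
    using g mb[OF that]
    by (intro Bochner_Integration.integrable_bound[OF g] borel_measurable_scaleR)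
       (auto intro!: AE_I2 simp: mult_left_le_one_le)
  have borel: "(LINT x|lebesgue_on S. indicat_real A x *\<^sub>R g x) = 0" if "A \<in> sets borel" for A
    using that
  proof (induction rule: borel_induct_open)
    case (compl A)
    \<comment> \<open>The whole space is itself open, so the integral over a complement is a
      difference of vanishing integrals.\<close>
    have "(\<lambda>x. indicat_real (- A) x *\<^sub>R g x) = (\<lambda>x. indicat_real UNIV x *\<^sub>R g x - indicat_real A x *\<^sub>R g x)"
      by (auto simp: indicator_def)
    then show ?case using compl gi[of A] gi[of UNIV] 0[of UNIV] by simp
  next
    case (union A)
    have "(\<lambda>n. LINT x|lebesgue_on S. indicat_real (\<Union>i<n. A i) x *\<^sub>R g x)
       \<longlonglongrightarrow> (LINT x|lebesgue_on S. indicat_real (\<Union>i. A i) x *\<^sub>R g x)"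
    proof (rule integral_dominated_convergence)
      show "integrable (lebesgue_on S) (\<lambda>x. norm (g x))" using g by simp
      show "AE x in lebesgue_on S. (\<lambda>n. indicat_real (\<Union>i<n. A i) x *\<^sub>R g x) \<longlonglongrightarrow> indicat_real (\<Union>i. A i) x *\<^sub>R g x"
        by (intro AE_I2 tendsto_intros LIMSEQ_indicator_UN)
      show "(\<lambda>x. indicat_real (\<Union>i. A i) x *\<^sub>R g x) \<in> borel_measurable (lebesgue_on S)"
        using union(2) by (intro borel_measurable_integrable gi) auto
      show "(\<lambda>x. indicat_real (\<Union>i<n. A i) x *\<^sub>R g x) \<in> borel_measurable (lebesgue_on S)" for n
        using union(2) by (intro borel_measurable_integrable gi) auto
    qed (auto simp: mult_left_le_one_le intro!: AE_I2)
    moreover have "(LINT x|lebesgue_on S. indicat_real (\<Union>i<n. A i) x *\<^sub>R g x) = 0" for n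
    proof -
      have "disjoint_family_on A {..<n}" using union(1) by (auto simp: disjoint_family_on_def)
      then have "(\<lambda>x. indicat_real (\<Union>i<n. A i) x *\<^sub>R g x) = (\<lambda>x. \<Sum>i<n. indicat_real (A i) x *\<^sub>R g x)"
        by (auto simp: indicator_UN_disjoint scaleR_left.sum)
      moreover have "(LINT x|lebesgue_on S. (\<Sum>i<n. indicat_real (A i) x *\<^sub>R g x)) =
          (\<Sum>i<n. LINT x|lebesgue_on S. indicat_real (A i) x *\<^sub>R g x)"
        using union(2) by (intro Bochner_Integration.integral_sum gi) auto
      ultimately show ?thesis by (simp only: union(3) sum.neutral_const)
    qed
    ultimately show ?case by (simp add: LIMSEQ_const_iff)
  qed (use 0 in auto)
  interpret finite_measure "lebesgue_on S" using S by (rule finite_measure_lebesgue_on)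
  show ?thesis
  proof (rule density_zero[OF g])
    fix A assume "A \<in> sets (lebesgue_on S)"
    then have A: "A \<in> sets lebesgue" "A \<subseteq> S" using SL by (auto simp: sets_restrict_space_iff)
    obtain B where B: "B \<in> sets borel" "AE x in lebesgue. x \<in> A \<longleftrightarrow> x \<in> B"
      using lebesgue_AE_borel[OF A(1)] .
    have "(LINT x|lebesgue_on S. indicat_real A x *\<^sub>R g x) = (LINT x|lebesgue_on S. indicat_real B x *\<^sub>R g x)"
    proof (rule integral_cong_AE)
      show "(\<lambda>x. indicat_real A x *\<^sub>R g x) \<in> borel_measurable (lebesgue_on S)"
        using g A by (intro borel_measurable_scaleR borel_measurable_integrable[OF g] measurable_restrict_space1) auto
      show "(\<lambda>x. indicat_real B x *\<^sub>R g x) \<in> borel_measurable (lebesgue_on S)"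
        using gi[OF B(1)] by (rule borel_measurable_integrable)
      show "AE x in lebesgue_on S. indicat_real A x *\<^sub>R g x = indicat_real B x *\<^sub>R g x"
        using AE_lebesgue_on_subset[OF B(2) SL] by eventually_elim (auto simp: indicator_def)
    qed
    then show "set_lebesgue_integral (lebesgue_on S) A g = 0"
      using borel[OF B(1)] by (simp add: set_lebesgue_integral_def)
  qed
qed

lemma locally_integrable_cbox:
  "locally_integrable \<Omega> g \<Longrightarrow> cbox c d \<subseteq> \<Omega> \<Longrightarrow> integrable (lebesgue_on (cbox c d)) g"
  by (simp add: locally_integrable_def set_integrable_def integrable_restrict_space)

lemma lebesgue_on_integral_subset:
  fixes f :: "'a::euclidean_space \<Rightarrow> 'b::euclidean_space"
  assumes "S \<subseteq> T" "S \<in> sets lebesgue" "T \<in> sets lebesgue" "\<And>x. x \<in> T \<Longrightarrow> x \<notin> S \<Longrightarrow> f x = 0"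
  shows "(LINT x|lebesgue_on T. f x) = (LINT x|lebesgue_on S. f x)"
proof -
  have "(\<lambda>x. indicat_real T x *\<^sub>R f x) = (\<lambda>x. indicat_real S x *\<^sub>R f x)"
    using assms by (auto simp: indicator_def fun_eq_iff)
  then show ?thesis using assms by (simp add: integral_restrict_space)
qed

text \<open>An open set is a countable union of closed boxes, so almost everywhere statements may be
  checked on boxes, where a locally integrable function is integrable.\<close>

lemma locally_integrable_AE:
  fixes \<Omega> :: "'a::euclidean_space set"
  assumes "open \<Omega>" and box: "\<And>c d. cbox c d \<subseteq> \<Omega> \<Longrightarrow> AE x in lebesgue_on (cbox c d). P x"
  shows "AE x in lebesgue_on \<Omega>. P x"
proof -
  obtain D where D: "countable D" "\<And>X. X \<in> D \<Longrightarrow> \<exists>a b. X = cbox a b" "\<Union>D = \<Omega>"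
    using open_countable_Union_open_cbox[OF assms(1)] by metis
  have "AE x in lebesgue. \<forall>X\<in>D. x \<in> X \<longrightarrow> P x"
  proof (subst AE_ball_countable[OF D(1)], rule ballI)
    fix X assume "X \<in> D"
    then obtain a b where "X = cbox a b" "cbox a b \<subseteq> \<Omega>" using D by blast
    then show "AE x in lebesgue. x \<in> X \<longrightarrow> P x"
      using box[of a b] by (simp add: AE_restrict_space_iff)
  qed
  then show ?thesis using D(3) assms(1) by (auto simp: AE_restrict_space_iff lborelD elim!: eventually_mono)
qed

text \<open>Inside an open box the indicator of an open set is a bounded pointwise limit of test
  functions, so dominated convergence turns the hypothesis into vanishing integrals over open sets.
  The faces of the box are null, which settles the closed box.\<close>

lemma fundamental_lemma:
  fixes g :: "real^'d::finite \<Rightarrow> 'b::euclidean_space"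
  assumes "open \<Omega>" and g: "locally_integrable \<Omega> g"
    and 0: "\<And>\<phi>. \<phi> \<in> test_functions \<Omega> \<Longrightarrow> (LINT x|lebesgue_on \<Omega>. (\<phi> x :: real) *\<^sub>R g x) = 0"
  shows "AE x in lebesgue_on \<Omega>. g x = 0"
proof (rule locally_integrable_AE[OF assms(1)])
  fix c d assume cd: "cbox c d \<subseteq> \<Omega>"
  let ?S = "box c d" and ?C = "cbox c d"
  have SO: "?S \<subseteq> \<Omega>" using cd box_subset_cbox by blast
  have OL: "\<Omega> \<in> sets lebesgue" using assms(1) by (simp add: borel_open sets_completionI_sets)
  have SL: "?S \<in> sets lebesgue" "?S \<in> lmeasurable" by auto
  have gC: "integrable (lebesgue_on ?C) g" using locally_integrable_cbox[OF g cd] .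
  have gS: "integrable (lebesgue_on ?S) g"
  proof -
    have "set_integrable lebesgue ?C g" using gC by (simp add: set_integrable_def integrable_restrict_space)
    then have "set_integrable lebesgue ?S g" by (rule set_integrable_subset) (auto intro: box_subset_cbox[THEN subsetD])
    then show ?thesis by (simp add: set_integrable_def integrable_restrict_space)
  qed
  have "AE x in lebesgue_on ?S. g x = 0"
  proof (rule AE_zero_if_open_integrals_zero[OF SL(2) gS])
    fix U :: "(real^'d) set" assume U: "open U"
    then have "open (U \<inter> ?S)" by (simp add: open_Int open_box)
    then obtain \<phi> :: "nat \<Rightarrow> real^'d \<Rightarrow> real" where \<phi>: "\<And>n. \<phi> n \<in> test_functions (U \<inter> ?S)"
      "\<And>n x. 0 \<le> \<phi> n x" "\<And>n x. \<phi> n x \<le> 1" "\<And>x. (\<lambda>n. \<phi> n x) \<longlonglongrightarrow> indicator (U \<inter> ?S) x"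
      using open_indicator_approx by metis
    have m: "\<phi> n \<in> borel_measurable (lebesgue_on ?S)" for n
      using test_functionsD(1)[OF \<phi>(1)] by (rule smooth_borel_lebesgue_on)
    have "(\<lambda>n. LINT x|lebesgue_on ?S. \<phi> n x *\<^sub>R g x) \<longlonglongrightarrow> (LINT x|lebesgue_on ?S. indicat_real U x *\<^sub>R g x)"
    proof (rule integral_dominated_convergence)
      show "integrable (lebesgue_on ?S) (\<lambda>x. norm (g x))" using gS by simp
      show "AE x in lebesgue_on ?S. (\<lambda>n. \<phi> n x *\<^sub>R g x) \<longlonglongrightarrow> indicat_real U x *\<^sub>R g x"
      proof (rule AE_I2)
        fix x assume "x \<in> space (lebesgue_on ?S)"
        then have "indicat_real (U \<inter> ?S) x = indicat_real U x" by (simp add: indicator_def)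
        then show "(\<lambda>n. \<phi> n x *\<^sub>R g x) \<longlonglongrightarrow> indicat_real U x *\<^sub>R g x"
          using \<phi>(4)[of x] by (auto intro: tendsto_scaleR)
      qed
      show "AE x in lebesgue_on ?S. norm (\<phi> n x *\<^sub>R g x) \<le> norm (g x)" for n
        using \<phi>(2,3) by (auto intro!: AE_I2 mult_left_le_one_le)
      have "U \<in> sets lebesgue" using U by (simp add: borel_open sets_completionI_sets)
      then show "(\<lambda>x. indicat_real U x *\<^sub>R g x) \<in> borel_measurable (lebesgue_on ?S)"
        by (intro borel_measurable_scaleR borel_measurable_integrable[OF gS] measurable_restrict_space1) auto
    qed (use m gS in auto)
    moreover have "(LINT x|lebesgue_on ?S. \<phi> n x *\<^sub>R g x) = 0" for n
    proof -
      have "(LINT x|lebesgue_on \<Omega>. \<phi> n x *\<^sub>R g x) = (LINT x|lebesgue_on ?S. \<phi> n x *\<^sub>R g x)"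
      proof (rule lebesgue_on_integral_subset[OF SO SL(1) OL])
        fix x assume "x \<notin> ?S"
        then show "\<phi> n x *\<^sub>R g x = 0" using test_functions_zero_outside[OF \<phi>(1)] by auto
      qed
      moreover have "\<phi> n \<in> test_functions \<Omega>" using SO by (intro test_functions_mono[OF \<phi>(1)]) auto
      ultimately show ?thesis using 0[of "\<phi> n"] by simp
    qed
    ultimately show "(LINT x|lebesgue_on ?S. indicat_real U x *\<^sub>R g x) = 0"
      by (simp add: LIMSEQ_const_iff)
  qed
  then have "AE x in lebesgue. x \<in> ?S \<longrightarrow> g x = 0" by (simp add: AE_restrict_space_iff)
  moreover have "AE x in lebesgue. x \<notin> ?C - ?S"
    using negligible_frontier_interval[of c d] by (intro AE_not_in) (simp add: negligible_iff_null_sets)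
  ultimately have "AE x in lebesgue. x \<in> ?C \<longrightarrow> g x = 0" by eventually_elim auto
  then show "AE x in lebesgue_on ?C. g x = 0" by (simp add: AE_restrict_space_iff)
qed

subsection \<open>Density of the test functions\<close>

lemma L2_tendsto_dominated:
  fixes f :: "'a::euclidean_space \<Rightarrow> 'b::euclidean_space"
  assumes w: "w \<in> Lp_space 2 S" and m: "\<And>n. F n \<in> borel_measurable (lebesgue_on S)" "f \<in> borel_measurable (lebesgue_on S)"
    and b: "\<And>n. AE x in lebesgue_on S. norm (F n x) \<le> norm (w x :: 'c::euclidean_space)"
    and lim: "AE x in lebesgue_on S. (\<lambda>n. F n x) \<longlonglongrightarrow> f x"
  shows "(\<lambda>n. L2_norm_on S (\<lambda>x. f x - F n x)) \<longlonglongrightarrow> 0"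
proof -
  have b': "AE x in lebesgue_on S. \<forall>n. norm (F n x) \<le> norm (w x)" using b by (simp add: AE_all_countable)
  have "(\<lambda>n. LINT x|lebesgue_on S. (norm (f x - F n x))\<^sup>2) \<longlonglongrightarrow> (LINT x|lebesgue_on S. 0)"
  proof (rule integral_dominated_convergence)
    show "integrable (lebesgue_on S) (\<lambda>x. 4 * (norm (w x))\<^sup>2)" using w by (simp add: Lp_space_2_iff)
    show "AE x in lebesgue_on S. (\<lambda>n. (norm (f x - F n x))\<^sup>2) \<longlonglongrightarrow> 0"
      using lim
    proof eventually_elim
      case (elim x)
      have "(\<lambda>n. (norm (f x - F n x))\<^sup>2) \<longlonglongrightarrow> (norm (f x - f x))\<^sup>2" by (intro tendsto_intros elim)
      then show ?case by simp
    qed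
    show "AE x in lebesgue_on S. norm ((norm (f x - F n x))\<^sup>2) \<le> 4 * (norm (w x))\<^sup>2" for n
      using lim b'
    proof eventually_elim
      case (elim x)
      have "norm (f x) \<le> norm (w x)"
        using elim by (intro LIMSEQ_le_const2[OF tendsto_norm[OF elim(1)]]) auto
      then have "norm (f x - F n x) \<le> 2 * norm (w x)"
        using elim(2) norm_triangle_ineq4[of "f x" "F n x"] by (smt (verit))
      then have "(norm (f x - F n x))\<^sup>2 \<le> (2 * norm (w x))\<^sup>2" by (intro power_mono) auto
      then show ?case by (simp add: power_mult_distrib)
    qed
  qed (use m in auto)
  then have "(\<lambda>n. sqrt ((L2_norm_on S (\<lambda>x. f x - F n x))\<^sup>2)) \<longlonglongrightarrow> sqrt 0"
    by (intro tendsto_real_sqrt) (simp add: L2_norm_sq)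
  then show ?thesis by simp
qed

lemma integrable_compact_support:
  fixes f :: "'a::euclidean_space \<Rightarrow> 'b::euclidean_space"
  assumes S: "S \<in> sets lebesgue" and m: "f \<in> borel_measurable (lebesgue_on S)"
    and K: "compact K" "\<And>x. x \<notin> K \<Longrightarrow> f x = 0" and B: "\<And>x. norm (f x) \<le> B"
  shows "integrable (lebesgue_on S) f"
proof -
  have "B \<ge> 0" using B[of undefined] norm_ge_zero order_trans by blast
  have "K \<in> lmeasurable" using K by (simp add: lmeasurable_compact)
  then have i: "integrable lebesgue (\<lambda>x. B * indicat_real K x)"
    by (intro integrable_mult_right) (auto simp: fmeasurable_def)
  have "integrable lebesgue (\<lambda>x. indicat_real S x *\<^sub>R f x)"
  proof (rule Bochner_Integration.integrable_bound[OF i])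
    show "(\<lambda>x. indicat_real S x *\<^sub>R f x) \<in> borel_measurable lebesgue"
      using m S by (simp add: borel_measurable_restrict_space_iff)
    show "AE x in lebesgue. norm (indicat_real S x *\<^sub>R f x) \<le> norm (B * indicat_real K x)"
      using K(2) B \<open>B \<ge> 0\<close> by (intro AE_I2) (auto simp: indicator_def)
  qed
  then show ?thesis using S by (simp add: integrable_restrict_space)
qed

lemma test_functions_integrable:
  assumes "\<phi> \<in> test_functions \<Omega>" "S \<in> sets lebesgue" shows "integrable (lebesgue_on S) \<phi>"
proof -
  obtain B where "B \<ge> 0" "\<And>x. norm (\<phi> x) \<le> B" using test_functions_bounded[OF assms(1)] by blast
  then show ?thesis
    by (intro integrable_compact_support[OF assms(2) _ test_functionsD(2)[OF assms(1)]]
        smooth_borel_lebesgue_on test_functionsD(1)[OF assms(1)] zero_outside_support)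
qed

lemma test_functions_L2:
  assumes "\<phi> \<in> test_functions \<Omega>" "S \<in> sets lebesgue" shows "\<phi> \<in> Lp_space 2 S"
proof -
  obtain B where B: "B \<ge> 0" "\<And>x. norm (\<phi> x) \<le> B" using test_functions_bounded[OF assms(1)] by blast
  have m: "\<phi> \<in> borel_measurable (lebesgue_on S)"
    using test_functionsD(1)[OF assms(1)] by (rule smooth_borel_lebesgue_on)
  have "integrable (lebesgue_on S) (\<lambda>x. (norm (\<phi> x))\<^sup>2)"
  proof (rule integrable_compact_support[OF assms(2) _ test_functionsD(2)[OF assms(1)]])
    show "norm ((norm (\<phi> x))\<^sup>2) \<le> B\<^sup>2" for x using B by (simp add: power_mono)
    show "(norm (\<phi> x))\<^sup>2 = 0" if "x \<notin> closure {x. \<phi> x \<noteq> 0}" for x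
      using zero_outside_support[OF that] by simp
    show "(\<lambda>x. (norm (\<phi> x))\<^sup>2) \<in> borel_measurable (lebesgue_on S)"
      using m by measurable
  qed
  with m show ?thesis by (simp add: Lp_space_2_iff)
qed

text \<open>This turns out to be all of \<open>L\<^sup>2(\<Omega>)\<close>.\<close>

definition L2_test_closure :: "(real^'d::finite) set \<Rightarrow> (real^'d \<Rightarrow> 'b::euclidean_space) set" where
  "L2_test_closure \<Omega> = {f \<in> Lp_space 2 \<Omega>.
     \<forall>e>0. \<exists>\<phi>\<in>test_functions \<Omega>. L2_norm_on \<Omega> (\<lambda>x. f x - \<phi> x) < e}"

lemma L2_test_closure_test:
  assumes "open \<Omega>" "\<phi> \<in> test_functions \<Omega>" shows "\<phi> \<in> L2_test_closure \<Omega>"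
proof -
  have "\<phi> \<in> Lp_space 2 \<Omega>" using assms by (intro test_functions_L2[OF assms(2)]) (simp add: borel_open sets_completionI_sets)
  then show ?thesis
    unfolding L2_test_closure_def using assms by (auto intro!: bexI[of _ \<phi>])
qed

lemma L2_test_closure_limit:
  assumes "open \<Omega>" "\<And>n. F n \<in> L2_test_closure \<Omega>" "f \<in> Lp_space 2 \<Omega>"
    and lim: "(\<lambda>n. L2_norm_on \<Omega> (\<lambda>x. f x - F n x)) \<longlonglongrightarrow> 0"
  shows "f \<in> L2_test_closure \<Omega>"
  unfolding L2_test_closure_def
proof (intro CollectI conjI allI impI assms(3))
  fix e :: real assume "e > 0"
  then obtain n where n: "L2_norm_on \<Omega> (\<lambda>x. f x - F n x) < e / 2"
    using order_tendstoD(2)[OF lim, of "e/2"] by (auto simp: eventually_sequentially)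
  obtain \<phi> where \<phi>: "\<phi> \<in> test_functions \<Omega>" "L2_norm_on \<Omega> (\<lambda>x. F n x - \<phi> x) < e / 2"
    using assms(2)[of n] \<open>e > 0\<close> half_gt_zero unfolding L2_test_closure_def by blast
  have F: "F n \<in> Lp_space 2 \<Omega>" using assms(2)[of n] by (simp add: L2_test_closure_def)
  have p: "\<phi> \<in> Lp_space 2 \<Omega>" using test_functions_L2[OF \<phi>(1)] assms(1) by (simp add: borel_open sets_completionI_sets)
  have "L2_norm_on \<Omega> (\<lambda>x. (f x - F n x) + (F n x - \<phi> x)) \<le>
      L2_norm_on \<Omega> (\<lambda>x. f x - F n x) + L2_norm_on \<Omega> (\<lambda>x. F n x - \<phi> x)"
    by (intro L2_norm_triangle L2_diff assms(3) F p)
  also have "\<dots> < e" using n \<phi>(2) by simp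
  finally show "\<exists>\<phi>\<in>test_functions \<Omega>. L2_norm_on \<Omega> (\<lambda>x. f x - \<phi> x) < e" using \<phi>(1) by auto
qed

lemma L2_test_closure_add:
  assumes "open \<Omega>" "f \<in> L2_test_closure \<Omega>" "g \<in> L2_test_closure \<Omega>"
  shows "(\<lambda>x. f x + g x) \<in> L2_test_closure \<Omega>"
  unfolding L2_test_closure_def
proof (intro CollectI conjI allI impI)
  have fg: "f \<in> Lp_space 2 \<Omega>" "g \<in> Lp_space 2 \<Omega>" using assms by (auto simp: L2_test_closure_def)
  then show "(\<lambda>x. f x + g x) \<in> Lp_space 2 \<Omega>" by (rule L2_add)
  fix e :: real assume "e > 0"
  then obtain \<phi> \<psi> where *: "\<phi> \<in> test_functions \<Omega>" "L2_norm_on \<Omega> (\<lambda>x. f x - \<phi> x) < e / 2"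
     "\<psi> \<in> test_functions \<Omega>" "L2_norm_on \<Omega> (\<lambda>x. g x - \<psi> x) < e / 2"
    using assms half_gt_zero[of e] unfolding L2_test_closure_def by blast
  have p: "\<phi> \<in> Lp_space 2 \<Omega>" "\<psi> \<in> Lp_space 2 \<Omega>"
    using test_functions_L2[OF *(1)] test_functions_L2[OF *(3)] assms(1) by (simp_all add: borel_open sets_completionI_sets)
  have "L2_norm_on \<Omega> (\<lambda>x. (f x - \<phi> x) + (g x - \<psi> x)) \<le>
      L2_norm_on \<Omega> (\<lambda>x. f x - \<phi> x) + L2_norm_on \<Omega> (\<lambda>x. g x - \<psi> x)"
    by (intro L2_norm_triangle L2_diff fg p)
  also have "\<dots> < e" using * by simp
  finally have "L2_norm_on \<Omega> (\<lambda>x. (f x + g x) - (\<phi> x + \<psi> x)) < e" by (simp add: algebra_simps)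
  then show "\<exists>\<phi>\<in>test_functions \<Omega>. L2_norm_on \<Omega> (\<lambda>x. f x + g x - \<phi> x) < e"
    by (intro bexI[of _ "\<lambda>x. \<phi> x + \<psi> x"] test_functions_add *(1,3))
qed

lemma L2_test_closure_uminus:
  assumes "f \<in> L2_test_closure \<Omega>" shows "(\<lambda>x. - f x) \<in> L2_test_closure \<Omega>"
  unfolding L2_test_closure_def
proof (intro CollectI conjI allI impI)
  show "(\<lambda>x. - f x) \<in> Lp_space 2 \<Omega>" using assms L2_scaleR[of f \<Omega> "-1"] by (simp add: L2_test_closure_def)
  fix e :: real assume "e > 0"
  then obtain \<phi> where *: "\<phi> \<in> test_functions \<Omega>" "L2_norm_on \<Omega> (\<lambda>x. f x - \<phi> x) < e"
    using assms unfolding L2_test_closure_def by blast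
  have "L2_norm_on \<Omega> (\<lambda>x. - f x - (-1) *\<^sub>R \<phi> x) < e"
    using *(2) L2_norm_scaleR[of \<Omega> "-1" "\<lambda>x. f x - \<phi> x"] by simp
  then show "\<exists>\<phi>\<in>test_functions \<Omega>. L2_norm_on \<Omega> (\<lambda>x. - f x - \<phi> x) < e"
    by (intro bexI[of _ "\<lambda>x. (-1) *\<^sub>R \<phi> x"] test_functions_const_scaleR *(1))
qed

lemma L2_bounded:
  fixes f :: "'a::euclidean_space \<Rightarrow> 'b::euclidean_space"
  assumes "S \<in> lmeasurable" "f \<in> borel_measurable (lebesgue_on S)" "AE x in lebesgue_on S. norm (f x) \<le> B"
  shows "f \<in> Lp_space 2 S"
proof -
  interpret finite_measure "lebesgue_on S" using assms(1) by (rule finite_measure_lebesgue_on)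
  have "(\<lambda>x. B) \<in> Lp_space 2 S" by (simp add: Lp_space_2_iff)
  moreover have "AE x in lebesgue_on S. norm (f x) \<le> 1 * norm B"
    using assms(3) by eventually_elim simp
  ultimately show ?thesis using L2_norm_mono(1)[OF _ assms(2), of "\<lambda>x. B" 1] by simp
qed

lemma L2_test_closure_cong_AE:
  assumes "open \<Omega>" "f \<in> L2_test_closure \<Omega>" "AE x in lebesgue_on \<Omega>. f x = g x"
  shows "g \<in> L2_test_closure \<Omega>"
proof (rule L2_test_closure_limit[OF assms(1), of "\<lambda>n. f"])
  have OL: "\<Omega> \<in> sets lebesgue" using assms(1) by (simp add: borel_open sets_completionI_sets)
  have f2: "f \<in> Lp_space 2 \<Omega>" using assms by (simp add: L2_test_closure_def)
  show "g \<in> Lp_space 2 \<Omega>" using L2_cong_AE(1)[OF OL f2 assms(3)] .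
  have "AE x in lebesgue_on \<Omega>. 0 = g x - f x" using assms(3) by auto
  from L2_cong_AE(2)[OF OL L2_zero this]
  show "(\<lambda>n. L2_norm_on \<Omega> (\<lambda>x. g x - f x)) \<longlonglongrightarrow> 0" by simp
qed (use assms in auto)

text \<open>The usual ladder: indicators of open, Borel and Lebesgue sets, then simple functions,
  then limits. Boundedness of \<Omega> puts constants into L2, so that a constant vector is the
  dominating function for the indicators.\<close>

lemma test_functions_dense_L2:
  fixes f :: "real^'d::finite \<Rightarrow> 'b::euclidean_space"
  assumes \<Omega>: "open \<Omega>" "bounded \<Omega>" and f: "f \<in> Lp_space 2 \<Omega>"
  shows "f \<in> L2_test_closure \<Omega>"
proof -
  have OM: "\<Omega> \<in> lmeasurable" using \<Omega> by (simp add: lmeasurable_open)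
  then have OL: "\<Omega> \<in> sets lebesgue" by (simp add: fmeasurableD)
  have ind2: "(\<lambda>x. indicat_real A x *\<^sub>R c) \<in> Lp_space 2 \<Omega>" if "A \<in> sets lebesgue" for A and c :: 'b
    using that by (intro L2_bounded[OF OM, where B="norm c"] borel_measurable_scaleR measurable_restrict_space1)
       (auto simp: indicator_def)
  have bl: "A \<in> sets borel \<Longrightarrow> A \<in> sets lebesgue" for A :: "(real^'d) set" by (simp add: sets_completionI_sets)
  have borel: "(\<lambda>x. indicat_real A x *\<^sub>R c) \<in> L2_test_closure \<Omega>" if "A \<in> sets borel" for A and c :: 'b
    using that
  proof (induction rule: borel_induct_open)
    case (opens U)
    have "open (U \<inter> \<Omega>)" using opens \<Omega> by auto
    then obtain \<phi> :: "nat \<Rightarrow> real^'d \<Rightarrow> real" where \<phi>: "\<And>n. \<phi> n \<in> test_functions (U \<inter> \<Omega>)"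
      "\<And>n x. 0 \<le> \<phi> n x" "\<And>n x. \<phi> n x \<le> 1" "\<And>x. (\<lambda>n. \<phi> n x) \<longlonglongrightarrow> indicator (U \<inter> \<Omega>) x"
      using open_indicator_approx by metis
    have t: "(\<lambda>x. \<phi> n x *\<^sub>R c) \<in> test_functions \<Omega>" for n
      using test_functions_scaleR_const[OF test_functions_mono[OF \<phi>(1)]] by auto
    have w: "(\<lambda>x. c) \<in> Lp_space 2 \<Omega>" using ind2[of UNIV c] by simp
    have "(\<lambda>n. L2_norm_on \<Omega> (\<lambda>x. indicat_real U x *\<^sub>R c - \<phi> n x *\<^sub>R c)) \<longlonglongrightarrow> 0"
    proof (rule L2_tendsto_dominated[OF w])
      show "AE x in lebesgue_on \<Omega>. (\<lambda>n. \<phi> n x *\<^sub>R c) \<longlonglongrightarrow> indicat_real U x *\<^sub>R c"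
      proof (rule AE_I2)
        fix x assume "x \<in> space (lebesgue_on \<Omega>)"
        then have "indicat_real (U \<inter> \<Omega>) x = indicat_real U x" by (simp add: indicator_def)
        then show "(\<lambda>n. \<phi> n x *\<^sub>R c) \<longlonglongrightarrow> indicat_real U x *\<^sub>R c"
          using \<phi>(4)[of x] by (auto intro: tendsto_scaleR)
      qed
      show "AE x in lebesgue_on \<Omega>. norm (\<phi> n x *\<^sub>R c) \<le> norm c" for n
        using \<phi>(2,3) by (auto intro!: AE_I2 mult_left_le_one_le)
      show "(\<lambda>x. \<phi> n x *\<^sub>R c) \<in> borel_measurable (lebesgue_on \<Omega>)" for n
        using test_functionsD(1)[OF t] by (rule smooth_borel_lebesgue_on)
      show "(\<lambda>x. indicat_real U x *\<^sub>R c) \<in> borel_measurable (lebesgue_on \<Omega>)"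
        using ind2[OF bl[of U]] opens by (auto simp: Lp_space_2_iff)
    qed
    then show ?case
      using opens by (intro L2_test_closure_limit[OF \<Omega>(1) L2_test_closure_test[OF \<Omega>(1) t]] ind2 bl) auto
  next
    case (compl A)
    \<comment> \<open>The indicator of a complement is a constant minus an indicator, so constants
      are approximated first, by test functions tending to the indicator of \<Omega>.\<close>
    obtain \<phi> :: "nat \<Rightarrow> real^'d \<Rightarrow> real" where \<phi>: "\<And>n. \<phi> n \<in> test_functions \<Omega>"
      "\<And>n x. 0 \<le> \<phi> n x" "\<And>n x. \<phi> n x \<le> 1" "\<And>x. (\<lambda>n. \<phi> n x) \<longlonglongrightarrow> indicator \<Omega> x"
      using open_indicator_approx[OF \<Omega>(1)] by metis
    have t: "(\<lambda>x. \<phi> n x *\<^sub>R c) \<in> test_functions \<Omega>" for n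
      using test_functions_scaleR_const[OF \<phi>(1)] by auto
    have w: "(\<lambda>x. c) \<in> Lp_space 2 \<Omega>" using ind2[of UNIV c] by simp
    have "(\<lambda>n. L2_norm_on \<Omega> (\<lambda>x. c - \<phi> n x *\<^sub>R c)) \<longlonglongrightarrow> 0"
    proof (rule L2_tendsto_dominated[OF w])
      show "AE x in lebesgue_on \<Omega>. (\<lambda>n. \<phi> n x *\<^sub>R c) \<longlonglongrightarrow> c"
      proof (rule AE_I2)
        fix x assume "x \<in> space (lebesgue_on \<Omega>)"
        then have "(\<lambda>n. \<phi> n x) \<longlonglongrightarrow> 1" using \<phi>(4)[of x] by (simp add: indicator_def)
        from tendsto_scaleR[OF this tendsto_const[of c]] show "(\<lambda>n. \<phi> n x *\<^sub>R c) \<longlonglongrightarrow> c" by simp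
      qed
      show "AE x in lebesgue_on \<Omega>. norm (\<phi> n x *\<^sub>R c) \<le> norm c" for n
        using \<phi>(2,3) by (auto intro!: AE_I2 mult_left_le_one_le)
      show "(\<lambda>x. \<phi> n x *\<^sub>R c) \<in> borel_measurable (lebesgue_on \<Omega>)" for n
        using test_functionsD(1)[OF t] by (rule smooth_borel_lebesgue_on)
    qed auto
    then have "(\<lambda>x. c) \<in> L2_test_closure \<Omega>"
      by (intro L2_test_closure_limit[OF \<Omega>(1) L2_test_closure_test[OF \<Omega>(1) t]] w)
    from L2_test_closure_add[OF \<Omega>(1) this L2_test_closure_uminus[OF compl(2)]]
    show ?case by (rule L2_test_closure_cong_AE[OF \<Omega>(1)]) (auto simp: indicator_def)
  next
    case (union A)
    have sum: "(\<lambda>x. \<Sum>i<n. indicat_real (A i) x *\<^sub>R c) \<in> L2_test_closure \<Omega>" for n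
    proof (induction n)
      case 0
      show ?case using L2_test_closure_test[OF \<Omega>(1) test_functions_zero] by simp
    next
      case (Suc n)
      from L2_test_closure_add[OF \<Omega>(1) Suc union(3)[of n]] show ?case by simp
    qed
    have "disjoint_family_on A {..<n}" for n using union(1) by (auto simp: disjoint_family_on_def)
    then have eq: "(\<lambda>x. \<Sum>i<n. indicat_real (A i) x *\<^sub>R c) = (\<lambda>x. indicat_real (\<Union>i<n. A i) x *\<^sub>R c)" for n
      by (auto simp: indicator_UN_disjoint scaleR_left.sum)
    have bA: "(\<Union>i<n. A i) \<in> sets borel" "(\<Union>i. A i) \<in> sets borel" for n using union(2) by auto
    have w: "(\<lambda>x. c) \<in> Lp_space 2 \<Omega>" using ind2[of UNIV c] by simp
    have "(\<lambda>n. L2_norm_on \<Omega> (\<lambda>x. indicat_real (\<Union>i. A i) x *\<^sub>R c - indicat_real (\<Union>i<n. A i) x *\<^sub>R c)) \<longlonglongrightarrow> 0"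
    proof (rule L2_tendsto_dominated[OF w])
      show "AE x in lebesgue_on \<Omega>. (\<lambda>n. indicat_real (\<Union>i<n. A i) x *\<^sub>R c) \<longlonglongrightarrow> indicat_real (\<Union>i. A i) x *\<^sub>R c"
        by (intro AE_I2 tendsto_intros LIMSEQ_indicator_UN)
    qed (use ind2[OF bl[OF bA(1)]] ind2[OF bl[OF bA(2)]] in \<open>auto simp: Lp_space_2_iff indicator_def\<close>)
    then show ?case
      using sum unfolding eq by (intro L2_test_closure_limit[OF \<Omega>(1) _ ind2[OF bl[OF bA(2)]]]) auto
  qed
  have leb: "(\<lambda>x. indicat_real A x *\<^sub>R c) \<in> L2_test_closure \<Omega>" if A: "A \<in> sets lebesgue" for A and c :: 'b
  proof -
    obtain B where B: "B \<in> sets borel" "AE x in lebesgue. x \<in> A \<longleftrightarrow> x \<in> B"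
      using lebesgue_AE_borel[OF A(1)] .
    have "AE x in lebesgue_on \<Omega>. indicat_real B x *\<^sub>R c = indicat_real A x *\<^sub>R c"
      using AE_lebesgue_on_subset[OF B(2) OL] by eventually_elim (auto simp: indicator_def)
    from L2_test_closure_cong_AE[OF \<Omega>(1) borel[OF B(1)] this] show ?thesis .
  qed
  obtain s where s: "\<And>i. simple_function (lebesgue_on \<Omega>) (s i)" "\<And>x. x \<in> \<Omega> \<Longrightarrow> (\<lambda>i. s i x) \<longlonglongrightarrow> f x"
    "\<And>i x. x \<in> \<Omega> \<Longrightarrow> norm (s i x) \<le> 2 * norm (f x)"
    using borel_measurable_implies_sequence_metric[OF Lp_space_2_measurable[OF f], of 0] by (auto; metis)
  have cl: "s i \<in> L2_test_closure \<Omega>" for i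
  proof -
    have fin: "finite (s i ` \<Omega>)" using simple_functionD(1)[OF s(1)[of i]] by simp
    have ms: "s i -` {y} \<inter> \<Omega> \<in> sets lebesgue" for y
      using simple_functionD(2)[OF s(1)[of i], of "{y}"] OL by (simp add: sets_restrict_space_iff)
    have "(\<lambda>x. \<Sum>y\<in>Y. indicat_real (s i -` {y} \<inter> \<Omega>) x *\<^sub>R y) \<in> L2_test_closure \<Omega>" if "finite Y" for Y
      using that
    proof (induction Y rule: finite_induct)
      case empty
      show ?case using L2_test_closure_test[OF \<Omega>(1) test_functions_zero] by simp
    next
      case (insert y Y)
      from L2_test_closure_add[OF \<Omega>(1) leb[OF ms[of y]] insert(3)] show ?case
        by (simp only: sum.insert[OF insert(1,2)])
    qed
    from this[OF fin] show ?thesis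
    proof (rule L2_test_closure_cong_AE[OF \<Omega>(1)], intro AE_I2)
      fix x assume x: "x \<in> space (lebesgue_on \<Omega>)"
      have "(\<Sum>y\<in>s i ` \<Omega>. indicat_real (s i -` {y} \<inter> \<Omega>) x *\<^sub>R y) = (\<Sum>y\<in>s i ` \<Omega>. if y = s i x then y else 0)"
        using x by (intro sum.cong) (auto simp: indicator_def)
      also have "\<dots> = s i x" using x fin by (simp add: sum.delta)
      finally show "(\<Sum>y\<in>s i ` \<Omega>. indicat_real (s i -` {y} \<inter> \<Omega>) x *\<^sub>R y) = s i x" .
    qed
  qed
  have "(\<lambda>n. L2_norm_on \<Omega> (\<lambda>x. f x - s n x)) \<longlonglongrightarrow> 0"
  proof (rule L2_tendsto_dominated[OF L2_scaleR[OF f, of 2]])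
    show "s n \<in> borel_measurable (lebesgue_on \<Omega>)" for n using s(1) by (rule borel_measurable_simple_function)
  qed (use s f in \<open>auto simp: Lp_space_2_iff intro!: AE_I2\<close>)
  from L2_test_closure_limit[OF \<Omega>(1) cl f this] show ?thesis .
qed

subsection \<open>Weak derivatives\<close>

lemma open_lebesgue: "open S \<Longrightarrow> S \<in> sets lebesgue"
  by (simp add: borel_open sets_completionI_sets)

text \<open>Translation invariance makes the integral of each forward difference quotient vanish,
  and the quotients converge to the partial derivative boundedly on a fixed compact set.\<close>

lemma integral_partial_zero:
  fixes \<psi> :: "real^'d::finite \<Rightarrow> 'b::euclidean_space"
  assumes "\<psi> \<in> test_functions UNIV"
  shows "(LINT x|lborel. partial_deriv i \<psi> x) = 0"
proof -
  let ?e = "axis i 1 :: real^'d"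
  define K where "K = closure {x. \<psi> x \<noteq> 0}"
  have K: "compact K" using test_functionsD(2)[OF assms] by (simp add: K_def)
  \<comment> \<open>The unit neighbourhood of the support contains the supports of all quotients, as
    the shifts have length at most 1.\<close>
  define K' where "K' = {x + y | x y. x \<in> K \<and> y \<in> cball (0::real^'d) 1}"
  have K': "compact K'" unfolding K'_def by (intro compact_sums K compact_cball)
  have sm: "smooth \<psi>" using test_functionsD(1)[OF assms] .
  obtain B where B: "B \<ge> 0" "\<And>x. norm (partial_deriv i \<psi> x) \<le> B"
    using test_functions_bounded[OF test_functions_partial[OF assms, of i]] by blast
  have der: "((\<lambda>t. \<psi> (x + t *\<^sub>R ?e)) has_vector_derivative partial_deriv i \<psi> (x + t *\<^sub>R ?e)) (at t)" for x t
  proof -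
    have 1: "(\<psi> has_derivative frechet_derivative \<psi> (at (x + t *\<^sub>R ?e))) (at (x + t *\<^sub>R ?e))"
      using smooth_differentiable[OF sm] frechet_derivative_works by blast
    have "((\<lambda>t. x + t *\<^sub>R ?e) has_derivative (\<lambda>s. s *\<^sub>R ?e)) (at t)"
      by (auto intro!: derivative_eq_intros)
    from diff_chain_at[OF this 1]
    have "((\<lambda>t. \<psi> (x + t *\<^sub>R ?e)) has_derivative (\<lambda>s. frechet_derivative \<psi> (at (x + t *\<^sub>R ?e)) (s *\<^sub>R ?e))) (at t)"
      by (simp add: o_def)
    moreover have "frechet_derivative \<psi> (at (x + t *\<^sub>R ?e)) (s *\<^sub>R ?e) = s *\<^sub>R partial_deriv i \<psi> (x + t *\<^sub>R ?e)" for s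
      using has_derivative_linear[OF 1] by (simp add: partial_deriv_def linear_cmul)
    ultimately show ?thesis by (simp add: has_vector_derivative_def)
  qed
  have mvt: "norm (\<psi> (x + t *\<^sub>R ?e) - \<psi> x) \<le> B * t" if "t > 0" for x t
  proof -
    have "norm (\<psi> (x + t *\<^sub>R ?e) - \<psi> (x + 0 *\<^sub>R ?e)) \<le> B * norm (t - 0)"
    proof (rule differentiable_bound[of "{0..t}" "\<lambda>t. \<psi> (x + t *\<^sub>R ?e)" "\<lambda>t s. s *\<^sub>R partial_deriv i \<psi> (x + t *\<^sub>R ?e)"])
      show "((\<lambda>t. \<psi> (x + t *\<^sub>R ?e)) has_derivative (\<lambda>s. s *\<^sub>R partial_deriv i \<psi> (x + u *\<^sub>R ?e))) (at u within {0..t})" for u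
        using der[of x u] unfolding has_vector_derivative_def by (rule has_derivative_at_withinI)
      show "onorm (\<lambda>s. s *\<^sub>R partial_deriv i \<psi> (x + u *\<^sub>R ?e)) \<le> B" for u
        using B by (intro onorm_bound) (auto intro: mult_right_mono simp: mult.commute[of _ "norm (partial_deriv i \<psi> _)"])
    qed (use that in auto)
    then show ?thesis using that by simp
  qed
  define s where "s n x = real (Suc n) *\<^sub>R (\<psi> (x + (1 / real (Suc n)) *\<^sub>R ?e) - \<psi> x)" for n x
  have mb: "\<psi> \<in> borel_measurable borel" using smooth_borel[OF sm] .
  have "(\<lambda>n. LINT x|lborel. s n x) \<longlonglongrightarrow> (LINT x|lborel. partial_deriv i \<psi> x)"
  proof (rule integral_dominated_convergence)
    show "integrable lborel (\<lambda>x. B * indicat_real K' x)"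
      using fmeasurable_compact[OF K'] by (intro integrable_mult_right) (auto simp: fmeasurable_def)
    show "AE x in lborel. (\<lambda>n. s n x) \<longlonglongrightarrow> partial_deriv i \<psi> x"
    proof (rule AE_I2)
      fix x
      have "((\<lambda>h. (\<psi> (x + (0 + h) *\<^sub>R ?e) - \<psi> (x + 0 *\<^sub>R ?e)) /\<^sub>R h) \<longlongrightarrow> partial_deriv i \<psi> (x + 0 *\<^sub>R ?e)) (at 0)"
      proof -
        define g where "g t = \<psi> (x + t *\<^sub>R ?e)" for t
        define D where "D = partial_deriv i \<psi> (x + 0 *\<^sub>R ?e)"
        have "(g has_derivative (\<lambda>s. s *\<^sub>R D)) (at 0)"
          using der[of x 0] unfolding has_vector_derivative_def g_def D_def .
        then have "(\<lambda>h. norm (g (0 + h) - g 0 - h *\<^sub>R D) / norm h) \<midarrow>0\<rightarrow> 0"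
          unfolding has_derivative_at by blast
        moreover have "norm (g (0 + h) - g 0 - h *\<^sub>R D) / norm h = norm ((g (0 + h) - g 0) /\<^sub>R h - D)" if "h \<noteq> 0" for h
        proof -
          have "(g (0 + h) - g 0) /\<^sub>R h - D = (g (0 + h) - g 0 - h *\<^sub>R D) /\<^sub>R h"
            using that by (simp add: scaleR_diff_right)
          then show ?thesis by (simp add: divide_inverse mult.commute)
        qed
        ultimately have "(\<lambda>h. norm ((g (0 + h) - g 0) /\<^sub>R h - D)) \<midarrow>0\<rightarrow> 0"
          by (simp cong: Lim_cong_within)
        then have "(\<lambda>h. (g (0 + h) - g 0) /\<^sub>R h - D) \<midarrow>0\<rightarrow> 0" by (rule tendsto_norm_zero_cancel)
        then show ?thesis unfolding g_def D_def by (rule LIM_zero_cancel)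
      qed
      then have *: "((\<lambda>h. (\<psi> (x + h *\<^sub>R ?e) - \<psi> x) /\<^sub>R h) \<longlongrightarrow> partial_deriv i \<psi> x) (at 0)" by simp
      have "filterlim (\<lambda>n. inverse (real (Suc n))) (at 0) sequentially"
        using LIMSEQ_inverse_real_of_nat by (auto simp: filterlim_at)
      from filterlim_compose[OF * this] show "(\<lambda>n. s n x) \<longlonglongrightarrow> partial_deriv i \<psi> x"
        by (simp add: s_def divide_inverse)
    qed
    show "AE x in lborel. norm (s n x) \<le> B * indicat_real K' x" for n
    proof (rule AE_I2)
      fix x
      show "norm (s n x) \<le> B * indicat_real K' x"
      proof (cases "x \<in> K'")
        case True
        have "norm (s n x) = real (Suc n) * norm (\<psi> (x + (1 / real (Suc n)) *\<^sub>R ?e) - \<psi> x)" by (simp add: s_def)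
        also have "\<dots> \<le> real (Suc n) * (B * (1 / real (Suc n)))" by (intro mult_left_mono mvt) auto
        finally show ?thesis using True by simp
      next
        case False
        have k1: "x \<notin> K"
        proof
          assume "x \<in> K"
          moreover have "(0::real^'d) \<in> cball 0 1" by simp
          ultimately have "x + 0 \<in> K'" unfolding K'_def by blast
          then show False using False by simp
        qed
        have k2: "x + (1 / real (Suc n)) *\<^sub>R ?e \<notin> K"
        proof
          assume "x + (1 / real (Suc n)) *\<^sub>R ?e \<in> K"
          moreover have "- ((1 / real (Suc n)) *\<^sub>R ?e) \<in> cball 0 1" by (simp add: norm_axis_1)
          ultimately have "(x + (1 / real (Suc n)) *\<^sub>R ?e) + - ((1 / real (Suc n)) *\<^sub>R ?e) \<in> K'"
            unfolding K'_def by blast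
          then show False using False by simp
        qed
        have "\<psi> x = 0" using k1 unfolding K_def by (rule zero_outside_support)
        moreover have "\<psi> (x + (1 / real (Suc n)) *\<^sub>R ?e) = 0"
          using k2 unfolding K_def by (rule zero_outside_support)
        ultimately show ?thesis using False by (simp add: s_def)
      qed
    qed
    show "partial_deriv i \<psi> \<in> borel_measurable lborel" using smooth_borel[OF smooth_partial[OF sm]] by simp
    show "s n \<in> borel_measurable lborel" for n unfolding s_def using mb by measurable
  qed
  moreover have "(LINT x|lborel. s n x) = 0" for n
  proof -
    let ?c = "(1 / real (Suc n)) *\<^sub>R ?e"
    have i0: "integrable lborel \<psi>"
      using test_functions_integrable[OF assms, of UNIV] mb by (simp add: lebesgue_on_UNIV_eq integrable_completion)
    have d: "lborel = distr lborel borel ((+) ?c)" by (simp add: lborel_distr_plus)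
    have "integrable (distr lborel borel ((+) ?c)) \<psi>" using i0 lborel_distr_plus[of ?c] by simp
    then have i1: "integrable lborel (\<lambda>x. \<psi> (?c + x))"
      using mb by (subst (asm) integrable_distr_eq) auto
    have "(LINT x|lborel. \<psi> x) = (LINT x|distr lborel borel ((+) ?c). \<psi> x)" by (simp add: lborel_distr_plus)
    also have "\<dots> = (LINT x|lborel. \<psi> (?c + x))" using mb by (intro integral_distr) auto
    finally show ?thesis using i0 i1 by (simp add: s_def add.commute)
  qed
  ultimately show ?thesis by (simp add: LIMSEQ_const_iff)
qed

lemma lebesgue_integral_test:
  fixes f :: "real^'d::finite \<Rightarrow> 'b::euclidean_space"
  assumes "open \<Omega>" "f \<in> test_functions \<Omega>"
  shows "(LINT x|lebesgue_on \<Omega>. f x) = (LINT x|lborel. f x)"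
proof -
  have "(\<lambda>x. indicat_real \<Omega> x *\<^sub>R f x) = f"
    using test_functions_zero_outside[OF assms(2)] by (auto simp: indicator_def fun_eq_iff)
  moreover have "f \<in> borel_measurable borel" using smooth_borel[OF test_functionsD(1)[OF assms(2)]] .
  ultimately show ?thesis
    using open_lebesgue[OF assms(1)] by (simp add: integral_restrict_space integral_completion)
qed

lemma integral_partial_test_zero:
  fixes f :: "real^'d::finite \<Rightarrow> 'b::euclidean_space"
  assumes "open \<Omega>" "f \<in> test_functions \<Omega>"
  shows "(LINT x|lebesgue_on \<Omega>. partial_deriv i f x) = 0"
  using lebesgue_integral_test[OF assms(1) test_functions_partial[OF assms(2)]]
    integral_partial_zero[OF test_functions_mono[OF assms(2)]] by simp

lemma smooth_integration_by_parts:
  fixes w :: "real^'d::finite \<Rightarrow> 'b::euclidean_space"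
  assumes "open \<Omega>" "\<eta> \<in> test_functions \<Omega>" "smooth w"
  shows "(LINT x|lebesgue_on \<Omega>. partial_deriv i \<eta> x *\<^sub>R w x) = - (LINT x|lebesgue_on \<Omega>. (\<eta> x :: real) *\<^sub>R partial_deriv i w x)"
proof -
  have OL: "\<Omega> \<in> sets lebesgue" using open_lebesgue assms by blast
  have "(\<lambda>x. partial_deriv i (\<lambda>x. \<eta> x *\<^sub>R w x) x) = (\<lambda>x. \<eta> x *\<^sub>R partial_deriv i w x + partial_deriv i \<eta> x *\<^sub>R w x)"
    by (intro ext partial_deriv_bilinear[OF bounded_bilinear_scaleR]
        smooth_differentiable[OF test_functionsD(1)[OF assms(2)]] smooth_differentiable[OF assms(3)])
  moreover have "(LINT x|lebesgue_on \<Omega>. partial_deriv i (\<lambda>x. \<eta> x *\<^sub>R w x) x) = 0"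
    using assms by (intro integral_partial_test_zero test_functions_scaleR)
  moreover have "integrable (lebesgue_on \<Omega>) (\<lambda>x. \<eta> x *\<^sub>R partial_deriv i w x)"
    by (rule test_functions_integrable[OF test_functions_scaleR[OF assms(2) smooth_partial[OF assms(3)]] OL])
  moreover have "integrable (lebesgue_on \<Omega>) (\<lambda>x. partial_deriv i \<eta> x *\<^sub>R w x)"
    by (rule test_functions_integrable[OF test_functions_scaleR[OF test_functions_partial[OF assms(2)] assms(3)] OL])
  ultimately show ?thesis by (simp add: eq_neg_iff_add_eq_0 add.commute)
qed

text \<open>Off its compact support the factor \<phi> vanishes and on it \<phi> is bounded, so only
  the integrability of \<open>f\<close> on that compact set matters.\<close>

lemma locally_integrable_test_integrable:
  fixes f :: "real^'d::finite \<Rightarrow> 'b::euclidean_space"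
  assumes "open \<Omega>" "\<phi> \<in> test_functions \<Omega>" "locally_integrable \<Omega> f"
  shows "integrable (lebesgue_on \<Omega>) (\<lambda>x. (\<phi> x :: real) *\<^sub>R f x)"
proof -
  let ?K = "closure {x. \<phi> x \<noteq> 0}"
  have OL: "\<Omega> \<in> sets lebesgue" using open_lebesgue assms by blast
  have "f absolutely_integrable_on ?K"
    using assms(3) test_functionsD[OF assms(2)] by (auto simp: locally_integrable_def)
  then have i: "integrable lebesgue (\<lambda>x. indicat_real ?K x *\<^sub>R f x)" by (simp add: set_integrable_def)
  obtain B where B: "B \<ge> 0" "\<And>x. norm (\<phi> x) \<le> B" using test_functions_bounded[OF assms(2)] by blast
  have m: "\<phi> \<in> borel_measurable lebesgue"
    using smooth_borel[OF test_functionsD(1)[OF assms(2)]] by (simp add: measurable_completion)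
  have "integrable lebesgue (\<lambda>x. \<phi> x *\<^sub>R (indicat_real ?K x *\<^sub>R f x))"
  proof (rule Bochner_Integration.integrable_bound[of _ "\<lambda>x. B *\<^sub>R (indicat_real ?K x *\<^sub>R f x)"])
    show "integrable lebesgue (\<lambda>x. B *\<^sub>R (indicat_real ?K x *\<^sub>R f x))" using i by (rule integrable_scaleR_right)
    show "(\<lambda>x. \<phi> x *\<^sub>R indicat_real ?K x *\<^sub>R f x) \<in> borel_measurable lebesgue"
      using borel_measurable_integrable[OF i] m by (rule borel_measurable_scaleR[rotated])
    show "AE x in lebesgue. norm (\<phi> x *\<^sub>R indicat_real ?K x *\<^sub>R f x) \<le> norm (B *\<^sub>R (indicat_real ?K x *\<^sub>R f x))"
      using B(2) by (intro AE_I2) (auto intro!: mult_right_mono simp: abs_mult \<open>B \<ge> 0\<close>)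
  qed
  moreover have "(\<lambda>x. \<phi> x *\<^sub>R (indicat_real ?K x *\<^sub>R f x)) = (\<lambda>x. indicat_real \<Omega> x *\<^sub>R (\<phi> x *\<^sub>R f x))"
  proof
    fix x
    show "\<phi> x *\<^sub>R (indicat_real ?K x *\<^sub>R f x) = indicat_real \<Omega> x *\<^sub>R (\<phi> x *\<^sub>R f x)"
    proof (cases "\<phi> x = 0")
      case False
      then have "x \<in> ?K" "x \<in> \<Omega>"
        using zero_outside_support[of x \<phi>] test_functions_zero_outside[OF assms(2), of x] by blast+
      then show ?thesis by simp
    qed simp
  qed
  ultimately show ?thesis using OL by (simp add: integrable_restrict_space)
qed

lemma locally_integrable_diff:
  "locally_integrable \<Omega> f \<Longrightarrow> locally_integrable \<Omega> g \<Longrightarrow> locally_integrable \<Omega> (\<lambda>x. f x - g x)"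
  by (auto simp: locally_integrable_def intro: set_integral_diff)

text \<open>\<open>weak_deriv\<close> quantifies over all orders of differentiation that realise a
  multi-index. Some order exists, so the condition is never vacuous and can determine the
  derivative.\<close>

lemma ex_list_count: "\<exists>js. \<forall>i. count_list js i = (\<alpha> :: 'd::finite \<Rightarrow> nat) i"
proof (induction "mi_order \<alpha>" arbitrary: \<alpha>)
  case 0
  then show ?case by (intro exI[of _ "[]"]) auto
next
  case (Suc n)
  then obtain i where i: "\<alpha> i > 0" by (metis bot_nat_0.not_eq_extremum nat.simps(3) sum.neutral)
  let ?\<beta> = "\<alpha>(i := \<alpha> i - 1)"
  have "mi_order \<alpha> = \<alpha> i + (\<Sum>j\<in>UNIV - {i}. \<alpha> j)" by (simp add: sum.remove)
  moreover have "mi_order ?\<beta> = (\<alpha> i - 1) + (\<Sum>j\<in>UNIV - {i}. ?\<beta> j)" by (simp add: sum.remove[of UNIV i])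
  moreover have "(\<Sum>j\<in>UNIV - {i}. ?\<beta> j) = (\<Sum>j\<in>UNIV - {i}. \<alpha> j)" by (intro sum.cong) auto
  ultimately have "n = mi_order ?\<beta>" using i Suc(2) by linarith
  from Suc(1)[OF this] obtain js where "\<forall>j. count_list js j = ?\<beta> j" by blast
  then have "\<forall>j. count_list (i # js) j = \<alpha> j" using i by auto
  then show ?case by blast
qed

lemma iter_partial_test:
  "\<phi> \<in> test_functions \<Omega> \<Longrightarrow> iter_partial js \<phi> \<in> test_functions \<Omega>"
  by (induction js) (auto intro: test_functions_partial)

lemma weak_deriv_unique:
  assumes "open \<Omega>" "weak_deriv \<Omega> \<alpha> f g" "weak_deriv \<Omega> \<alpha> f g'"
  shows "AE x in lebesgue_on \<Omega>. g x = g' x"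
proof -
  have li: "locally_integrable \<Omega> g" "locally_integrable \<Omega> g'" using assms by (auto simp: weak_deriv_def)
  have "AE x in lebesgue_on \<Omega>. g x - g' x = 0"
  proof (rule fundamental_lemma[OF assms(1) locally_integrable_diff[OF li]])
    fix \<phi> :: "real^'a \<Rightarrow> real" assume \<phi>: "\<phi> \<in> test_functions \<Omega>"
    obtain js where js: "\<forall>i. count_list js i = \<alpha> i" using ex_list_count by blast
    have "(-1) ^ mi_order \<alpha> *\<^sub>R (LINT x|lebesgue_on \<Omega>. \<phi> x *\<^sub>R g x) = (-1) ^ mi_order \<alpha> *\<^sub>R (LINT x|lebesgue_on \<Omega>. \<phi> x *\<^sub>R g' x)"
    proof -
      have "(LINT x|lebesgue_on \<Omega>. iter_partial js \<phi> x *\<^sub>R f x) = (-1) ^ mi_order \<alpha> *\<^sub>R (LINT x|lebesgue_on \<Omega>. \<phi> x *\<^sub>R g x)"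
        using assms(2) \<phi> js by (simp add: weak_deriv_def)
      moreover have "(LINT x|lebesgue_on \<Omega>. iter_partial js \<phi> x *\<^sub>R f x) = (-1) ^ mi_order \<alpha> *\<^sub>R (LINT x|lebesgue_on \<Omega>. \<phi> x *\<^sub>R g' x)"
        using assms(3) \<phi> js by (simp add: weak_deriv_def)
      ultimately show ?thesis by simp
    qed
    then have "(LINT x|lebesgue_on \<Omega>. \<phi> x *\<^sub>R g x) = (LINT x|lebesgue_on \<Omega>. \<phi> x *\<^sub>R g' x)"
      by (simp add: scaleR_cancel_left)
    then show "(LINT x|lebesgue_on \<Omega>. \<phi> x *\<^sub>R (g x - g' x)) = 0"
      using li by (simp add: scaleR_diff_right locally_integrable_test_integrable[OF assms(1) \<phi>])
  qed
  then show ?thesis by simp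
qed

lemma wD_weak_deriv:
  assumes "weak_deriv \<Omega> \<alpha> f g" shows "weak_deriv \<Omega> \<alpha> f (wD \<Omega> \<alpha> f)"
  unfolding wD_def using assms by (rule someI[of "weak_deriv \<Omega> \<alpha> f"])

text \<open>\<open>wD\<close> is a choice among weak derivatives. By uniqueness the choice only
  matters on a null set, which is why the calculus rules for \<open>wD\<close>, \<open>grad\<close>
  and \<open>divg\<close> hold almost everywhere.\<close>

lemma wD_AE:
  assumes "open \<Omega>" "weak_deriv \<Omega> \<alpha> f g" shows "AE x in lebesgue_on \<Omega>. wD \<Omega> \<alpha> f x = g x"
  using weak_deriv_unique[OF assms(1) wD_weak_deriv[OF assms(2)] assms(2)] .

lemma weak_deriv_add:
  assumes "open \<Omega>" "weak_deriv \<Omega> \<alpha> f f'" "weak_deriv \<Omega> \<alpha> g g'"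
  shows "weak_deriv \<Omega> \<alpha> (\<lambda>x. f x + g x) (\<lambda>x. f' x + g' x)"
proof -
  have li: "locally_integrable \<Omega> f" "locally_integrable \<Omega> f'" "locally_integrable \<Omega> g" "locally_integrable \<Omega> g'"
    using assms by (auto simp: weak_deriv_def)
  then have "locally_integrable \<Omega> (\<lambda>x. f x + g x)" "locally_integrable \<Omega> (\<lambda>x. f' x + g' x)"
    by (auto simp: locally_integrable_def intro: set_integral_add)
  moreover have "(LINT x|lebesgue_on \<Omega>. iter_partial js \<phi> x *\<^sub>R (f x + g x))
       = (-1) ^ mi_order \<alpha> *\<^sub>R (LINT x|lebesgue_on \<Omega>. \<phi> x *\<^sub>R (f' x + g' x))"
    if "\<phi> \<in> test_functions \<Omega> \<and> (\<forall>i. count_list js i = \<alpha> i)" for \<phi> :: "real^'a \<Rightarrow> real" and js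
    using that assms(2,3) li iter_partial_test[of \<phi> \<Omega> js]
    by (simp add: weak_deriv_def scaleR_add_right locally_integrable_test_integrable[OF assms(1)])
  ultimately show ?thesis by (simp add: weak_deriv_def)
qed

lemma weak_deriv_linear:
  fixes L :: "'b::euclidean_space \<Rightarrow> 'c::euclidean_space"
  assumes L: "bounded_linear L" and "open \<Omega>" "weak_deriv \<Omega> \<alpha> f f'"
  shows "weak_deriv \<Omega> \<alpha> (\<lambda>x. L (f x)) (\<lambda>x. L (f' x))"
proof -
  have li: "locally_integrable \<Omega> f" "locally_integrable \<Omega> f'"
    using assms by (auto simp: weak_deriv_def)
  then have "locally_integrable \<Omega> (\<lambda>x. L (f x))" "locally_integrable \<Omega> (\<lambda>x. L (f' x))"
    using absolutely_integrable_linear[OF _ L] by (auto simp: locally_integrable_def o_def)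
  moreover have "(LINT x|lebesgue_on \<Omega>. iter_partial js \<phi> x *\<^sub>R L (f x))
       = (-1) ^ mi_order \<alpha> *\<^sub>R (LINT x|lebesgue_on \<Omega>. \<phi> x *\<^sub>R L (f' x))"
    if *: "\<phi> \<in> test_functions \<Omega> \<and> (\<forall>i. count_list js i = \<alpha> i)" for \<phi> :: "real^'a \<Rightarrow> real" and js
  proof -
    have i: "integrable (lebesgue_on \<Omega>) (\<lambda>x. iter_partial js \<phi> x *\<^sub>R f x)" "integrable (lebesgue_on \<Omega>) (\<lambda>x. \<phi> x *\<^sub>R f' x)"
      using * li iter_partial_test[of \<phi> \<Omega> js] locally_integrable_test_integrable[OF assms(2)] by blast+
    have "(LINT x|lebesgue_on \<Omega>. L (iter_partial js \<phi> x *\<^sub>R f x)) = L (LINT x|lebesgue_on \<Omega>. iter_partial js \<phi> x *\<^sub>R f x)"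
      by (rule integral_bounded_linear[OF L i(1)])
    also have "\<dots> = (-1) ^ mi_order \<alpha> *\<^sub>R L (LINT x|lebesgue_on \<Omega>. \<phi> x *\<^sub>R f' x)"
      using assms(3) * unfolding weak_deriv_def by (simp add: linear_cmul[OF bounded_linear.linear[OF L]])
    also have "L (LINT x|lebesgue_on \<Omega>. \<phi> x *\<^sub>R f' x) = (LINT x|lebesgue_on \<Omega>. L (\<phi> x *\<^sub>R f' x))"
      by (rule integral_bounded_linear[OF L i(2), symmetric])
    finally show ?thesis by (simp add: linear_cmul[OF bounded_linear.linear[OF L]])
  qed
  ultimately show ?thesis by (simp add: weak_deriv_def)
qed

lemma weak_deriv_scaleR:
  "open \<Omega> \<Longrightarrow> weak_deriv \<Omega> \<alpha> f f' \<Longrightarrow> weak_deriv \<Omega> \<alpha> (\<lambda>x. c *\<^sub>R f x) (\<lambda>x. c *\<^sub>R f' x)"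
  by (rule weak_deriv_linear[OF bounded_linear_scaleR_right])

lemma weak_deriv_diff:
  assumes "open \<Omega>" "weak_deriv \<Omega> \<alpha> f f'" "weak_deriv \<Omega> \<alpha> g g'"
  shows "weak_deriv \<Omega> \<alpha> (\<lambda>x. f x - g x) (\<lambda>x. f' x - g' x)"
  using weak_deriv_add[OF assms(1,2) weak_deriv_scaleR[OF assms(1,3), of "-1"]] by simp

text \<open>A test function of the smaller set is one of the larger set as well, and the integrands
  vanish off the smaller one.\<close>

lemma weak_deriv_subset:
  fixes \<Omega> :: "(real^'d::finite) set"
  assumes "open \<Omega>" "open U" "U \<subseteq> \<Omega>" "weak_deriv \<Omega> \<alpha> f f'"
  shows "weak_deriv U \<alpha> f f'"
proof -
  have OL: "\<Omega> \<in> sets lebesgue" "U \<in> sets lebesgue" using open_lebesgue assms by blast+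
  have "(LINT x|lebesgue_on U. iter_partial js \<phi> x *\<^sub>R f x)
       = (-1) ^ mi_order \<alpha> *\<^sub>R (LINT x|lebesgue_on U. \<phi> x *\<^sub>R f' x)"
    if *: "\<phi> \<in> test_functions U \<and> (\<forall>i. count_list js i = \<alpha> i)" for \<phi> :: "real^'d \<Rightarrow> real" and js
  proof -
    have "(LINT x|lebesgue_on \<Omega>. iter_partial js \<phi> x *\<^sub>R f x) = (LINT x|lebesgue_on U. iter_partial js \<phi> x *\<^sub>R f x)"
      using * test_functions_zero_outside[OF iter_partial_test[of \<phi> U js]]
      by (intro lebesgue_on_integral_subset[OF assms(3) OL(2,1)]) auto
    moreover have "(LINT x|lebesgue_on \<Omega>. \<phi> x *\<^sub>R f' x) = (LINT x|lebesgue_on U. \<phi> x *\<^sub>R f' x)"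
      using * test_functions_zero_outside[of \<phi> U]
      by (intro lebesgue_on_integral_subset[OF assms(3) OL(2,1)]) auto
    moreover have "\<phi> \<in> test_functions \<Omega>" using * test_functions_mono assms(3) by blast
    ultimately show ?thesis using assms(4) * by (simp add: weak_deriv_def)
  qed
  then show ?thesis using assms(3,4) by (auto simp: weak_deriv_def locally_integrable_def)
qed

lemma weak_deriv_zero_order:
  assumes "locally_integrable \<Omega> f" shows "weak_deriv \<Omega> (\<lambda>i. 0) f f"
proof -
  have "js = []" if "\<forall>i. count_list js i = 0" for js :: "'a list"
    using that by (cases js) (auto dest: spec[of _ "hd js"])
  then have "(LINT x|lebesgue_on \<Omega>. iter_partial js \<phi> x *\<^sub>R f x) = (LINT x|lebesgue_on \<Omega>. \<phi> x *\<^sub>R f x)"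
    if "\<forall>i. count_list js i = 0" for js and \<phi> :: "real^'a \<Rightarrow> real" using that by fastforce
  then show ?thesis using assms by (auto simp: weak_deriv_def)
qed

lemma mi_order_unit [simp]: "mi_order (unit_mi i) = 1"
  by (simp add: unit_mi_def)

lemma count_list_unit_mi:
  assumes "\<forall>i. count_list js i = unit_mi j i" shows "js = [j]"
proof (cases js)
  case Nil
  with assms[rule_format, of j] show ?thesis by (simp add: unit_mi_def)
next
  case (Cons a ks)
  have "a = j" using assms[rule_format, of a] Cons by (auto simp: unit_mi_def split: if_splits)
  then have "\<forall>i. count_list ks i = 0" using assms Cons by (auto simp: unit_mi_def split: if_splits)
  then have "ks = []" by (cases ks) (auto dest: spec[of _ "hd ks"])
  with Cons \<open>a = j\<close> show ?thesis by simp
qed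

lemma weak_deriv_unit_iff:
  "weak_deriv \<Omega> (unit_mi j) f g \<longleftrightarrow> locally_integrable \<Omega> f \<and> locally_integrable \<Omega> g \<and>
     (\<forall>\<phi> :: real^'d::finite \<Rightarrow> real. \<phi> \<in> test_functions \<Omega> \<longrightarrow>
        (LINT x|lebesgue_on \<Omega>. partial_deriv j \<phi> x *\<^sub>R f x) = - (LINT x|lebesgue_on \<Omega>. \<phi> x *\<^sub>R g x))"
proof -
  have "(\<forall>i. count_list js i = unit_mi j i) \<longleftrightarrow> js = [j]" for js
    using count_list_unit_mi[of js j] by (auto simp: unit_mi_def)
  then show ?thesis by (simp add: weak_deriv_def)
qed

lemma smooth_locally_integrable:
  fixes f :: "real^'d::finite \<Rightarrow> 'b::euclidean_space"
  assumes "smooth f" shows "locally_integrable \<Omega> f"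
  unfolding locally_integrable_def
proof safe
  fix K :: "(real^'d) set" assume K: "compact K"
  then obtain a b where "K \<subseteq> cbox a b" using bounded_subset_cbox_symmetric compact_imp_bounded by metis
  moreover have "f absolutely_integrable_on cbox a b"
    using smooth_continuous_on[OF assms] by (rule absolutely_integrable_continuous)
  ultimately show "f absolutely_integrable_on K"
    using K by (meson set_integrable_subset lmeasurable_compact fmeasurableD)
qed

lemma smooth_weak_deriv:
  assumes "open \<Omega>" "smooth f" shows "weak_deriv \<Omega> (unit_mi j) f (partial_deriv j f)"
  using assms smooth_integration_by_parts[OF assms(1) _ assms(2)]
  by (auto simp: weak_deriv_unit_iff smooth_locally_integrable smooth_partial)

text \<open>The measure of \<Omega> is finite and |f| <= 1 + |f|^2. This makes weak derivatives
  available for all functions in L2.\<close>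

lemma L2_locally_integrable:
  fixes f :: "'a::euclidean_space \<Rightarrow> 'b::euclidean_space"
  assumes "open \<Omega>" "bounded \<Omega>" "f \<in> Lp_space 2 \<Omega>"
  shows "integrable (lebesgue_on \<Omega>) f" "locally_integrable \<Omega> f"
proof -
  have OM: "\<Omega> \<in> lmeasurable" using assms by (simp add: lmeasurable_open)
  interpret finite_measure "lebesgue_on \<Omega>" using OM by (rule finite_measure_lebesgue_on)
  have i: "integrable (lebesgue_on \<Omega>) (\<lambda>x. 1 + (norm (f x))\<^sup>2)" using assms by (simp add: Lp_space_2_iff)
  show *: "integrable (lebesgue_on \<Omega>) f"
  proof (rule Bochner_Integration.integrable_bound[OF i])
    have "norm (f x) \<le> 1 + (norm (f x))\<^sup>2" for x
      using zero_le_power2[of "norm (f x) - 1"] by (simp add: power2_diff) (smt (verit) norm_ge_zero)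
    then show "AE x in lebesgue_on \<Omega>. norm (f x) \<le> norm (1 + (norm (f x))\<^sup>2)"
      by (intro AE_I2) (smt (verit) real_norm_def)
  qed (use assms in \<open>auto simp: Lp_space_2_iff\<close>)
  then have "set_integrable lebesgue \<Omega> f"
    using open_lebesgue[OF assms(1)] by (simp add: set_integrable_def integrable_restrict_space)
  then show "locally_integrable \<Omega> f"
    unfolding locally_integrable_def
    by (meson set_integrable_subset lmeasurable_compact fmeasurableD)
qed

subsection \<open>Sobolev spaces on bounded open sets\<close>

lemma finite_mi_order: "finite {\<alpha> :: 'd::finite \<Rightarrow> nat. mi_order \<alpha> \<le> m}"
proof (rule finite_subset)
  show "{\<alpha> :: 'd \<Rightarrow> nat. mi_order \<alpha> \<le> m} \<subseteq> (UNIV \<rightarrow>\<^sub>E {..m})"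
  proof
    fix \<alpha> :: "'d \<Rightarrow> nat" assume "\<alpha> \<in> {\<alpha>. mi_order \<alpha> \<le> m}"
    then have "\<alpha> i \<le> m" for i
      using member_le_sum[of i UNIV \<alpha>] by (simp add: order_trans)
    then show "\<alpha> \<in> (UNIV \<rightarrow>\<^sub>E {..m})" by auto
  qed
qed (auto intro: finite_PiE)

lemma mi_order_le_1:
  assumes "mi_order (\<alpha> :: 'd::finite \<Rightarrow> nat) \<le> 1"
  obtains "\<alpha> = (\<lambda>i. 0)" | j where "\<alpha> = unit_mi j"
proof (cases "\<alpha> = (\<lambda>i. 0)")
  case False
  then obtain j where j: "\<alpha> j \<noteq> 0" by auto
  have "mi_order \<alpha> = \<alpha> j + (\<Sum>i\<in>UNIV - {j}. \<alpha> i)" by (simp add: sum.remove)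
  then have "\<alpha> j = 1" and s0: "(\<Sum>i\<in>UNIV - {j}. \<alpha> i) = 0" using assms j by linarith+
  moreover have "\<alpha> i = 0" if "i \<noteq> j" for i
    using that s0 by (metis Diff_iff UNIV_I finite singletonD sum_eq_0_iff)
  ultimately have "\<alpha> = unit_mi j" by (auto simp: unit_mi_def fun_eq_iff)
  with that show ?thesis by blast
qed (use that in blast)

lemma H_norm_nonneg [simp]: "H_norm m \<Omega> f \<ge> 0"
  by (simp add: sobolev_norm_def ereal_2_neq_infinity)

lemma H_norm_sq: "(H_norm m \<Omega> f)\<^sup>2 = (\<Sum>\<alpha> | mi_order \<alpha> \<le> m. (L2_norm_on \<Omega> (wD \<Omega> \<alpha> f))\<^sup>2)"
proof -
  have "(\<Sum>\<alpha> | mi_order \<alpha> \<le> m. (L2_norm_on \<Omega> (wD \<Omega> \<alpha> f))\<^sup>2) \<ge> 0" by (intro sum_nonneg) auto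
  then show ?thesis
    by (simp add: sobolev_norm_def ereal_2_neq_infinity real_of_ereal_2 powr_numeral powr_half_sqrt)
qed

lemma L2_wD_le_H_norm:
  assumes "mi_order \<alpha> \<le> m" shows "L2_norm_on \<Omega> (wD \<Omega> \<alpha> f) \<le> H_norm m \<Omega> f"
proof (rule power2_le_imp_le)
  show "(L2_norm_on \<Omega> (wD \<Omega> \<alpha> f))\<^sup>2 \<le> (H_norm m \<Omega> f)\<^sup>2"
    unfolding H_norm_sq using assms
    by (intro member_le_sum[of \<alpha> _ "\<lambda>\<alpha>. (L2_norm_on \<Omega> (wD \<Omega> \<alpha> f))\<^sup>2"]) (auto simp: finite_mi_order)
qed simp

lemma H_norm_le:
  fixes \<Omega> :: "(real^'d::finite) set"
  assumes "\<And>\<alpha>. mi_order \<alpha> \<le> m \<Longrightarrow> L2_norm_on \<Omega> (wD \<Omega> \<alpha> f) \<le> M" "M \<ge> 0"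
  shows "H_norm m \<Omega> f \<le> sqrt (real (card {\<alpha> :: 'd \<Rightarrow> nat. mi_order \<alpha> \<le> m})) * M"
proof (rule power2_le_imp_le)
  have "(\<Sum>\<alpha> | mi_order \<alpha> \<le> m. (L2_norm_on \<Omega> (wD \<Omega> \<alpha> f))\<^sup>2) \<le> (\<Sum>\<alpha> :: 'd \<Rightarrow> nat | mi_order \<alpha> \<le> m. M\<^sup>2)"
    using assms by (intro sum_mono power_mono) auto
  then show "(H_norm m \<Omega> f)\<^sup>2 \<le> (sqrt (real (card {\<alpha> :: 'd \<Rightarrow> nat. mi_order \<alpha> \<le> m})) * M)\<^sup>2"
    by (simp add: H_norm_sq power_mult_distrib)
qed (use assms in auto)

lemma H_spaceD: "f \<in> H_space m \<Omega> \<Longrightarrow> mi_order \<alpha> \<le> m \<Longrightarrow> \<exists>g. weak_deriv \<Omega> \<alpha> f g \<and> g \<in> Lp_space 2 \<Omega>"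
  by (simp add: sobolev_space_def)

lemma H_space_mono: "f \<in> H_space m \<Omega> \<Longrightarrow> m' \<le> m \<Longrightarrow> f \<in> H_space m' \<Omega>"
  by (auto simp: sobolev_space_def)

lemma norm_matrix_sq: "(norm (A :: real^'n::finite^'m::finite))\<^sup>2 = (\<Sum>i\<in>UNIV. \<Sum>j\<in>UNIV. (A $ i $ j)\<^sup>2)"
  unfolding power2_norm_eq_inner by (simp add: inner_vec_def power2_eq_square)

lemma norm_matrix_vector_le: "norm ((A :: real^'n::finite^'m::finite) *v w) \<le> norm A * norm w"
proof (rule power2_le_imp_le)
  have "(norm (A *v w))\<^sup>2 = (\<Sum>i\<in>UNIV. ((A $ i) \<bullet> w)\<^sup>2)"
    unfolding power2_norm_eq_inner
    by (simp add: inner_vec_def[of "A *v w"] matrix_vector_mul_component power2_eq_square)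
  also have "\<dots> \<le> (\<Sum>i\<in>UNIV. (norm (A $ i))\<^sup>2 * (norm w)\<^sup>2)"
  proof (rule sum_mono)
    fix i
    have "\<bar>(A $ i) \<bullet> w\<bar>\<^sup>2 \<le> (norm (A $ i) * norm w)\<^sup>2" by (intro power_mono Cauchy_Schwarz_ineq2) auto
    then show "((A $ i) \<bullet> w)\<^sup>2 \<le> (norm (A $ i))\<^sup>2 * (norm w)\<^sup>2" by (simp add: power_mult_distrib)
  qed
  also have "\<dots> = (norm A * norm w)\<^sup>2"
    unfolding power_mult_distrib power2_norm_eq_inner[of A] inner_vec_def[of A]
    by (simp add: sum_distrib_right power2_norm_eq_inner)
  finally show "(norm (A *v w))\<^sup>2 \<le> (norm A * norm w)\<^sup>2" .
qed auto

text \<open>Isometric embedding of a vector as a column. The gradient is the sum of its embedded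
  columns, so its integrability comes from that of the partial derivatives.\<close>

definition column_matrix :: "'d::finite \<Rightarrow> real^'d \<Rightarrow> real^'d^'d" where
  "column_matrix j y = (\<chi> i k. if k = j then y $ i else 0)"

lemma bounded_linear_column_matrix: "bounded_linear (column_matrix j)"
  by (intro linear_conv_bounded_linear[THEN iffD1] linearI) (auto simp: column_matrix_def vec_eq_iff)

lemma norm_column_matrix: "norm (column_matrix j y) = norm y"
proof -
  have "(norm (column_matrix j y))\<^sup>2 = (norm y)\<^sup>2"
    by (simp add: norm_matrix_sq column_matrix_def if_distrib[of "\<lambda>x. x\<^sup>2"] power2_norm_eq_inner[of y] inner_vec_def power2_eq_square[of "y $ _"] cong: if_cong)
  then show ?thesis by simp
qed

lemma grad_eq_sum_columns: "grad \<Omega> v x = (\<Sum>j\<in>UNIV. column_matrix j (wD \<Omega> (unit_mi j) v x))"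
  by (simp add: grad_def column_matrix_def vec_eq_iff)

lemma norm_grad_le: "norm (grad \<Omega> v x) \<le> (\<Sum>j\<in>UNIV. norm (wD \<Omega> (unit_mi j) v x))"
  unfolding grad_eq_sum_columns by (rule order_trans[OF norm_sum]) (simp add: norm_column_matrix)

lemma abs_divg_le: "\<bar>divg \<Omega> v x\<bar> \<le> (\<Sum>j\<in>UNIV. norm (wD \<Omega> (unit_mi j) v x))"
  unfolding divg_def by (rule order_trans[OF sum_abs]) (intro sum_mono component_le_norm_cart)

lemma grad_mult_vector: "grad \<Omega> v x *v w = (\<Sum>j\<in>UNIV. (w $ j) *\<^sub>R wD \<Omega> (unit_mi j) v x)"
  by (simp add: vec_eq_iff matrix_vector_mult_def grad_def mult.commute)

text \<open>Besides the domain itself, the interiors of mesh cells are instances, through which the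
  cellwise norms are evaluated.\<close>

locale bounded_open_set =
  fixes \<Omega> :: "(real^'d::finite) set"
  assumes open_\<Omega>: "open \<Omega>" and bounded_\<Omega>: "bounded \<Omega>"
begin

lemma lebesgue_\<Omega>: "\<Omega> \<in> sets lebesgue"
  using open_lebesgue open_\<Omega> by blast

lemma lmeasurable_\<Omega>: "\<Omega> \<in> lmeasurable"
  using open_\<Omega> bounded_\<Omega> by (simp add: lmeasurable_open)

abbreviation D :: "'d \<Rightarrow> (real^'d \<Rightarrow> 'b::euclidean_space) \<Rightarrow> real^'d \<Rightarrow> 'b" where
  "D j f \<equiv> wD \<Omega> (unit_mi j) f"

abbreviation L2 :: "(real^'d \<Rightarrow> 'b::euclidean_space) set" where "L2 \<equiv> Lp_space 2 \<Omega>"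
abbreviation Li :: "(real^'d \<Rightarrow> 'b::euclidean_space) set" where "Li \<equiv> Lp_space \<infinity> \<Omega>"
abbreviation n2 :: "(real^'d \<Rightarrow> 'b::euclidean_space) \<Rightarrow> real" where "n2 \<equiv> L2_norm_on \<Omega>"
abbreviation ni :: "(real^'d \<Rightarrow> 'b::euclidean_space) \<Rightarrow> real" where "ni \<equiv> Linf_norm \<Omega>"
abbreviation ip :: "(real^'d \<Rightarrow> 'b::euclidean_space) \<Rightarrow> (real^'d \<Rightarrow> 'b) \<Rightarrow> real" where "ip \<equiv> L2_inner \<Omega>"
abbreviation H1 :: "(real^'d \<Rightarrow> 'b::euclidean_space) set" where "H1 \<equiv> H_space 1 \<Omega>"

lemma L2_cong:
  fixes f :: "real^'d \<Rightarrow> 'b::euclidean_space"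
  shows "f \<in> L2 \<Longrightarrow> AE x in lebesgue_on \<Omega>. f x = g x \<Longrightarrow> g \<in> L2"
    "f \<in> L2 \<Longrightarrow> AE x in lebesgue_on \<Omega>. f x = g x \<Longrightarrow> n2 g = n2 f"
  using L2_cong_AE[OF lebesgue_\<Omega>] by blast+

lemma ip_cong:
  fixes f :: "real^'d \<Rightarrow> 'b::euclidean_space"
  assumes "f \<in> L2" "h \<in> L2" "AE x in lebesgue_on \<Omega>. f x = g x" shows "ip f h = ip g h"
  using assms by (intro L2_inner_eq_AE[OF lebesgue_\<Omega>]) (auto simp: Lp_space_2_iff)

lemma Li_cong:
  fixes f :: "real^'d \<Rightarrow> 'b::euclidean_space"
  assumes "f \<in> Li" "AE x in lebesgue_on \<Omega>. f x = g x"
  shows "g \<in> Li" "ni g \<le> ni f"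
proof -
  have m: "g \<in> borel_measurable (lebesgue_on \<Omega>)"
    using assms by (intro borel_measurable_AE_on[OF lebesgue_\<Omega> _ assms(2)]) (auto simp: Linf_iff)
  have ae: "AE x in lebesgue_on \<Omega>. norm (g x) \<le> ni f" using Linf_AE[OF assms(1)] assms(2) by eventually_elim simp
  show "g \<in> Li" "ni g \<le> ni f" using Linf_le[OF m ae Linf_norm_nonneg] by auto
qed

lemma Li_imp_L2: "f \<in> Li \<Longrightarrow> f \<in> L2" for f :: "real^'d \<Rightarrow> 'b::euclidean_space"
  using L2_bounded[OF lmeasurable_\<Omega>] by (auto simp: Linf_iff)

lemma L2_loc: "f \<in> L2 \<Longrightarrow> locally_integrable \<Omega> f" for f :: "real^'d \<Rightarrow> 'b::euclidean_space"
  using L2_locally_integrable[OF open_\<Omega> bounded_\<Omega>] by blast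

lemma H_wD:
  fixes f :: "real^'d \<Rightarrow> 'b::euclidean_space"
  assumes "f \<in> H_space m \<Omega>" "mi_order \<alpha> \<le> m"
  shows "weak_deriv \<Omega> \<alpha> f (wD \<Omega> \<alpha> f)" "wD \<Omega> \<alpha> f \<in> L2"
proof -
  obtain g where g: "weak_deriv \<Omega> \<alpha> f g" "g \<in> L2" using H_spaceD[OF assms] by blast
  show "weak_deriv \<Omega> \<alpha> f (wD \<Omega> \<alpha> f)" using g(1) by (rule wD_weak_deriv)
  have "AE x in lebesgue_on \<Omega>. g x = wD \<Omega> \<alpha> f x" using wD_AE[OF open_\<Omega> g(1)] by eventually_elim simp
  then show "wD \<Omega> \<alpha> f \<in> L2" by (rule L2_cong(1)[OF g(2)])
qed

lemma W_wD:
  fixes f :: "real^'d \<Rightarrow> 'b::euclidean_space"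
  assumes "f \<in> sobolev_space m \<infinity> \<Omega>" "mi_order \<alpha> \<le> m"
  shows "weak_deriv \<Omega> \<alpha> f (wD \<Omega> \<alpha> f)" "wD \<Omega> \<alpha> f \<in> Li"
proof -
  obtain g where g: "weak_deriv \<Omega> \<alpha> f g" "g \<in> Li" using assms by (auto simp: sobolev_space_def)
  show "weak_deriv \<Omega> \<alpha> f (wD \<Omega> \<alpha> f)" using g(1) by (rule wD_weak_deriv)
  have "AE x in lebesgue_on \<Omega>. g x = wD \<Omega> \<alpha> f x" using wD_AE[OF open_\<Omega> g(1)] by eventually_elim simp
  then show "wD \<Omega> \<alpha> f \<in> Li" by (rule Li_cong(1)[OF g(2)])
qed

lemma wD_0:
  fixes f :: "real^'d \<Rightarrow> 'b::euclidean_space"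
  assumes "weak_deriv \<Omega> (\<lambda>i. 0) f g"
  shows "AE x in lebesgue_on \<Omega>. wD \<Omega> (\<lambda>i. 0) f x = f x"
  using assms by (intro wD_AE[OF open_\<Omega>] weak_deriv_zero_order) (simp add: weak_deriv_def)

lemma H_L2: "f \<in> H_space m \<Omega> \<Longrightarrow> f \<in> L2" for f :: "real^'d \<Rightarrow> 'b::euclidean_space"
  using H_wD[of f m "\<lambda>i. 0"] wD_0[of f] by (auto intro: L2_cong(1))

lemma H1_L2: "f \<in> H1 \<Longrightarrow> f \<in> L2" for f :: "real^'d \<Rightarrow> 'b::euclidean_space"
  by (rule H_L2)

lemma L2_le_H_norm: "f \<in> H_space m \<Omega> \<Longrightarrow> n2 f \<le> H_norm m \<Omega> f" for f :: "real^'d \<Rightarrow> 'b::euclidean_space"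
  using H_wD[of f m "\<lambda>i. 0"] wD_0[of f] L2_cong(2)[of "wD \<Omega> (\<lambda>i. 0) f" f] L2_wD_le_H_norm[of "\<lambda>i. 0" m \<Omega> f]
  by simp

lemma W_Li: "f \<in> sobolev_space m \<infinity> \<Omega> \<Longrightarrow> f \<in> Li" for f :: "real^'d \<Rightarrow> 'b::euclidean_space"
  using W_wD[of f m "\<lambda>i. 0"] wD_0[of f] by (auto intro: Li_cong(1))

lemma Li_wD_le: "mi_order \<alpha> \<le> m \<Longrightarrow> ni (wD \<Omega> \<alpha> f) \<le> sobolev_norm m \<infinity> \<Omega> f"
  for f :: "real^'d \<Rightarrow> 'b::euclidean_space"
  by (auto simp: sobolev_norm_def finite_mi_order intro!: Max_ge)

lemma Li_le_W_norm: "f \<in> sobolev_space m \<infinity> \<Omega> \<Longrightarrow> ni f \<le> sobolev_norm m \<infinity> \<Omega> f"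
  for f :: "real^'d \<Rightarrow> 'b::euclidean_space"
  using W_wD[of f m "\<lambda>i. 0"] wD_0[of f] Li_cong(2)[of "wD \<Omega> (\<lambda>i. 0) f" f] Li_wD_le[of "\<lambda>i. 0" m f]
  by simp

lemma H_diff:
  fixes f g :: "real^'d \<Rightarrow> 'b::euclidean_space"
  assumes "f \<in> H_space m \<Omega>" "g \<in> H_space m \<Omega>" shows "(\<lambda>x. f x - g x) \<in> H_space m \<Omega>"
  unfolding sobolev_space_def
  using weak_deriv_diff[OF open_\<Omega> H_wD(1)[OF assms(1)] H_wD(1)[OF assms(2)]]
    L2_diff[OF H_wD(2)[OF assms(1)] H_wD(2)[OF assms(2)]] by blast

lemma H_scaleR:
  fixes f :: "real^'d \<Rightarrow> 'b::euclidean_space"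
  assumes "f \<in> H_space m \<Omega>" shows "(\<lambda>x. c *\<^sub>R f x) \<in> H_space m \<Omega>"
  unfolding sobolev_space_def
  using weak_deriv_scaleR[OF open_\<Omega> H_wD(1)[OF assms(1)]] L2_scaleR[OF H_wD(2)[OF assms(1)]] by blast

lemma wD_diff:
  fixes f g :: "real^'d \<Rightarrow> 'b::euclidean_space"
  assumes "f \<in> H_space m \<Omega>" "g \<in> H_space m \<Omega>" "mi_order \<alpha> \<le> m"
  shows "AE x in lebesgue_on \<Omega>. wD \<Omega> \<alpha> (\<lambda>x. f x - g x) x = wD \<Omega> \<alpha> f x - wD \<Omega> \<alpha> g x"
  using assms by (intro wD_AE[OF open_\<Omega>] weak_deriv_diff[OF open_\<Omega>] H_wD(1))

lemma wD_scaleR: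
  fixes f :: "real^'d \<Rightarrow> 'b::euclidean_space"
  assumes "f \<in> H_space m \<Omega>" "mi_order \<alpha> \<le> m"
  shows "AE x in lebesgue_on \<Omega>. wD \<Omega> \<alpha> (\<lambda>x. c *\<^sub>R f x) x = c *\<^sub>R wD \<Omega> \<alpha> f x"
  using assms by (intro wD_AE[OF open_\<Omega>] weak_deriv_scaleR[OF open_\<Omega>] H_wD(1))

lemma H1_I:
  fixes f :: "real^'d \<Rightarrow> 'b::euclidean_space"
  assumes "f \<in> L2" "\<And>j. \<exists>g. weak_deriv \<Omega> (unit_mi j) f g \<and> g \<in> L2"
  shows "f \<in> H1"
  unfolding sobolev_space_def
proof safe
  fix \<alpha> :: "'d \<Rightarrow> nat" assume "mi_order \<alpha> \<le> 1"
  then show "\<exists>g. weak_deriv \<Omega> \<alpha> f g \<and> g \<in> L2"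
  proof (cases rule: mi_order_le_1)
    case 1
    then show ?thesis using weak_deriv_zero_order[OF L2_loc[OF assms(1)]] assms(1) by auto
  next
    case (2 j)
    then show ?thesis using assms(2) by simp
  qed
qed

lemma test_L2: "\<phi> \<in> test_functions \<Omega> \<Longrightarrow> \<phi> \<in> L2" for \<phi> :: "real^'d \<Rightarrow> 'b::euclidean_space"
  by (rule test_functions_L2[OF _ lebesgue_\<Omega>])

lemma test_weak_deriv:
  "\<phi> \<in> test_functions \<Omega> \<Longrightarrow> weak_deriv \<Omega> (unit_mi j) \<phi> (partial_deriv j \<phi>)" for \<phi> :: "real^'d \<Rightarrow> 'b::euclidean_space"
  by (rule smooth_weak_deriv[OF open_\<Omega> test_functionsD(1)])

lemma test_H1: "\<phi> \<in> test_functions \<Omega> \<Longrightarrow> \<phi> \<in> H1" for \<phi> :: "real^'d \<Rightarrow> 'b::euclidean_space"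
  using test_weak_deriv test_L2 test_functions_partial by (intro H1_I) blast+

lemma test_D: "\<phi> \<in> test_functions \<Omega> \<Longrightarrow> AE x in lebesgue_on \<Omega>. D j \<phi> x = partial_deriv j \<phi> x"
  for \<phi> :: "real^'d \<Rightarrow> 'b::euclidean_space"
  using test_weak_deriv by (rule wD_AE[OF open_\<Omega>])

lemma H1_D: "f \<in> H1 \<Longrightarrow> weak_deriv \<Omega> (unit_mi j) f (D j f)" "f \<in> H1 \<Longrightarrow> D j f \<in> L2"
  for f :: "real^'d \<Rightarrow> 'b::euclidean_space"
  using H_wD[of f 1 "unit_mi j"] by auto

lemma H10_H1: "v \<in> H10_space \<Omega> \<Longrightarrow> v \<in> H1" for v :: "real^'d \<Rightarrow> 'b::euclidean_space"
  by (simp add: H10_space_def)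

subsection \<open>Gradient and divergence\<close>

lemma L2_contraction:
  fixes f :: "real^'d \<Rightarrow> 'b::euclidean_space" and L :: "'b \<Rightarrow> 'c::euclidean_space"
  assumes L: "bounded_linear L" "\<And>y. norm (L y) \<le> norm y" and f: "f \<in> L2"
  shows "(\<lambda>x. L (f x)) \<in> L2" "n2 (\<lambda>x. L (f x)) \<le> n2 f"
proof -
  have "L \<in> borel_measurable borel"
    by (rule borel_measurable_continuous_onI[OF linear_continuous_on[OF L(1)]])
  then have m: "(\<lambda>x. L (f x)) \<in> borel_measurable (lebesgue_on \<Omega>)"
    by (rule measurable_compose[OF Lp_space_2_measurable[OF f]])
  have "AE x in lebesgue_on \<Omega>. norm (L (f x)) \<le> 1 * norm (f x)" using L(2) by simp
  from L2_norm_mono[OF f m _ this] show "(\<lambda>x. L (f x)) \<in> L2" "n2 (\<lambda>x. L (f x)) \<le> n2 f" by auto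
qed

lemma component_L2: "f \<in> L2 \<Longrightarrow> (\<lambda>x. f x $ j) \<in> L2" for f :: "real^'d \<Rightarrow> real^'d"
  by (rule L2_contraction(1)[OF bounded_linear_vec_nth[of j]]) (simp_all add: component_le_norm_cart)

lemma n2_component_le: "f \<in> L2 \<Longrightarrow> n2 (\<lambda>x. f x $ j) \<le> n2 f" for f :: "real^'d \<Rightarrow> real^'d"
  by (rule L2_contraction(2)[OF bounded_linear_vec_nth[of j]]) (simp_all add: component_le_norm_cart)

lemma grad_L2:
  assumes "v \<in> H1" shows "grad \<Omega> v \<in> L2"
proof -
  have "(\<lambda>x. column_matrix j (D j v x)) \<in> L2" for j
    by (rule L2_contraction(1)[OF bounded_linear_column_matrix _ H1_D(2)[OF assms]]) (simp add: norm_column_matrix)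
  then show ?thesis unfolding grad_eq_sum_columns[abs_def] by (intro L2_sum) auto
qed

lemma divg_L2:
  assumes "v \<in> H1" shows "divg \<Omega> v \<in> L2"
proof -
  have "(\<lambda>x. D j v x $ j) \<in> L2" for j by (rule component_L2[OF H1_D(2)[OF assms]])
  then show ?thesis unfolding divg_def[abs_def] by (intro L2_sum) auto
qed

lemma norms_L2: "f \<in> L2 \<Longrightarrow> (\<lambda>x. norm (f x)) \<in> L2" "n2 (\<lambda>x. norm (f x)) = n2 f"
  for f :: "real^'d \<Rightarrow> 'b::euclidean_space"
  by (auto simp: Lp_space_2_iff Lp_norm_def)

text \<open>Gradient and divergence are both dominated pointwise by the sum of the norms of the
  partial derivatives. The factor \<open>CARD('d)\<close> lost here is the \<open>dd\<close> of the
  final constants.\<close>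

lemma L2_sum_norm_bound:
  fixes h :: "real^'d \<Rightarrow> 'b::euclidean_space" and v :: "real^'d \<Rightarrow> 'c::euclidean_space"
  assumes v: "v \<in> H1" and "h \<in> L2" "\<And>x. norm (h x) \<le> (\<Sum>j\<in>UNIV. norm (D j v x))"
  shows "n2 h \<le> real CARD('d) * H_norm 1 \<Omega> v"
proof -
  have l: "(\<lambda>x. \<Sum>j\<in>UNIV. norm (D j v x)) \<in> L2" using H1_D(2)[OF v] by (intro L2_sum norms_L2) auto
  have "n2 h \<le> 1 * n2 (\<lambda>x. \<Sum>j\<in>UNIV. norm (D j v x))"
    using assms(2,3) by (intro L2_norm_mono(2)[OF l]) (auto simp: Lp_space_2_iff intro: order_trans[OF _ abs_ge_self])
  also have "\<dots> \<le> (\<Sum>j\<in>UNIV. n2 (\<lambda>x. norm (D j v x)))"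
    using H1_D(2)[OF v] L2_norm_sum[of UNIV "\<lambda>j x. norm (D j v x)" \<Omega>] by (simp add: norms_L2)
  also have "\<dots> \<le> (\<Sum>j\<in>(UNIV::'d set). H_norm 1 \<Omega> v)"
    by (intro sum_mono) (simp add: norms_L2 L2_wD_le_H_norm)
  finally show ?thesis by simp
qed

lemma n2_grad_le: "v \<in> H1 \<Longrightarrow> n2 (grad \<Omega> v) \<le> real CARD('d) * H_norm 1 \<Omega> v"
  by (intro L2_sum_norm_bound grad_L2 norm_grad_le)

lemma n2_divg_le: "v \<in> H1 \<Longrightarrow> n2 (divg \<Omega> v) \<le> real CARD('d) * H_norm 1 \<Omega> v"
  by (intro L2_sum_norm_bound divg_L2) (auto simp: abs_divg_le)

lemma grad_diff:
  assumes "v \<in> H1" "w \<in> H1"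
  shows "AE x in lebesgue_on \<Omega>. grad \<Omega> (\<lambda>x. v x - w x) x = grad \<Omega> v x - grad \<Omega> w x"
proof -
  have "AE x in lebesgue_on \<Omega>. \<forall>j. D j (\<lambda>x. v x - w x) x = D j v x - D j w x"
    using wD_diff[OF assms, of "unit_mi _"] by (simp add: AE_all_countable)
  then show ?thesis by eventually_elim (simp add: grad_def vec_eq_iff)
qed

lemma divg_diff:
  assumes "v \<in> H1" "w \<in> H1"
  shows "AE x in lebesgue_on \<Omega>. divg \<Omega> (\<lambda>x. v x - w x) x = divg \<Omega> v x - divg \<Omega> w x"
proof -
  have "AE x in lebesgue_on \<Omega>. \<forall>j. D j (\<lambda>x. v x - w x) x = D j v x - D j w x"
    using wD_diff[OF assms, of "unit_mi _"] by (simp add: AE_all_countable)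
  then show ?thesis by eventually_elim (simp add: divg_def sum_subtractf)
qed

lemma divg_scale:
  assumes "v \<in> H1" shows "AE x in lebesgue_on \<Omega>. divg \<Omega> (\<lambda>x. c *\<^sub>R v x) x = c * divg \<Omega> v x"
proof -
  have "AE x in lebesgue_on \<Omega>. \<forall>j. D j (\<lambda>x. c *\<^sub>R v x) x = c *\<^sub>R D j v x"
    using wD_scaleR[OF assms, of "unit_mi _"] by (simp add: AE_all_countable)
  then show ?thesis by eventually_elim (simp add: divg_def sum_distrib_left)
qed

subsection \<open>Integration by parts\<close>

text \<open>The device behind all integrations by parts with zero boundary values: an identity is
  written as the vanishing of a functional that respects differences and is bounded by the
  first-order norm, and then only has to be checked on test functions.\<close>

lemma H10_principle:
  fixes F :: "(real^'d \<Rightarrow> 'b::euclidean_space) \<Rightarrow> real"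
  assumes diff: "\<And>v w. v \<in> H1 \<Longrightarrow> w \<in> H1 \<Longrightarrow> F (\<lambda>x. v x - w x) = F v - F w"
    and bound: "\<And>v. v \<in> H1 \<Longrightarrow> \<bar>F v\<bar> \<le> C * H_norm 1 \<Omega> v"
    and test: "\<And>\<phi>. \<phi> \<in> test_functions \<Omega> \<Longrightarrow> F \<phi> = 0"
    and v: "v \<in> H10_space \<Omega>"
  shows "F v = 0"
proof (rule ccontr)
  assume nz: "F v \<noteq> 0"
  \<comment> \<open>Adding 1 to |C| keeps the tolerance well defined whatever the sign or size of
    C.\<close>
  let ?e = "\<bar>F v\<bar> / (\<bar>C\<bar> + 1)"
  have e: "?e > 0" using nz by (simp add: add_nonneg_pos)
  obtain \<phi> where \<phi>: "\<phi> \<in> test_functions \<Omega>" "H_norm 1 \<Omega> (\<lambda>x. v x - \<phi> x) < ?e"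
    using v e unfolding H10_space_def by blast
  have vH: "v \<in> H1" "\<phi> \<in> H1" using v H10_H1 test_H1 \<phi> by auto
  have "\<bar>F v\<bar> = \<bar>F (\<lambda>x. v x - \<phi> x)\<bar>" using diff[OF vH] test[OF \<phi>(1)] by simp
  also have "\<dots> \<le> C * H_norm 1 \<Omega> (\<lambda>x. v x - \<phi> x)" by (rule bound[OF H_diff[OF vH]])
  also have "\<dots> \<le> (\<bar>C\<bar> + 1) * H_norm 1 \<Omega> (\<lambda>x. v x - \<phi> x)" by (intro mult_right_mono) auto
  also have "\<dots> < (\<bar>C\<bar> + 1) * ?e" using \<phi>(2) by (intro mult_strict_left_mono) auto
  also have "\<dots> = \<bar>F v\<bar>" by (simp add: add_nonneg_pos less_imp_neq[symmetric])
  finally show False by simp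
qed

lemma iter_partial_linear:
  assumes L: "bounded_linear L" and "\<phi> \<in> test_functions \<Omega>"
  shows "iter_partial js (\<lambda>x. L (\<phi> x)) = (\<lambda>x. L (iter_partial js \<phi> x))"
proof (induction js)
  case (Cons j js)
  show ?case
    unfolding iter_partial.simps Cons
    by (intro ext partial_deriv_linear[OF L] smooth_differentiable test_functionsD(1)[OF iter_partial_test[OF assms(2)]])
qed simp

text \<open>\<open>weak_deriv\<close> is tested by scalar functions only. Each scalar component of
  \<zeta> is admissible; taking the matching component of the resulting vector identity and summing
  over a basis gives the inner product.\<close>

lemma weak_deriv_test_inner:
  fixes w \<zeta> :: "real^'d \<Rightarrow> 'b::euclidean_space"
  assumes wd: "weak_deriv \<Omega> \<alpha> w g" and \<zeta>: "\<zeta> \<in> test_functions \<Omega>" and js: "\<forall>i. count_list js i = \<alpha> i"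
  shows "ip (iter_partial js \<zeta>) w = (-1) ^ mi_order \<alpha> * ip \<zeta> g"
proof -
  have t: "(\<lambda>x. \<zeta> x \<bullet> b) \<in> test_functions \<Omega>" for b
    using test_functions_linear[OF bounded_linear_inner_left \<zeta>] .
  have p: "iter_partial js (\<lambda>x. \<zeta> x \<bullet> b) = (\<lambda>x. iter_partial js \<zeta> x \<bullet> b)" for b
    by (rule iter_partial_linear[OF bounded_linear_inner_left \<zeta>])
  have li: "locally_integrable \<Omega> w" "locally_integrable \<Omega> g" using wd by (auto simp: weak_deriv_def)
  have i1: "integrable (lebesgue_on \<Omega>) (\<lambda>x. (iter_partial js \<zeta> x \<bullet> b) *\<^sub>R w x)" for b
    using locally_integrable_test_integrable[OF open_\<Omega> iter_partial_test[OF t[of b], of js] li(1)]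
    by (simp add: p)
  have i2: "integrable (lebesgue_on \<Omega>) (\<lambda>x. (\<zeta> x \<bullet> b) *\<^sub>R g x)" for b
    using locally_integrable_test_integrable[OF open_\<Omega> t[of b] li(2)] .
  have c: "(LINT x|lebesgue_on \<Omega>. (iter_partial js \<zeta> x \<bullet> b) * (w x \<bullet> b)) = (-1) ^ mi_order \<alpha> * (LINT x|lebesgue_on \<Omega>. (\<zeta> x \<bullet> b) * (g x \<bullet> b))" for b
  proof -
    have "(LINT x|lebesgue_on \<Omega>. (iter_partial js \<zeta> x \<bullet> b) *\<^sub>R w x) = (-1) ^ mi_order \<alpha> *\<^sub>R (LINT x|lebesgue_on \<Omega>. (\<zeta> x \<bullet> b) *\<^sub>R g x)"
    proof -
      have "\<forall>\<phi> :: real^'d \<Rightarrow> real. \<forall>js. \<phi> \<in> test_functions \<Omega> \<and> (\<forall>i. count_list js i = \<alpha> i) \<longrightarrow>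
        (LINT x|lebesgue_on \<Omega>. iter_partial js \<phi> x *\<^sub>R w x) = (-1) ^ mi_order \<alpha> *\<^sub>R (LINT x|lebesgue_on \<Omega>. \<phi> x *\<^sub>R g x)"
        using wd unfolding weak_deriv_def by (elim conjE)
      from this[rule_format, OF conjI[OF t[of b] js]] show ?thesis by (simp only: p)
    qed
    then have "(LINT x|lebesgue_on \<Omega>. (iter_partial js \<zeta> x \<bullet> b) *\<^sub>R w x) \<bullet> b = ((-1) ^ mi_order \<alpha> *\<^sub>R (LINT x|lebesgue_on \<Omega>. (\<zeta> x \<bullet> b) *\<^sub>R g x)) \<bullet> b"
      by simp
    then show ?thesis
      using integral_inner_left[of b, OF i1[of b]] integral_inner_left[of b, OF i2[of b]] by simp
  qed
  have i1': "integrable (lebesgue_on \<Omega>) (\<lambda>x. (iter_partial js \<zeta> x \<bullet> b) * (w x \<bullet> b))" for b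
    using integrable_inner_left[of b, OF i1[of b]] by simp
  have i2': "integrable (lebesgue_on \<Omega>) (\<lambda>x. (\<zeta> x \<bullet> b) * (g x \<bullet> b))" for b
    using integrable_inner_left[of b, OF i2[of b]] by simp
  have "ip (iter_partial js \<zeta>) w = (\<Sum>b\<in>Basis. LINT x|lebesgue_on \<Omega>. (iter_partial js \<zeta> x \<bullet> b) * (w x \<bullet> b))"
    unfolding L2_inner_def by (subst euclidean_inner) (simp add: Bochner_Integration.integral_sum i1')
  moreover have "ip \<zeta> g = (\<Sum>b\<in>Basis. LINT x|lebesgue_on \<Omega>. (\<zeta> x \<bullet> b) * (g x \<bullet> b))"
    unfolding L2_inner_def by (subst euclidean_inner) (simp add: Bochner_Integration.integral_sum i2')
  ultimately show ?thesis by (simp only: c sum_distrib_left)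
qed

lemma weak_deriv_vector_test:
  fixes w \<zeta> :: "real^'d \<Rightarrow> 'b::euclidean_space"
  assumes w: "w \<in> H1" and \<zeta>: "\<zeta> \<in> test_functions \<Omega>"
  shows "ip (partial_deriv j \<zeta>) w + ip \<zeta> (D j w) = 0"
proof -
  have "\<forall>i. count_list [j] i = unit_mi j i" by (simp add: unit_mi_def)
  from weak_deriv_test_inner[OF H1_D(1)[OF w] \<zeta> this] show ?thesis by simp
qed

lemma test_divg: "\<phi> \<in> test_functions \<Omega> \<Longrightarrow> AE x in lebesgue_on \<Omega>. divg \<Omega> \<phi> x = (\<Sum>j\<in>UNIV. partial_deriv j \<phi> x $ j)"
proof -
  assume \<phi>: "\<phi> \<in> test_functions \<Omega>"
  have "AE x in lebesgue_on \<Omega>. \<forall>j. D j \<phi> x = partial_deriv j \<phi> x"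
    using test_D[OF \<phi>] by (simp add: AE_all_countable)
  then show ?thesis by eventually_elim (simp add: divg_def)
qed

lemma grad_scalar_L2:
  assumes "q \<in> H1" shows "grad_scalar \<Omega> q \<in> L2"
proof -
  have "grad_scalar \<Omega> q = (\<lambda>x. \<Sum>j\<in>UNIV. D j q x *\<^sub>R axis j 1)"
    by (auto simp: grad_scalar_def vec_eq_iff fun_eq_iff axis_def if_distrib cong: if_cong)
  moreover have "(\<lambda>x. D j q x *\<^sub>R (axis j 1 :: real^'d)) \<in> L2" for j
    by (rule L2_contraction(1)[OF bounded_linear_scaleR_left _ H1_D(2)[OF assms]]) (simp add: norm_axis_1)
  ultimately show ?thesis by (simp add: L2_sum)
qed

text \<open>This turns the pressure gradient inside \<open>g\<close> into a term in the divergence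
  of the test function, where discrete incompressibility can act.\<close>

lemma grad_scalar_by_parts:
  assumes q: "q \<in> H1" and v: "v \<in> H10_space \<Omega>"
  shows "ip (grad_scalar \<Omega> q) v = - ip q (divg \<Omega> v)"
proof -
  have g: "grad_scalar \<Omega> q \<in> L2" and q2: "q \<in> L2" using grad_scalar_L2[OF q] H1_L2[OF q] by auto
  have "ip (grad_scalar \<Omega> q) v + ip q (divg \<Omega> v) = 0"
  proof (rule H10_principle[where C="n2 (grad_scalar \<Omega> q) + n2 q * real CARD('d)", OF _ _ _ v])
    fix v w :: "real^'d \<Rightarrow> real^'d" assume vw: "v \<in> H1" "w \<in> H1"
    have "ip q (divg \<Omega> (\<lambda>x. v x - w x)) = ip (\<lambda>x. divg \<Omega> v x - divg \<Omega> w x) q"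
      using vw q2 by (subst L2_inner_commute) (intro ip_cong divg_diff divg_L2 H_diff)
    then show "ip (grad_scalar \<Omega> q) (\<lambda>x. v x - w x) + ip q (divg \<Omega> (\<lambda>x. v x - w x))
        = ip (grad_scalar \<Omega> q) v + ip q (divg \<Omega> v) - (ip (grad_scalar \<Omega> q) w + ip q (divg \<Omega> w))"
      using vw g q2 by (simp add: L2_inner_diff_right L2_inner_diff_left H1_L2 divg_L2 L2_inner_commute[of \<Omega> _ q])
  next
    fix v :: "real^'d \<Rightarrow> real^'d" assume v: "v \<in> H1"
    have "\<bar>ip (grad_scalar \<Omega> q) v\<bar> \<le> n2 (grad_scalar \<Omega> q) * H_norm 1 \<Omega> v"
      using L2_Cauchy_Schwarz[OF g H1_L2[OF v]] mult_left_mono[OF L2_le_H_norm[OF v], of "n2 (grad_scalar \<Omega> q)"] by simp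
    moreover have "\<bar>ip q (divg \<Omega> v)\<bar> \<le> n2 q * (real CARD('d) * H_norm 1 \<Omega> v)"
      using L2_Cauchy_Schwarz[OF q2 divg_L2[OF v]] mult_left_mono[OF n2_divg_le[OF v], of "n2 q"] by simp
    ultimately show "\<bar>ip (grad_scalar \<Omega> q) v + ip q (divg \<Omega> v)\<bar> \<le> (n2 (grad_scalar \<Omega> q) + n2 q * real CARD('d)) * H_norm 1 \<Omega> v"
      by (simp add: algebra_simps)
  next
    fix \<phi> :: "real^'d \<Rightarrow> real^'d" assume \<phi>: "\<phi> \<in> test_functions \<Omega>"
    have t: "(\<lambda>x. \<phi> x $ j) \<in> test_functions \<Omega>" for j
      using test_functions_linear[OF bounded_linear_vec_nth \<phi>] .
    have p: "partial_deriv j (\<lambda>x. \<phi> x $ j) = (\<lambda>x. partial_deriv j \<phi> x $ j)" for j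
      by (intro ext partial_deriv_linear[OF bounded_linear_vec_nth smooth_differentiable[OF test_functionsD(1)[OF \<phi>]]])
    have pl: "(\<lambda>x. partial_deriv j \<phi> x $ j) \<in> L2" for j
      using test_L2[OF test_functions_partial[OF t[of j], of j]] by (simp add: p)
    have "ip q (divg \<Omega> \<phi>) = ip (\<lambda>x. \<Sum>j\<in>UNIV. partial_deriv j \<phi> x $ j) q"
      using test_divg[OF \<phi>] divg_L2[OF test_H1[OF \<phi>]] q2 by (subst L2_inner_commute) (intro ip_cong)
    also have "\<dots> = (\<Sum>j\<in>UNIV. ip (\<lambda>x. partial_deriv j \<phi> x $ j) q)"
      using pl q2 by (intro L2_inner_sum_left) auto
    also have "\<dots> = - (\<Sum>j\<in>UNIV. ip (\<lambda>x. \<phi> x $ j) (D j q))"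
      unfolding sum_negf[symmetric]
    proof (rule sum.cong[OF refl])
      fix j
      show "ip (\<lambda>x. partial_deriv j \<phi> x $ j) q = - ip (\<lambda>x. \<phi> x $ j) (D j q)"
        using weak_deriv_vector_test[OF q t[of j], of j] by (simp add: p)
    qed
    also have "(\<Sum>j\<in>UNIV. ip (\<lambda>x. \<phi> x $ j) (D j q)) = ip (grad_scalar \<Omega> q) \<phi>"
    proof -
      have "(\<Sum>j\<in>UNIV. ip (\<lambda>x. \<phi> x $ j) (D j q)) = (LINT x|lebesgue_on \<Omega>. (\<Sum>j\<in>UNIV. \<phi> x $ j * D j q x))"
        using L2_inner_integrable[OF test_L2[OF t] H1_D(2)[OF q]] by (simp add: L2_inner_def Bochner_Integration.integral_sum)
      then show ?thesis by (simp add: L2_inner_def grad_scalar_def inner_vec_def mult.commute)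
    qed
    finally show "ip (grad_scalar \<Omega> q) \<phi> + ip q (divg \<Omega> \<phi>) = 0" by simp
  qed
  then show ?thesis by simp
qed

lemma L2_scaleR_Li:
  fixes f :: "real^'d \<Rightarrow> real" and g :: "real^'d \<Rightarrow> 'b::euclidean_space"
  shows "f \<in> Li \<Longrightarrow> g \<in> L2 \<Longrightarrow> (\<lambda>x. f x *\<^sub>R g x) \<in> L2"
    and "f \<in> Li \<Longrightarrow> g \<in> L2 \<Longrightarrow> n2 (\<lambda>x. f x *\<^sub>R g x) \<le> ni f * n2 g"
proof -
  assume f: "f \<in> Li" and g: "g \<in> L2"
  have ae: "AE x in lebesgue_on \<Omega>. norm (f x *\<^sub>R g x) \<le> ni f * norm (g x)"
    using Linf_AE[OF f] by eventually_elim (simp add: mult_right_mono)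
  have m: "(\<lambda>x. f x *\<^sub>R g x) \<in> borel_measurable (lebesgue_on \<Omega>)" using f g by (auto simp: Linf_iff Lp_space_2_iff)
  show "(\<lambda>x. f x *\<^sub>R g x) \<in> L2" "n2 (\<lambda>x. f x *\<^sub>R g x) \<le> ni f * n2 g"
    using L2_norm_mono[OF g m Linf_norm_nonneg ae] by auto
qed

lemma L2_inner_Li:
  fixes f g :: "real^'d \<Rightarrow> 'b::euclidean_space"
  assumes f: "f \<in> Li" and g: "g \<in> L2" shows "(\<lambda>x. f x \<bullet> g x) \<in> L2"
proof -
  have ae: "AE x in lebesgue_on \<Omega>. norm (f x \<bullet> g x) \<le> ni f * norm (g x)"
    using Linf_AE[OF f]
  proof eventually_elim
    case (elim x)
    have "\<bar>f x \<bullet> g x\<bar> \<le> norm (f x) * norm (g x)" by (rule Cauchy_Schwarz_ineq2)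
    also have "\<dots> \<le> ni f * norm (g x)" using elim by (intro mult_right_mono) auto
    finally show ?case by simp
  qed
  have m: "(\<lambda>x. f x \<bullet> g x) \<in> borel_measurable (lebesgue_on \<Omega>)" using f g by (auto simp: Linf_iff Lp_space_2_iff)
  show ?thesis using L2_norm_mono[OF g m Linf_norm_nonneg ae] by auto
qed

lemma test_Li:
  fixes \<phi> :: "real^'d \<Rightarrow> 'b::euclidean_space"
  assumes "\<phi> \<in> test_functions \<Omega>" shows "\<phi> \<in> Li"
proof -
  obtain B where "\<And>x. norm (\<phi> x) \<le> B" using test_functions_bounded[OF assms] by blast
  then show ?thesis using smooth_borel_lebesgue_on[OF test_functionsD(1)[OF assms]] by (auto simp: Linf_iff)
qed

text \<open>Smoothness of the scalar factor \<phi> makes the derivative movable: when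
  \<open>e\<close> is replaced by a test function \<psi>, the product of \<phi> and \<psi> is a test
  function for the weak derivative of \<open>w\<close>. Later \<phi> is one component of a smooth
  transporting field.\<close>

lemma transport_by_parts_test:
  fixes w e :: "real^'d \<Rightarrow> 'b::euclidean_space" and \<phi> :: "real^'d \<Rightarrow> real"
  assumes w: "w \<in> H1" and \<phi>: "\<phi> \<in> test_functions \<Omega>" and e: "e \<in> H10_space \<Omega>"
  shows "ip (\<lambda>x. \<phi> x *\<^sub>R w x) (D j e) + ip (\<lambda>x. \<phi> x *\<^sub>R D j w x + partial_deriv j \<phi> x *\<^sub>R w x) e = 0"
    (is "?F e = 0")
proof (rule H10_principle[where F="?F", OF _ _ _ e])
  have A: "(\<lambda>x. \<phi> x *\<^sub>R w x) \<in> L2" using L2_scaleR_Li[OF test_Li[OF \<phi>] H1_L2[OF w]] by blast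
  have B1: "(\<lambda>x. \<phi> x *\<^sub>R D j w x) \<in> L2" using L2_scaleR_Li[OF test_Li[OF \<phi>] H1_D(2)[OF w]] by blast
  have B2: "(\<lambda>x. partial_deriv j \<phi> x *\<^sub>R w x) \<in> L2"
    using L2_scaleR_Li[OF test_Li[OF test_functions_partial[OF \<phi>]] H1_L2[OF w]] by blast
  have B: "(\<lambda>x. \<phi> x *\<^sub>R D j w x + partial_deriv j \<phi> x *\<^sub>R w x) \<in> L2" using L2_add[OF B1 B2] .
  {
    fix v w' :: "real^'d \<Rightarrow> 'b" assume vw: "v \<in> H1" "w' \<in> H1"
    have "ip (\<lambda>x. \<phi> x *\<^sub>R w x) (D j (\<lambda>x. v x - w' x)) = ip (\<lambda>x. D j v x - D j w' x) (\<lambda>x. \<phi> x *\<^sub>R w x)"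
      using vw A wD_diff[OF vw, of "unit_mi j"]
      by (subst L2_inner_commute) (intro ip_cong H1_D(2) H_diff, auto)
    then show "?F (\<lambda>x. v x - w' x) = ?F v - ?F w'"
      using vw A B by (simp add: L2_inner_diff_right L2_inner_diff_left H1_L2 H1_D L2_inner_commute[of \<Omega> "D j _"])
  next
    fix v :: "real^'d \<Rightarrow> 'b" assume v: "v \<in> H1"
    have "\<bar>ip (\<lambda>x. \<phi> x *\<^sub>R w x) (D j v)\<bar> \<le> n2 (\<lambda>x. \<phi> x *\<^sub>R w x) * H_norm 1 \<Omega> v"
      using L2_Cauchy_Schwarz[OF A H1_D(2)[OF v], of j]
        mult_left_mono[OF L2_wD_le_H_norm[of "unit_mi j" 1 \<Omega> v], of "n2 (\<lambda>x. \<phi> x *\<^sub>R w x)"] by fastforce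
    moreover have "\<bar>ip (\<lambda>x. \<phi> x *\<^sub>R D j w x + partial_deriv j \<phi> x *\<^sub>R w x) v\<bar>
        \<le> n2 (\<lambda>x. \<phi> x *\<^sub>R D j w x + partial_deriv j \<phi> x *\<^sub>R w x) * H_norm 1 \<Omega> v"
      using L2_Cauchy_Schwarz[OF B H1_L2[OF v]]
        mult_left_mono[OF L2_le_H_norm[OF v], of "n2 (\<lambda>x. \<phi> x *\<^sub>R D j w x + partial_deriv j \<phi> x *\<^sub>R w x)"] by fastforce
    ultimately show "\<bar>?F v\<bar> \<le> (n2 (\<lambda>x. \<phi> x *\<^sub>R w x) + n2 (\<lambda>x. \<phi> x *\<^sub>R D j w x + partial_deriv j \<phi> x *\<^sub>R w x)) * H_norm 1 \<Omega> v"
      by (simp add: algebra_simps)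
  next
    fix \<psi> :: "real^'d \<Rightarrow> 'b" assume \<psi>: "\<psi> \<in> test_functions \<Omega>"
    have t: "(\<lambda>x. \<phi> x *\<^sub>R \<psi> x) \<in> test_functions \<Omega>" using test_functions_scaleR[OF \<phi> test_functionsD(1)[OF \<psi>]] .
    have p: "partial_deriv j (\<lambda>x. \<phi> x *\<^sub>R \<psi> x) = (\<lambda>x. \<phi> x *\<^sub>R partial_deriv j \<psi> x + partial_deriv j \<phi> x *\<^sub>R \<psi> x)"
      by (intro ext partial_deriv_bilinear[OF bounded_bilinear_scaleR]
        smooth_differentiable[OF test_functionsD(1)[OF \<phi>]] smooth_differentiable[OF test_functionsD(1)[OF \<psi>]])
    have l1: "(\<lambda>x. \<phi> x *\<^sub>R partial_deriv j \<psi> x) \<in> L2"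
      using L2_scaleR_Li[OF test_Li[OF \<phi>] test_L2[OF test_functions_partial[OF \<psi>]]] by blast
    have l2: "(\<lambda>x. partial_deriv j \<phi> x *\<^sub>R \<psi> x) \<in> L2"
      using L2_scaleR_Li[OF test_Li[OF test_functions_partial[OF \<phi>]] test_L2[OF \<psi>]] by blast
    have "ip (partial_deriv j (\<lambda>x. \<phi> x *\<^sub>R \<psi> x)) w + ip (\<lambda>x. \<phi> x *\<^sub>R \<psi> x) (D j w) = 0"
      by (rule weak_deriv_vector_test[OF w t])
    then have "ip (\<lambda>x. \<phi> x *\<^sub>R partial_deriv j \<psi> x) w + ip (\<lambda>x. partial_deriv j \<phi> x *\<^sub>R \<psi> x) w + ip (\<lambda>x. \<phi> x *\<^sub>R \<psi> x) (D j w) = 0"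
      using l1 l2 H1_L2[OF w] by (simp add: p L2_inner_add_left)
    moreover have "ip (\<lambda>x. \<phi> x *\<^sub>R partial_deriv j \<psi> x) w = ip (\<lambda>x. \<phi> x *\<^sub>R w x) (partial_deriv j \<psi>)"
      "ip (\<lambda>x. partial_deriv j \<phi> x *\<^sub>R \<psi> x) w = ip (\<lambda>x. partial_deriv j \<phi> x *\<^sub>R w x) \<psi>"
      "ip (\<lambda>x. \<phi> x *\<^sub>R \<psi> x) (D j w) = ip (\<lambda>x. \<phi> x *\<^sub>R D j w x) \<psi>"
      by (simp_all add: L2_inner_def inner_commute)
    moreover have "ip (\<lambda>x. \<phi> x *\<^sub>R w x) (D j \<psi>) = ip (\<lambda>x. \<phi> x *\<^sub>R w x) (partial_deriv j \<psi>)"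
      using ip_cong[OF H1_D(2)[OF test_H1[OF \<psi>]] A test_D[OF \<psi>]] by (simp add: L2_inner_commute)
    ultimately show "?F \<psi> = 0" using B1 B2 test_L2[OF \<psi>] by (simp add: L2_inner_add_left)
  }
qed

text \<open>
  Skew-symmetry of the convective term. Only \<open>e\<close> is required to be Lipschitz, which is what makes
  the identity available both for discrete velocities and for the time derivative of \<open>u\<close>.
\<close>

lemma transport_by_parts:
  assumes w: "w \<in> H1" and e: "e \<in> H10_space \<Omega>" "e \<in> Li" "\<And>j. D j e \<in> Li"
    and a: "a \<in> H10_space \<Omega>" "a \<in> Li"
  shows "ip (\<lambda>x. grad \<Omega> e x *v a x) w + ip (\<lambda>x. grad \<Omega> w x *v a x) e + ip (\<lambda>x. divg \<Omega> a x *\<^sub>R e x) w = 0"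
proof -
  have w2: "w \<in> L2" and e1: "e \<in> H1" using H1_L2[OF w] H10_H1[OF e(1)] by auto
  \<comment> \<open>Formally \<open>g j\<close> is the j-th partial derivative of the pointwise
    product \<open>s\<close>. The claim says that the integral of div (s a) vanishes; it is linear
    in \<open>a\<close>, which can therefore be replaced by a test function.\<close>
  define g where "g j x = D j e x \<bullet> w x + D j w x \<bullet> e x" for j x
  define s where "s x = w x \<bullet> e x" for x
  have g: "g j \<in> L2" for j
    unfolding g_def using L2_add[OF L2_inner_Li[OF e(3) w2] L2_inner_Li[OF e(2) H1_D(2)[OF w]], of j j]
    by (simp add: inner_commute)
  have s: "s \<in> L2" unfolding s_def using L2_inner_Li[OF e(2) w2] by (simp add: inner_commute)
  let ?F = "\<lambda>a. (\<Sum>j\<in>UNIV. ip (\<lambda>x. a x $ j) (g j)) + ip (divg \<Omega> a) s"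
  have "?F a = 0"
  proof (rule H10_principle[where F="?F", OF _ _ _ a(1)])
    fix v v' :: "real^'d \<Rightarrow> real^'d" assume vw: "v \<in> H1" "v' \<in> H1"
    have "ip (divg \<Omega> (\<lambda>x. v x - v' x)) s = ip (\<lambda>x. divg \<Omega> v x - divg \<Omega> v' x) s"
      using vw s by (intro ip_cong divg_diff divg_L2 H_diff)
    then show "?F (\<lambda>x. v x - v' x) = ?F v - ?F v'"
      using vw g s by (simp add: L2_inner_diff_left component_L2 H1_L2 divg_L2 sum_subtractf)
  next
    fix v :: "real^'d \<Rightarrow> real^'d" assume v: "v \<in> H1"
    have "\<bar>ip (\<lambda>x. v x $ j) (g j)\<bar> \<le> H_norm 1 \<Omega> v * n2 (g j)" for j
    proof -
      have "\<bar>ip (\<lambda>x. v x $ j) (g j)\<bar> \<le> n2 (\<lambda>x. v x $ j) * n2 (g j)"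
        using L2_Cauchy_Schwarz[OF component_L2[OF H1_L2[OF v]] g] .
      also have "\<dots> \<le> H_norm 1 \<Omega> v * n2 (g j)"
        using n2_component_le[OF H1_L2[OF v], of j] L2_le_H_norm[OF v] by (intro mult_right_mono) auto
      finally show ?thesis .
    qed
    then have "\<bar>\<Sum>j\<in>UNIV. ip (\<lambda>x. v x $ j) (g j)\<bar> \<le> (\<Sum>j\<in>UNIV. H_norm 1 \<Omega> v * n2 (g j))"
      by (intro order_trans[OF sum_abs] sum_mono)
    moreover have "\<bar>ip (divg \<Omega> v) s\<bar> \<le> real CARD('d) * H_norm 1 \<Omega> v * n2 s"
      using L2_Cauchy_Schwarz[OF divg_L2[OF v] s] mult_right_mono[OF n2_divg_le[OF v], of "n2 s"] by simp
    ultimately show "\<bar>?F v\<bar> \<le> ((\<Sum>j\<in>UNIV. n2 (g j)) + real CARD('d) * n2 s) * H_norm 1 \<Omega> v"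
      by (simp add: algebra_simps sum_distrib_left)
  next
    fix \<phi> :: "real^'d \<Rightarrow> real^'d" assume \<phi>: "\<phi> \<in> test_functions \<Omega>"
    have t: "(\<lambda>x. \<phi> x $ j) \<in> test_functions \<Omega>" for j
      using test_functions_linear[OF bounded_linear_vec_nth \<phi>] .
    have p: "partial_deriv j (\<lambda>x. \<phi> x $ j) = (\<lambda>x. partial_deriv j \<phi> x $ j)" for j
      by (intro ext partial_deriv_linear[OF bounded_linear_vec_nth smooth_differentiable[OF test_functionsD(1)[OF \<phi>]]])
    have pl: "(\<lambda>x. partial_deriv j \<phi> x $ j) \<in> L2" for j
      using test_L2[OF test_functions_partial[OF t[of j], of j]] by (simp add: p)
    have "ip (divg \<Omega> \<phi>) s = ip (\<lambda>x. \<Sum>j\<in>UNIV. partial_deriv j \<phi> x $ j) s"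
      using test_divg[OF \<phi>] divg_L2[OF test_H1[OF \<phi>]] s by (intro ip_cong)
    also have "\<dots> = (\<Sum>j\<in>UNIV. ip (\<lambda>x. partial_deriv j \<phi> x $ j) s)"
      using pl s by (intro L2_inner_sum_left) auto
    finally have "?F \<phi> = (\<Sum>j\<in>UNIV. ip (\<lambda>x. \<phi> x $ j) (g j) + ip (\<lambda>x. partial_deriv j \<phi> x $ j) s)"
      by (simp add: sum.distrib)
    also have "\<dots> = 0"
    proof (rule sum.neutral, rule ballI)
      fix j
      have A: "(\<lambda>x. \<phi> x $ j *\<^sub>R w x) \<in> L2" using L2_scaleR_Li[OF test_Li[OF t] w2] by blast
      have B1: "(\<lambda>x. \<phi> x $ j *\<^sub>R D j w x) \<in> L2" using L2_scaleR_Li[OF test_Li[OF t] H1_D(2)[OF w]] by blast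
      have B2: "(\<lambda>x. partial_deriv j \<phi> x $ j *\<^sub>R w x) \<in> L2"
        using L2_scaleR_Li[OF test_Li[OF test_functions_partial[OF t[of j], of j]] w2] by (simp add: p)
      have "ip (\<lambda>x. \<phi> x $ j *\<^sub>R w x) (D j e) + ip (\<lambda>x. \<phi> x $ j *\<^sub>R D j w x + partial_deriv j \<phi> x $ j *\<^sub>R w x) e = 0"
        using transport_by_parts_test[OF w t[of j] e(1), of j] by (simp add: p)
      then have "(LINT x|lebesgue_on \<Omega>. (\<phi> x $ j *\<^sub>R w x) \<bullet> D j e x) + (LINT x|lebesgue_on \<Omega>. (\<phi> x $ j *\<^sub>R D j w x) \<bullet> e x)
          + (LINT x|lebesgue_on \<Omega>. (partial_deriv j \<phi> x $ j *\<^sub>R w x) \<bullet> e x) = 0"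
        using L2_inner_add_left[OF B1 B2 H1_L2[OF e1]] by (simp add: L2_inner_def)
      moreover have "ip (\<lambda>x. \<phi> x $ j) (g j) = (LINT x|lebesgue_on \<Omega>. (\<phi> x $ j *\<^sub>R w x) \<bullet> D j e x) + (LINT x|lebesgue_on \<Omega>. (\<phi> x $ j *\<^sub>R D j w x) \<bullet> e x)"
        using L2_inner_integrable[OF A H1_D(2)[OF e1, of j]] L2_inner_integrable[OF B1 H1_L2[OF e1]]
        by (simp add: L2_inner_def g_def algebra_simps inner_commute)
      ultimately show "ip (\<lambda>x. \<phi> x $ j) (g j) + ip (\<lambda>x. partial_deriv j \<phi> x $ j) s = 0"
        by (simp add: L2_inner_def s_def)
    qed
    finally show "?F \<phi> = 0" .
  qed
  moreover have "(\<Sum>j\<in>UNIV. ip (\<lambda>x. a x $ j) (g j)) = ip (\<lambda>x. grad \<Omega> e x *v a x) w + ip (\<lambda>x. grad \<Omega> w x *v a x) e"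
  proof -
    have ac: "(\<lambda>x. a x $ j) \<in> Li" for j
    proof -
      have "AE x in lebesgue_on \<Omega>. norm (a x $ j) \<le> ni a"
        using Linf_AE[OF a(2)] by eventually_elim (use component_le_norm_cart order_trans in fastforce)
      moreover have "(\<lambda>x. a x $ j) \<in> borel_measurable (lebesgue_on \<Omega>)"
        using component_L2[OF Li_imp_L2[OF a(2)]] by (rule Lp_space_2_measurable)
      ultimately show ?thesis by (auto simp: Linf_iff)
    qed
    have A: "(\<lambda>x. a x $ j *\<^sub>R D j e x) \<in> L2" for j using L2_scaleR_Li[OF ac H1_D(2)[OF e1]] by blast
    have B: "(\<lambda>x. a x $ j *\<^sub>R D j w x) \<in> L2" for j using L2_scaleR_Li[OF ac H1_D(2)[OF w]] by blast
    have "ip (\<lambda>x. a x $ j) (g j) = ip (\<lambda>x. a x $ j *\<^sub>R D j e x) w + ip (\<lambda>x. a x $ j *\<^sub>R D j w x) e" for j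
      using L2_inner_integrable[OF A[of j] w2] L2_inner_integrable[OF B[of j] H1_L2[OF e1]]
      by (simp add: L2_inner_def g_def algebra_simps)
    then show ?thesis
      using A B w2 H1_L2[OF e1]
      by (simp add: grad_mult_vector L2_inner_sum_left sum.distrib)
  qed
  moreover have "ip (divg \<Omega> a) s = ip (\<lambda>x. divg \<Omega> a x *\<^sub>R e x) w"
    by (simp add: L2_inner_def s_def inner_commute)
  ultimately show ?thesis by simp
qed

end

subsection \<open>Piecewise polynomials on meshes\<close>

lemma smooth_polynomial:
  assumes "polynomial_fun r w" shows "smooth w"
proof -
  obtain c where "\<And>x. w x = (\<Sum>\<alpha> | mi_order \<alpha> \<le> r. (\<Prod>i\<in>UNIV. (x $ i) ^ \<alpha> i) *\<^sub>R c \<alpha>)"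
    using assms by (auto simp: polynomial_fun_def)
  then have "w = (\<lambda>x. \<Sum>\<alpha> | mi_order \<alpha> \<le> r. (\<Prod>i\<in>UNIV. (x $ i) ^ \<alpha> i) *\<^sub>R c \<alpha>)" by auto
  then show ?thesis
    by (auto intro!: smooth_sum smooth_scaleR smooth_prod smooth_power smooth_component smooth_const)
qed

text \<open>Cells are convex, so their boundaries are null, and together they cover the closure of
  the domain.\<close>

lemma mesh_partition_AE:
  fixes \<Omega> :: "'a::euclidean_space set"
  assumes "mesh_partition \<Omega> \<T>"
  shows "AE x in lebesgue. x \<in> \<Omega> \<longrightarrow> (\<exists>K\<in>\<T>. x \<in> interior K)"
proof -
  have fin: "finite \<T>" and U: "\<Union>\<T> = closure \<Omega>" and p: "\<And>K. K \<in> \<T> \<Longrightarrow> polytope K"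
    using assms by (auto simp: mesh_partition_def)
  have "negligible (\<Union>K\<in>\<T>. frontier K)"
    using fin p by (intro negligible_Union) (auto intro: negligible_convex_frontier polytope_imp_convex)
  then have "AE x in lebesgue. x \<notin> (\<Union>K\<in>\<T>. frontier K)"
    by (intro AE_not_in) (simp add: negligible_iff_null_sets)
  then show ?thesis
  proof eventually_elim
    case (elim x)
    show ?case
    proof
      assume "x \<in> \<Omega>"
      then obtain K where K: "K \<in> \<T>" "x \<in> K" using U closure_subset by blast
      then have "x \<notin> frontier K" using elim by blast
      then have "x \<in> interior K" using K(2) closure_subset by (auto simp: frontier_def)
      then show "\<exists>K\<in>\<T>. x \<in> interior K" using K(1) by blast
    qed
  qed
qed

text \<open>The cells cover the closure of \<Omega>, so the interior of a cell is known to lie in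
  \<Omega> only up to the frontier. As a finite union of polytopes of lower dimension, the frontier
  is null.\<close>

lemma negligible_polyhedral_frontier:
  fixes \<Omega> :: "'a::euclidean_space set"
  assumes "polyhedral_boundary \<Omega>" shows "negligible (frontier \<Omega>)"
proof -
  obtain F where F: "finite F" "frontier \<Omega> = \<Union>F" "\<And>P. P \<in> F \<Longrightarrow> polytope P \<and> aff_dim P = int DIM('a) - 1"
    using assms unfolding polyhedral_boundary_def by blast
  have "negligible P" if "P \<in> F" for P
  proof -
    have "convex P" "interior P = {}"
      using F(3)[OF that] by (auto simp: polytope_imp_convex intro!: low_dim_interior)
    then show ?thesis by (simp add: negligible_convex_interior)
  qed
  then show ?thesis using F by (simp add: negligible_Union)
qed

context bounded_open_set
begin

text \<open>Uniqueness of weak derivatives on the smaller open set, where \<open>v\<close> and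
  \<open>w\<close> cannot be told apart by test functions.\<close>

lemma weak_deriv_eq_on_open:
  fixes v w :: "real^'d \<Rightarrow> 'b::euclidean_space"
  assumes v: "v \<in> H1" and U: "open U" "U \<subseteq> \<Omega>" and w: "smooth w" and eq: "\<And>x. x \<in> U \<Longrightarrow> v x = w x"
  shows "AE x in lebesgue_on U. D j v x = partial_deriv j w x"
proof (rule weak_deriv_unique[OF U(1)])
  show 1: "weak_deriv U (unit_mi j) v (D j v)"
    by (rule weak_deriv_subset[OF open_\<Omega> U H1_D(1)[OF v]])
  have 2: "weak_deriv U (unit_mi j) w (partial_deriv j w)" by (rule smooth_weak_deriv[OF U(1) w])
  have "(LINT x|lebesgue_on U. partial_deriv j \<phi> x *\<^sub>R v x) = (LINT x|lebesgue_on U. partial_deriv j \<phi> x *\<^sub>R w x)"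
    for \<phi> :: "real^'d \<Rightarrow> real" by (intro Bochner_Integration.integral_cong) (auto simp: eq)
  then show "weak_deriv U (unit_mi j) v (partial_deriv j w)"
    using 1 2 by (simp add: weak_deriv_unit_iff)
qed

text \<open>On a cell the function is a polynomial, bounded because the cell is compact, and by
  uniqueness on the open cell the weak derivative is the classical one. Finitely many cells give one
  bound. This supplies the Lipschitz regularity that the trilinear form asks of discrete
  velocities.\<close>

lemma piecewise_polynomial_Li:
  fixes v :: "real^'d \<Rightarrow> 'b::euclidean_space"
  assumes v: "v \<in> H1" and mesh: "mesh_partition \<Omega> \<T>" and pp: "piecewise_polynomial \<T> r v"
  shows "v \<in> Li" "D j v \<in> Li"
proof -
  have fin: "finite \<T>" and K: "\<And>K. K \<in> \<T> \<Longrightarrow> compact K"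
    using mesh polytope_imp_compact by (auto simp: mesh_partition_def)
  obtain w where w: "\<And>K. K \<in> \<T> \<Longrightarrow> smooth (w K)" "\<And>K x. K \<in> \<T> \<Longrightarrow> x \<in> interior K \<Longrightarrow> v x = w K x"
    using pp smooth_polynomial unfolding piecewise_polynomial_def by metis
  have bd: "\<exists>B. \<forall>x\<in>K. norm (f x) \<le> B" if "smooth f" "K \<in> \<T>" for f :: "real^'d \<Rightarrow> 'b" and K
    using compact_imp_bounded[OF compact_continuous_image[OF smooth_continuous_on[OF that(1)] K[OF that(2)]]]
    by (auto simp: bounded_iff)
  have cover: "AE x in lebesgue_on \<Omega>. \<exists>K\<in>\<T>. x \<in> interior K"
    using mesh_partition_AE[OF mesh] lebesgue_\<Omega> by (simp add: AE_restrict_space_iff)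
  have "\<forall>K\<in>\<T>. \<exists>B. \<forall>x\<in>K. norm (w K x) \<le> B" using bd[OF w(1)] by blast
  then obtain B where B: "\<And>K x. K \<in> \<T> \<Longrightarrow> x \<in> K \<Longrightarrow> norm (w K x) \<le> B K" using bchoice by metis
  have "\<forall>K\<in>\<T>. \<exists>B. \<forall>x\<in>K. norm (partial_deriv j (w K) x) \<le> B" using bd[OF smooth_partial[OF w(1)]] by blast
  then obtain B' where B': "\<And>K x. K \<in> \<T> \<Longrightarrow> x \<in> K \<Longrightarrow> norm (partial_deriv j (w K) x) \<le> B' K"
    using bchoice by metis
  have le: "b K \<le> (\<Sum>K\<in>\<T>. \<bar>b K\<bar>)" if "K \<in> \<T>" for b :: "(real^'d) set \<Rightarrow> real" and K
    using member_le_sum[OF that, of "\<lambda>K. \<bar>b K\<bar>"] fin by auto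
  have "AE x in lebesgue_on \<Omega>. norm (v x) \<le> (\<Sum>K\<in>\<T>. \<bar>B K\<bar>)"
    using cover
  proof eventually_elim
    case (elim x)
    then obtain K where "K \<in> \<T>" "x \<in> interior K" by blast
    then show ?case using w(2) B[of K x] le[of K B] interior_subset by fastforce
  qed
  then show "v \<in> Li" using H1_L2[OF v] by (auto simp: Linf_iff Lp_space_2_iff)
  have "AE x in lebesgue. \<forall>K\<in>\<T>. x \<in> interior K \<inter> \<Omega> \<longrightarrow> D j v x = partial_deriv j (w K) x"
  proof (subst AE_ball_countable[OF countable_finite[OF fin]], rule ballI)
    fix K assume "K \<in> \<T>"
    then have "AE x in lebesgue_on (interior K \<inter> \<Omega>). D j v x = partial_deriv j (w K) x"
      using w by (intro weak_deriv_eq_on_open[OF v]) (auto simp: open_\<Omega>)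
    then show "AE x in lebesgue. x \<in> interior K \<inter> \<Omega> \<longrightarrow> D j v x = partial_deriv j (w K) x"
      using open_lebesgue[of "interior K \<inter> \<Omega>"] open_\<Omega> by (subst (asm) AE_restrict_space_iff) auto
  qed
  then have "AE x in lebesgue_on \<Omega>. \<forall>K\<in>\<T>. x \<in> interior K \<inter> \<Omega> \<longrightarrow> D j v x = partial_deriv j (w K) x"
    by (rule AE_lebesgue_on_subset[OF _ lebesgue_\<Omega>])
  then have "AE x in lebesgue_on \<Omega>. norm (D j v x) \<le> (\<Sum>K\<in>\<T>. \<bar>B' K\<bar>)"
    using cover AE_space
  proof eventually_elim
    case (elim x)
    then obtain K where KT: "K \<in> \<T>" "x \<in> interior K" by blast
    then have "D j v x = partial_deriv j (w K) x" using elim by auto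
    moreover have "x \<in> K" using KT interior_subset by blast
    ultimately show ?case using B'[OF KT(1), of x] le[OF KT(1), of B'] by simp
  qed
  then show "D j v \<in> Li" using H1_D(2)[OF v, of j] by (auto simp: Linf_iff Lp_space_2_iff)
qed

text \<open>The bound on the pressure projection is phrased with cellwise norms. Those of order 0
  dominate the global L2 norm because the open cells cover \<Omega> up to a null set.\<close>

lemma n2_le_broken_norm:
  fixes q :: "real^'d \<Rightarrow> 'b::euclidean_space"
  assumes q: "q \<in> L2" and mesh: "mesh_partition \<Omega> \<T>" and fr: "negligible (frontier \<Omega>)"
  shows "n2 q \<le> broken_H_norm \<T> 0 q"
proof -
  have fin: "finite \<T>" and U: "\<Union>\<T> = closure \<Omega>" and K: "\<And>K. K \<in> \<T> \<Longrightarrow> compact K"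
    using mesh polytope_imp_compact by (auto simp: mesh_partition_def)
  \<comment> \<open>Extension by zero turns the integrals over \<Omega> and over the cells into
    integrals over the whole space. On the cells it agrees with \<open>q\<close> almost everywhere
    since the frontier of \<Omega> is null.\<close>
  define q0 where "q0 x = (if x \<in> \<Omega> then q x else 0)" for x
  have q0m: "q0 \<in> borel_measurable lebesgue"
    unfolding q0_def using q by (intro borel_measurable_if_I lebesgue_\<Omega>) (simp add: Lp_space_2_iff)
  have "integrable lebesgue (\<lambda>x. if x \<in> \<Omega> then (norm (q x))\<^sup>2 else 0)"
    using q by (subst Lebesgue_Measure.integrable_restrict_UNIV[OF lebesgue_\<Omega>]) (simp add: Lp_space_2_iff)
  moreover have "(\<lambda>x. if x \<in> \<Omega> then (norm (q x))\<^sup>2 else 0) = (\<lambda>x. (norm (q0 x))\<^sup>2)" by (auto simp: q0_def)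
  ultimately have q0i: "integrable lebesgue (\<lambda>x. (norm (q0 x))\<^sup>2)" by simp
  have oi: "interior K \<in> sets lebesgue" for K :: "(real^'d) set" by (simp add: open_lebesgue)
  have ae: "AE x in lebesgue_on (interior K). q0 x = q x" if "K \<in> \<T>" for K
  proof -
    have "AE x in lebesgue. x \<notin> frontier \<Omega>" using fr by (intro AE_not_in) (simp add: negligible_iff_null_sets)
    then have "AE x in lebesgue. x \<in> interior K \<longrightarrow> q0 x = q x"
    proof eventually_elim
      case (elim x)
      have "x \<in> interior K \<Longrightarrow> x \<in> closure \<Omega>" using that U interior_subset by blast
      then show ?case using elim open_\<Omega> by (auto simp: q0_def frontier_def interior_open)
    qed
    then show ?thesis using oi by (simp add: AE_restrict_space_iff)
  qed
  have q0K: "q0 \<in> Lp_space 2 (interior K)" for K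
    using measurable_restrict_space1[OF q0m] integrable_mult_indicator[OF oi q0i] oi
    by (auto simp: Lp_space_2_iff integrable_restrict_space)
  have H0: "(H_norm 0 (interior K) q)\<^sup>2 = (LINT x|lebesgue. indicat_real (interior K) x *\<^sub>R (norm (q0 x))\<^sup>2)" if KT: "K \<in> \<T>" for K
  proof -
    interpret K: bounded_open_set "interior K"
      by standard (use K[OF KT] compact_imp_bounded bounded_subset interior_subset in auto)
    have qK: "q \<in> Lp_space 2 (interior K)" "L2_norm_on (interior K) q = L2_norm_on (interior K) q0"
      using L2_cong_AE[OF oi q0K ae[OF KT]] by auto
    have wd: "weak_deriv (interior K) (\<lambda>i. 0) q q" by (rule weak_deriv_zero_order[OF K.L2_loc[OF qK(1)]])
    have "AE x in lebesgue_on (interior K). q x = wD (interior K) (\<lambda>i. 0) q x" using K.wD_0[OF wd] by eventually_elim simp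
    from K.L2_cong(2)[OF qK(1) this]
    have "L2_norm_on (interior K) (wD (interior K) (\<lambda>i. 0) q) = L2_norm_on (interior K) q0" using qK by simp
    moreover have "{\<alpha> :: 'd \<Rightarrow> nat. mi_order \<alpha> \<le> 0} = {\<lambda>i. 0}" by (auto simp: fun_eq_iff)
    ultimately have "(H_norm 0 (interior K) q)\<^sup>2 = (L2_norm_on (interior K) q0)\<^sup>2" by (simp only: H_norm_sq sum.insert sum.empty) simp
    then show ?thesis using oi by (simp add: L2_norm_sq integral_restrict_space)
  qed
  have ii: "integrable lebesgue (\<lambda>x. indicat_real (interior K) x *\<^sub>R (norm (q0 x))\<^sup>2)" for K :: "(real^'d) set"
    by (rule integrable_mult_indicator[OF oi q0i])
  have cov: "AE x in lebesgue. (norm (q0 x))\<^sup>2 \<le> (\<Sum>K\<in>\<T>. indicat_real (interior K) x *\<^sub>R (norm (q0 x))\<^sup>2)"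
    using mesh_partition_AE[OF mesh]
  proof eventually_elim
    case (elim x)
    show ?case
    proof (cases "x \<in> \<Omega>")
      case True
      then obtain K where KT: "K \<in> \<T>" "x \<in> interior K" using elim by blast
      have "indicat_real (interior K) x *\<^sub>R (norm (q0 x))\<^sup>2 \<le> (\<Sum>K\<in>\<T>. indicat_real (interior K) x *\<^sub>R (norm (q0 x))\<^sup>2)"
        using KT fin by (intro member_le_sum) (auto simp: indicator_def)
      then show ?thesis using KT by simp
    qed (simp add: q0_def)
  qed
  have "(n2 q)\<^sup>2 = (LINT x|lebesgue. (norm (q0 x))\<^sup>2)"
    using lebesgue_\<Omega> by (simp add: L2_norm_sq integral_restrict_space q0_def)
      (intro Bochner_Integration.integral_cong, auto simp: indicator_def)
  also have "\<dots> \<le> (LINT x|lebesgue. (\<Sum>K\<in>\<T>. indicat_real (interior K) x *\<^sub>R (norm (q0 x))\<^sup>2))"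
    using q0i ii cov by (intro integral_mono_AE Bochner_Integration.integrable_sum) auto
  also have "\<dots> = (\<Sum>K\<in>\<T>. (H_norm 0 (interior K) q)\<^sup>2)"
    using ii by (subst Bochner_Integration.integral_sum) (auto simp: H0)
  finally show ?thesis by (simp add: broken_H_norm_def real_le_rsqrt)
qed

subsection \<open>Lower semicontinuity of Sobolev norms\<close>

lemma dense_approx:
  fixes g :: "real^'d \<Rightarrow> 'b::euclidean_space"
  assumes "g \<in> L2" "e > 0"
  obtains \<phi> where "\<phi> \<in> test_functions \<Omega>" "n2 (\<lambda>x. g x - \<phi> x) < e"
  using test_functions_dense_L2[OF open_\<Omega> bounded_\<Omega> assms(1)] assms(2) unfolding L2_test_closure_def by blast

text \<open>The pairing of \<open>g\<close> with itself is enough. Taylor remainders can thus be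
  estimated through scalar functions of time, with the test element frozen to be the
  remainder.\<close>

lemma n2_le_by_duality:
  fixes g :: "real^'d \<Rightarrow> 'b::euclidean_space"
  assumes "g \<in> L2" "M \<ge> 0" "\<bar>ip g g\<bar> \<le> M * n2 g" shows "n2 g \<le> M"
proof (cases "n2 g = 0")
  case False
  then have "n2 g > 0" using L2_norm_nonneg[of \<Omega> g] by linarith
  moreover have "n2 g * n2 g \<le> M * n2 g" using assms(3) L2_norm_sq_inner[of \<Omega> g] by (simp add: power2_eq_square)
  ultimately show ?thesis by simp
qed (use assms in simp)

text \<open>Test functions are dense in L2, so the inequality extends from them to \<open>g\<close>
  itself. The tolerance \<open>d\<close> is small enough to absorb the error in both the pairing and
  the norm.\<close>

lemma n2_le_by_tests:
  fixes g :: "real^'d \<Rightarrow> 'b::euclidean_space"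
  assumes g: "g \<in> L2" and M: "M \<ge> 0" and b: "\<And>\<phi>. \<phi> \<in> test_functions \<Omega> \<Longrightarrow> \<bar>ip \<phi> g\<bar> \<le> M * n2 \<phi>"
  shows "n2 g \<le> M"
proof (rule n2_le_by_duality[OF g M])
  show "\<bar>ip g g\<bar> \<le> M * n2 g"
  proof (rule field_le_epsilon)
    fix \<epsilon> :: real assume "\<epsilon> > 0"
    define d where "d = \<epsilon> / (n2 g + M + 1)"
    have pos: "n2 g + M + 1 > 0" using M L2_norm_nonneg[of \<Omega> g] by linarith
    then have d: "d > 0" using \<open>\<epsilon> > 0\<close> by (simp add: d_def)
    obtain \<phi> where \<phi>: "\<phi> \<in> test_functions \<Omega>" "n2 (\<lambda>x. g x - \<phi> x) < d" using dense_approx[OF g d] by blast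
    have p: "\<phi> \<in> L2" by (rule test_L2[OF \<phi>(1)])
    have "ip g g = ip (\<lambda>x. g x - \<phi> x) g + ip \<phi> g" using g p by (simp add: L2_inner_diff_left)
    moreover have "\<bar>ip (\<lambda>x. g x - \<phi> x) g\<bar> \<le> d * n2 g"
      using L2_Cauchy_Schwarz[OF L2_diff[OF g p] g] mult_right_mono[of "n2 (\<lambda>x. g x - \<phi> x)" d "n2 g"] \<phi>(2) by simp
    moreover have "\<bar>ip \<phi> g\<bar> \<le> M * (n2 g + d)"
    proof -
      have "n2 (\<lambda>x. g x - (g x - \<phi> x)) \<le> n2 g + n2 (\<lambda>x. g x - \<phi> x)" by (rule L2_norm_triangle_diff[OF g L2_diff[OF g p]])
      then have "n2 \<phi> \<le> n2 g + d" using \<phi>(2) by simp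
      then show ?thesis using b[OF \<phi>(1)] mult_left_mono[OF _ M] by (meson order_trans)
    qed
    ultimately have "\<bar>ip g g\<bar> \<le> M * n2 g + d * (n2 g + M)" by (simp add: algebra_simps)
    also have "d * (n2 g + M) \<le> d * (n2 g + M + 1)" using d by (intro mult_left_mono) auto
    also have "\<dots> = \<epsilon>" using pos by (simp add: d_def)
    finally show "\<bar>ip g g\<bar> \<le> M * n2 g + \<epsilon>" by simp
  qed
qed

definition n1 :: "(real^'d \<Rightarrow> 'b::euclidean_space) \<Rightarrow> real" where
  "n1 f = (LINT x|lebesgue_on \<Omega>. norm (f x))"

lemma L1_le_L2:
  fixes f :: "real^'d \<Rightarrow> 'b::euclidean_space"
  assumes "f \<in> L2" shows "integrable (lebesgue_on \<Omega>) (\<lambda>x. norm (f x))" "n1 f \<le> n2 (\<lambda>x. 1 :: real) * n2 f"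
proof -
  have 1: "(\<lambda>x. 1 :: real) \<in> L2" by (rule L2_bounded[OF lmeasurable_\<Omega>, where B=1]) auto
  show "integrable (lebesgue_on \<Omega>) (\<lambda>x. norm (f x))" using L2_norm_product_integrable[OF 1 assms] by simp
  show "n1 f \<le> n2 (\<lambda>x. 1 :: real) * n2 f" using L2_Cauchy_Schwarz_norm[OF 1 assms] by (simp add: n1_def)
qed

text \<open>The sup norm is detected by pairing with \<open>F\<close>, the part of \<open>g\<close>
  that exceeds M: the pairing is the integral of |g|^2 over that part, the bound is M times the
  integral of |g|, so the part must be null. Approximation in L2 suffices since on a bounded set it
  controls the L1 norm.\<close>

lemma ni_le_by_tests:
  fixes g :: "real^'d \<Rightarrow> 'b::euclidean_space"
  assumes g: "g \<in> L2" and M: "M \<ge> 0" and b: "\<And>\<phi>. \<phi> \<in> test_functions \<Omega> \<Longrightarrow> \<bar>ip \<phi> g\<bar> \<le> M * n1 \<phi>"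
  shows "ni g \<le> M"
proof -
  define F where "F x = indicat_real {y. norm (g y) > M} x *\<^sub>R g x" for x
  have mg: "g \<in> borel_measurable (lebesgue_on \<Omega>)" using g by (rule Lp_space_2_measurable)
  have mF: "F \<in> borel_measurable (lebesgue_on \<Omega>)"
  proof -
    have "{x \<in> space (lebesgue_on \<Omega>). norm (g x) > M} \<in> sets (lebesgue_on \<Omega>)" using mg by measurable
    then have "(\<lambda>x. indicat_real {x \<in> space (lebesgue_on \<Omega>). norm (g x) > M} x *\<^sub>R g x) \<in> borel_measurable (lebesgue_on \<Omega>)"
      using mg by (intro borel_measurable_scaleR borel_measurable_indicator)
    then show ?thesis by (subst measurable_cong[of _ _ "\<lambda>x. indicat_real {x \<in> space (lebesgue_on \<Omega>). norm (g x) > M} x *\<^sub>R g x"]) (auto simp: F_def indicator_def)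
  qed
  have F: "F \<in> L2" using L2_norm_mono(1)[OF g mF, of 1] by (auto simp: F_def indicator_def)
  have "\<bar>ip F g\<bar> \<le> M * n1 F"
  proof (rule field_le_epsilon)
    fix \<epsilon> :: real assume "\<epsilon> > 0"
    let ?c = "n2 (\<lambda>x. 1 :: real)"
    define d where "d = \<epsilon> / (n2 g + M * ?c + 1)"
    have pos: "n2 g + M * ?c + 1 > 0" using M L2_norm_nonneg[of \<Omega> g] mult_nonneg_nonneg[OF M L2_norm_nonneg[of \<Omega> "\<lambda>x. 1 :: real"]] by linarith
    then have d: "d > 0" using \<open>\<epsilon> > 0\<close> by (simp add: d_def)
    obtain \<phi> where \<phi>: "\<phi> \<in> test_functions \<Omega>" "n2 (\<lambda>x. F x - \<phi> x) < d" using dense_approx[OF F d] by blast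
    have p: "\<phi> \<in> L2" by (rule test_L2[OF \<phi>(1)])
    have "ip F g = ip (\<lambda>x. F x - \<phi> x) g + ip \<phi> g" using g p F by (simp add: L2_inner_diff_left)
    moreover have "\<bar>ip (\<lambda>x. F x - \<phi> x) g\<bar> \<le> d * n2 g"
      using L2_Cauchy_Schwarz[OF L2_diff[OF F p] g] mult_right_mono[of "n2 (\<lambda>x. F x - \<phi> x)" d "n2 g"] \<phi>(2) by simp
    moreover have "\<bar>ip \<phi> g\<bar> \<le> M * (n1 F + ?c * d)"
    proof -
      have "n1 \<phi> \<le> (LINT x|lebesgue_on \<Omega>. norm (F x) + norm (F x - \<phi> x))"
        unfolding n1_def
      proof (intro integral_mono Bochner_Integration.integrable_add)
        show "norm (\<phi> x) \<le> norm (F x) + norm (F x - \<phi> x)" for x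
          using norm_triangle_ineq4[of "F x" "F x - \<phi> x"] by simp
      qed (use L1_le_L2(1)[OF F] L1_le_L2(1)[OF p] L1_le_L2(1)[OF L2_diff[OF F p]] in auto)
      also have "\<dots> = n1 F + n1 (\<lambda>x. F x - \<phi> x)"
        unfolding n1_def using L1_le_L2(1)[OF F] L1_le_L2(1)[OF L2_diff[OF F p]] by simp
      also have "n1 (\<lambda>x. F x - \<phi> x) \<le> ?c * n2 (\<lambda>x. F x - \<phi> x)" by (rule L1_le_L2(2)[OF L2_diff[OF F p]])
      also have "\<dots> \<le> ?c * d" using \<phi>(2) by (intro mult_left_mono) auto
      finally have "n1 \<phi> \<le> n1 F + ?c * d" by simp
      then show ?thesis using b[OF \<phi>(1)] mult_left_mono[OF _ M] by (meson order_trans)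
    qed
    ultimately have "\<bar>ip F g\<bar> \<le> M * n1 F + d * (n2 g + M * ?c)" by (simp add: algebra_simps)
    also have "d * (n2 g + M * ?c) \<le> d * (n2 g + M * ?c + 1)" using d by (intro mult_left_mono) auto
    also have "\<dots> = \<epsilon>" using pos by (simp add: d_def)
    finally show "\<bar>ip F g\<bar> \<le> M * n1 F + \<epsilon>" by simp
  qed
  then have "(LINT x|lebesgue_on \<Omega>. F x \<bullet> g x - M * norm (F x)) \<le> 0"
    using L2_inner_integrable[OF F g] L1_le_L2(1)[OF F] by (simp add: L2_inner_def n1_def)
  moreover have nn: "F x \<bullet> g x - M * norm (F x) \<ge> 0" for x
  proof (cases "norm (g x) > M")
    case True
    then have "M * norm (g x) \<le> norm (g x) * norm (g x)" by (intro mult_right_mono) auto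
    then show ?thesis using True by (simp add: F_def dot_square_norm power2_eq_square)
  qed (simp add: F_def)
  moreover have int: "integrable (lebesgue_on \<Omega>) (\<lambda>x. F x \<bullet> g x - M * norm (F x))"
    using L2_inner_integrable[OF F g] L1_le_L2(1)[OF F] by simp
  ultimately have "(LINT x|lebesgue_on \<Omega>. F x \<bullet> g x - M * norm (F x)) = 0"
    by (intro antisym integral_nonneg_AE) auto
  then have "AE x in lebesgue_on \<Omega>. F x \<bullet> g x - M * norm (F x) = 0"
    using nn by (subst (asm) integral_nonneg_eq_0_iff_AE[OF int]) auto
  then have "AE x in lebesgue_on \<Omega>. norm (g x) \<le> M"
  proof eventually_elim
    case (elim x)
    show ?case
    proof (rule ccontr)
      assume *: "\<not> norm (g x) \<le> M"
      then have "norm (g x) * norm (g x) = M * norm (g x)"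
        using elim by (simp add: F_def dot_square_norm power2_eq_square)
      then show False using * M by simp
    qed
  qed
  then show ?thesis using Linf_le(2)[OF mg _ M] by blast
qed

text \<open>Against a fixed test function all derivatives move to the test function, so L2
  convergence of the functions alone gives convergence of the pairings of their derivatives. Lower
  semicontinuity of the norms rests on this weak convergence.\<close>

lemma wD_test_limit:
  fixes u :: "real^'d \<Rightarrow> 'b::euclidean_space"
  assumes lim: "(\<lambda>n. n2 (\<lambda>x. U n x - u x)) \<longlonglongrightarrow> 0"
    and U: "\<And>n. weak_deriv \<Omega> \<alpha> (U n) (wD \<Omega> \<alpha> (U n))" "\<And>n. U n \<in> L2"
    and u: "weak_deriv \<Omega> \<alpha> u (wD \<Omega> \<alpha> u)" "u \<in> L2"
    and \<phi>: "\<phi> \<in> test_functions \<Omega>"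
  shows "(\<lambda>n. ip \<phi> (wD \<Omega> \<alpha> (U n))) \<longlonglongrightarrow> ip \<phi> (wD \<Omega> \<alpha> u)"
proof -
  obtain js where js: "\<forall>i. count_list js i = \<alpha> i" using ex_list_count by blast
  let ?\<psi> = "iter_partial js \<phi>"
  have \<psi>: "?\<psi> \<in> L2" by (rule test_L2[OF iter_partial_test[OF \<phi>]])
  have "(\<lambda>n. ip ?\<psi> (U n) - ip ?\<psi> u) \<longlonglongrightarrow> 0"
  proof (rule Lim_null_comparison)
    show "\<forall>\<^sub>F n in sequentially. norm (ip ?\<psi> (U n) - ip ?\<psi> u) \<le> n2 ?\<psi> * n2 (\<lambda>x. U n x - u x)"
      using L2_Cauchy_Schwarz[OF \<psi> L2_diff[OF U(2) u(2)]] by (simp add: L2_inner_diff_right[OF U(2) u(2) \<psi>])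
    show "(\<lambda>n. n2 ?\<psi> * n2 (\<lambda>x. U n x - u x)) \<longlonglongrightarrow> 0" using tendsto_mult_left[OF lim] by simp
  qed
  then have "(\<lambda>n. (-1) ^ mi_order \<alpha> * ip ?\<psi> (U n)) \<longlonglongrightarrow> (-1) ^ mi_order \<alpha> * ip ?\<psi> u"
    by (intro tendsto_mult_left) (rule LIM_zero_cancel)
  then show ?thesis
    by (simp add: weak_deriv_test_inner[OF U(1) \<phi> js] weak_deriv_test_inner[OF u(1) \<phi> js])
qed

lemma lsc_L2:
  fixes u :: "real^'d \<Rightarrow> 'b::euclidean_space"
  assumes lim: "(\<lambda>n. n2 (\<lambda>x. U n x - u x)) \<longlonglongrightarrow> 0"
    and U: "\<And>n. U n \<in> H_space m \<Omega>" and u: "u \<in> H_space m \<Omega>" and \<alpha>: "mi_order \<alpha> \<le> m"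
    and M: "\<And>n. n2 (wD \<Omega> \<alpha> (U n)) \<le> M"
  shows "n2 (wD \<Omega> \<alpha> u) \<le> M"
proof (rule n2_le_by_tests[OF H_wD(2)[OF u \<alpha>]])
  show "M \<ge> 0" using M[of 0] L2_norm_nonneg order_trans by blast
  fix \<phi> :: "real^'d \<Rightarrow> 'b" assume \<phi>: "\<phi> \<in> test_functions \<Omega>"
  have "(\<lambda>n. \<bar>ip \<phi> (wD \<Omega> \<alpha> (U n))\<bar>) \<longlonglongrightarrow> \<bar>ip \<phi> (wD \<Omega> \<alpha> u)\<bar>"
    by (intro tendsto_rabs wD_test_limit[OF lim H_wD(1)[OF U \<alpha>] H_L2[OF U] H_wD(1)[OF u \<alpha>] H_L2[OF u] \<phi>])
  moreover have "\<bar>ip \<phi> (wD \<Omega> \<alpha> (U n))\<bar> \<le> M * n2 \<phi>" for n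
    using L2_Cauchy_Schwarz[OF test_L2[OF \<phi>] H_wD(2)[OF U \<alpha>], of n] mult_left_mono[OF M[of n], of "n2 \<phi>"]
    by (simp add: mult.commute)
  ultimately show "\<bar>ip \<phi> (wD \<Omega> \<alpha> u)\<bar> \<le> M * n2 \<phi>" by (intro LIMSEQ_le_const2) auto
qed

lemma lsc_Li:
  fixes u :: "real^'d \<Rightarrow> 'b::euclidean_space"
  assumes lim: "(\<lambda>n. n2 (\<lambda>x. U n x - u x)) \<longlonglongrightarrow> 0"
    and U: "\<And>n. U n \<in> sobolev_space m \<infinity> \<Omega>" and u: "u \<in> sobolev_space m \<infinity> \<Omega>" and \<alpha>: "mi_order \<alpha> \<le> m"
    and M: "\<And>n. ni (wD \<Omega> \<alpha> (U n)) \<le> M"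
  shows "ni (wD \<Omega> \<alpha> u) \<le> M"
proof (rule ni_le_by_tests[OF Li_imp_L2[OF W_wD(2)[OF u \<alpha>]]])
  show "M \<ge> 0" using M[of 0] Linf_norm_nonneg order_trans by blast
  fix \<phi> :: "real^'d \<Rightarrow> 'b" assume \<phi>: "\<phi> \<in> test_functions \<Omega>"
  have "(\<lambda>n. \<bar>ip \<phi> (wD \<Omega> \<alpha> (U n))\<bar>) \<longlonglongrightarrow> \<bar>ip \<phi> (wD \<Omega> \<alpha> u)\<bar>"
    by (intro tendsto_rabs wD_test_limit[OF lim W_wD(1)[OF U \<alpha>] Li_imp_L2[OF W_Li[OF U]]
          W_wD(1)[OF u \<alpha>] Li_imp_L2[OF W_Li[OF u]] \<phi>])
  moreover have "\<bar>ip \<phi> (wD \<Omega> \<alpha> (U n))\<bar> \<le> M * n1 \<phi>" for n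
  proof -
    have w: "wD \<Omega> \<alpha> (U n) \<in> Li" by (rule W_wD(2)[OF U \<alpha>])
    have "\<bar>ip \<phi> (wD \<Omega> \<alpha> (U n))\<bar> \<le> (LINT x|lebesgue_on \<Omega>. \<bar>\<phi> x \<bullet> wD \<Omega> \<alpha> (U n) x\<bar>)"
      unfolding L2_inner_def by (rule integral_abs_bound)
    also have "\<dots> \<le> (LINT x|lebesgue_on \<Omega>. M * norm (\<phi> x))"
    proof (rule integral_mono_AE)
      show "integrable (lebesgue_on \<Omega>) (\<lambda>x. \<bar>\<phi> x \<bullet> wD \<Omega> \<alpha> (U n) x\<bar>)"
        by (intro integrable_abs L2_inner_integrable test_L2[OF \<phi>] Li_imp_L2[OF w])
      show "integrable (lebesgue_on \<Omega>) (\<lambda>x. M * norm (\<phi> x))" using L1_le_L2(1)[OF test_L2[OF \<phi>]] by simp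
      show "AE x in lebesgue_on \<Omega>. \<bar>\<phi> x \<bullet> wD \<Omega> \<alpha> (U n) x\<bar> \<le> M * norm (\<phi> x)"
        using Linf_AE[OF w]
      proof eventually_elim
        case (elim x)
        have "\<bar>\<phi> x \<bullet> wD \<Omega> \<alpha> (U n) x\<bar> \<le> norm (\<phi> x) * norm (wD \<Omega> \<alpha> (U n) x)" by (rule Cauchy_Schwarz_ineq2)
        also have "\<dots> \<le> norm (\<phi> x) * M" using elim M[of n] by (intro mult_left_mono) auto
        finally show ?case by (simp add: mult.commute)
      qed
    qed
    finally show ?thesis by (simp add: n1_def)
  qed
  ultimately show "\<bar>ip \<phi> (wD \<Omega> \<alpha> u)\<bar> \<le> M * n1 \<phi>" by (intro LIMSEQ_le_const2) auto
qed

end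

text \<open>A set of full measure meets every neighbourhood of t within (0, T), because nonempty
  open sets are not null. The end points 0 and T are included since they lie in the closure.\<close>

lemma AE_interval_sequence:
  assumes ae: "AE t in lebesgue_on {0<..<T::real}. P t" and T: "T > 0" and t: "t \<in> {0..T}"
  obtains s where "\<And>n::nat. s n \<in> {0<..<T}" "\<And>n. P (s n)" "s \<longlonglongrightarrow> t"
proof -
  have "\<exists>r. r \<in> {0<..<T} \<and> P r \<and> dist r t < 1 / real (Suc n)" for n
  proof (rule ccontr)
    assume no: "\<not> ?thesis"
    let ?U = "{0<..<T} \<inter> ball t (1 / real (Suc n))"
    have "open ?U" by auto
    moreover have "?U \<noteq> {}"
    proof -
      have "t \<in> closure {0<..<T}" using T t by simp
      then have "\<exists>y\<in>{0<..<T}. dist y t < 1 / real (Suc n)" unfolding closure_approachable by simp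
      then show ?thesis by (auto simp: dist_commute)
    qed
    ultimately have "\<not> negligible ?U" by (rule open_not_negligible)
    moreover have "AE r in lebesgue. r \<notin> ?U"
    proof -
      have "AE r in lebesgue. r \<in> {0<..<T} \<longrightarrow> P r" using ae by (subst (asm) AE_restrict_space_iff) auto
      then show ?thesis by eventually_elim (use no in \<open>auto simp: dist_commute\<close>)
    qed
    then have "?U \<in> null_sets lebesgue" by (subst (asm) AE_iff_null_sets[symmetric]) auto
    ultimately show False by (simp add: negligible_iff_null_sets)
  qed
  then obtain s where s: "\<And>n. s n \<in> {0<..<T} \<and> P (s n) \<and> dist (s n) t < 1 / real (Suc n)" by metis
  have "s \<longlonglongrightarrow> t"
  proof (rule metric_LIMSEQ_I)
    fix r :: real assume "r > 0"
    then obtain no where no: "1 / real (Suc no) < r" using nat_approx_posE by blast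
    have "dist (s n) t < r" if "n \<ge> no" for n
    proof -
      have "1 / real (Suc n) \<le> 1 / real (Suc no)" using that by (intro divide_left_mono) auto
      then show ?thesis using s[of n] no by linarith
    qed
    then show "\<exists>no. \<forall>n\<ge>no. dist (s n) t < r" by blast
  qed
  with s that show ?thesis by blast
qed

subsection \<open>Integrals over time intervals\<close>

lemma AE_subinterval:
  assumes ae: "AE r in lebesgue_on {0<..<T::real}. P r" and "0 \<le> s" "t \<le> T"
  shows "AE r in lebesgue_on {s..t}. P r"
proof -
  have "AE r in lebesgue. r \<in> {0<..<T} \<longrightarrow> P r" using ae by (subst (asm) AE_restrict_space_iff) auto
  moreover have "AE r in lebesgue. r \<notin> {0, T}"
    by (intro AE_not_in) (simp add: negligible_iff_null_sets[symmetric])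
  ultimately have "AE r in lebesgue. r \<in> {s..t} \<longrightarrow> P r"
    by eventually_elim (use assms in auto)
  then show ?thesis by (subst AE_restrict_space_iff) auto
qed

text \<open>Norms in time live on the open interval (0, T), increments on closed intervals that may
  touch 0 or T. The two end points are null, so integrals can be moved between the two
  settings.\<close>

lemma subinterval_integral:
  fixes g :: "real \<Rightarrow> 'b::euclidean_space"
  assumes g: "integrable (lebesgue_on {0<..<T}) g" and st: "0 \<le> s" "t \<le> T"
  shows "integrable (lebesgue_on {s..t}) g"
    "(LINT r|lebesgue_on {s..t}. g r) = (LINT r|lebesgue_on {0<..<T}. indicat_real {s..t} r *\<^sub>R g r)"
    "integrable (lebesgue_on {0<..<T}) (\<lambda>r. indicat_real {s..t} r *\<^sub>R g r)"
proof -
  let ?h1 = "\<lambda>r. indicat_real {s..t} r *\<^sub>R (indicat_real {0<..<T} r *\<^sub>R g r)"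
  let ?h2 = "\<lambda>r. indicat_real {s..t} r *\<^sub>R g r"
  have "integrable lebesgue (\<lambda>r. indicat_real {0<..<T} r *\<^sub>R g r)"
    using g by (simp add: integrable_restrict_space)
  then have h1: "integrable lebesgue ?h1" by (rule integrable_mult_indicator[rotated]) auto
  have "AE r in lebesgue. r \<notin> {0, T}"
    by (intro AE_not_in) (simp add: negligible_iff_null_sets[symmetric])
  then have ae: "AE r in lebesgue. ?h1 r = ?h2 r"
    by eventually_elim (use st in \<open>auto simp: indicator_def\<close>)
  have m: "?h2 \<in> borel_measurable lebesgue"
    by (rule borel_measurable_AE[OF borel_measurable_integrable[OF h1] ae])
  have h2: "integrable lebesgue ?h2"
    using integrable_cong_AE[OF borel_measurable_integrable[OF h1] m ae] h1 by simp
  then show "integrable (lebesgue_on {s..t}) g" by (simp add: integrable_restrict_space)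
  have eq: "indicat_real {0<..<T} r *\<^sub>R (indicat_real {s..t} r *\<^sub>R g r) = ?h1 r" for r
    by (simp add: mult.commute)
  show "(LINT r|lebesgue_on {s..t}. g r) = (LINT r|lebesgue_on {0<..<T}. indicat_real {s..t} r *\<^sub>R g r)"
    using integral_cong_AE[OF borel_measurable_integrable[OF h1] m ae]
    by (simp add: integral_restrict_space mult.commute)
  show "integrable (lebesgue_on {0<..<T}) (\<lambda>r. indicat_real {s..t} r *\<^sub>R g r)"
    using h1 by (simp add: integrable_restrict_space mult.commute)
qed

lemma subinterval_integral_add:
  fixes g :: "real \<Rightarrow> 'b::euclidean_space"
  assumes g: "integrable (lebesgue_on {0<..<T}) g" and "0 \<le> s" "s \<le> t" "t \<le> v" "v \<le> T"
  shows "(LINT r|lebesgue_on {s..v}. g r) = (LINT r|lebesgue_on {s..t}. g r) + (LINT r|lebesgue_on {t..v}. g r)"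
proof -
  have i: "integrable (lebesgue_on {0<..<T}) (\<lambda>r. indicat_real {s..t} r *\<^sub>R g r)"
    "integrable (lebesgue_on {0<..<T}) (\<lambda>r. indicat_real {t..v} r *\<^sub>R g r)"
    "integrable (lebesgue_on {0<..<T}) (\<lambda>r. indicat_real {s..v} r *\<^sub>R g r)"
    using subinterval_integral(3)[OF g] assms by auto
  have "AE r in lebesgue. r \<notin> {t}" by (intro AE_not_in) (simp add: negligible_iff_null_sets[symmetric])
  then have "AE r in lebesgue_on {0<..<T}. r \<notin> {t}" by (rule AE_lebesgue_on_subset) auto
  then have ae: "AE r in lebesgue_on {0<..<T}. indicat_real {s..v} r *\<^sub>R g r
      = indicat_real {s..t} r *\<^sub>R g r + indicat_real {t..v} r *\<^sub>R g r"
    by eventually_elim (use assms in \<open>auto simp: indicator_def\<close>)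
  have "(LINT r|lebesgue_on {0<..<T}. indicat_real {s..v} r *\<^sub>R g r) =
     (LINT r|lebesgue_on {0<..<T}. indicat_real {s..t} r *\<^sub>R g r + indicat_real {t..v} r *\<^sub>R g r)"
    using i by (intro integral_cong_AE ae) (auto simp del: scaleR_eq_0_iff)
  then show ?thesis using i assms by (simp add: subinterval_integral(2)[OF g])
qed

lemma subinterval_integral_mono:
  fixes f g :: "real \<Rightarrow> real"
  assumes f: "integrable (lebesgue_on {0<..<T}) f" and g: "integrable (lebesgue_on {0<..<T}) g"
    and ae: "AE r in lebesgue_on {0<..<T}. f r \<le> g r" and st: "0 \<le> s" "t \<le> T"
  shows "(LINT r|lebesgue_on {s..t}. f r) \<le> (LINT r|lebesgue_on {s..t}. g r)"
  by (intro integral_mono_AE subinterval_integral(1)[OF f st] subinterval_integral(1)[OF g st] AE_subinterval[OF ae st])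

lemma subinterval_integral_abs_le:
  fixes f g :: "real \<Rightarrow> real"
  assumes f: "integrable (lebesgue_on {0<..<T}) f" and g: "integrable (lebesgue_on {0<..<T}) g"
    and ae: "AE r in lebesgue_on {0<..<T}. \<bar>f r\<bar> \<le> g r" and st: "0 \<le> s" "t \<le> T"
  shows "\<bar>LINT r|lebesgue_on {s..t}. f r\<bar> \<le> (LINT r|lebesgue_on {s..t}. g r)"
proof -
  have "\<bar>LINT r|lebesgue_on {s..t}. f r\<bar> \<le> (LINT r|lebesgue_on {s..t}. \<bar>f r\<bar>)" by (rule integral_abs_bound)
  also have "\<dots> \<le> (LINT r|lebesgue_on {s..t}. g r)"
    using f by (intro subinterval_integral_mono[OF _ g ae st]) auto
  finally show ?thesis .
qed

lemma interval_integral_const: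
  assumes "s \<le> t" shows "(LINT r|lebesgue_on {s..t}. c :: real) = c * (t - s)"
proof -
  have "measure (lebesgue_on {s..t}) {s..t} = t - s"
    using assms by (simp add: measure_restrict_space)
  then show ?thesis by (simp add: mult.commute)
qed

lemma interval_integrable_const: "integrable (lebesgue_on {0<..<T::real}) (\<lambda>r. c :: real)"
  using finite_measure.integrable_const[OF finite_measure_lebesgue_on, of "{0<..<T}"] by auto

lemma interval_integral_linear:
  fixes d b :: real
  assumes "s \<le> t" "t \<le> b"
  shows "integrable (lebesgue_on {s..t}) (\<lambda>r. d * (r - b))"
    "(LINT r|lebesgue_on {s..t}. d * (r - b)) = d * ((t - b)\<^sup>2 - (s - b)\<^sup>2) / 2"
proof -
  have "((\<lambda>r. d * (r - b)) has_integral (d * (t - b)\<^sup>2 / 2 - d * (s - b)\<^sup>2 / 2)) {s..t}"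
    by (intro fundamental_theorem_of_calculus assms(1))
       (auto simp: has_real_derivative_iff_has_vector_derivative[symmetric] intro!: derivative_eq_intros)
  moreover show i: "integrable (lebesgue_on {s..t}) (\<lambda>r. d * (r - b))"
    by (intro continuous_imp_integrable_real continuous_intros)
  ultimately show "(LINT r|lebesgue_on {s..t}. d * (r - b)) = d * ((t - b)\<^sup>2 - (s - b)\<^sup>2) / 2"
  proof -
    assume h: "((\<lambda>r. d * (r - b)) has_integral (d * (t - b)\<^sup>2 / 2 - d * (s - b)\<^sup>2 / 2)) {s..t}"
    have "(LINT r|lebesgue_on {s..t}. d * (r - b)) = integral {s..t} (\<lambda>r. d * (r - b))"
      by (rule lebesgue_integral_eq_integral[OF i]) simp
    then show ?thesis using integral_unique[OF h] by (simp add: algebra_simps diff_divide_distrib)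
  qed
qed

subsection \<open>Taylor expansion for absolutely continuous functions\<close>

text \<open>Absolute continuity of a scalar function in integral form. This is the property that
  survives when an L2-valued function of time is paired with a fixed element.\<close>

definition int_deriv :: "real \<Rightarrow> (real \<Rightarrow> real) \<Rightarrow> (real \<Rightarrow> real) \<Rightarrow> bool" where
  "int_deriv T y y' \<longleftrightarrow> integrable (lebesgue_on {0<..<T}) y' \<and>
     (\<forall>s t. 0 \<le> s \<and> s \<le> t \<and> t \<le> T \<longrightarrow> y t - y s = (LINT r|lebesgue_on {s..t}. y' r))"

lemma int_deriv_bound:
  assumes y: "int_deriv T y y'" and b: "integrable (lebesgue_on {0<..<T}) b"
    and ae: "AE r in lebesgue_on {0<..<T}. \<bar>y' r\<bar> \<le> b r" and st: "0 \<le> s" "s \<le> t" "t \<le> T"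
  shows "\<bar>y t - y s\<bar> \<le> (LINT r|lebesgue_on {s..t}. b r)"
  using y st subinterval_integral_abs_le[OF _ b ae, of s t] by (auto simp: int_deriv_def)

text \<open>Integrates an affine approximation of the derivative, centred at the later time
  \<open>b\<close>. With d = 0 it becomes the constant case; with c and d the first two derivatives
  at \<open>b\<close> it bounds the quadratic Taylor remainder.\<close>

lemma int_deriv_linear_remainder:
  assumes y: "int_deriv T y y'" and st: "0 \<le> s" "s \<le> t" "t \<le> T" "t \<le> b"
    and K: "\<And>r. r \<in> {s..t} \<Longrightarrow> \<bar>y' r - c - d * (r - b)\<bar> \<le> K"
  shows "\<bar>y t - y s - c * (t - s) - d * ((t - b)\<^sup>2 - (s - b)\<^sup>2) / 2\<bar> \<le> K * (t - s)"
proof -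
  have i: "integrable (lebesgue_on {s..t}) y'"
    using y st subinterval_integral(1)[of T y' s t] by (auto simp: int_deriv_def)
  have c: "integrable (lebesgue_on {s..t}) (\<lambda>r. c)" for c :: real
    using finite_measure.integrable_const[OF finite_measure_lebesgue_on, of "{s..t}"] by auto
  note l = interval_integral_linear[OF st(2,4), of d]
  have "y t - y s - c * (t - s) - d * ((t - b)\<^sup>2 - (s - b)\<^sup>2) / 2 = (LINT r|lebesgue_on {s..t}. y' r - c - d * (r - b))"
  proof -
    have "(LINT r|lebesgue_on {s..t}. y' r - c - d * (r - b)) = (LINT r|lebesgue_on {s..t}. y' r) - (LINT r|lebesgue_on {s..t}. c) - (LINT r|lebesgue_on {s..t}. d * (r - b))"
      using i c l(1) by (simp only: Bochner_Integration.integral_diff Bochner_Integration.integrable_diff)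
    then show ?thesis using y st by (simp only: l(2) interval_integral_const[OF st(2)]) (simp add: int_deriv_def)
  qed
  also have "\<bar>\<dots>\<bar> \<le> (LINT r|lebesgue_on {s..t}. \<bar>y' r - c - d * (r - b)\<bar>)" by (rule integral_abs_bound)
  also have "\<dots> \<le> (LINT r|lebesgue_on {s..t}. K)"
  proof (rule integral_mono_AE)
    show "AE r in lebesgue_on {s..t}. \<bar>y' r - c - d * (r - b)\<bar> \<le> K" using K by (intro AE_I2) auto
  qed (use i c l(1) in auto)
  also have "\<dots> = K * (t - s)" by (rule interval_integral_const[OF st(2)])
  finally show ?thesis .
qed

lemma int_deriv_const_remainder:
  assumes y: "int_deriv T y y'" and st: "0 \<le> s" "s \<le> t" "t \<le> T"
    and K: "\<And>r. r \<in> {s..t} \<Longrightarrow> \<bar>y' r - c\<bar> \<le> K"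
  shows "\<bar>y t - y s - c * (t - s)\<bar> \<le> K * (t - s)"
  using int_deriv_linear_remainder[OF y st order_refl, of c 0 K] K by simp

lemma nonneg_subinterval_integral_mono:
  fixes b :: "real \<Rightarrow> real"
  assumes b: "integrable (lebesgue_on {0<..<T}) b" and nn: "\<And>r. b r \<ge> 0"
    and "0 \<le> s" "s \<le> s'" "s' \<le> t'" "t' \<le> t" "t \<le> T"
  shows "(LINT r|lebesgue_on {s'..t'}. b r) \<le> (LINT r|lebesgue_on {s..t}. b r)"
proof -
  have "(LINT r|lebesgue_on {s..t}. b r) = (LINT r|lebesgue_on {s..s'}. b r) + ((LINT r|lebesgue_on {s'..t'}. b r) + (LINT r|lebesgue_on {t'..t}. b r))"
    using assms by (simp add: subinterval_integral_add[OF b, of s s' t] subinterval_integral_add[OF b, of s' t' t])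
  moreover have "(LINT r|lebesgue_on {a..c}. b r) \<ge> 0" for a c using nn by (intro integral_nonneg_AE) auto
  ultimately show ?thesis by (smt (verit))
qed

lemma first_order_consistency:
  assumes y: "int_deriv T y y'" "int_deriv T y' y''" and b: "integrable (lebesgue_on {0<..<T}) b" "\<And>r. b r \<ge> 0"
    and ae: "AE r in lebesgue_on {0<..<T}. \<bar>y'' r\<bar> \<le> b r" and st: "0 \<le> s" "s \<le> t" "t \<le> T"
  shows "\<bar>y t - y s - (t - s) * y' t\<bar> \<le> (t - s) * (LINT r|lebesgue_on {s..t}. b r)"
proof -
  have "\<bar>y' r - y' t\<bar> \<le> (LINT r|lebesgue_on {s..t}. b r)" if "r \<in> {s..t}" for r
  proof -
    have "\<bar>y' t - y' r\<bar> \<le> (LINT r|lebesgue_on {r..t}. b r)" using that st by (intro int_deriv_bound[OF y(2) b(1) ae]) auto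
    also have "\<dots> \<le> (LINT r|lebesgue_on {s..t}. b r)" using that st by (intro nonneg_subinterval_integral_mono[OF b]) auto
    finally show ?thesis by (simp add: abs_minus_commute)
  qed
  from int_deriv_const_remainder[OF y(1) st this] show ?thesis by (simp add: mult.commute)
qed

text \<open>Both increments are compared with the slope at the final time
  \<open>t + 2 * \<tau>\<close>, which cancels in their difference. The quantity is the error of the
  extrapolation 2 u^n - u^(n-1) as an approximation of u^(n+1).\<close>

lemma second_difference_bound:
  assumes y: "int_deriv T y y'" "int_deriv T y' y''" and b: "integrable (lebesgue_on {0<..<T}) b" "\<And>r. b r \<ge> 0"
    and ae: "AE r in lebesgue_on {0<..<T}. \<bar>y'' r\<bar> \<le> b r" and t: "0 \<le> t" "\<tau> \<ge> 0" "t + 2 * \<tau> \<le> T"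
  shows "\<bar>y (t + 2 * \<tau>) - 2 * y (t + \<tau>) + y t\<bar> \<le> 2 * \<tau> * (LINT r|lebesgue_on {t..t + 2 * \<tau>}. b r)"
proof -
  let ?K = "LINT r|lebesgue_on {t..t + 2 * \<tau>}. b r" and ?c = "y' (t + 2 * \<tau>)"
  have K: "\<bar>y' r - ?c\<bar> \<le> ?K" if "r \<in> {t..t + 2 * \<tau>}" for r
  proof -
    have "\<bar>?c - y' r\<bar> \<le> (LINT r|lebesgue_on {r..t + 2 * \<tau>}. b r)" using that t by (intro int_deriv_bound[OF y(2) b(1) ae]) auto
    also have "\<dots> \<le> ?K" using that t by (intro nonneg_subinterval_integral_mono[OF b]) auto
    finally show ?thesis by (simp add: abs_minus_commute)
  qed
  have "\<bar>y (t + \<tau>) - y t - ?c * (t + \<tau> - t)\<bar> \<le> ?K * (t + \<tau> - t)"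
    using t by (intro int_deriv_const_remainder[OF y(1)] K) auto
  moreover have "\<bar>y (t + 2 * \<tau>) - y (t + \<tau>) - ?c * (t + 2 * \<tau> - (t + \<tau>))\<bar> \<le> ?K * (t + 2 * \<tau> - (t + \<tau>))"
    using t by (intro int_deriv_const_remainder[OF y(1)] K) auto
  ultimately show ?thesis by (simp add: algebra_simps abs_le_iff)
qed

lemma BDF2_consistency:
  assumes y: "int_deriv T y y'" "int_deriv T y' y''" "int_deriv T y'' y'''"
    and b: "integrable (lebesgue_on {0<..<T}) b" "\<And>r. b r \<ge> 0"
    and ae: "AE r in lebesgue_on {0<..<T}. \<bar>y''' r\<bar> \<le> b r" and t: "0 \<le> t" "\<tau> \<ge> 0" "t + 2 * \<tau> \<le> T"
  shows "\<bar>3/2 * y (t + 2 * \<tau>) - 2 * y (t + \<tau>) + 1/2 * y t - \<tau> * y' (t + 2 * \<tau>)\<bar>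
     \<le> 6 * \<tau>\<^sup>2 * (LINT r|lebesgue_on {t..t + 2 * \<tau>}. b r)"
proof -
  let ?e = "t + 2 * \<tau>"
  let ?K = "LINT r|lebesgue_on {t..?e}. b r" and ?c = "y' ?e" and ?d = "y'' ?e"
  have K0: "?K \<ge> 0" using b(2) by (intro integral_nonneg_AE) auto
  have K: "\<bar>y'' r - ?d\<bar> \<le> ?K" if "r \<in> {t..?e}" for r
  proof -
    have "\<bar>?d - y'' r\<bar> \<le> (LINT r|lebesgue_on {r..?e}. b r)" using that t by (intro int_deriv_bound[OF y(3) b(1) ae]) auto
    also have "\<dots> \<le> ?K" using that t by (intro nonneg_subinterval_integral_mono[OF b]) auto
    finally show ?thesis by (simp add: abs_minus_commute)
  qed
  \<comment> \<open>On the whole window the second derivative is within \<open>?K\<close> of its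
    final value; integrating back from the final time, the first derivative is within 2 \<tau>
    \<open>?K\<close> of its tangent there.\<close>
  have K1: "\<bar>y' r - ?c - ?d * (r - ?e)\<bar> \<le> 2 * \<tau> * ?K" if r: "r \<in> {t..?e}" for r
  proof -
    have "\<bar>y' ?e - y' r - ?d * (?e - r)\<bar> \<le> ?K * (?e - r)"
      using r t by (intro int_deriv_const_remainder[OF y(2)] K) auto
    also have "\<dots> \<le> ?K * (2 * \<tau>)" using r K0 by (intro mult_left_mono) auto
    finally show ?thesis by (simp add: algebra_simps abs_le_iff)
  qed
  have 1: "\<bar>y ?e - y (t + \<tau>) - ?c * (?e - (t + \<tau>)) - ?d * ((?e - ?e)\<^sup>2 - (t + \<tau> - ?e)\<^sup>2) / 2\<bar> \<le> 2 * \<tau> * ?K * (?e - (t + \<tau>))"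
    using t by (intro int_deriv_linear_remainder[OF y(1)] K1) auto
  have 2: "\<bar>y ?e - y t - ?c * (?e - t) - ?d * ((?e - ?e)\<^sup>2 - (t - ?e)\<^sup>2) / 2\<bar> \<le> 2 * \<tau> * ?K * (?e - t)"
    using t by (intro int_deriv_linear_remainder[OF y(1)] K1) auto
  define A where "A = y ?e - y (t + \<tau>) - ?c * \<tau> + ?d * \<tau>\<^sup>2 / 2"
  define B where "B = y ?e - y t - ?c * (2 * \<tau>) + ?d * (2 * \<tau>)\<^sup>2 / 2"
  have sq: "(t + \<tau> - ?e)\<^sup>2 = \<tau>\<^sup>2" "(t - ?e)\<^sup>2 = (2 * \<tau>)\<^sup>2" by (simp_all add: power2_eq_square algebra_simps)
  have A: "\<bar>A\<bar> \<le> 2 * \<tau>\<^sup>2 * ?K" using 1 unfolding A_def sq by (simp add: power2_eq_square algebra_simps)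
  have B: "\<bar>B\<bar> \<le> 4 * \<tau>\<^sup>2 * ?K" using 2 unfolding B_def sq by (simp add: power2_eq_square algebra_simps)
  \<comment> \<open>A and B are the quadratic Taylor remainders over one and two steps, expanded at
    the final time. In 2 A - B / 2 the second derivatives cancel, and the bounds 2 and 4 give the
    factor 6 = 2 * 2 + 4 / 2.\<close>
  have "3/2 * y ?e - 2 * y (t + \<tau>) + 1/2 * y t - \<tau> * ?c = 2 * A - B / 2"
    unfolding A_def B_def by (simp add: power2_eq_square field_simps)
  then show ?thesis using A B by (simp add: abs_le_iff)
qed

subsection \<open>Functions of time with values in \<open>L\<^sup>2\<close>\<close>

lemma time_space_inf_AE:
  assumes "w \<in> time_space \<infinity> T X N"
  shows "AE t in lebesgue_on {0<..<T}. w t \<in> X \<and> N (w t) \<le> time_norm \<infinity> T N w"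
proof -
  have "AE t in lebesgue_on {0<..<T}. norm (N (w t)) \<le> time_norm \<infinity> T N w"
    using assms Linf_AE[of "\<lambda>t. N (w t)" "{0<..<T}"] by (simp add: time_space_def time_norm_def)
  moreover have "AE t in lebesgue_on {0<..<T}. w t \<in> X" using assms by (simp add: time_space_def)
  ultimately show ?thesis by eventually_elim auto
qed

lemma time_space_2D:
  assumes "w \<in> time_space 2 T X N"
  shows "AE t in lebesgue_on {0<..<T}. w t \<in> X" "(\<lambda>t. N (w t)) \<in> Lp_space 2 {0<..<T}"
    "(time_norm 2 T N w)\<^sup>2 = (LINT t|lebesgue_on {0<..<T}. (N (w t))\<^sup>2)"
    "integrable (lebesgue_on {0<..<T}) (\<lambda>t. (N (w t))\<^sup>2)"
    "integrable (lebesgue_on {0<..<T}) (\<lambda>t. N (w t))"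
proof -
  show 1: "AE t in lebesgue_on {0<..<T}. w t \<in> X" "(\<lambda>t. N (w t)) \<in> Lp_space 2 {0<..<T}"
    using assms by (auto simp: time_space_def)
  show "(time_norm 2 T N w)\<^sup>2 = (LINT t|lebesgue_on {0<..<T}. (N (w t))\<^sup>2)"
    by (simp add: time_norm_def L2_norm_sq)
  show "integrable (lebesgue_on {0<..<T}) (\<lambda>t. (N (w t))\<^sup>2)" using 1 by (simp add: Lp_space_2_iff)
  show "integrable (lebesgue_on {0<..<T}) (\<lambda>t. N (w t))"
    using L2_locally_integrable(1)[OF _ _ 1(2)] by auto
qed

lemma interval_Cauchy_Schwarz:
  fixes b :: "real \<Rightarrow> real"
  assumes b: "b \<in> Lp_space 2 {0<..<T}" and st: "0 \<le> s" "s \<le> t" "t \<le> T"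
  shows "(LINT r|lebesgue_on {s..t}. b r)\<^sup>2 \<le> (t - s) * (LINT r|lebesgue_on {s..t}. (b r)\<^sup>2)"
proof -
  have i: "integrable (lebesgue_on {0<..<T}) b" "integrable (lebesgue_on {0<..<T}) (\<lambda>r. (b r)\<^sup>2)"
    using L2_locally_integrable(1)[OF _ _ b] b by (auto simp: Lp_space_2_iff)
  have b2: "b \<in> Lp_space 2 {s..t}"
    using subinterval_integral(1)[OF i(1), of s t] subinterval_integral(1)[OF i(2), of s t] st
    by (auto simp: Lp_space_2_iff)
  have 1: "(\<lambda>r. 1 :: real) \<in> Lp_space 2 {s..t}" by (rule L2_bounded[where B=1]) auto
  have "\<bar>L2_inner {s..t} (\<lambda>r. 1) b\<bar> \<le> L2_norm_on {s..t} (\<lambda>r. 1 :: real) * L2_norm_on {s..t} b"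
    by (rule L2_Cauchy_Schwarz[OF 1 b2])
  then have "\<bar>L2_inner {s..t} (\<lambda>r. 1) b\<bar>\<^sup>2 \<le> (L2_norm_on {s..t} (\<lambda>r. 1 :: real) * L2_norm_on {s..t} b)\<^sup>2"
    by (rule power_mono) simp
  then show ?thesis
    using interval_integral_const[OF st(2), of 1] by (simp add: L2_inner_def power_mult_distrib L2_norm_sq)
qed

context bounded_open_set
begin

lemma time_deriv_integrable_norm:
  fixes w w' :: "real \<Rightarrow> real^'d \<Rightarrow> 'b::euclidean_space"
  assumes "has_time_deriv T \<Omega> w w'"
  shows "AE r in lebesgue_on {0<..<T}. w' r \<in> L2" "integrable (lebesgue_on {0<..<T}) (\<lambda>r. n2 (w' r))"
proof -
  have "w' \<in> time_space 1 T L2 n2" using assms by (simp add: has_time_deriv_def)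
  then have *: "AE r in lebesgue_on {0<..<T}. w' r \<in> L2" "(\<lambda>r. n2 (w' r)) \<in> Lp_space 1 {0<..<T}"
    by (auto simp: time_space_def)
  show "AE r in lebesgue_on {0<..<T}. w' r \<in> L2" using * by simp
  have "real_of_ereal 1 = 1" "(1::ereal) \<noteq> \<infinity>" by auto
  then show "integrable (lebesgue_on {0<..<T}) (\<lambda>r. n2 (w' r))" using *(2) by (simp add: Lp_space_def)
qed

text \<open>Fubini: for fixed s and t the increment formula holds at almost every point of \<Omega>;
  after multiplication by \<open>z\<close> and integration over \<Omega>, the joint measurability of
  \<open>w'\<close> allows the integrals to be exchanged.\<close>

lemma time_deriv_pairing:
  fixes w w' :: "real \<Rightarrow> real^'d \<Rightarrow> 'b::euclidean_space"
  assumes w: "has_time_deriv T \<Omega> w w'" and z: "z \<in> L2"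
  shows "int_deriv T (\<lambda>t. ip (w t) z) (\<lambda>r. ip (w' r) z)"
    "AE r in lebesgue_on {0<..<T}. \<bar>ip (w' r) z\<bar> \<le> n2 (w' r) * n2 z"
proof -
  let ?M1 = "lebesgue_on {0<..<T}" and ?M2 = "lebesgue_on \<Omega>"
  note wl = time_deriv_integrable_norm[OF w]
  show "AE r in ?M1. \<bar>ip (w' r) z\<bar> \<le> n2 (w' r) * n2 z"
    using wl(1) by eventually_elim (rule L2_Cauchy_Schwarz[OF _ z])
  interpret M1: finite_measure ?M1 by (rule finite_measure_lebesgue_on) simp
  interpret M2: finite_measure ?M2 by (rule finite_measure_lebesgue_on[OF lmeasurable_\<Omega>])
  interpret P: pair_sigma_finite ?M1 ?M2 ..
  have mw: "(\<lambda>(r, x). w' r x) \<in> borel_measurable (?M1 \<Otimes>\<^sub>M ?M2)" using w by (simp add: has_time_deriv_def)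
  have mz: "z \<in> borel_measurable ?M2" using z by (rule Lp_space_2_measurable)
  have mz': "(\<lambda>q. z (snd q)) \<in> borel_measurable (?M1 \<Otimes>\<^sub>M ?M2)"
    by (rule measurable_compose[OF measurable_snd mz])
  have mwz: "(\<lambda>(r, x). w' r x \<bullet> z x) \<in> borel_measurable (?M1 \<Otimes>\<^sub>M ?M2)"
    using borel_measurable_inner[OF mw mz'] by (simp add: case_prod_beta')
  have 1: "(\<lambda>x. 1 :: real) \<in> L2" by (rule L2_bounded[OF lmeasurable_\<Omega>, where B=1]) auto
  \<comment> \<open>Integrability of \<open>w'\<close> itself on the product, besides that of its
    product with \<open>z\<close>, makes the time integral at almost every point a genuine one, so
    that the inner product with \<open>z x\<close> may be pulled inside.\<close>
  have iw: "integrable (?M1 \<Otimes>\<^sub>M ?M2) (\<lambda>(r, x). w' r x)"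
  proof (rule P.Fubini_integrable[OF mw])
    show "AE r in ?M1. integrable ?M2 (\<lambda>x. case (r, x) of (r, x) \<Rightarrow> w' r x)"
      using wl(1) by eventually_elim (use L2_locally_integrable(1)[OF open_\<Omega> bounded_\<Omega>] in auto)
    have m: "(\<lambda>r. LINT x|?M2. norm (w' r x)) \<in> borel_measurable ?M1"
      using M2.borel_measurable_lebesgue_integral[of "\<lambda>r x. norm (w' r x)" ?M1] measurable_compose[OF mw borel_measurable_norm]
      by (simp add: case_prod_beta')
    have "integrable ?M1 (\<lambda>r. n2 (\<lambda>x. 1 :: real) * n2 (w' r))" using wl(2) by simp
    then have "integrable ?M1 (\<lambda>r. LINT x|?M2. norm (w' r x))"
    proof (rule Bochner_Integration.integrable_bound[OF _ m])
      show "AE r in ?M1. norm (LINT x|?M2. norm (w' r x)) \<le> norm (n2 (\<lambda>x. 1 :: real) * n2 (w' r))"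
        using wl(1)
      proof eventually_elim
        case (elim r)
        have "(LINT x|?M2. norm (w' r x)) \<ge> 0" by (intro integral_nonneg_AE) auto
        then show ?case using L1_le_L2(2)[OF elim] by (simp add: n1_def abs_mult)
      qed
    qed
    then show "integrable ?M1 (\<lambda>r. LINT x|?M2. norm (case (r, x) of (r, x) \<Rightarrow> w' r x))" by simp
  qed
  have iz: "integrable (?M1 \<Otimes>\<^sub>M ?M2) (\<lambda>(r, x). w' r x \<bullet> z x)"
  proof (rule P.Fubini_integrable[OF mwz])
    show "AE r in ?M1. integrable ?M2 (\<lambda>x. case (r, x) of (r, x) \<Rightarrow> w' r x \<bullet> z x)"
      using wl(1) by eventually_elim (use L2_inner_integrable[OF _ z] in auto)
    have m: "(\<lambda>r. LINT x|?M2. norm (w' r x \<bullet> z x)) \<in> borel_measurable ?M1"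
      using M2.borel_measurable_lebesgue_integral[of "\<lambda>r x. norm (w' r x \<bullet> z x)" ?M1] measurable_compose[OF mwz borel_measurable_norm]
      by (simp add: case_prod_beta')
    have "integrable ?M1 (\<lambda>r. n2 (w' r) * n2 z)" using wl(2) by simp
    then have "integrable ?M1 (\<lambda>r. LINT x|?M2. norm (w' r x \<bullet> z x))"
    proof (rule Bochner_Integration.integrable_bound[OF _ m])
      show "AE r in ?M1. norm (LINT x|?M2. norm (w' r x \<bullet> z x)) \<le> norm (n2 (w' r) * n2 z)"
        using wl(1)
      proof eventually_elim
        case (elim r)
        have "(LINT x|?M2. norm (w' r x \<bullet> z x)) \<le> (LINT x|?M2. norm (w' r x) * norm (z x))"
          using L2_inner_integrable[OF elim z] L2_norm_product_integrable[OF elim z]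
          by (intro integral_mono) (auto simp: Cauchy_Schwarz_ineq2)
        moreover have "(LINT x|?M2. norm (w' r x \<bullet> z x)) \<ge> 0" by (intro integral_nonneg_AE) auto
        ultimately show ?case using L2_Cauchy_Schwarz_norm[OF elim z] by (simp add: abs_mult)
      qed
    qed
    then show "integrable ?M1 (\<lambda>r. LINT x|?M2. norm (case (r, x) of (r, x) \<Rightarrow> w' r x \<bullet> z x))" by simp
  qed
  have iy: "integrable ?M1 (\<lambda>r. ip (w' r) z)"
    using P.integrable_fst[OF iz] by (simp add: L2_inner_def)
  show "int_deriv T (\<lambda>t. ip (w t) z) (\<lambda>r. ip (w' r) z)"
    unfolding int_deriv_def
  proof (intro conjI allI impI)
    show "integrable ?M1 (\<lambda>r. ip (w' r) z)" by (rule iy)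
    fix s t assume st: "0 \<le> s \<and> s \<le> t \<and> t \<le> T"
    have wst: "w t \<in> L2" "w s \<in> L2" using w st by (auto simp: has_time_deriv_def)
    have "ip (w t) z - ip (w s) z = (LINT x|?M2. (w t x - w s x) \<bullet> z x)"
      using L2_inner_diff_left[OF wst z] by (simp add: L2_inner_def)
    also have "\<dots> = (LINT x|?M2. (LINT r|?M1. indicat_real {s..t} r * (w' r x \<bullet> z x)))"
    proof (rule integral_cong_AE)
      show "(\<lambda>x. (w t x - w s x) \<bullet> z x) \<in> borel_measurable ?M2"
        using L2_inner_integrable[OF L2_diff[OF wst] z] by (rule borel_measurable_integrable)
      have "AE x in ?M2. w t x - w s x = (LINT r|lebesgue_on {s..t}. w' r x)"
        using w st by (simp add: has_time_deriv_def)
      moreover have "AE x in ?M2. integrable ?M1 (\<lambda>r. w' r x)" by (rule P.AE_integrable_snd[OF iw])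
      ultimately show "AE x in ?M2. (w t x - w s x) \<bullet> z x = (LINT r|?M1. indicat_real {s..t} r * (w' r x \<bullet> z x))"
      proof eventually_elim
        case (elim x)
        note si = subinterval_integral[OF elim(2), of s t]
        have "(LINT r|lebesgue_on {s..t}. w' r x) = (LINT r|?M1. indicat_real {s..t} r *\<^sub>R w' r x)"
          using st by (intro si(2)) auto
        then have "(w t x - w s x) \<bullet> z x = (LINT r|?M1. indicat_real {s..t} r *\<^sub>R w' r x) \<bullet> z x"
          using elim by simp
        also have "\<dots> = (LINT r|?M1. (indicat_real {s..t} r *\<^sub>R w' r x) \<bullet> z x)"
          using integral_inner_left[of "z x", OF si(3)] st by simp
        finally show ?case by simp
      qed
      have "(\<lambda>(x, r). indicat_real {s..t} r * (w' r x \<bullet> z x)) \<in> borel_measurable (?M2 \<Otimes>\<^sub>M ?M1)"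
      proof -
        have i: "(\<lambda>q. indicat_real {s..t} (snd q)) \<in> borel_measurable (?M2 \<Otimes>\<^sub>M ?M1)"
          by (rule measurable_compose[OF measurable_snd]) (rule measurable_restrict_space1, rule borel_measurable_indicator, simp)
        have "(\<lambda>q. (case (snd q, fst q) of (r, x) \<Rightarrow> w' r x \<bullet> z x)) \<in> borel_measurable (?M2 \<Otimes>\<^sub>M ?M1)"
          by (rule measurable_compose[OF measurable_Pair[OF measurable_snd measurable_fst] mwz])
        from borel_measurable_times[OF i this] show ?thesis by (simp add: case_prod_beta')
      qed
      then show "(\<lambda>x. LINT r|?M1. indicat_real {s..t} r * (w' r x \<bullet> z x)) \<in> borel_measurable ?M2"
        by (rule M1.borel_measurable_lebesgue_integral)
    qed
    also have "\<dots> = (LINT r|?M1. (LINT x|?M2. indicat_real {s..t} r * (w' r x \<bullet> z x)))"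
    proof (rule P.Fubini_integral)
      show "integrable (?M1 \<Otimes>\<^sub>M ?M2) (\<lambda>(r, x). indicat_real {s..t} r * (w' r x \<bullet> z x))"
      proof (rule Bochner_Integration.integrable_bound[OF iz])
        have i: "(\<lambda>q. indicat_real {s..t} (fst q)) \<in> borel_measurable (?M1 \<Otimes>\<^sub>M ?M2)"
          by (rule measurable_compose[OF measurable_fst]) (rule measurable_restrict_space1, rule borel_measurable_indicator, simp)
        from borel_measurable_times[OF i mwz]
        show "(\<lambda>(r, x). indicat_real {s..t} r * (w' r x \<bullet> z x)) \<in> borel_measurable (?M1 \<Otimes>\<^sub>M ?M2)"
          by (simp add: case_prod_beta')
      qed (auto simp: abs_mult indicator_def)
    qed
    also have "\<dots> = (LINT r|?M1. indicat_real {s..t} r *\<^sub>R ip (w' r) z)" by (simp add: L2_inner_def)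
    also have "\<dots> = (LINT r|lebesgue_on {s..t}. ip (w' r) z)"
      using subinterval_integral(2)[OF iy, of s t] st by simp
    finally show "ip (w t) z - ip (w s) z = (LINT r|lebesgue_on {s..t}. ip (w' r) z)" .
  qed
qed

lemma time_deriv_L2: "has_time_deriv T \<Omega> w w' \<Longrightarrow> t \<in> {0..T} \<Longrightarrow> w t \<in> L2"
  for w w' :: "real \<Rightarrow> real^'d \<Rightarrow> 'b::euclidean_space"
  by (simp add: has_time_deriv_def)

lemma time_deriv_pairing_bound:
  fixes w w' :: "real \<Rightarrow> real^'d \<Rightarrow> 'b::euclidean_space"
  assumes w: "has_time_deriv T \<Omega> w w'" and z: "z \<in> L2" and b: "AE r in lebesgue_on {0<..<T}. n2 (w' r) \<le> b r"
  shows "AE r in lebesgue_on {0<..<T}. \<bar>ip (w' r) z\<bar> \<le> n2 z * b r"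
  using time_deriv_pairing(2)[OF w z] b
proof eventually_elim
  case (elim r)
  have "n2 (w' r) * n2 z \<le> b r * n2 z" using elim(2) by (intro mult_right_mono) auto
  then show ?case using elim(1) by (simp add: mult.commute)
qed

text \<open>Minkowski's inequality for vector-valued integrals, obtained from scalar integrals only:
  the increment is tested with itself.\<close>

lemma n2_difference_le:
  fixes w w' :: "real \<Rightarrow> real^'d \<Rightarrow> 'b::euclidean_space"
  assumes w: "has_time_deriv T \<Omega> w w'" and b: "integrable (lebesgue_on {0<..<T}) b"
    and ae: "AE r in lebesgue_on {0<..<T}. n2 (w' r) \<le> b r" and nn: "\<And>r. b r \<ge> 0"
    and st: "0 \<le> s" "s \<le> t" "t \<le> T"
  shows "n2 (\<lambda>x. w t x - w s x) \<le> (LINT r|lebesgue_on {s..t}. b r)"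
proof -
  let ?z = "\<lambda>x. w t x - w s x"
  have ws: "w t \<in> L2" "w s \<in> L2" using time_deriv_L2[OF w] st by auto
  have z: "?z \<in> L2" by (rule L2_diff[OF ws])
  show ?thesis
  proof (rule n2_le_by_duality[OF z])
    show "(LINT r|lebesgue_on {s..t}. b r) \<ge> 0" using nn by (intro integral_nonneg_AE) auto
    have "\<bar>ip (w t) ?z - ip (w s) ?z\<bar> \<le> (LINT r|lebesgue_on {s..t}. n2 ?z * b r)"
      using b by (intro int_deriv_bound[OF time_deriv_pairing(1)[OF w z] _ time_deriv_pairing_bound[OF w z ae] st]) auto
    then show "\<bar>ip ?z ?z\<bar> \<le> (LINT r|lebesgue_on {s..t}. b r) * n2 ?z"
      by (simp add: L2_inner_diff_left[OF ws z] mult.commute)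
  qed
qed

lemma n2_first_order_consistency:
  fixes w w' w'' :: "real \<Rightarrow> real^'d \<Rightarrow> 'b::euclidean_space"
  assumes w: "has_time_deriv T \<Omega> w w'" "has_time_deriv T \<Omega> w' w''" and b: "integrable (lebesgue_on {0<..<T}) b"
    and ae: "AE r in lebesgue_on {0<..<T}. n2 (w'' r) \<le> b r" and nn: "\<And>r. b r \<ge> 0"
    and st: "0 \<le> s" "s \<le> t" "t \<le> T"
  shows "n2 (\<lambda>x. w t x - w s x - (t - s) *\<^sub>R w' t x) \<le> (t - s) * (LINT r|lebesgue_on {s..t}. b r)"
proof -
  let ?z = "\<lambda>x. w t x - w s x - (t - s) *\<^sub>R w' t x"
  have ws: "w t \<in> L2" "w s \<in> L2" "w' t \<in> L2" using time_deriv_L2[OF w(1)] time_deriv_L2[OF w(2)] st by auto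
  have z: "?z \<in> L2" by (intro L2_diff L2_scaleR ws)
  show ?thesis
  proof (rule n2_le_by_duality[OF z])
    show "(t - s) * (LINT r|lebesgue_on {s..t}. b r) \<ge> 0" using nn st by (intro mult_nonneg_nonneg integral_nonneg_AE) auto
    have "\<bar>ip (w t) ?z - ip (w s) ?z - (t - s) * ip (w' t) ?z\<bar> \<le> (t - s) * (LINT r|lebesgue_on {s..t}. n2 ?z * b r)"
      using b nn by (intro first_order_consistency[OF time_deriv_pairing(1)[OF w(1) z] time_deriv_pairing(1)[OF w(2) z] _ _ time_deriv_pairing_bound[OF w(2) z ae] st]) auto
    moreover have "ip ?z ?z = ip (w t) ?z - ip (w s) ?z - (t - s) * ip (w' t) ?z"
      by (simp only: L2_inner_diff_left[OF L2_diff[OF ws(1,2)] L2_scaleR[OF ws(3)] z] L2_inner_diff_left[OF ws(1,2) z] L2_inner_scaleR_left)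
    ultimately show "\<bar>ip ?z ?z\<bar> \<le> (t - s) * (LINT r|lebesgue_on {s..t}. b r) * n2 ?z"
      by (simp add: mult_ac)
  qed
qed

lemma n2_second_difference:
  fixes w w' w'' :: "real \<Rightarrow> real^'d \<Rightarrow> 'b::euclidean_space"
  assumes w: "has_time_deriv T \<Omega> w w'" "has_time_deriv T \<Omega> w' w''" and b: "integrable (lebesgue_on {0<..<T}) b"
    and ae: "AE r in lebesgue_on {0<..<T}. n2 (w'' r) \<le> b r" and nn: "\<And>r. b r \<ge> 0"
    and t: "0 \<le> t" "\<tau> \<ge> 0" "t + 2 * \<tau> \<le> T"
  shows "n2 (\<lambda>x. w (t + 2 * \<tau>) x - 2 *\<^sub>R w (t + \<tau>) x + w t x) \<le> 2 * \<tau> * (LINT r|lebesgue_on {t..t + 2 * \<tau>}. b r)"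
proof -
  let ?z = "\<lambda>x. w (t + 2 * \<tau>) x - 2 *\<^sub>R w (t + \<tau>) x + w t x"
  have ws: "w (t + 2 * \<tau>) \<in> L2" "w (t + \<tau>) \<in> L2" "w t \<in> L2" using time_deriv_L2[OF w(1)] t by auto
  have z: "?z \<in> L2" by (intro L2_add L2_diff L2_scaleR ws)
  show ?thesis
  proof (rule n2_le_by_duality[OF z])
    show "2 * \<tau> * (LINT r|lebesgue_on {t..t + 2 * \<tau>}. b r) \<ge> 0" using nn t by (intro mult_nonneg_nonneg integral_nonneg_AE) auto
    have "\<bar>ip (w (t + 2 * \<tau>)) ?z - 2 * ip (w (t + \<tau>)) ?z + ip (w t) ?z\<bar> \<le> 2 * \<tau> * (LINT r|lebesgue_on {t..t + 2 * \<tau>}. n2 ?z * b r)"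
      using b nn by (intro second_difference_bound[OF time_deriv_pairing(1)[OF w(1) z] time_deriv_pairing(1)[OF w(2) z] _ _ time_deriv_pairing_bound[OF w(2) z ae] t]) auto
    moreover have "ip ?z ?z = ip (w (t + 2 * \<tau>)) ?z - 2 * ip (w (t + \<tau>)) ?z + ip (w t) ?z"
      by (simp only: L2_inner_add_left[OF L2_diff[OF ws(1) L2_scaleR[OF ws(2)]] ws(3) z] L2_inner_diff_left[OF ws(1) L2_scaleR[OF ws(2)] z] L2_inner_scaleR_left)
    ultimately show "\<bar>ip ?z ?z\<bar> \<le> 2 * \<tau> * (LINT r|lebesgue_on {t..t + 2 * \<tau>}. b r) * n2 ?z"
      by (simp add: mult_ac)
  qed
qed

lemma n2_BDF2_consistency:
  fixes w w' w'' w''' :: "real \<Rightarrow> real^'d \<Rightarrow> 'b::euclidean_space"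
  assumes w: "has_time_deriv T \<Omega> w w'" "has_time_deriv T \<Omega> w' w''" "has_time_deriv T \<Omega> w'' w'''"
    and b: "integrable (lebesgue_on {0<..<T}) b"
    and ae: "AE r in lebesgue_on {0<..<T}. n2 (w''' r) \<le> b r" and nn: "\<And>r. b r \<ge> 0"
    and t: "0 \<le> t" "\<tau> \<ge> 0" "t + 2 * \<tau> \<le> T"
  shows "n2 (\<lambda>x. (3/2) *\<^sub>R w (t + 2 * \<tau>) x - 2 *\<^sub>R w (t + \<tau>) x + (1/2) *\<^sub>R w t x - \<tau> *\<^sub>R w' (t + 2 * \<tau>) x)
     \<le> 6 * \<tau>\<^sup>2 * (LINT r|lebesgue_on {t..t + 2 * \<tau>}. b r)"
proof -
  let ?z = "\<lambda>x. (3/2) *\<^sub>R w (t + 2 * \<tau>) x - 2 *\<^sub>R w (t + \<tau>) x + (1/2) *\<^sub>R w t x - \<tau> *\<^sub>R w' (t + 2 * \<tau>) x"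
  have ws: "w (t + 2 * \<tau>) \<in> L2" "w (t + \<tau>) \<in> L2" "w t \<in> L2" "w' (t + 2 * \<tau>) \<in> L2"
    using time_deriv_L2[OF w(1)] time_deriv_L2[OF w(2)] t by auto
  have 1: "(\<lambda>x. (3/2) *\<^sub>R w (t + 2 * \<tau>) x - 2 *\<^sub>R w (t + \<tau>) x) \<in> L2" by (intro L2_diff L2_scaleR ws)
  have 2: "(\<lambda>x. (3/2) *\<^sub>R w (t + 2 * \<tau>) x - 2 *\<^sub>R w (t + \<tau>) x + (1/2) *\<^sub>R w t x) \<in> L2" by (intro L2_add L2_diff L2_scaleR ws)
  have z: "?z \<in> L2" by (intro L2_add L2_diff L2_scaleR ws)
  show ?thesis
  proof (rule n2_le_by_duality[OF z])
    show "6 * \<tau>\<^sup>2 * (LINT r|lebesgue_on {t..t + 2 * \<tau>}. b r) \<ge> 0" using nn t by (intro mult_nonneg_nonneg integral_nonneg_AE) auto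
    have "\<bar>3/2 * ip (w (t + 2 * \<tau>)) ?z - 2 * ip (w (t + \<tau>)) ?z + 1/2 * ip (w t) ?z - \<tau> * ip (w' (t + 2 * \<tau>)) ?z\<bar>
        \<le> 6 * \<tau>\<^sup>2 * (LINT r|lebesgue_on {t..t + 2 * \<tau>}. n2 ?z * b r)"
      using b nn by (intro BDF2_consistency[OF time_deriv_pairing(1)[OF w(1) z] time_deriv_pairing(1)[OF w(2) z]
          time_deriv_pairing(1)[OF w(3) z] _ _ time_deriv_pairing_bound[OF w(3) z ae] t]) auto
    moreover have "ip ?z ?z = 3/2 * ip (w (t + 2 * \<tau>)) ?z - 2 * ip (w (t + \<tau>)) ?z + 1/2 * ip (w t) ?z - \<tau> * ip (w' (t + 2 * \<tau>)) ?z"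
      by (simp only: L2_inner_diff_left[OF 2 L2_scaleR[OF ws(4)] z] L2_inner_add_left[OF 1 L2_scaleR[OF ws(3)] z]
          L2_inner_diff_left[OF L2_scaleR[OF ws(1)] L2_scaleR[OF ws(2)] z] L2_inner_scaleR_left)
    ultimately show "\<bar>ip ?z ?z\<bar> \<le> 6 * \<tau>\<^sup>2 * (LINT r|lebesgue_on {t..t + 2 * \<tau>}. b r) * n2 ?z"
      by (simp add: mult_ac)
  qed
qed

lemma time_deriv_continuous_sequentially:
  fixes w w' :: "real \<Rightarrow> real^'d \<Rightarrow> 'b::euclidean_space"
  assumes w: "has_time_deriv T \<Omega> w w'" and s: "\<And>n::nat. s n \<in> {0..T}" "s \<longlonglongrightarrow> t" and t: "t \<in> {0..T}"
  shows "(\<lambda>n. n2 (\<lambda>x. w (s n) x - w t x)) \<longlonglongrightarrow> 0"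
proof -
  let ?M = "lebesgue_on {0<..<T}"
  define b where "b r = n2 (w' r)" for r
  have b: "integrable ?M b" unfolding b_def by (rule time_deriv_integrable_norm(2)[OF w])
  \<comment> \<open>The primitive of the norm of the derivative controls the increments; its
    continuity follows from dominated convergence of indicators.\<close>
  define B where "B v = (LINT r|lebesgue_on {0..v}. b r)" for v
  have diff: "n2 (\<lambda>x. w v x - w u x) \<le> B v - B u" if "0 \<le> u" "u \<le> v" "v \<le> T" for u v
  proof -
    have "n2 (\<lambda>x. w v x - w u x) \<le> (LINT r|lebesgue_on {u..v}. b r)"
      using that by (intro n2_difference_le[OF w b]) (auto simp: b_def)
    moreover have "B v = B u + (LINT r|lebesgue_on {u..v}. b r)"
      unfolding B_def using that by (intro subinterval_integral_add[OF b]) auto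
    ultimately show ?thesis by simp
  qed
  have abs: "n2 (\<lambda>x. w (s n) x - w t x) \<le> \<bar>B (s n) - B t\<bar>" for n
  proof (cases "s n \<le> t")
    case True
    then show ?thesis using diff[of "s n" t] s(1)[of n] t L2_norm_minus_commute[of \<Omega> "w t" "w (s n)"] by auto
  next
    case False
    then show ?thesis using diff[of t "s n"] s(1)[of n] t by auto
  qed
  have "(\<lambda>n. LINT r|?M. indicat_real {0..s n} r *\<^sub>R b r) \<longlonglongrightarrow> (LINT r|?M. indicat_real {0..t} r *\<^sub>R b r)"
  proof (rule integral_dominated_convergence)
    show "integrable ?M (\<lambda>r. norm (b r))" using b by simp
    have "AE r in lebesgue. r \<notin> {t}" by (intro AE_not_in) (simp add: negligible_iff_null_sets[symmetric])
    then have "AE r in ?M. r \<notin> {t}" by (rule AE_lebesgue_on_subset) auto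
    then show "AE r in ?M. (\<lambda>n. indicat_real {0..s n} r *\<^sub>R b r) \<longlonglongrightarrow> indicat_real {0..t} r *\<^sub>R b r"
    proof eventually_elim
      case (elim r)
      then consider "r < t" | "t < r" by (metis insertI1 linorder_neqE_linordered_idom)
      then have "\<forall>\<^sub>F n in sequentially. indicat_real {0..t} r *\<^sub>R b r = indicat_real {0..s n} r *\<^sub>R b r"
      proof cases
        case 1
        then have "\<forall>\<^sub>F n in sequentially. r < s n" by (rule order_tendstoD(1)[OF s(2)])
        then show ?thesis by eventually_elim (use 1 in \<open>auto simp: indicator_def\<close>)
      next
        case 2
        then have "\<forall>\<^sub>F n in sequentially. s n < r" by (rule order_tendstoD(2)[OF s(2)])
        then show ?thesis by eventually_elim (use 2 in \<open>auto simp: indicator_def\<close>)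
      qed
      then show ?case by (rule Lim_transform_eventually[OF tendsto_const])
    qed
    show "AE r in ?M. norm (indicat_real {0..s n} r *\<^sub>R b r) \<le> norm (b r)" for n by (auto simp: indicator_def)
    show "(\<lambda>r. indicat_real {0..s n} r *\<^sub>R b r) \<in> borel_measurable ?M" for n
      using s(1)[of n] by (intro borel_measurable_integrable subinterval_integral(3)[OF b]) auto
    show "(\<lambda>r. indicat_real {0..t} r *\<^sub>R b r) \<in> borel_measurable ?M"
      using t by (intro borel_measurable_integrable subinterval_integral(3)[OF b]) auto
  qed
  then have "(\<lambda>n. B (s n)) \<longlonglongrightarrow> B t"
    using s(1) t subinterval_integral(2)[OF b] by (simp add: B_def)
  then have "(\<lambda>n. \<bar>B (s n) - B t\<bar>) \<longlonglongrightarrow> 0" by (intro tendsto_rabs_zero LIM_zero)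
  then show ?thesis
    by (rule Lim_null_comparison[rotated]) (use abs in auto)
qed

lemma time_continuous_sequentially:
  fixes w :: "real \<Rightarrow> real^'d \<Rightarrow> 'b::euclidean_space"
  assumes w: "time_continuous_L2 T \<Omega> w" and s: "\<And>n::nat. s n \<in> {0..T}" "s \<longlonglongrightarrow> t" and t: "t \<in> {0..T}"
  shows "(\<lambda>n. n2 (\<lambda>x. w (s n) x - w t x)) \<longlonglongrightarrow> 0"
proof -
  let ?f = "\<lambda>s. n2 (\<lambda>x. w s x - w t x)"
  have "(?f \<longlongrightarrow> ?f t) (at t within {0..T})" using w t by (simp add: time_continuous_L2_def)
  then have "continuous (at t within {0..T}) ?f" by (simp add: continuous_within)
  from this[unfolded continuous_within_sequentially, rule_format, of s] s
  show ?thesis by (simp add: o_def)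
qed

subsection \<open>Norms essentially bounded in time are bounded at every time\<close>

text \<open>Lower semicontinuity is applied to each derivative separately with the common bound
  \<open>?M\<close>, so the sum of squares costs the number of multi-indices. Continuity enters as
  the abstract premise \<open>cont\<close> because it comes from a time derivative for
  \<open>u\<close> and is assumed outright for \<open>p\<close>.\<close>

lemma H_norm_time_bound:
  fixes w :: "real \<Rightarrow> real^'d \<Rightarrow> 'b::euclidean_space"
  assumes T: "T > 0" and cont: "\<And>s t. (\<And>n::nat. s n \<in> {0..T}) \<Longrightarrow> s \<longlonglongrightarrow> t \<Longrightarrow> t \<in> {0..T} \<Longrightarrow>
        (\<lambda>n. n2 (\<lambda>x. w (s n) x - w t x)) \<longlonglongrightarrow> 0"
    and H: "\<And>t. t \<in> {0..T} \<Longrightarrow> w t \<in> H_space m \<Omega>"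
    and w: "w \<in> time_space \<infinity> T (H_space m \<Omega>) (H_norm m \<Omega>)" and t: "t \<in> {0..T}"
  shows "H_norm m \<Omega> (w t) \<le> sqrt (real (card {\<alpha> :: 'd \<Rightarrow> nat. mi_order \<alpha> \<le> m})) * time_norm \<infinity> T (H_norm m \<Omega>) w"
proof -
  let ?M = "time_norm \<infinity> T (H_norm m \<Omega>) w"
  obtain s where s: "\<And>n::nat. s n \<in> {0<..<T}" "\<And>n. w (s n) \<in> H_space m \<Omega> \<and> H_norm m \<Omega> (w (s n)) \<le> ?M" "s \<longlonglongrightarrow> t"
    using AE_interval_sequence[OF time_space_inf_AE[OF w] T t] by blast
  have s': "s n \<in> {0..T}" for n using s(1)[of n] by auto
  show ?thesis
  proof (rule H_norm_le)
    show "?M \<ge> 0" using s(2)[of 0] H_norm_nonneg order_trans by blast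
    fix \<alpha> :: "'d \<Rightarrow> nat" assume \<alpha>: "mi_order \<alpha> \<le> m"
    show "n2 (wD \<Omega> \<alpha> (w t)) \<le> ?M"
    proof (rule lsc_L2[OF cont[OF s' s(3) t] _ H[OF t] \<alpha>])
      show "w (s n) \<in> H_space m \<Omega>" for n using s(2) by blast
      show "n2 (wD \<Omega> \<alpha> (w (s n))) \<le> ?M" for n
        using L2_wD_le_H_norm[OF \<alpha>, of \<Omega> "w (s n)"] s(2)[of n] by linarith
    qed
  qed
qed

text \<open>The norm is a maximum over the derivatives instead of a sum, so that the common bound
  passes to it without a factor.\<close>

lemma W_norm_time_bound:
  fixes w :: "real \<Rightarrow> real^'d \<Rightarrow> 'b::euclidean_space"
  assumes T: "T > 0" and cont: "\<And>s t. (\<And>n::nat. s n \<in> {0..T}) \<Longrightarrow> s \<longlonglongrightarrow> t \<Longrightarrow> t \<in> {0..T} \<Longrightarrow>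
        (\<lambda>n. n2 (\<lambda>x. w (s n) x - w t x)) \<longlonglongrightarrow> 0"
    and W: "\<And>t. t \<in> {0..T} \<Longrightarrow> w t \<in> sobolev_space m \<infinity> \<Omega>"
    and w: "w \<in> time_space \<infinity> T (sobolev_space m \<infinity> \<Omega>) (sobolev_norm m \<infinity> \<Omega>)" and t: "t \<in> {0..T}"
  shows "sobolev_norm m \<infinity> \<Omega> (w t) \<le> time_norm \<infinity> T (sobolev_norm m \<infinity> \<Omega>) w"
proof -
  let ?M = "time_norm \<infinity> T (sobolev_norm m \<infinity> \<Omega>) w"
  obtain s where s: "\<And>n::nat. s n \<in> {0<..<T}" "\<And>n. w (s n) \<in> sobolev_space m \<infinity> \<Omega> \<and> sobolev_norm m \<infinity> \<Omega> (w (s n)) \<le> ?M" "s \<longlonglongrightarrow> t"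
    using AE_interval_sequence[OF time_space_inf_AE[OF w] T t] by blast
  have s': "s n \<in> {0..T}" for n using s(1)[of n] by auto
  have "ni (wD \<Omega> \<alpha> (w t)) \<le> ?M" if \<alpha>: "mi_order \<alpha> \<le> m" for \<alpha>
  proof (rule lsc_Li[OF cont[OF s' s(3) t] _ W[OF t] \<alpha>])
    show "w (s n) \<in> sobolev_space m \<infinity> \<Omega>" for n using s(2) by blast
    show "ni (wD \<Omega> \<alpha> (w (s n))) \<le> ?M" for n
      using Li_wD_le[OF \<alpha>, of "w (s n)"] s(2)[of n] by linarith
  qed
  then have "Max ((\<lambda>\<alpha>. ni (wD \<Omega> \<alpha> (w t))) ` {\<alpha>. mi_order \<alpha> \<le> m}) \<le> ?M"
  proof (subst Max_le_iff)
    have "(\<lambda>i. 0) \<in> {\<alpha> :: 'd \<Rightarrow> nat. mi_order \<alpha> \<le> m}" by simp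
    then show "(\<lambda>\<alpha>. ni (wD \<Omega> \<alpha> (w t))) ` {\<alpha>. mi_order \<alpha> \<le> m} \<noteq> {}" by blast
  qed (auto simp: finite_mi_order)
  then show ?thesis by (simp add: sobolev_norm_def)
qed

lemma Li_norm_time_bound:
  fixes w :: "real \<Rightarrow> real^'d \<Rightarrow> 'b::euclidean_space"
  assumes T: "T > 0" and cont: "\<And>s t. (\<And>n::nat. s n \<in> {0..T}) \<Longrightarrow> s \<longlonglongrightarrow> t \<Longrightarrow> t \<in> {0..T} \<Longrightarrow>
        (\<lambda>n. n2 (\<lambda>x. w (s n) x - w t x)) \<longlonglongrightarrow> 0"
    and W: "\<And>t. t \<in> {0..T} \<Longrightarrow> w t \<in> Li"
    and w: "w \<in> time_space \<infinity> T Li ni" and t: "t \<in> {0..T}"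
  shows "ni (w t) \<le> time_norm \<infinity> T ni w"
proof -
  let ?M = "time_norm \<infinity> T ni w"
  obtain s where s: "\<And>n::nat. s n \<in> {0<..<T}" "\<And>n. w (s n) \<in> Li \<and> ni (w (s n)) \<le> ?M" "s \<longlonglongrightarrow> t"
    using AE_interval_sequence[OF time_space_inf_AE[OF w] T t] by blast
  have s': "s n \<in> {0..T}" for n using s(1)[of n] by auto
  have "{\<alpha> :: 'd \<Rightarrow> nat. mi_order \<alpha> \<le> 0} = {\<lambda>i. 0}" by (auto simp: fun_eq_iff)
  \<comment> \<open>An essentially bounded function lies in the Sobolev space of order 0, so the
    lower semicontinuity result covers the plain sup norm.\<close>
  have LW: "f \<in> sobolev_space 0 \<infinity> \<Omega>" if "f \<in> Li" for f :: "real^'d \<Rightarrow> 'b"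
  proof -
    have "weak_deriv \<Omega> (\<lambda>i. 0) f f" by (rule weak_deriv_zero_order[OF L2_loc[OF Li_imp_L2[OF that]]])
    moreover have "\<alpha> = (\<lambda>i. 0)" if "mi_order \<alpha> \<le> 0" for \<alpha> :: "'d \<Rightarrow> nat" using that by (auto simp: fun_eq_iff)
    ultimately show ?thesis unfolding sobolev_space_def using \<open>f \<in> Li\<close> by blast
  qed
  have eq: "AE x in lebesgue_on \<Omega>. wD \<Omega> (\<lambda>i. 0) f x = f x" if "f \<in> Li" for f :: "real^'d \<Rightarrow> 'b"
    using wD_0[OF W_wD(1)[OF LW[OF that], of "\<lambda>i. 0"]] by simp
  have D0: "wD \<Omega> (\<lambda>i. 0) f \<in> Li" if "f \<in> Li" for f :: "real^'d \<Rightarrow> 'b"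
    using W_wD(2)[OF LW[OF that], of "\<lambda>i. 0"] by simp
  have le1: "ni f \<le> ni (wD \<Omega> (\<lambda>i. 0) f)" if "f \<in> Li" for f :: "real^'d \<Rightarrow> 'b"
    by (rule Li_cong(2)[OF D0[OF that] eq[OF that]])
  have le2: "ni (wD \<Omega> (\<lambda>i. 0) f) \<le> ni f" if "f \<in> Li" for f :: "real^'d \<Rightarrow> 'b"
  proof (rule Li_cong(2)[OF that])
    show "AE x in lebesgue_on \<Omega>. f x = wD \<Omega> (\<lambda>i. 0) f x" using eq[OF that] by eventually_elim simp
  qed
  have "ni (wD \<Omega> (\<lambda>i. 0) (w t)) \<le> ?M"
  proof (rule lsc_Li[OF cont[OF s' s(3) t]])
    show "w (s n) \<in> sobolev_space 0 \<infinity> \<Omega>" for n using s(2) LW by blast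
    show "ni (wD \<Omega> (\<lambda>i. 0) (w (s n))) \<le> ?M" for n using le2[of "w (s n)"] s(2)[of n] by linarith
  qed (use LW W t in auto)
  then show ?thesis using le1[OF W[OF t]] by linarith
qed

end

subsection \<open>A discrete energy estimate\<close>

text \<open>The inequality 1/(1 - \<gamma>) <= exp (2 \<gamma>), written without division. With the
  quadratic Taylor polynomial of the exponential the product becomes 1 + \<gamma> - 2
  \<gamma>^3.\<close>

lemma one_le_exp_Gronwall:
  fixes \<gamma> :: real
  assumes "0 \<le> \<gamma>" "\<gamma> \<le> 1 / 2" shows "1 \<le> (1 - \<gamma>) * exp (2 * \<gamma>)"
proof -
  have "\<gamma> * (2 * (\<gamma> * \<gamma>)) \<le> \<gamma> * 1"
    using assms mult_mono[of \<gamma> "1/2" \<gamma> "1/2"] by (intro mult_left_mono) auto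
  then have "1 \<le> (1 - \<gamma>) * (1 + 2 * \<gamma> + (2 * \<gamma>)\<^sup>2 / 2)" by (simp add: power2_eq_square algebra_simps)
  also have "\<dots> \<le> (1 - \<gamma>) * exp (2 * \<gamma>)"
    using assms exp_lower_Taylor_quadratic[of "2 * \<gamma>"] by (intro mult_left_mono) auto
  finally show ?thesis .
qed

text \<open>The new value occurs on both sides. Solving for it divides by 1 - \<gamma>, which costs
  a factor exp (2 \<gamma>) per step and explains both the restriction to 1/2 and the 2 in the
  exponent.\<close>

lemma implicit_discrete_Gronwall:
  fixes X r \<gamma> :: "nat \<Rightarrow> real"
  assumes "\<And>m. 1 \<le> m \<Longrightarrow> m \<le> n \<Longrightarrow> X (Suc m) \<le> X m + \<gamma> (Suc m) * X (Suc m) + r m"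
    and "\<And>j. 2 \<le> j \<Longrightarrow> j \<le> Suc n \<Longrightarrow> 0 \<le> \<gamma> j \<and> \<gamma> j \<le> 1 / 2"
    and "\<And>m. r m \<ge> 0" and "X 1 \<ge> 0"
  shows "X (Suc n) \<le> exp (2 * (\<Sum>j=2..Suc n. \<gamma> j)) * (X 1 + (\<Sum>m=1..n. r m))"
  using assms(1,2)
proof (induction n)
  case (Suc n)
  let ?A = "exp (2 * (\<Sum>j=2..Suc n. \<gamma> j))"
  let ?B = "X 1 + (\<Sum>m=1..n. r m)"
  let ?g = "\<gamma> (Suc (Suc n))"
  have IH: "X (Suc n) \<le> ?A * ?B" using Suc.prems by (intro Suc.IH) auto
  have g: "0 \<le> ?g" "?g \<le> 1 / 2" using Suc.prems(2)[of "Suc (Suc n)"] by auto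
  have "(\<Sum>j=2..Suc n. \<gamma> j) \<ge> 0" using Suc.prems(2) by (intro sum_nonneg) auto
  then have A1: "?A \<ge> 1" by simp
  have B0: "?B \<ge> 0" using assms(3,4) by (simp add: sum_nonneg)
  have "(1 - ?g) * X (Suc (Suc n)) \<le> X (Suc n) + r (Suc n)"
    using Suc.prems(1)[of "Suc n"] by (simp add: algebra_simps)
  also have "\<dots> \<le> ?A * ?B + ?A * r (Suc n)"
    using IH mult_right_mono[OF A1 assms(3)[of "Suc n"]] by simp
  also have "\<dots> = ?A * (?B + r (Suc n)) * 1" by (simp add: algebra_simps)
  also have "\<dots> \<le> ?A * (?B + r (Suc n)) * ((1 - ?g) * exp (2 * ?g))"
    using one_le_exp_Gronwall[OF g] B0 assms(3)[of "Suc n"] by (intro mult_left_mono) auto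
  finally have "(1 - ?g) * X (Suc (Suc n)) \<le> (1 - ?g) * (?A * exp (2 * ?g) * (?B + r (Suc n)))"
    by (simp add: mult_ac)
  then have "X (Suc (Suc n)) \<le> ?A * exp (2 * ?g) * (?B + r (Suc n))"
    using g by simp
  moreover have "(\<Sum>j=2..Suc (Suc n). \<gamma> j) = (\<Sum>j=2..Suc n. \<gamma> j) + ?g"
    by (subst sum.cl_ivl_Suc) simp
  moreover have "(\<Sum>m=1..Suc n. r m) = (\<Sum>m=1..n. r m) + r (Suc n)" by simp
  ultimately show ?case by (simp only: distrib_left[of 2] exp_add add.assoc)
qed simp

text \<open>
  The Lyapunov function \<open>W\<close> carries along the contributions of the extrapolated error to the next
  two steps, so that every \<open>a j\<close> is finally multiplied by the full stability coefficient \<open>NN j\<close>.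
\<close>

lemma discrete_energy_estimate:
  fixes a q g d G S r :: "nat \<Rightarrow> real" and \<tau> T \<mu> \<nu> :: real
  defines "NN \<equiv> \<lambda>j. 4 * ((1/2) * G j + 9 / (2 * \<mu>) * (S j)\<^sup>2 + 3 * G (j + 1) + (3/2) * G (j + 2))"
  assumes pos: "\<tau> > 0" "T > 0" "\<mu> > 0" "\<nu> > 0"
    and nn: "\<And>j. a j \<ge> 0" "\<And>j. g j \<ge> 0" "\<And>j. d j \<ge> 0" "\<And>j. G j \<ge> 0" "\<And>j. r j \<ge> 0" "\<And>j. a j \<le> q j"
    and zero: "a 0 = 0" "d 0 = 0" and n: "n \<ge> 1" "real n * \<tau> \<le> T"
    and step: "\<And>m. 1 \<le> m \<Longrightarrow> m \<le> n \<Longrightarrow>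
      q (m + 1) + 4 * \<tau> * (\<nu> * g (m + 1) + \<mu> * d (m + 1)) \<le> q m
       + \<tau> * (G (m + 1) * (2 * a (m + 1) + 12 * a m + 6 * a (m - 1)) + 18 / \<mu> * (S (m + 1))\<^sup>2 * a (m + 1)
              + \<mu> / 18 * (6 * d m + 3 * d (m - 1)))
       + \<tau> * (a (m + 1) / T + 2 * \<mu> * d (m + 1) + r m)"
    and small: "\<And>j. 2 \<le> j \<Longrightarrow> j \<le> n + 1 \<Longrightarrow> \<tau> * (1 / T + NN j) \<le> 1 / 2"
  shows "a (n + 1) + (\<Sum>j=2..n + 1. \<nu> * \<tau> * g j) + \<mu> * (\<Sum>j=2..n + 1. \<tau> * d j)
    \<le> exp (2 + 2 * T * Max (NN ` {2..n + 1})) * (q 1 + 4 * a 1 + \<mu> * \<tau> * d 1 + \<tau> * (\<Sum>m=1..n. r m))"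
proof -
  \<comment> \<open>The share d m / 2 equals d m / 3 + d m / 6, what the next two steps charge to
    \<open>d m\<close>. Of the 4 units of grad-div dissipation in a step, 2 go into the residual and
    1/2 into \<open>W\<close>, so one unit can be kept for the sum.\<close>
  define W where "W m = q m + \<tau> * (12 * G (m + 1) * a m + 6 * G (m + 2) * a m + 6 * G (m + 1) * a (m - 1))
     + \<tau> * \<mu> * (d m / 2 + d (m - 1) / 6)" for m
  define X where "X m = W m + (\<Sum>j=2..m. \<tau> * \<nu> * g j + \<tau> * \<mu> * d j)" for m
  define \<gamma> where "\<gamma> j = \<tau> * (1 / T + NN j)" for j
  have NN0: "NN j \<ge> 0" for j unfolding NN_def using nn(4) pos by (intro mult_nonneg_nonneg add_nonneg_nonneg) auto
  have S0: "(\<Sum>j=2..m. \<tau> * \<nu> * g j + \<tau> * \<mu> * d j) \<ge> 0" for m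
    using pos nn by (intro sum_nonneg add_nonneg_nonneg mult_nonneg_nonneg) (auto simp: less_imp_le)
  have qW: "q m \<le> W m" for m
  proof -
    have "\<tau> * (12 * G (m + 1) * a m + 6 * G (m + 2) * a m + 6 * G (m + 1) * a (m - 1)) \<ge> 0"
      using pos nn by (intro mult_nonneg_nonneg add_nonneg_nonneg) (auto simp: less_imp_le)
    moreover have "\<tau> * \<mu> * (d m / 2 + d (m - 1) / 6) \<ge> 0"
      using pos nn by (intro mult_nonneg_nonneg add_nonneg_nonneg) (auto simp: less_imp_le)
    ultimately show ?thesis by (simp add: W_def)
  qed
  have aX: "a m \<le> X m" for m using nn(6)[of m] qW[of m] S0[of m] by (simp add: X_def)
  have main: "X (Suc m) \<le> X m + \<gamma> (Suc m) * X (Suc m) + \<tau> * r m" if m: "1 \<le> m" "m \<le> n" for m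
  proof -
    have "W (Suc m) + (\<tau> * \<nu> * g (Suc m) + \<tau> * \<mu> * d (Suc m)) \<le> W m + \<gamma> (Suc m) * a (Suc m) + \<tau> * r m"
    proof -
      have e1: "\<tau> * \<nu> * g (Suc m) \<ge> 0" "\<tau> * \<mu> * d (Suc m) \<ge> 0"
        using pos nn by (auto intro!: mult_nonneg_nonneg simp: less_imp_le)
      have st: "q (Suc m) + 4 * (\<tau> * \<nu> * g (Suc m)) + 4 * (\<tau> * \<mu> * d (Suc m)) \<le> q m
        + \<tau> * (G (Suc m) * (2 * a (Suc m) + 12 * a m + 6 * a (m - 1))) + \<tau> * (18 / \<mu> * (S (Suc m))\<^sup>2 * a (Suc m))
        + \<tau> * \<mu> * (d m / 3 + d (m - 1) / 6) + \<tau> * (a (Suc m) / T) + 2 * (\<tau> * \<mu> * d (Suc m)) + \<tau> * r m"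
        using step[OF m] by (simp add: algebra_simps)
      \<comment> \<open>Four times the bracket in \<open>NN\<close> is exactly what is charged to
        one value of \<open>a\<close>: 2 G and 18 / \<mu> S^2 by the current step, 12 G and 6 G by
        the two following ones.\<close>
      have g: "\<gamma> (Suc m) * a (Suc m) = \<tau> * (a (Suc m) / T) + 2 * (\<tau> * (G (Suc m) * a (Suc m)))
          + \<tau> * (18 / \<mu> * (S (Suc m))\<^sup>2 * a (Suc m)) + 12 * (\<tau> * (G (Suc (Suc m)) * a (Suc m)))
          + 6 * (\<tau> * (G (Suc (Suc (Suc m))) * a (Suc m)))"
        unfolding \<gamma>_def NN_def using pos by (simp add: field_simps)
      have w1: "W (Suc m) = q (Suc m) + 12 * (\<tau> * (G (Suc (Suc m)) * a (Suc m))) + 6 * (\<tau> * (G (Suc (Suc (Suc m))) * a (Suc m)))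
          + 6 * (\<tau> * (G (Suc (Suc m)) * a m)) + \<tau> * \<mu> * d (Suc m) / 2 + \<tau> * \<mu> * d m / 6"
        by (simp add: W_def algebra_simps)
      have w0: "W m = q m + 12 * (\<tau> * (G (Suc m) * a m)) + 6 * (\<tau> * (G (Suc (Suc m)) * a m))
          + 6 * (\<tau> * (G (Suc m) * a (m - 1))) + \<tau> * \<mu> * d m / 2 + \<tau> * \<mu> * d (m - 1) / 6"
        by (simp add: W_def algebra_simps)
      have x: "\<tau> * (G (Suc m) * (2 * a (Suc m) + 12 * a m + 6 * a (m - 1))) =
         2 * (\<tau> * (G (Suc m) * a (Suc m))) + 12 * (\<tau> * (G (Suc m) * a m)) + 6 * (\<tau> * (G (Suc m) * a (m - 1)))"
        "\<tau> * \<mu> * (d m / 3 + d (m - 1) / 6) = \<tau> * \<mu> * d m / 3 + \<tau> * \<mu> * d (m - 1) / 6"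
        by (simp_all add: algebra_simps)
      show ?thesis using st e1 unfolding g w1 w0 x by linarith
    qed
    moreover have "X (Suc m) = W (Suc m) + (\<Sum>j=2..m. \<tau> * \<nu> * g j + \<tau> * \<mu> * d j) + (\<tau> * \<nu> * g (Suc m) + \<tau> * \<mu> * d (Suc m))"
      using m by (simp add: X_def)
    moreover have "\<gamma> (Suc m) * a (Suc m) \<le> \<gamma> (Suc m) * X (Suc m)"
      using aX NN0 pos by (intro mult_left_mono) (auto simp: \<gamma>_def intro!: mult_nonneg_nonneg add_nonneg_nonneg)
    ultimately show ?thesis by (simp add: X_def)
  qed
  have G: "X (Suc n) \<le> exp (2 * (\<Sum>j=2..Suc n. \<gamma> j)) * (X 1 + (\<Sum>m=1..n. \<tau> * r m))"
  proof (rule implicit_discrete_Gronwall[where X=X and \<gamma>=\<gamma> and r="\<lambda>m. \<tau> * r m"])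
    show "X (Suc m) \<le> X m + \<gamma> (Suc m) * X (Suc m) + \<tau> * r m" if "1 \<le> m" "m \<le> n" for m by (rule main[OF that])
    show "0 \<le> \<gamma> j \<and> \<gamma> j \<le> 1 / 2" if "2 \<le> j" "j \<le> Suc n" for j
      using small[of j] that NN0[of j] pos by (auto simp: \<gamma>_def)
    show "\<tau> * r m \<ge> 0" for m using pos nn by simp
    show "X 1 \<ge> 0" using aX[of 1] nn(1)[of 1] by linarith
  qed
  \<comment> \<open>The initial value carries the advance charges of \<open>W\<close>. They are
    bounded by the step restriction at j = 2: since 2 G 2 + 12 G 3 is part of \<open>NN 2\<close>,
    six times that restriction gives the bound 3 on \<tau> times 12 G 2 + 6 G 3.\<close>
  have X1: "X 1 \<le> q 1 + 4 * a 1 + \<mu> * \<tau> * d 1"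
  proof -
    have s2: "\<tau> * (1 / T + NN 2) \<le> 1 / 2" using small[of 2] n by auto
    have "G 2 \<ge> 0" "G 3 \<ge> 0" "G 4 \<ge> 0" "9 / (2 * \<mu>) * (S 2)\<^sup>2 \<ge> 0" "1 / T \<ge> 0" using nn(4) pos by auto
    then have "2 * G 2 + 12 * G 3 \<le> 1 / T + NN 2" unfolding NN_def by (simp add: numeral_eq_Suc)
    then have "\<tau> * (2 * G 2 + 12 * G 3) \<le> \<tau> * (1 / T + NN 2)" using pos by (intro mult_left_mono) auto
    then have "\<tau> * (2 * G 2 + 12 * G 3) \<le> 1 / 2" using s2 by linarith
    then have "\<tau> * (12 * G 2 + 6 * G 3) \<le> 3"
    proof -
      have "0 \<le> \<tau> * G 3" using pos nn(4)[of 3] by simp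
      moreover have "2 * (\<tau> * G 2) + 12 * (\<tau> * G 3) \<le> 1 / 2"
        using \<open>\<tau> * (2 * G 2 + 12 * G 3) \<le> 1 / 2\<close> by (simp add: distrib_left)
      ultimately have "12 * (\<tau> * G 2) + 6 * (\<tau> * G 3) \<le> 3" by linarith
      then show ?thesis by (simp add: distrib_left)
    qed
    then have "\<tau> * (12 * G 2 + 6 * G 3) * a 1 \<le> 3 * a 1" using nn(1) by (rule mult_right_mono)
    moreover have "X 1 = q 1 + \<tau> * (12 * G 2 + 6 * G 3) * a 1 + \<tau> * \<mu> * d 1 / 2"
      using zero by (simp add: X_def W_def numeral_eq_Suc algebra_simps)
    moreover have "\<tau> * \<mu> * d 1 \<ge> 0" using pos nn by simp
    ultimately show ?thesis using nn(1)[of 1] by (simp add: mult.commute)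
  qed
  \<comment> \<open>The n shares \<open>\<tau> / T\<close> add up to at most 1, which after doubling
    contributes the 2 in the exponent.\<close>
  have "2 * (\<Sum>j=2..Suc n. \<gamma> j) \<le> 2 + 2 * T * Max (NN ` {2..n + 1})"
  proof -
    let ?M = "Max (NN ` {2..n + 1})"
    have le: "NN j \<le> ?M" if "j \<in> {2..Suc n}" for j using that by (intro Max_ge) auto
    have "NN 2 \<le> ?M" using n by (intro le) auto
    then have M0: "?M \<ge> 0" using NN0[of 2] by linarith
    have "(\<Sum>j=2..Suc n. \<gamma> j) \<le> (\<Sum>j=2..Suc n. \<tau> * (1 / T + ?M))"
      unfolding \<gamma>_def using le pos by (intro sum_mono mult_left_mono add_left_mono) auto
    also have "\<dots> = real n * \<tau> * (1 / T + ?M)" by simp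
    also have "\<dots> \<le> T * (1 / T + ?M)" using n(2) M0 pos by (intro mult_right_mono) auto
    also have "\<dots> = 1 + T * ?M" using pos by (simp add: distrib_left)
    finally show ?thesis by (simp add: algebra_simps)
  qed
  then have "exp (2 * (\<Sum>j=2..Suc n. \<gamma> j)) * (X 1 + (\<Sum>m=1..n. \<tau> * r m)) \<le>
      exp (2 + 2 * T * Max (NN ` {2..n + 1})) * (q 1 + 4 * a 1 + \<mu> * \<tau> * d 1 + \<tau> * (\<Sum>m=1..n. r m))"
    using X1 aX[of 1] nn(1)[of 1] nn(5) pos
    by (intro mult_mono add_mono) (auto simp: sum_distrib_left intro!: sum_nonneg add_nonneg_nonneg)
  moreover have "a (n + 1) + (\<Sum>j=2..n + 1. \<nu> * \<tau> * g j) + \<mu> * (\<Sum>j=2..n + 1. \<tau> * d j) \<le> X (Suc n)"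
  proof -
    have "(\<Sum>j=2..Suc n. \<tau> * \<nu> * g j + \<tau> * \<mu> * d j) = (\<Sum>j=2..n + 1. \<nu> * \<tau> * g j) + \<mu> * (\<Sum>j=2..n + 1. \<tau> * d j)"
      unfolding sum_distrib_left sum.distrib[symmetric] by (intro sum.cong) (auto simp: algebra_simps)
    then show ?thesis using nn(6)[of "n + 1"] qW[of "n + 1"] by (simp only: X_def Suc_eq_plus1)
  qed
  ultimately show ?thesis using G by linarith
qed

subsection \<open>The convective term\<close>

lemma bounded_bilinear_matrix_vector_mult:
  "bounded_bilinear ((*v) :: real^'n::finite^'m::finite \<Rightarrow> real^'n \<Rightarrow> real^'m)"
proof
  show "\<exists>K. \<forall>(A :: real^'n^'m) w. norm (A *v w) \<le> norm A * norm w * K"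
    using norm_matrix_vector_le by (intro exI[of _ 1]) auto
qed (auto simp: matrix_vector_mult_add_rdistrib matrix_vector_right_distrib scaleR_matrix_vector_assoc matrix_vector_mult_scaleR)

context bounded_open_set
begin

lemma matrix_vector_measurable:
  fixes A :: "real^'d \<Rightarrow> real^'d^'d" and a :: "real^'d \<Rightarrow> real^'d"
  assumes "A \<in> borel_measurable (lebesgue_on \<Omega>)" "a \<in> borel_measurable (lebesgue_on \<Omega>)"
  shows "(\<lambda>x. A x *v a x) \<in> borel_measurable (lebesgue_on \<Omega>)"
  using assms
  by (rule borel_measurable_continuous_Pair)
     (intro bounded_bilinear.continuous_on[OF bounded_bilinear_matrix_vector_mult] continuous_intros)

lemma matrix_vector_L2:
  fixes A :: "real^'d \<Rightarrow> real^'d^'d" and a :: "real^'d \<Rightarrow> real^'d"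
  shows "A \<in> L2 \<Longrightarrow> a \<in> Li \<Longrightarrow> (\<lambda>x. A x *v a x) \<in> L2"
    and "A \<in> L2 \<Longrightarrow> a \<in> Li \<Longrightarrow> n2 (\<lambda>x. A x *v a x) \<le> ni a * n2 A"
    and "A \<in> Li \<Longrightarrow> a \<in> L2 \<Longrightarrow> (\<lambda>x. A x *v a x) \<in> L2"
    and "A \<in> Li \<Longrightarrow> a \<in> L2 \<Longrightarrow> n2 (\<lambda>x. A x *v a x) \<le> ni A * n2 a"
proof -
  {
    assume A: "A \<in> L2" and a: "a \<in> Li"
    have m: "(\<lambda>x. A x *v a x) \<in> borel_measurable (lebesgue_on \<Omega>)"
      using A a by (intro matrix_vector_measurable) (auto simp: Lp_space_2_iff Linf_iff)
    have ae: "AE x in lebesgue_on \<Omega>. norm (A x *v a x) \<le> ni a * norm (A x)"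
      using Linf_AE[OF a]
    proof eventually_elim
      case (elim x)
      have "norm (A x *v a x) \<le> norm (A x) * norm (a x)" by (rule norm_matrix_vector_le)
      also have "\<dots> \<le> norm (A x) * ni a" using elim by (intro mult_left_mono) auto
      finally show ?case by (simp add: mult.commute)
    qed
    show "(\<lambda>x. A x *v a x) \<in> L2" "n2 (\<lambda>x. A x *v a x) \<le> ni a * n2 A"
      using L2_norm_mono[OF A m Linf_norm_nonneg ae] by auto
  }
  {
    assume A: "A \<in> Li" and a: "a \<in> L2"
    have m: "(\<lambda>x. A x *v a x) \<in> borel_measurable (lebesgue_on \<Omega>)"
      using A a by (intro matrix_vector_measurable) (auto simp: Lp_space_2_iff Linf_iff)
    have ae: "AE x in lebesgue_on \<Omega>. norm (A x *v a x) \<le> ni A * norm (a x)"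
      using Linf_AE[OF A]
    proof eventually_elim
      case (elim x)
      have "norm (A x *v a x) \<le> norm (A x) * norm (a x)" by (rule norm_matrix_vector_le)
      also have "\<dots> \<le> ni A * norm (a x)" using elim by (intro mult_right_mono) auto
      finally show ?case .
    qed
    show "(\<lambda>x. A x *v a x) \<in> L2" "n2 (\<lambda>x. A x *v a x) \<le> ni A * n2 a"
      using L2_norm_mono[OF a m Linf_norm_nonneg ae] by auto
  }
qed

lemma L2_scaleR_right_Li:
  fixes f :: "real^'d \<Rightarrow> real" and g :: "real^'d \<Rightarrow> 'b::euclidean_space"
  assumes f: "f \<in> L2" and g: "g \<in> Li"
  shows "(\<lambda>x. f x *\<^sub>R g x) \<in> L2" "n2 (\<lambda>x. f x *\<^sub>R g x) \<le> ni g * n2 f"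
proof -
  have ae: "AE x in lebesgue_on \<Omega>. norm (f x *\<^sub>R g x) \<le> ni g * norm (f x)"
    using Linf_AE[OF g]
  proof eventually_elim
    case (elim x)
    have "\<bar>f x\<bar> * norm (g x) \<le> \<bar>f x\<bar> * ni g" using elim by (intro mult_left_mono) auto
    then show ?case by (simp add: mult.commute)
  qed
  have m: "(\<lambda>x. f x *\<^sub>R g x) \<in> borel_measurable (lebesgue_on \<Omega>)" using f g by (auto simp: Linf_iff Lp_space_2_iff)
  show "(\<lambda>x. f x *\<^sub>R g x) \<in> L2" "n2 (\<lambda>x. f x *\<^sub>R g x) \<le> ni g * n2 f"
    using L2_norm_mono[OF f m Linf_norm_nonneg ae] by auto
qed

lemma Li_diff:
  fixes f g :: "real^'d \<Rightarrow> 'b::euclidean_space"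
  assumes "f \<in> Li" "g \<in> Li" shows "(\<lambda>x. f x - g x) \<in> Li" "ni (\<lambda>x. f x - g x) \<le> ni f + ni g"
proof -
  have m: "(\<lambda>x. f x - g x) \<in> borel_measurable (lebesgue_on \<Omega>)" using assms by (auto simp: Linf_iff)
  have ae: "AE x in lebesgue_on \<Omega>. norm (f x - g x) \<le> ni f + ni g"
    using Linf_AE[OF assms(1)] Linf_AE[OF assms(2)]
    by eventually_elim (meson add_mono norm_triangle_ineq4 order_trans)
  show "(\<lambda>x. f x - g x) \<in> Li" "ni (\<lambda>x. f x - g x) \<le> ni f + ni g"
    using Linf_le[OF m ae] Linf_norm_nonneg by (auto intro!: add_nonneg_nonneg)
qed

lemma Li_scaleR:
  fixes f :: "real^'d \<Rightarrow> 'b::euclidean_space"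
  assumes "f \<in> Li" shows "(\<lambda>x. c *\<^sub>R f x) \<in> Li" "ni (\<lambda>x. c *\<^sub>R f x) \<le> \<bar>c\<bar> * ni f"
proof -
  have m: "(\<lambda>x. c *\<^sub>R f x) \<in> borel_measurable (lebesgue_on \<Omega>)" using assms by (auto simp: Linf_iff)
  have ae: "AE x in lebesgue_on \<Omega>. norm (c *\<^sub>R f x) \<le> \<bar>c\<bar> * ni f"
    using Linf_AE[OF assms(1)] by eventually_elim (simp add: mult_left_mono)
  show "(\<lambda>x. c *\<^sub>R f x) \<in> Li" "ni (\<lambda>x. c *\<^sub>R f x) \<le> \<bar>c\<bar> * ni f"
    using Linf_le[OF m ae] Linf_norm_nonneg[of \<Omega> f] by auto
qed

lemma grad_Li:
  assumes v: "v \<in> H1" and "\<And>j. D j v \<in> Li"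
  shows "grad \<Omega> v \<in> Li" "ni (grad \<Omega> v) \<le> (\<Sum>j\<in>UNIV. ni (D j v))"
proof -
  have m: "grad \<Omega> v \<in> borel_measurable (lebesgue_on \<Omega>)" using grad_L2[OF v] by (rule Lp_space_2_measurable)
  have "AE x in lebesgue_on \<Omega>. \<forall>j. norm (D j v x) \<le> ni (D j v)"
    using Linf_AE[OF assms(2)] by (simp add: AE_all_countable)
  then have ae: "AE x in lebesgue_on \<Omega>. norm (grad \<Omega> v x) \<le> (\<Sum>j\<in>UNIV. ni (D j v))"
    by eventually_elim (rule order_trans[OF norm_grad_le sum_mono], simp)
  show "grad \<Omega> v \<in> Li" "ni (grad \<Omega> v) \<le> (\<Sum>j\<in>UNIV. ni (D j v))"
    using Linf_le[OF m ae] by (auto intro!: sum_nonneg Linf_norm_nonneg)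
qed

text \<open>Common regularity class of the exact velocity and of the discrete ones, on which every
  term of the trilinear form is square integrable.\<close>

definition W1i :: "(real^'d \<Rightarrow> real^'d) set" where
  "W1i = {v \<in> H1. v \<in> Li \<and> (\<forall>j. D j v \<in> Li)}"

lemma W1iD: "v \<in> W1i \<Longrightarrow> v \<in> H1" "v \<in> W1i \<Longrightarrow> v \<in> Li" "v \<in> W1i \<Longrightarrow> D j v \<in> Li" "v \<in> W1i \<Longrightarrow> v \<in> L2"
  "v \<in> W1i \<Longrightarrow> grad \<Omega> v \<in> L2" "v \<in> W1i \<Longrightarrow> grad \<Omega> v \<in> Li" "v \<in> W1i \<Longrightarrow> divg \<Omega> v \<in> L2"
  using H1_L2 grad_L2 divg_L2 grad_Li(1) by (auto simp: W1i_def)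

lemma conv_form_L2:
  assumes "a \<in> W1i" "v \<in> W1i"
  shows "(\<lambda>x. grad \<Omega> v x *v a x) \<in> L2" "(\<lambda>x. divg \<Omega> a x *\<^sub>R v x) \<in> L2"
  using matrix_vector_L2(1)[OF W1iD(5)[OF assms(2)] W1iD(2)[OF assms(1)]]
    L2_scaleR_right_Li(1)[OF W1iD(7)[OF assms(1)] W1iD(2)[OF assms(2)]] by auto

lemma conv_form_eq:
  assumes "a \<in> W1i" "v \<in> W1i" "w \<in> L2"
  shows "conv_form \<Omega> a v w = ip (\<lambda>x. grad \<Omega> v x *v a x) w + (1/2) * ip (\<lambda>x. divg \<Omega> a x *\<^sub>R v x) w"
proof -
  have "conv_form \<Omega> a v w = ip (\<lambda>x. grad \<Omega> v x *v a x + (1/2) *\<^sub>R (divg \<Omega> a x *\<^sub>R v x)) w"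
    by (simp add: conv_form_def)
  also have "\<dots> = ip (\<lambda>x. grad \<Omega> v x *v a x) w + ip (\<lambda>x. (1/2) *\<^sub>R (divg \<Omega> a x *\<^sub>R v x)) w"
    by (rule L2_inner_add_left[OF conv_form_L2(1)[OF assms(1,2)] L2_scaleR[OF conv_form_L2(2)[OF assms(1,2)]] assms(3)])
  finally show ?thesis by (simp only: L2_inner_scaleR_left)
qed

lemma conv_form_diff_left:
  assumes "a \<in> W1i" "b \<in> W1i" "(\<lambda>x. a x - b x) \<in> W1i" "v \<in> W1i" "w \<in> L2"
  shows "conv_form \<Omega> (\<lambda>x. a x - b x) v w = conv_form \<Omega> a v w - conv_form \<Omega> b v w"
proof -
  have "ip (\<lambda>x. grad \<Omega> v x *v (a x - b x)) w = ip (\<lambda>x. grad \<Omega> v x *v a x) w - ip (\<lambda>x. grad \<Omega> v x *v b x) w"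
    using L2_inner_diff_left[OF conv_form_L2(1)[OF assms(1,4)] conv_form_L2(1)[OF assms(2,4)] assms(5)]
    by (simp add: matrix_vector_mult_diff_distrib)
  moreover have "ip (\<lambda>x. divg \<Omega> (\<lambda>x. a x - b x) x *\<^sub>R v x) w = ip (\<lambda>x. divg \<Omega> a x *\<^sub>R v x - divg \<Omega> b x *\<^sub>R v x) w"
  proof (rule ip_cong[OF conv_form_L2(2)[OF assms(3,4)] assms(5)])
    show "AE x in lebesgue_on \<Omega>. divg \<Omega> (\<lambda>x. a x - b x) x *\<^sub>R v x = divg \<Omega> a x *\<^sub>R v x - divg \<Omega> b x *\<^sub>R v x"
      using divg_diff[OF W1iD(1)[OF assms(1)] W1iD(1)[OF assms(2)]] by eventually_elim (simp add: scaleR_left_diff_distrib)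
  qed
  ultimately show ?thesis
    using assms by (simp add: conv_form_eq L2_inner_diff_left conv_form_L2 algebra_simps)
qed

lemma conv_form_diff_right:
  assumes "a \<in> W1i" "v \<in> W1i" "v' \<in> W1i" "(\<lambda>x. v x - v' x) \<in> W1i" "w \<in> L2"
  shows "conv_form \<Omega> a (\<lambda>x. v x - v' x) w = conv_form \<Omega> a v w - conv_form \<Omega> a v' w"
proof -
  have "ip (\<lambda>x. grad \<Omega> (\<lambda>x. v x - v' x) x *v a x) w = ip (\<lambda>x. grad \<Omega> v x *v a x - grad \<Omega> v' x *v a x) w"
  proof (rule ip_cong[OF conv_form_L2(1)[OF assms(1,4)] assms(5)])
    show "AE x in lebesgue_on \<Omega>. grad \<Omega> (\<lambda>x. v x - v' x) x *v a x = grad \<Omega> v x *v a x - grad \<Omega> v' x *v a x"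
      using grad_diff[OF W1iD(1)[OF assms(2)] W1iD(1)[OF assms(3)]]
      by eventually_elim (simp add: matrix_vector_mult_diff_rdistrib)
  qed
  moreover have "ip (\<lambda>x. divg \<Omega> a x *\<^sub>R (v x - v' x)) w = ip (\<lambda>x. divg \<Omega> a x *\<^sub>R v x) w - ip (\<lambda>x. divg \<Omega> a x *\<^sub>R v' x) w"
    using L2_inner_diff_left[OF conv_form_L2(2)[OF assms(1,2)] conv_form_L2(2)[OF assms(1,3)] assms(5)]
    by (simp add: scaleR_right_diff_distrib)
  ultimately show ?thesis
    using assms by (simp add: conv_form_eq L2_inner_diff_left conv_form_L2 algebra_simps)
qed

text \<open>The half divergence term is exactly what integration by parts leaves over when both
  arguments equal \<open>v\<close>.\<close>

lemma conv_form_skew: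
  assumes "a \<in> H10_space \<Omega>" "a \<in> W1i" "v \<in> H10_space \<Omega>" "v \<in> W1i"
  shows "conv_form \<Omega> a v v = 0"
  using transport_by_parts[OF W1iD(1)[OF assms(4)] assms(3) W1iD(2,3)[OF assms(4)] assms(1) W1iD(2)[OF assms(2)]]
  by (simp add: conv_form_eq[OF assms(2,4) W1iD(4)[OF assms(4)]])

text \<open>Both sup norms fall on the transported argument. With \<open>v\<close> the projection
  and \<open>a\<close> the extrapolated error, this is the origin of the norms of \<open>s\<close>
  and its gradient in the stability coefficients; the divergence is left to the grad-div
  term.\<close>

lemma conv_form_bound:
  assumes "a \<in> W1i" "v \<in> W1i" "w \<in> L2"
  shows "\<bar>conv_form \<Omega> a v w\<bar> \<le> (ni (grad \<Omega> v) * n2 a + (1/2) * (ni v * n2 (divg \<Omega> a))) * n2 w"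
proof -
  have "\<bar>ip (\<lambda>x. grad \<Omega> v x *v a x) w\<bar> \<le> ni (grad \<Omega> v) * n2 a * n2 w"
    using L2_Cauchy_Schwarz[OF conv_form_L2(1)[OF assms(1,2)] assms(3)]
      mult_right_mono[OF matrix_vector_L2(4)[OF W1iD(6)[OF assms(2)] W1iD(4)[OF assms(1)]] L2_norm_nonneg[of \<Omega> w]]
    by linarith
  moreover have "\<bar>ip (\<lambda>x. divg \<Omega> a x *\<^sub>R v x) w\<bar> \<le> ni v * n2 (divg \<Omega> a) * n2 w"
    using L2_Cauchy_Schwarz[OF conv_form_L2(2)[OF assms(1,2)] assms(3)]
      mult_right_mono[OF L2_scaleR_right_Li(2)[OF W1iD(7)[OF assms(1)] W1iD(2)[OF assms(2)]] L2_norm_nonneg[of \<Omega> w]]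
    by linarith
  ultimately show ?thesis by (simp add: conv_form_eq[OF assms] algebra_simps abs_le_iff)
qed

text \<open>Dahlquist's G-stability in explicit form: the right-hand side exceeds the left by
  exactly the squared norm of x - 2 y + z, which is discarded.\<close>

lemma BDF2_energy:
  fixes x y z :: "real^'d \<Rightarrow> 'b::euclidean_space"
  assumes "x \<in> L2" "y \<in> L2" "z \<in> L2"
  shows "(n2 x)\<^sup>2 + (n2 (\<lambda>t. 2 *\<^sub>R x t - y t))\<^sup>2 - (n2 y)\<^sup>2 - (n2 (\<lambda>t. 2 *\<^sub>R y t - z t))\<^sup>2
    \<le> 4 * ip (\<lambda>t. (3/2) *\<^sub>R x t - 2 *\<^sub>R y t + (1/2) *\<^sub>R z t) x"
proof -
  note i = L2_inner_integrable
  have c: "ip y x = ip x y" "ip z x = ip x z" "ip z y = ip y z" by (simp_all add: L2_inner_commute)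
  have lin: "ip (\<lambda>t. a *\<^sub>R x t + b *\<^sub>R y t + c *\<^sub>R z t) w = a * ip x w + b * ip y w + c * ip z w"
    if "w \<in> L2" for a b c and w :: "real^'d \<Rightarrow> 'b"
    using assms that by (simp add: L2_inner_add_left L2_inner_scaleR_left L2_add L2_scaleR)
  have sq: "(n2 (\<lambda>t. a *\<^sub>R x t + b *\<^sub>R y t + c *\<^sub>R z t))\<^sup>2 =
     a * (a * ip x x + b * ip x y + c * ip x z) + b * (a * ip x y + b * ip y y + c * ip y z) + c * (a * ip x z + b * ip y z + c * ip z z)" for a b c
  proof -
    let ?w = "\<lambda>t. a *\<^sub>R x t + b *\<^sub>R y t + c *\<^sub>R z t"
    have w: "?w \<in> L2" using assms by (intro L2_add L2_scaleR)
    have "(n2 ?w)\<^sup>2 = a * ip ?w x + b * ip ?w y + c * ip ?w z"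
      by (simp add: L2_norm_sq_inner lin[OF w] L2_inner_commute[of \<Omega> _ ?w])
    then show ?thesis by (simp add: lin[OF assms(1)] lin[OF assms(2)] lin[OF assms(3)] c)
  qed
  have "(n2 (\<lambda>t. 2 *\<^sub>R x t - y t))\<^sup>2 = 4 * ip x x - 4 * ip x y + ip y y"
    using sq[of 2 "-1" 0] by simp
  moreover have "(n2 (\<lambda>t. 2 *\<^sub>R y t - z t))\<^sup>2 = 4 * ip y y - 4 * ip y z + ip z z"
    using sq[of 0 2 "-1"] by simp
  moreover have "0 \<le> ip x x + 4 * ip y y + ip z z - 4 * ip x y + 2 * ip x z - 4 * ip y z"
  proof -
    have "0 \<le> (n2 (\<lambda>t. 1 *\<^sub>R x t + (-2) *\<^sub>R y t + 1 *\<^sub>R z t))\<^sup>2" by (rule zero_le_power2)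
    then show ?thesis unfolding sq by (simp add: algebra_simps)
  qed
  moreover have "ip (\<lambda>t. (3/2) *\<^sub>R x t - 2 *\<^sub>R y t + (1/2) *\<^sub>R z t) x = 3/2 * ip x x - 2 * ip x y + 1/2 * ip x z"
    using lin[OF assms(1), of "3/2" "-2" "1/2"] by (simp add: c)
  ultimately show ?thesis by (simp add: L2_norm_sq_inner)
qed

end

subsection \<open>The error of the semi-implicit scheme\<close>

text \<open>A single mesh size is fixed and the mesh has disappeared: what is kept of the piecewise
  polynomials is that discrete velocities and their gradients are bounded,
  \<open>W1i\<close>.\<close>

locale semi_implicit_error = bounded_open_set \<Omega>
  for \<Omega> :: "(real^'d::finite) set" +
  fixes Vh :: "(real^'d \<Rightarrow> real^'d) set" and Qh :: "(real^'d \<Rightarrow> real) set"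
    and T \<nu> \<mu> :: real and f u ut :: "real \<Rightarrow> real^'d \<Rightarrow> real^'d" and p \<pi> :: "real \<Rightarrow> real^'d \<Rightarrow> real"
    and s :: "real \<Rightarrow> real^'d \<Rightarrow> real^'d" and lh :: "real \<Rightarrow> real^'d \<Rightarrow> real"
    and N :: nat and uh :: "nat \<Rightarrow> real^'d \<Rightarrow> real^'d" and ph :: "nat \<Rightarrow> real^'d \<Rightarrow> real"
  assumes Vh_subspace: "function_subspace Vh" and Vh_H10: "v \<in> Vh \<Longrightarrow> v \<in> H10_space \<Omega>"
    and Vh_W1i: "v \<in> Vh \<Longrightarrow> v \<in> W1i"
    and Qh_subspace: "function_subspace Qh" and Qh_L2: "q \<in> Qh \<Longrightarrow> q \<in> L2"
    and T_pos: "T > 0" and \<nu>_pos: "\<nu> > 0" and \<mu>_pos: "\<mu> > 0" and N_pos: "N \<ge> 1"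
    and f_L2: "t \<in> {0..T} \<Longrightarrow> f t \<in> L2" and ut_L2: "t \<in> {0..T} \<Longrightarrow> ut t \<in> L2"
    and u_H10: "t \<in> {0..T} \<Longrightarrow> u t \<in> H10_space \<Omega>" and u_W1i: "t \<in> {0..T} \<Longrightarrow> u t \<in> W1i"
    and u_div: "t \<in> {0..T} \<Longrightarrow> AE x in lebesgue_on \<Omega>. divg \<Omega> (u t) x = 0"
    and p_H1: "t \<in> {0..T} \<Longrightarrow> p t \<in> H1"
    and stokes: "t \<in> {0..T} \<Longrightarrow> discrete_stokes \<Omega> \<nu> Vh Qh
        (\<lambda>x. f t x - ut t x - grad \<Omega> (u t) x *v u t x - grad_scalar \<Omega> (p t) x) (s t) (lh t)"
    and \<pi>_Qh: "t \<in> {0..T} \<Longrightarrow> \<pi> t \<in> Qh"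
    and scheme: "semi_implicit_method \<Omega> \<nu> \<mu> Vh Qh f (s 0) (T / real N) N uh ph"
begin

definition "\<tau> = T / real N"
definition "tm j = real j * \<tau>"
definition "sn j = s (tm j)"
definition "e j x = sn j x - uh j x"

lemma \<tau>_pos: "\<tau> > 0" using T_pos N_pos by (simp add: \<tau>_def)

lemma tm_in: "j \<le> N \<Longrightarrow> tm j \<in> {0..T}"
proof -
  assume "j \<le> N"
  then have "real j * \<tau> \<le> real N * \<tau>" using \<tau>_pos by (intro mult_right_mono) auto
  moreover have "real N * \<tau> = T" using N_pos by (simp add: \<tau>_def)
  ultimately show ?thesis using \<tau>_pos by (simp add: tm_def)
qed

lemma Vh_diff: "v \<in> Vh \<Longrightarrow> w \<in> Vh \<Longrightarrow> (\<lambda>x. v x - w x) \<in> Vh"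
proof -
  assume vw: "v \<in> Vh" "w \<in> Vh"
  have add: "\<forall>v\<in>Vh. \<forall>w\<in>Vh. (\<lambda>x. v x + w x) \<in> Vh" and sc: "\<forall>c. \<forall>v\<in>Vh. (\<lambda>x. c *\<^sub>R v x) \<in> Vh"
    using Vh_subspace by (simp_all add: function_subspace_def)
  from add[rule_format, OF vw(1) sc[rule_format, OF vw(2), of "-1"]] show ?thesis by simp
qed

lemma Vh_scale: "v \<in> Vh \<Longrightarrow> (\<lambda>x. c *\<^sub>R v x) \<in> Vh"
  using Vh_subspace unfolding function_subspace_def by blast

lemma Vh_extrap: "v n \<in> Vh \<Longrightarrow> v (n - 1) \<in> Vh \<Longrightarrow> extrap v n \<in> Vh"
  using Vh_diff[OF Vh_scale[of "v n" 2], of "v (n - 1)"] by (simp add: extrap_def[abs_def])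

lemma sn_Vh: "j \<le> N \<Longrightarrow> sn j \<in> Vh"
  using stokes[OF tm_in] by (simp add: sn_def discrete_stokes_def)

lemma uh_0: "uh 0 = sn 0" using scheme by (simp add: semi_implicit_method_def sn_def tm_def)

lemma uh_Vh: "j \<le> N \<Longrightarrow> uh j \<in> Vh"
proof (cases j)
  case 0
  then show "j \<le> N \<Longrightarrow> ?thesis" using uh_0 sn_Vh by simp
next
  case (Suc n)
  then show "j \<le> N \<Longrightarrow> ?thesis" using scheme by (simp add: semi_implicit_method_def)
qed

lemma e_Vh: "j \<le> N \<Longrightarrow> e j \<in> Vh"
  using Vh_diff[OF sn_Vh uh_Vh] by (simp add: e_def[abs_def])

lemma e_0: "e 0 = (\<lambda>x. 0)" by (simp add: e_def[abs_def] uh_0)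

lemma ph_L2: "1 \<le> j \<Longrightarrow> j \<le> N \<Longrightarrow> ph j \<in> Qh"
  using scheme by (cases j) (auto simp: semi_implicit_method_def)

lemma method_eq:
  assumes "m < N" "v \<in> Vh" "q \<in> Qh"
  shows "ip (\<lambda>x. (1 / \<tau>) *\<^sub>R time_diff uh (m + 1) x) v
          + \<nu> * ip (grad \<Omega> (uh (m + 1))) (grad \<Omega> v)
          + (if m = 0 then conv_form \<Omega> (uh 0) (uh 0) v else conv_form \<Omega> (extrap uh m) (uh (m + 1)) v)
          - ip (ph (m + 1)) (divg \<Omega> v) + ip (divg \<Omega> (uh (m + 1))) q
          + \<mu> * ip (divg \<Omega> (uh (m + 1))) (divg \<Omega> v) = ip (f (tm (m + 1))) v"
  using scheme assms unfolding semi_implicit_method_def tm_def \<tau>_def by blast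

lemma divg_sn: "j \<le> N \<Longrightarrow> q \<in> Qh \<Longrightarrow> ip (divg \<Omega> (sn j)) q = 0"
  using stokes[OF tm_in] by (simp add: sn_def discrete_stokes_def)

text \<open>Testing the scheme with zero velocity, once with \<open>q\<close> and once with zero
  pressure, isolates the discrete continuity equation; the initial value inherits it from the Stokes
  projection.\<close>

lemma divg_uh:
  assumes "j \<le> N" "q \<in> Qh" shows "ip (divg \<Omega> (uh j)) q = 0"
proof (cases j)
  case 0
  then show ?thesis using divg_sn assms uh_0 by simp
next
  case (Suc m)
  have z: "(\<lambda>x. 0) \<in> Qh" using Qh_subspace by (simp add: function_subspace_def)
  have v: "(\<lambda>x. 0) \<in> Vh" using Vh_subspace by (simp add: function_subspace_def)
  have "ip (divg \<Omega> (uh (m + 1))) q = ip (divg \<Omega> (uh (m + 1))) (\<lambda>x. 0)"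
    using method_eq[of m _ q, OF _ v assms(2)] method_eq[of m, OF _ v z] Suc assms by auto
  then show ?thesis using Suc by (simp add: L2_inner_def)
qed

lemma divg_e_AE: "j \<le> N \<Longrightarrow> AE x in lebesgue_on \<Omega>. divg \<Omega> (e j) x = divg \<Omega> (sn j) x - divg \<Omega> (uh j) x"
  unfolding e_def[abs_def] using sn_Vh uh_Vh W1iD(1)[OF Vh_W1i] by (intro divg_diff) auto

lemma grad_e_AE: "j \<le> N \<Longrightarrow> AE x in lebesgue_on \<Omega>. grad \<Omega> (e j) x = grad \<Omega> (sn j) x - grad \<Omega> (uh j) x"
  unfolding e_def[abs_def] using sn_Vh uh_Vh W1iD(1)[OF Vh_W1i] by (intro grad_diff) auto

lemmas Vh_facts = W1iD[OF Vh_W1i]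

lemma ip_divg_e:
  assumes j: "j \<le> N" and w: "w \<in> L2"
  shows "ip (divg \<Omega> (e j)) w = ip (divg \<Omega> (sn j)) w - ip (divg \<Omega> (uh j)) w"
  using ip_cong[OF Vh_facts(7)[OF e_Vh[OF j]] w divg_e_AE[OF j]]
    L2_inner_diff_left[OF Vh_facts(7)[OF sn_Vh[OF j]] Vh_facts(7)[OF uh_Vh[OF j]] w] by simp

lemma ip_grad_e:
  assumes j: "j \<le> N" and w: "w \<in> L2"
  shows "ip (grad \<Omega> (e j)) w = ip (grad \<Omega> (sn j)) w - ip (grad \<Omega> (uh j)) w"
  using ip_cong[OF Vh_facts(5)[OF e_Vh[OF j]] w grad_e_AE[OF j]]
    L2_inner_diff_left[OF Vh_facts(5)[OF sn_Vh[OF j]] Vh_facts(5)[OF uh_Vh[OF j]] w] by simp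

lemma divg_e_Qh: "j \<le> N \<Longrightarrow> q \<in> Qh \<Longrightarrow> ip (divg \<Omega> (e j)) q = 0"
  by (simp add: ip_divg_e Qh_L2 divg_sn divg_uh)

lemma time_diff_L2:
  fixes v :: "nat \<Rightarrow> real^'d \<Rightarrow> real^'d"
  assumes "v k \<in> L2" "v (k - 1) \<in> L2" "v (k - 2) \<in> L2" "v 0 \<in> L2" "v 1 \<in> L2"
  shows "time_diff v k \<in> L2"
proof (cases "k = 1")
  case True
  then show ?thesis using L2_diff[OF assms(5,4)] by (simp add: time_diff_def[abs_def])
next
  case False
  then show ?thesis
    using L2_add[OF L2_diff[OF L2_scaleR[OF assms(1), of "3/2"] L2_scaleR[OF assms(2), of 2]] L2_scaleR[OF assms(3), of "1/2"]]
    by (simp add: time_diff_def[abs_def])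
qed

lemma time_diff_e: "time_diff e k = (\<lambda>x. time_diff sn k x - time_diff uh k x)"
  by (auto simp: time_diff_def e_def fun_eq_iff algebra_simps)

text \<open>The discrete Stokes problem is read backwards, as a formula for the forcing. Its viscous
  part is that of \<open>s\<close>, so the comparison with the scheme leaves no viscous
  residual.\<close>

lemma forcing_eq:
  assumes t: "t \<in> {0..T}" and v: "v \<in> Vh"
  shows "ip (f t) v = \<nu> * ip (grad \<Omega> (s t)) (grad \<Omega> v) - ip (divg \<Omega> v) (lh t)
     + ip (ut t) v + ip (\<lambda>x. grad \<Omega> (u t) x *v u t x) v - ip (p t) (divg \<Omega> v)"
proof -
  have c: "(\<lambda>x. grad \<Omega> (u t) x *v u t x) \<in> L2" using conv_form_L2(1)[OF u_W1i[OF t] u_W1i[OF t]] .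
  have g: "grad_scalar \<Omega> (p t) \<in> L2" by (rule grad_scalar_L2[OF p_H1[OF t]])
  have v2: "v \<in> L2" by (rule Vh_facts(4)[OF v])
  have 1: "(\<lambda>x. f t x - ut t x) \<in> L2" by (rule L2_diff[OF f_L2[OF t] ut_L2[OF t]])
  have 2: "(\<lambda>x. f t x - ut t x - grad \<Omega> (u t) x *v u t x) \<in> L2" by (rule L2_diff[OF 1 c])
  have "ip (\<lambda>x. f t x - ut t x - grad \<Omega> (u t) x *v u t x - grad_scalar \<Omega> (p t) x) v
     = ip (f t) v - ip (ut t) v - ip (\<lambda>x. grad \<Omega> (u t) x *v u t x) v - ip (grad_scalar \<Omega> (p t)) v"
    by (simp only: L2_inner_diff_left[OF 2 g v2] L2_inner_diff_left[OF 1 c v2] L2_inner_diff_left[OF f_L2[OF t] ut_L2[OF t] v2])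
  moreover have "ip (grad_scalar \<Omega> (p t)) v = - ip (p t) (divg \<Omega> v)"
    by (rule grad_scalar_by_parts[OF p_H1[OF t] Vh_H10[OF v]])
  moreover have "\<nu> * ip (grad \<Omega> (s t)) (grad \<Omega> v) - ip (divg \<Omega> v) (lh t)
     = ip (\<lambda>x. f t x - ut t x - grad \<Omega> (u t) x *v u t x - grad_scalar \<Omega> (p t) x) v"
    using stokes[OF t] v by (simp add: discrete_stokes_def)
  ultimately show ?thesis by simp
qed

text \<open>The error is split off in the transported argument first, while the transporting field
  is still the full discrete one, so that skew-symmetry removes the resulting term. Only then is the
  transporting field split.\<close>

lemma convection_split:
  assumes m: "m < N" and m1: "m \<ge> 1" and E: "E = e (m + 1)"
  shows "conv_form \<Omega> (extrap uh m) (uh (m + 1)) E = conv_form \<Omega> (extrap sn m) (sn (m + 1)) E - conv_form \<Omega> (extrap e m) (sn (m + 1)) E"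
proof -
  have ne: "e (m + 1) \<in> Vh" "sn (m + 1) \<in> Vh" "uh (m + 1) \<in> Vh" "extrap uh m \<in> Vh" "extrap sn m \<in> Vh" "extrap e m \<in> Vh"
    using m by (auto intro!: Vh_extrap e_Vh sn_Vh uh_Vh)
  have E2: "E \<in> L2" using Vh_facts(4)[OF ne(1)] E by simp
  have u1: "uh (m + 1) = (\<lambda>x. sn (m + 1) x - e (m + 1) x)" by (auto simp: e_def)
  have u2: "extrap uh m = (\<lambda>x. extrap sn m x - extrap e m x)" by (auto simp: e_def extrap_def fun_eq_iff algebra_simps)
  have "conv_form \<Omega> (extrap uh m) (uh (m + 1)) E = conv_form \<Omega> (extrap uh m) (sn (m + 1)) E - conv_form \<Omega> (extrap uh m) (e (m + 1)) E"
    using conv_form_diff_right[OF Vh_W1i[OF ne(4)] Vh_W1i[OF ne(2)] Vh_W1i[OF ne(1)] _ E2] Vh_W1i[OF ne(3)] u1 by simp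
  moreover have "conv_form \<Omega> (extrap uh m) (e (m + 1)) E = 0"
    unfolding E by (rule conv_form_skew[OF Vh_H10[OF ne(4)] Vh_W1i[OF ne(4)] Vh_H10[OF ne(1)] Vh_W1i[OF ne(1)]])
  moreover have "conv_form \<Omega> (extrap uh m) (sn (m + 1)) E = conv_form \<Omega> (extrap sn m) (sn (m + 1)) E - conv_form \<Omega> (extrap e m) (sn (m + 1)) E"
    using conv_form_diff_left[OF Vh_W1i[OF ne(5)] Vh_W1i[OF ne(6)] _ Vh_W1i[OF ne(2)] E2] Vh_W1i[OF ne(4)] u2 by simp
  ultimately show ?thesis by simp
qed

text \<open>The error is discretely divergence-free, hence both discrete pressures drop out and, for
  the same reason, \<pi> may be subtracted from p at no cost. For m = 0 the convective term of the
  scheme is evaluated at the initial value, where the error is zero.\<close>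

lemma error_equation:
  assumes m: "m < N"
  defines "E \<equiv> e (m + 1)" and "k \<equiv> m + 1"
  shows "(1 / \<tau>) * ip (time_diff e k) E + \<nu> * (n2 (grad \<Omega> E))\<^sup>2 + \<mu> * (n2 (divg \<Omega> E))\<^sup>2
      + (if m = 0 then 0 else conv_form \<Omega> (extrap e m) (sn k) E)
    = ip (\<lambda>x. (1 / \<tau>) *\<^sub>R time_diff sn k x - ut (tm k) x) E + \<mu> * ip (divg \<Omega> (sn k)) (divg \<Omega> E)
      + ((if m = 0 then conv_form \<Omega> (sn 0) (sn 0) E else conv_form \<Omega> (extrap sn m) (sn k) E)
         - ip (\<lambda>x. grad \<Omega> (u (tm k)) x *v u (tm k) x) E)
      + ip (\<lambda>x. p (tm k) x - \<pi> (tm k) x) (divg \<Omega> E)"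
proof -
  have kN: "k \<le> N" using m by (simp add: k_def)
  have t: "tm k \<in> {0..T}" by (rule tm_in[OF kN])
  have EV: "E \<in> Vh" unfolding E_def k_def[symmetric] by (rule e_Vh[OF kN])
  have Ek: "E = e k" by (simp add: E_def k_def)
  note EL = Vh_facts[OF EV]
  have dL: "divg \<Omega> E \<in> L2" and gL: "grad \<Omega> E \<in> L2" and E2: "E \<in> L2" using EL by auto
  have z: "(\<lambda>x. 0) \<in> Qh" using Qh_subspace by (simp add: function_subspace_def)
  have V2: "v \<in> Vh \<Longrightarrow> v \<in> L2" for v by (rule Vh_facts(4))
  have tds: "time_diff sn k \<in> L2" using kN N_pos by (intro time_diff_L2 V2 sn_Vh) auto
  have tdu: "time_diff uh k \<in> L2" using kN N_pos by (intro time_diff_L2 V2 uh_Vh) auto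
  have eq: "ip (\<lambda>x. (1 / \<tau>) *\<^sub>R time_diff uh k x) E + \<nu> * ip (grad \<Omega> (uh k)) (grad \<Omega> E)
          + (if m = 0 then conv_form \<Omega> (uh 0) (uh 0) E else conv_form \<Omega> (extrap uh m) (uh k) E)
          - ip (ph k) (divg \<Omega> E) + ip (divg \<Omega> (uh k)) (\<lambda>x. 0)
          + \<mu> * ip (divg \<Omega> (uh k)) (divg \<Omega> E) = ip (f (tm k)) E"
    unfolding k_def by (rule method_eq[OF m EV z])
  have z0: "ip (divg \<Omega> (uh k)) (\<lambda>x. 0) = 0" by (simp add: L2_inner_def)
  have ph0: "ip (ph k) (divg \<Omega> E) = 0"
    using divg_e_Qh[OF kN ph_L2[of k]] kN by (simp add: L2_inner_commute Ek k_def)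
  have lh0: "ip (divg \<Omega> E) (lh (tm k)) = 0"
    using divg_e_Qh[OF kN, of "lh (tm k)"] stokes[OF t] by (simp add: Ek discrete_stokes_def)
  have pi0: "ip (\<lambda>x. p (tm k) x - \<pi> (tm k) x) (divg \<Omega> E) = ip (p (tm k)) (divg \<Omega> E)"
    using L2_inner_diff_left[OF H1_L2[OF p_H1[OF t]] Qh_L2[OF \<pi>_Qh[OF t]] dL] divg_e_Qh[OF kN \<pi>_Qh[OF t]]
    by (simp add: L2_inner_commute Ek)
  have g1: "ip (grad \<Omega> (uh k)) (grad \<Omega> E) = ip (grad \<Omega> (sn k)) (grad \<Omega> E) - (n2 (grad \<Omega> E))\<^sup>2"
    using ip_grad_e[OF kN gL] by (simp add: L2_norm_sq_inner Ek)
  have d1: "ip (divg \<Omega> (uh k)) (divg \<Omega> E) = ip (divg \<Omega> (sn k)) (divg \<Omega> E) - (n2 (divg \<Omega> E))\<^sup>2"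
    using ip_divg_e[OF kN dL] by (simp add: L2_norm_sq_inner Ek)
  have td: "ip (\<lambda>x. (1 / \<tau>) *\<^sub>R time_diff uh k x) E = (1 / \<tau>) * ip (time_diff sn k) E - (1 / \<tau>) * ip (time_diff e k) E"
    by (simp only: L2_inner_scaleR_left time_diff_e L2_inner_diff_left[OF tds tdu E2]) (simp add: algebra_simps)
  have ts: "ip (\<lambda>x. (1 / \<tau>) *\<^sub>R time_diff sn k x - ut (tm k) x) E = (1 / \<tau>) * ip (time_diff sn k) E - ip (ut (tm k)) E"
    by (simp only: L2_inner_diff_left[OF L2_scaleR[OF tds] ut_L2[OF t] E2] L2_inner_scaleR_left)
  have cv: "(if m = 0 then conv_form \<Omega> (uh 0) (uh 0) E else conv_form \<Omega> (extrap uh m) (uh k) E)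
     = (if m = 0 then conv_form \<Omega> (sn 0) (sn 0) E else conv_form \<Omega> (extrap sn m) (sn k) E)
       - (if m = 0 then 0 else conv_form \<Omega> (extrap e m) (sn k) E)"
    using convection_split[OF m, of E] by (auto simp: uh_0 k_def E_def)
  have gs: "grad \<Omega> (s (tm k)) = grad \<Omega> (sn k)" by (simp add: sn_def)
  show ?thesis
    using eq forcing_eq[OF t EV] unfolding z0 ph0 lh0 pi0 g1 d1 td ts cv gs
    by (simp add: algebra_simps)
qed

section \<open>Residuals and the energy inequality of a single step\<close>

definition "a_err j = (n2 (e j))\<^sup>2"
definition "d_err j = (n2 (divg \<Omega> (e j)))\<^sup>2"
definition "g_err j = (n2 (grad \<Omega> (e j)))\<^sup>2"
definition "q_err j = a_err j + (n2 (extrap e j))\<^sup>2"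

text \<open>Here \<delta> is the projection error in the first-order norm, W bounds \<open>u\<close>
  and its derivatives, and c1 W bounds \<open>s\<close> and its gradient, all uniformly in time.
  Kept abstract, they separate these estimates from powers of h.\<close>

context
  fixes \<delta> W c1 :: real
  assumes \<delta>: "t \<in> {0..T} \<Longrightarrow> H_norm 1 \<Omega> (\<lambda>x. u t x - s t x) \<le> \<delta>"
    and W: "t \<in> {0..T} \<Longrightarrow> ni (u t) \<le> W" "t \<in> {0..T} \<Longrightarrow> ni (D j (u t)) \<le> W"
    and c1: "t \<in> {0..T} \<Longrightarrow> ni (s t) \<le> c1 * W" "t \<in> {0..T} \<Longrightarrow> ni (grad \<Omega> (s t)) \<le> c1 * W"
begin

lemma W_nonneg: "W \<ge> 0" and \<delta>_nonneg: "\<delta> \<ge> 0" and c1W_nonneg: "c1 * W \<ge> 0"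
proof -
  have 0: "0 \<in> {0..T}" using T_pos by simp
  show "W \<ge> 0" using W(1)[OF 0] Linf_norm_nonneg[of \<Omega> "u 0"] by linarith
  show "\<delta> \<ge> 0" using \<delta>[OF 0] H_norm_nonneg[of 1 \<Omega> "\<lambda>x. u 0 x - s 0 x"] by linarith
  show "c1 * W \<ge> 0" using c1(1)[OF 0] Linf_norm_nonneg[of \<Omega> "s 0"] by linarith
qed

lemma s_Vh: "t \<in> {0..T} \<Longrightarrow> s t \<in> Vh"
  using stokes by (simp add: discrete_stokes_def)

lemma us_H1: "t \<in> {0..T} \<Longrightarrow> (\<lambda>x. u t x - s t x) \<in> H1"
  by (rule H_diff[OF W1iD(1)[OF u_W1i] Vh_facts(1)[OF s_Vh]])

text \<open>The velocity is divergence-free, so the divergence of \<open>s t\<close> is, up to sign,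
  that of the projection error and just as small.\<close>

lemma us_bounds:
  assumes t: "t \<in> {0..T}"
  shows "n2 (\<lambda>x. u t x - s t x) \<le> \<delta>" "n2 (grad \<Omega> (\<lambda>x. u t x - s t x)) \<le> real CARD('d) * \<delta>"
    "n2 (divg \<Omega> (s t)) \<le> real CARD('d) * \<delta>"
proof -
  show "n2 (\<lambda>x. u t x - s t x) \<le> \<delta>" using L2_le_H_norm[OF us_H1[OF t]] \<delta>[OF t] by linarith
  have d: "real CARD('d) * H_norm 1 \<Omega> (\<lambda>x. u t x - s t x) \<le> real CARD('d) * \<delta>" using \<delta>[OF t] by (intro mult_left_mono) auto
  show "n2 (grad \<Omega> (\<lambda>x. u t x - s t x)) \<le> real CARD('d) * \<delta>" using n2_grad_le[OF us_H1[OF t]] d by linarith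
  have ae: "AE x in lebesgue_on \<Omega>. divg \<Omega> (\<lambda>x. u t x - s t x) x = (-1) *\<^sub>R divg \<Omega> (s t) x"
    using divg_diff[OF W1iD(1)[OF u_W1i[OF t]] Vh_facts(1)[OF s_Vh[OF t]]] u_div[OF t] by eventually_elim simp
  have "n2 (\<lambda>x. (-1) *\<^sub>R divg \<Omega> (s t) x) = n2 (divg \<Omega> (\<lambda>x. u t x - s t x))"
    by (rule L2_cong(2)[OF divg_L2[OF us_H1[OF t]] ae])
  then have "n2 (divg \<Omega> (s t)) = n2 (divg \<Omega> (\<lambda>x. u t x - s t x))" by (simp add: L2_norm_scaleR[of \<Omega> "-1", simplified])
  then show "n2 (divg \<Omega> (s t)) \<le> real CARD('d) * \<delta>" using n2_divg_le[OF us_H1[OF t]] d by linarith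
qed

lemma grad_u_bound: "t \<in> {0..T} \<Longrightarrow> ni (grad \<Omega> (u t)) \<le> real CARD('d) * W"
  using grad_Li(2)[OF W1iD(1,3)[OF u_W1i], of t] sum_mono[of UNIV "\<lambda>j. ni (D j (u t))" "\<lambda>_. W"] W(2) by fastforce

text \<open>The defect splits into the gradient of \<open>s t\<close> acting on a - b, half the
  divergence of \<open>a\<close> times \<open>s t\<close>, and the gradient of the projection error
  acting on \<open>b\<close>; each is small in one factor and bounded in the other. The factors 3
  leave room for the extrapolation weights 2 + 1.\<close>

lemma convection_consistency:
  assumes t: "t \<in> {0..T}" and a: "a \<in> W1i" and b: "b \<in> L2" "b \<in> Li" and w: "w \<in> L2"
    and ab: "n2 (\<lambda>x. a x - b x) \<le> 3 * \<delta>" and da: "n2 (divg \<Omega> a) \<le> 3 * real CARD('d) * \<delta>" and nb: "ni b \<le> 3 * W"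
  shows "\<bar>conv_form \<Omega> a (s t) w - ip (\<lambda>x. grad \<Omega> (u t) x *v b x) w\<bar>
     \<le> (3 * c1 + 3/2 * real CARD('d) * c1 + 3 * real CARD('d)) * W * \<delta> * n2 w"
proof -
  have sV: "s t \<in> W1i" using Vh_W1i[OF s_Vh[OF t]] .
  have gs: "grad \<Omega> (s t) \<in> Li" "grad \<Omega> (s t) \<in> L2" and gu: "grad \<Omega> (u t) \<in> L2" using W1iD[OF sV] W1iD[OF u_W1i[OF t]] by auto
  have gus: "grad \<Omega> (\<lambda>x. u t x - s t x) \<in> L2" by (rule grad_L2[OF us_H1[OF t]])
  have ab2: "(\<lambda>x. a x - b x) \<in> L2" by (rule L2_diff[OF W1iD(4)[OF a] b(1)])
  have A: "(\<lambda>x. grad \<Omega> (s t) x *v (a x - b x)) \<in> L2" by (rule matrix_vector_L2(3)[OF gs(1) ab2])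
  have sb: "(\<lambda>x. grad \<Omega> (s t) x *v b x) \<in> L2" by (rule matrix_vector_L2(3)[OF gs(1) b(1)])
  have ub: "(\<lambda>x. grad \<Omega> (u t) x *v b x) \<in> L2" by (rule matrix_vector_L2(1)[OF gu b(2)])
  have usb: "(\<lambda>x. grad \<Omega> (\<lambda>x. u t x - s t x) x *v b x) \<in> L2" by (rule matrix_vector_L2(1)[OF gus b(2)])
  have 1: "ip (\<lambda>x. grad \<Omega> (s t) x *v a x) w = ip (\<lambda>x. grad \<Omega> (s t) x *v (a x - b x)) w + ip (\<lambda>x. grad \<Omega> (s t) x *v b x) w"
    using L2_inner_add_left[OF A sb w] by (simp add: matrix_vector_mult_diff_distrib)
  have 2: "ip (\<lambda>x. grad \<Omega> (\<lambda>x. u t x - s t x) x *v b x) w = ip (\<lambda>x. grad \<Omega> (u t) x *v b x) w - ip (\<lambda>x. grad \<Omega> (s t) x *v b x) w"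
  proof -
    have "AE x in lebesgue_on \<Omega>. grad \<Omega> (\<lambda>x. u t x - s t x) x *v b x = grad \<Omega> (u t) x *v b x - grad \<Omega> (s t) x *v b x"
      using grad_diff[OF W1iD(1)[OF u_W1i[OF t]] W1iD(1)[OF sV]]
      by eventually_elim (simp add: matrix_vector_mult_diff_rdistrib)
    from ip_cong[OF usb w this] show ?thesis by (simp add: L2_inner_diff_left[OF ub sb w])
  qed
  have wn: "n2 w \<ge> 0" by simp
  have b1: "\<bar>ip (\<lambda>x. grad \<Omega> (s t) x *v (a x - b x)) w\<bar> \<le> c1 * W * (3 * \<delta>) * n2 w"
  proof -
    have "n2 (\<lambda>x. grad \<Omega> (s t) x *v (a x - b x)) \<le> ni (grad \<Omega> (s t)) * n2 (\<lambda>x. a x - b x)" by (rule matrix_vector_L2(4)[OF gs(1) ab2])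
    also have "\<dots> \<le> c1 * W * (3 * \<delta>)" using c1(2)[OF t] ab c1W_nonneg by (intro mult_mono) auto
    finally show ?thesis using L2_Cauchy_Schwarz[OF A w] mult_right_mono[OF _ wn] by (meson order_trans)
  qed
  have b2: "\<bar>ip (\<lambda>x. divg \<Omega> a x *\<^sub>R s t x) w\<bar> \<le> c1 * W * (3 * real CARD('d) * \<delta>) * n2 w"
  proof -
    have "n2 (\<lambda>x. divg \<Omega> a x *\<^sub>R s t x) \<le> ni (s t) * n2 (divg \<Omega> a)" by (rule L2_scaleR_right_Li(2)[OF W1iD(7)[OF a] W1iD(2)[OF sV]])
    also have "\<dots> \<le> c1 * W * (3 * real CARD('d) * \<delta>)" using c1(1)[OF t] da c1W_nonneg by (intro mult_mono) auto
    finally show ?thesis using L2_Cauchy_Schwarz[OF conv_form_L2(2)[OF a sV] w] mult_right_mono[OF _ wn] by (meson order_trans)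
  qed
  have b3: "\<bar>ip (\<lambda>x. grad \<Omega> (\<lambda>x. u t x - s t x) x *v b x) w\<bar> \<le> 3 * W * (real CARD('d) * \<delta>) * n2 w"
  proof -
    have "n2 (\<lambda>x. grad \<Omega> (\<lambda>x. u t x - s t x) x *v b x) \<le> ni b * n2 (grad \<Omega> (\<lambda>x. u t x - s t x))" by (rule matrix_vector_L2(2)[OF gus b(2)])
    also have "\<dots> \<le> 3 * W * (real CARD('d) * \<delta>)" using nb us_bounds(2)[OF t] W_nonneg by (intro mult_mono) auto
    finally show ?thesis using L2_Cauchy_Schwarz[OF usb w] mult_right_mono[OF _ wn] by (meson order_trans)
  qed
  have "conv_form \<Omega> a (s t) w - ip (\<lambda>x. grad \<Omega> (u t) x *v b x) w =
    ip (\<lambda>x. grad \<Omega> (s t) x *v (a x - b x)) w + (1/2) * ip (\<lambda>x. divg \<Omega> a x *\<^sub>R s t x) w - ip (\<lambda>x. grad \<Omega> (\<lambda>x. u t x - s t x) x *v b x) w"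
    by (simp add: conv_form_eq[OF a sV w] 1 2)
  then have "\<bar>conv_form \<Omega> a (s t) w - ip (\<lambda>x. grad \<Omega> (u t) x *v b x) w\<bar> \<le>
     c1 * W * (3 * \<delta>) * n2 w + (1/2) * (c1 * W * (3 * real CARD('d) * \<delta>) * n2 w) + 3 * W * (real CARD('d) * \<delta>) * n2 w"
    using b1 b2 b3 by linarith
  also have "\<dots> = (3 * c1 + 3/2 * real CARD('d) * c1 + 3 * real CARD('d)) * W * \<delta> * n2 w" by (simp add: algebra_simps)
  finally show ?thesis .
qed

definition Cc :: real where "Cc = 3 * c1 + 3/2 * real CARD('d) * c1 + 3 * real CARD('d)"

lemma n2_extrap_le:
  fixes v :: "nat \<Rightarrow> real^'d \<Rightarrow> real^'d"
  assumes "m \<le> N" "\<And>j. j \<le> N \<Longrightarrow> v j \<in> L2"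
  shows "n2 (extrap v m) \<le> 2 * n2 (v m) + n2 (v (m - 1))"
  using L2_norm_triangle_diff[OF L2_scaleR[OF assms(2)[of m], of 2] assms(2)[of "m - 1"]] assms(1)
  by (simp add: extrap_def[abs_def] L2_norm_scaleR)

lemma n2_divg_extrap_le:
  assumes m: "m \<le> N" and v: "\<And>j. j \<le> N \<Longrightarrow> v j \<in> Vh"
  shows "n2 (divg \<Omega> (extrap v m)) \<le> 2 * n2 (divg \<Omega> (v m)) + n2 (divg \<Omega> (v (m - 1)))"
proof -
  have vm: "v m \<in> Vh" "v (m - 1) \<in> Vh" using v m by auto
  note d = Vh_facts(7)[OF vm(1)] Vh_facts(7)[OF vm(2)]
  have "AE x in lebesgue_on \<Omega>. divg \<Omega> (extrap v m) x = divg \<Omega> (\<lambda>x. 2 *\<^sub>R v m x) x - divg \<Omega> (v (m - 1)) x"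
    unfolding extrap_def[abs_def] by (rule divg_diff[OF H_scaleR[OF Vh_facts(1)[OF vm(1)]] Vh_facts(1)[OF vm(2)]])
  then have "AE x in lebesgue_on \<Omega>. 2 *\<^sub>R divg \<Omega> (v m) x - divg \<Omega> (v (m - 1)) x = divg \<Omega> (extrap v m) x"
    using divg_scale[OF Vh_facts(1)[OF vm(1)], of 2] by eventually_elim simp
  from L2_cong(2)[OF L2_diff[OF L2_scaleR[OF d(1)] d(2)] this]
  have "n2 (divg \<Omega> (extrap v m)) = n2 (\<lambda>x. 2 *\<^sub>R divg \<Omega> (v m) x - divg \<Omega> (v (m - 1)) x)" .
  also have "\<dots> \<le> n2 (\<lambda>x. 2 *\<^sub>R divg \<Omega> (v m) x) + n2 (divg \<Omega> (v (m - 1)))"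
    by (rule L2_norm_triangle_diff[OF L2_scaleR[OF d(1)] d(2)])
  finally show ?thesis by (simp only: L2_norm_scaleR)
qed

text \<open>The spatial defect is measured with both transporting fields extrapolated. Replacing the
  extrapolated exact velocity by the one at the new time then costs B, an L2 quantity multiplied by
  the bounded gradient of \<open>u\<close>.\<close>

lemma convection_residual:
  assumes m: "1 \<le> m" "m < N" and w: "w \<in> L2"
    and B: "n2 (\<lambda>x. extrap (\<lambda>j. u (tm j)) m x - u (tm (m + 1)) x) \<le> B"
  shows "\<bar>conv_form \<Omega> (extrap sn m) (sn (m + 1)) w - ip (\<lambda>x. grad \<Omega> (u (tm (m + 1))) x *v u (tm (m + 1)) x) w\<bar>
     \<le> (Cc * W * \<delta> + real CARD('d) * W * B) * n2 w"
proof -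
  let ?un = "\<lambda>j. u (tm j)" and ?t = "tm (m + 1)"
  let ?b = "extrap ?un m"
  have t: "?t \<in> {0..T}" "tm m \<in> {0..T}" "tm (m - 1) \<in> {0..T}" by (rule tm_in, use m in simp)+
  note un = W1iD[OF u_W1i]
  have b2: "?b \<in> L2" unfolding extrap_def[abs_def] by (intro L2_diff L2_scaleR un(4) t)
  have bi: "?b \<in> Li" "ni ?b \<le> 3 * W"
  proof -
    note d = Li_diff[OF Li_scaleR(1)[OF un(2)[OF t(2)], of 2] un(2)[OF t(3)]]
    show "?b \<in> Li" using d(1) by (simp add: extrap_def[abs_def])
    have "ni ?b \<le> ni (\<lambda>x. 2 *\<^sub>R u (tm m) x) + ni (u (tm (m - 1)))" using d(2) by (simp add: extrap_def[abs_def])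
    also have "\<dots> \<le> 3 * W" using Li_scaleR(2)[OF un(2)[OF t(2)], of 2] W(1)[OF t(2)] W(1)[OF t(3)] by simp
    finally show "ni ?b \<le> 3 * W" .
  qed
  have aV: "extrap sn m \<in> Vh" using m by (intro Vh_extrap sn_Vh) auto
  have ab: "n2 (\<lambda>x. extrap sn m x - ?b x) \<le> 3 * \<delta>"
  proof -
    let ?f = "\<lambda>j x. u (tm j) x - s (tm j) x"
    have f2: "?f m \<in> L2" "?f (m - 1) \<in> L2" using H1_L2[OF us_H1[OF t(2)]] H1_L2[OF us_H1[OF t(3)]] by auto
    have "(\<lambda>x. extrap sn m x - ?b x) = (\<lambda>x. ?f (m - 1) x - 2 *\<^sub>R ?f m x)"
      by (auto simp: extrap_def sn_def fun_eq_iff algebra_simps)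
    then have "n2 (\<lambda>x. extrap sn m x - ?b x) \<le> n2 (?f (m - 1)) + 2 * n2 (?f m)"
      using L2_norm_triangle_diff[OF f2(2) L2_scaleR[OF f2(1), of 2]] by (simp add: L2_norm_scaleR)
    then show ?thesis using us_bounds(1)[OF t(2)] us_bounds(1)[OF t(3)] by simp
  qed
  have da: "n2 (divg \<Omega> (extrap sn m)) \<le> 3 * real CARD('d) * \<delta>"
    using n2_divg_extrap_le[of m sn] sn_Vh us_bounds(3)[OF t(2)] us_bounds(3)[OF t(3)] m by (simp add: sn_def)
  have 1: "\<bar>conv_form \<Omega> (extrap sn m) (sn (m + 1)) w - ip (\<lambda>x. grad \<Omega> (u ?t) x *v ?b x) w\<bar> \<le> Cc * W * \<delta> * n2 w"
    using convection_consistency[OF t(1) Vh_W1i[OF aV] b2 bi(1) w ab da bi(2)] by (simp add: sn_def Cc_def)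
  have gu: "grad \<Omega> (u ?t) \<in> Li" by (rule un(6)[OF t(1)])
  have bu: "(\<lambda>x. ?b x - u ?t x) \<in> L2" by (rule L2_diff[OF b2 un(4)[OF t(1)]])
  have 2: "\<bar>ip (\<lambda>x. grad \<Omega> (u ?t) x *v (?b x - u ?t x)) w\<bar> \<le> real CARD('d) * W * B * n2 w"
  proof -
    have "n2 (\<lambda>x. grad \<Omega> (u ?t) x *v (?b x - u ?t x)) \<le> ni (grad \<Omega> (u ?t)) * n2 (\<lambda>x. ?b x - u ?t x)" by (rule matrix_vector_L2(4)[OF gu bu])
    also have "\<dots> \<le> real CARD('d) * W * B" using grad_u_bound[OF t(1)] B W_nonneg by (intro mult_mono) auto
    finally show ?thesis
      using L2_Cauchy_Schwarz[OF matrix_vector_L2(3)[OF gu bu] w] mult_right_mono[OF _ L2_norm_nonneg[of \<Omega> w]] by (meson order_trans)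
  qed
  have 3: "ip (\<lambda>x. grad \<Omega> (u ?t) x *v (?b x - u ?t x)) w = ip (\<lambda>x. grad \<Omega> (u ?t) x *v ?b x) w - ip (\<lambda>x. grad \<Omega> (u ?t) x *v u ?t x) w"
    using L2_inner_diff_left[OF matrix_vector_L2(3)[OF gu b2] matrix_vector_L2(3)[OF gu un(4)[OF t(1)]] w]
    by (simp add: matrix_vector_mult_diff_distrib)
  have "\<bar>conv_form \<Omega> (extrap sn m) (sn (m + 1)) w - ip (\<lambda>x. grad \<Omega> (u ?t) x *v u ?t x) w\<bar>
     \<le> Cc * W * \<delta> * n2 w + real CARD('d) * W * B * n2 w" using 1 2 3 by linarith
  then show ?thesis by (simp add: distrib_right)
qed

text \<open>The Euler step evaluates both arguments of the convective term at time 0, so the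
  increment of \<open>u\<close> occurs twice: as transporting field, where its L2 norm B1 suffices,
  and under the gradient, which is what B2 accounts for.\<close>

lemma convection_residual_first:
  assumes E: "E \<in> Vh" and B1: "n2 (\<lambda>x. u (tm 1) x - u 0 x) \<le> B1"
    and B2: "\<bar>ip (\<lambda>x. u (tm 1) x - u 0 x) (\<lambda>x. grad \<Omega> E x *v u (tm 1) x)\<bar> \<le> B2 * n2 E"
  shows "\<bar>conv_form \<Omega> (sn 0) (sn 0) E - ip (\<lambda>x. grad \<Omega> (u (tm 1)) x *v u (tm 1) x) E\<bar>
     \<le> (Cc * W * \<delta> + real CARD('d) * W * B1 + B2) * n2 E"
proof -
  let ?u0 = "u 0" and ?u1 = "u (tm 1)"
  have t: "0 \<in> {0..T}" "tm 1 \<in> {0..T}" using T_pos tm_in[of 1] N_pos by auto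
  note un = W1iD[OF u_W1i]
  have s0: "s 0 = sn 0" by (simp add: sn_def tm_def)
  have sV: "sn 0 \<in> Vh" by (rule sn_Vh) simp
  have E2: "E \<in> L2" by (rule Vh_facts(4)[OF E])
  have ab: "n2 (\<lambda>x. sn 0 x - ?u0 x) \<le> 3 * \<delta>"
    using us_bounds(1)[OF t(1)] \<delta>_nonneg by (simp add: s0 L2_norm_minus_commute[of \<Omega> ?u0])
  have da: "n2 (divg \<Omega> (sn 0)) \<le> 3 * real CARD('d) * \<delta>"
    using us_bounds(3)[OF t(1)] mult_nonneg_nonneg[OF of_nat_0_le_iff \<delta>_nonneg, of "CARD('d)"] unfolding s0 by linarith
  have "ni ?u0 \<le> 3 * W" using W(1)[OF t(1)] W_nonneg by linarith
  from convection_consistency[OF t(1) Vh_W1i[OF sV] un(4)[OF t(1)] un(2)[OF t(1)] E2 ab da this]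
  have 1: "\<bar>conv_form \<Omega> (sn 0) (sn 0) E - ip (\<lambda>x. grad \<Omega> ?u0 x *v ?u0 x) E\<bar> \<le> Cc * W * \<delta> * n2 E"
    by (simp add: s0 Cc_def)
  have gu: "grad \<Omega> ?u0 \<in> Li" "grad \<Omega> ?u0 \<in> L2" "grad \<Omega> ?u1 \<in> L2" using un(5,6) t by auto
  let ?w = "\<lambda>x. ?u0 x - ?u1 x"
  have wH: "?w \<in> H1" by (rule H_diff[OF un(1)[OF t(1)] un(1)[OF t(2)]])
  have w2: "?w \<in> L2" by (rule H1_L2[OF wH])
  have 2: "\<bar>ip (\<lambda>x. grad \<Omega> ?u0 x *v ?w x) E\<bar> \<le> real CARD('d) * W * B1 * n2 E"
  proof -
    have "n2 (\<lambda>x. grad \<Omega> ?u0 x *v ?w x) \<le> ni (grad \<Omega> ?u0) * n2 ?w" by (rule matrix_vector_L2(4)[OF gu(1) w2])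
    also have "\<dots> \<le> real CARD('d) * W * B1"
      using grad_u_bound[OF t(1)] B1 W_nonneg by (intro mult_mono) (auto simp: L2_norm_minus_commute[of \<Omega> ?u0])
    finally show ?thesis
      using L2_Cauchy_Schwarz[OF matrix_vector_L2(3)[OF gu(1) w2] E2] mult_right_mono[OF _ L2_norm_nonneg[of \<Omega> E]] by (meson order_trans)
  qed
  have gw: "(\<lambda>x. grad \<Omega> ?w x *v ?u1 x) \<in> L2" by (rule matrix_vector_L2(1)[OF grad_L2[OF wH] un(2)[OF t(2)]])
  have c00: "(\<lambda>x. grad \<Omega> ?u0 x *v ?u0 x) \<in> L2" and c01: "(\<lambda>x. grad \<Omega> ?u0 x *v ?u1 x) \<in> L2"
    and c11: "(\<lambda>x. grad \<Omega> ?u1 x *v ?u1 x) \<in> L2"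
    using matrix_vector_L2(1)[OF gu(2) un(2)[OF t(1)]] matrix_vector_L2(1)[OF gu(2) un(2)[OF t(2)]]
      matrix_vector_L2(1)[OF gu(3) un(2)[OF t(2)]] by auto
  have 3: "ip (\<lambda>x. grad \<Omega> ?w x *v ?u1 x) E = ip (\<lambda>x. grad \<Omega> ?u0 x *v ?u1 x) E - ip (\<lambda>x. grad \<Omega> ?u1 x *v ?u1 x) E"
  proof -
    have "AE x in lebesgue_on \<Omega>. grad \<Omega> ?w x *v ?u1 x = grad \<Omega> ?u0 x *v ?u1 x - grad \<Omega> ?u1 x *v ?u1 x"
      using grad_diff[OF un(1)[OF t(1)] un(1)[OF t(2)]] by eventually_elim (simp add: matrix_vector_mult_diff_rdistrib)
    from ip_cong[OF gw E2 this] show ?thesis by (simp only: L2_inner_diff_left[OF c01 c11 E2])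
  qed
  have 4: "ip (\<lambda>x. grad \<Omega> ?u0 x *v ?w x) E = ip (\<lambda>x. grad \<Omega> ?u0 x *v ?u0 x) E - ip (\<lambda>x. grad \<Omega> ?u0 x *v ?u1 x) E"
    using L2_inner_diff_left[OF c00 c01 E2] by (simp add: matrix_vector_mult_diff_distrib)
  \<comment> \<open>As \<open>u\<close> is divergence-free at the first time level, the by-parts
    identity loses its divergence term and the gradient passes to the discrete function
    \<open>E\<close>.\<close>
  have 5: "ip (\<lambda>x. grad \<Omega> ?w x *v ?u1 x) E = ip (\<lambda>x. ?u1 x - ?u0 x) (\<lambda>x. grad \<Omega> E x *v ?u1 x)"
  proof -
    have dv: "AE x in lebesgue_on \<Omega>. (0 :: real^'d) = divg \<Omega> ?u1 x *\<^sub>R E x" using u_div[OF t(2)] by eventually_elim simp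
    have "ip (\<lambda>x. divg \<Omega> ?u1 x *\<^sub>R E x) ?w = 0"
      using ip_cong[OF L2_zero w2 dv] by (simp add: L2_inner_def)
    then have "ip (\<lambda>x. grad \<Omega> E x *v ?u1 x) ?w + ip (\<lambda>x. grad \<Omega> ?w x *v ?u1 x) E = 0"
      using transport_by_parts[OF wH Vh_H10[OF E] Vh_facts(2,3)[OF E] u_H10[OF t(2)] un(2)[OF t(2)]] by simp
    moreover have "ip (\<lambda>x. ?u1 x - ?u0 x) (\<lambda>x. grad \<Omega> E x *v ?u1 x) = - ip (\<lambda>x. grad \<Omega> E x *v ?u1 x) ?w"
      using L2_inner_scaleR_left[of \<Omega> "-1" ?w "\<lambda>x. grad \<Omega> E x *v ?u1 x"] by (simp add: L2_inner_commute)
    ultimately show ?thesis by simp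
  qed
  have "\<bar>conv_form \<Omega> (sn 0) (sn 0) E - ip (\<lambda>x. grad \<Omega> ?u1 x *v ?u1 x) E\<bar>
     \<le> Cc * W * \<delta> * n2 E + real CARD('d) * W * B1 * n2 E + B2 * n2 E" using 1 2 3 4 5 B2 by linarith
  then show ?thesis by (simp add: distrib_right)
qed

lemma pressure_terms:
  assumes k: "k \<le> N" and Y: "n2 (\<lambda>x. p (tm k) x - \<pi> (tm k) x) \<le> Y"
  shows "\<mu> * ip (divg \<Omega> (sn k)) (divg \<Omega> (e k)) + ip (\<lambda>x. p (tm k) x - \<pi> (tm k) x) (divg \<Omega> (e k))
    \<le> (\<mu> * (real CARD('d) * \<delta>) + Y) * n2 (divg \<Omega> (e k))"
proof -
  note dE = Vh_facts(7)[OF e_Vh[OF k]] and dS = Vh_facts(7)[OF sn_Vh[OF k]]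
  have pp: "(\<lambda>x. p (tm k) x - \<pi> (tm k) x) \<in> L2"
    by (rule L2_diff[OF H1_L2[OF p_H1[OF tm_in[OF k]]] Qh_L2[OF \<pi>_Qh[OF tm_in[OF k]]]])
  have "ip (divg \<Omega> (sn k)) (divg \<Omega> (e k)) \<le> real CARD('d) * \<delta> * n2 (divg \<Omega> (e k))"
    using L2_Cauchy_Schwarz[OF dS dE] mult_right_mono[OF us_bounds(3)[OF tm_in[OF k]] L2_norm_nonneg[of \<Omega> "divg \<Omega> (e k)"]]
    by (simp add: sn_def)
  then have "\<mu> * ip (divg \<Omega> (sn k)) (divg \<Omega> (e k)) \<le> \<mu> * (real CARD('d) * \<delta> * n2 (divg \<Omega> (e k)))"
    using \<mu>_pos by (intro mult_left_mono) auto
  moreover have "ip (\<lambda>x. p (tm k) x - \<pi> (tm k) x) (divg \<Omega> (e k)) \<le> Y * n2 (divg \<Omega> (e k))"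
    using L2_Cauchy_Schwarz[OF pp dE] mult_right_mono[OF Y L2_norm_nonneg[of \<Omega> "divg \<Omega> (e k)"]] by linarith
  ultimately show ?thesis by (simp add: algebra_simps)
qed

lemma energy_step:
  assumes m: "1 \<le> m" "m < N"
    and A: "n2 (\<lambda>x. (1 / \<tau>) *\<^sub>R time_diff sn (m + 1) x - ut (tm (m + 1)) x) \<le> A"
    and B: "n2 (\<lambda>x. extrap (\<lambda>j. u (tm j)) m x - u (tm (m + 1)) x) \<le> B"
    and Y: "n2 (\<lambda>x. p (tm (m + 1)) x - \<pi> (tm (m + 1)) x) \<le> Y"
  defines "G \<equiv> ni (grad \<Omega> (sn (m + 1)))" and "S \<equiv> ni (sn (m + 1))"
    and "R \<equiv> A + Cc * W * \<delta> + real CARD('d) * W * B"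
  shows "q_err (m + 1) + 4 * \<tau> * (\<nu> * g_err (m + 1) + \<mu> * d_err (m + 1)) \<le> q_err m
       + \<tau> * (G * (2 * a_err (m + 1) + 12 * a_err m + 6 * a_err (m - 1)) + 18 / \<mu> * S\<^sup>2 * a_err (m + 1)
              + \<mu> / 18 * (6 * d_err m + 3 * d_err (m - 1)))
       + \<tau> * (a_err (m + 1) / T + 2 * \<mu> * d_err (m + 1)
              + (4 * T * R\<^sup>2 + 4 * \<mu> * (real CARD('d) * \<delta>)\<^sup>2 + 4 * Y\<^sup>2 / \<mu>))"
proof -
  let ?k = "m + 1" and ?E = "e (m + 1)"
  have k: "?k \<le> N" "m \<le> N" "m - 1 \<le> N" using m by auto
  have eV: "e ?k \<in> Vh" "e m \<in> Vh" "e (m - 1) \<in> Vh" using e_Vh k by auto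
  have e2: "e ?k \<in> L2" "e m \<in> L2" "e (m - 1) \<in> L2" using eV Vh_facts(4) by auto
  define y z where "y = n2 ?E" and "z = n2 (divg \<Omega> ?E)"
  have nn: "y \<ge> 0" "z \<ge> 0" "G \<ge> 0" "S \<ge> 0" by (auto simp: y_def z_def G_def S_def Linf_norm_nonneg)
  have td: "time_diff e ?k = (\<lambda>x. (3/2) *\<^sub>R e ?k x - 2 *\<^sub>R e m x + (1/2) *\<^sub>R e (m - 1) x)"
  proof -
    have "m + 1 - 2 = m - 1" by simp
    then show ?thesis using m by (simp add: time_diff_def[abs_def])
  qed
  have bdf: "q_err ?k - q_err m \<le> 4 * ip (time_diff e ?k) ?E"
    using BDF2_energy[OF e2] unfolding td q_err_def a_err_def extrap_def[abs_def] by simp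
  have eq: "(1 / \<tau>) * ip (time_diff e ?k) ?E + \<nu> * g_err ?k + \<mu> * d_err ?k + conv_form \<Omega> (extrap e m) (sn ?k) ?E
    = ip (\<lambda>x. (1 / \<tau>) *\<^sub>R time_diff sn ?k x - ut (tm ?k) x) ?E + \<mu> * ip (divg \<Omega> (sn ?k)) (divg \<Omega> ?E)
      + (conv_form \<Omega> (extrap sn m) (sn ?k) ?E - ip (\<lambda>x. grad \<Omega> (u (tm ?k)) x *v u (tm ?k) x) ?E)
      + ip (\<lambda>x. p (tm ?k) x - \<pi> (tm ?k) x) (divg \<Omega> ?E)"
    using error_equation[OF m(2)] m(1) by (simp add: g_err_def d_err_def)
  have 1: "ip (\<lambda>x. (1 / \<tau>) *\<^sub>R time_diff sn ?k x - ut (tm ?k) x) ?E \<le> A * y"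
  proof -
    have "time_diff sn ?k \<in> L2" using k N_pos m by (intro time_diff_L2 Vh_facts(4) sn_Vh) auto
    then have "(\<lambda>x. (1 / \<tau>) *\<^sub>R time_diff sn ?k x - ut (tm ?k) x) \<in> L2" by (intro L2_diff L2_scaleR ut_L2 tm_in k)
    from L2_Cauchy_Schwarz[OF this e2(1)] show ?thesis using mult_right_mono[OF A L2_norm_nonneg[of \<Omega> ?E]] by (simp add: y_def)
  qed
  have 2: "conv_form \<Omega> (extrap sn m) (sn ?k) ?E - ip (\<lambda>x. grad \<Omega> (u (tm ?k)) x *v u (tm ?k) x) ?E
      \<le> (Cc * W * \<delta> + real CARD('d) * W * B) * y"
    using convection_residual[OF m e2(1) B] by (simp add: y_def)
  have 3: "\<mu> * ip (divg \<Omega> (sn ?k)) (divg \<Omega> ?E) + ip (\<lambda>x. p (tm ?k) x - \<pi> (tm ?k) x) (divg \<Omega> ?E) \<le> (\<mu> * (real CARD('d) * \<delta>) + Y) * z"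
    using pressure_terms[OF k(1) Y] by (simp add: z_def)
  define X Z where "X = n2 (extrap e m)" and "Z = n2 (divg \<Omega> (extrap e m))"
  have exV: "extrap e m \<in> Vh" by (rule Vh_extrap[OF eV(2,3)])
  have 4: "- conv_form \<Omega> (extrap e m) (sn ?k) ?E \<le> (G * X + (1/2) * (S * Z)) * y"
    using conv_form_bound[OF Vh_W1i[OF exV] Vh_W1i[OF sn_Vh[OF k(1)]] e2(1)] by (simp add: G_def S_def X_def Z_def y_def)
  \<comment> \<open>The weights 6 and 3 belong to the extrapolation 2 a + b; the slack is 2 (a -
    b)^2.\<close>
  have sq: "c\<^sup>2 \<le> 6 * a\<^sup>2 + 3 * b\<^sup>2" if "c \<le> 2 * a + b" "c \<ge> 0" for a b c :: real
  proof -
    have "c\<^sup>2 \<le> (2 * a + b)\<^sup>2" using that by (intro power_mono) auto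
    also have "\<dots> \<le> 6 * a\<^sup>2 + 3 * b\<^sup>2" using zero_le_power2[of "a - b"] by (simp add: power2_eq_square algebra_simps)
    finally show ?thesis .
  qed
  have X: "X\<^sup>2 \<le> 6 * a_err m + 3 * a_err (m - 1)"
    unfolding X_def a_err_def by (intro sq n2_extrap_le k(2) Vh_facts(4) e_Vh) auto
  have Z: "Z\<^sup>2 \<le> 6 * d_err m + 3 * d_err (m - 1)"
    unfolding Z_def d_err_def by (intro sq n2_divg_extrap_le k(2) e_Vh) auto
  have young: "2 * a * b \<le> c * a\<^sup>2 + b\<^sup>2 / c" if "c > 0" for a b c :: real
  proof -
    have "0 \<le> (c * a - b)\<^sup>2 / c" using that by simp
    also have "\<dots> = c * a\<^sup>2 + b\<^sup>2 / c - 2 * a * b" using that by (simp add: power2_eq_square field_simps)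
    finally show ?thesis by simp
  qed
  have y2: "y\<^sup>2 = a_err ?k" and z2: "z\<^sup>2 = d_err ?k" by (simp_all add: y_def z_def a_err_def d_err_def)
  have i: "4 * (G * X * y) \<le> G * (2 * y\<^sup>2 + 12 * a_err m + 6 * a_err (m - 1))"
  proof -
    have "2 * X * y \<le> X\<^sup>2 + y\<^sup>2" using sum_squares_bound[of X y] by simp
    then have "4 * (X * y) \<le> 2 * y\<^sup>2 + 12 * a_err m + 6 * a_err (m - 1)" using X by simp
    from mult_left_mono[OF this nn(3)] show ?thesis by (simp add: mult_ac)
  qed
  \<comment> \<open>The Young weight 18 / \<mu> becomes 9 / (2 \<mu>) in the stability coefficient
    after division by 4. It leaves divergence terms of total weight \<mu> (6 + 3) / 18 = \<mu> / 2,
    small enough for the grad-div dissipation of the neighbouring steps.\<close>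
  have ii: "2 * (S * Z * y) \<le> 18 / \<mu> * S\<^sup>2 * y\<^sup>2 + \<mu> / 18 * (6 * d_err m + 3 * d_err (m - 1))"
  proof -
    have "2 * (S * y) * Z \<le> 18 / \<mu> * (S * y)\<^sup>2 + Z\<^sup>2 / (18 / \<mu>)" using \<mu>_pos by (intro young) auto
    moreover have "Z\<^sup>2 / (18 / \<mu>) \<le> \<mu> / 18 * (6 * d_err m + 3 * d_err (m - 1))"
      using mult_left_mono[OF Z, of "\<mu> / 18"] \<mu>_pos by (simp add: mult.commute)
    ultimately show ?thesis by (simp add: power_mult_distrib mult_ac)
  qed
  \<comment> \<open>The weight 1/T is the origin of the 1/T in the step size restriction; over the
    whole time interval it only adds a constant to the exponent.\<close>
  have iii: "4 * (R * y) \<le> y\<^sup>2 / T + 4 * T * R\<^sup>2"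
    using young[of T "2 * R" y] T_pos by (simp add: power_mult_distrib mult_ac)
  \<comment> \<open>This estimate and the next each consume one \<mu> z^2 of the four supplied by
    the grad-div term.\<close>
  have iv: "4 * (\<mu> * (real CARD('d) * \<delta>) * z) \<le> \<mu> * z\<^sup>2 + 4 * \<mu> * (real CARD('d) * \<delta>)\<^sup>2"
  proof -
    have "2 * (2 * (real CARD('d) * \<delta>)) * z \<le> (2 * (real CARD('d) * \<delta>))\<^sup>2 + z\<^sup>2" by (rule sum_squares_bound)
    from mult_left_mono[OF this, of \<mu>] \<mu>_pos show ?thesis by (simp add: power_mult_distrib algebra_simps)
  qed
  have v: "4 * (Y * z) \<le> \<mu> * z\<^sup>2 + 4 * Y\<^sup>2 / \<mu>"
    using young[of \<mu> z "2 * Y"] \<mu>_pos by (simp add: power_mult_distrib mult_ac)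
  have "ip (time_diff e ?k) ?E + \<tau> * (\<nu> * g_err ?k + \<mu> * d_err ?k) = \<tau> * (
      - conv_form \<Omega> (extrap e m) (sn ?k) ?E + (ip (\<lambda>x. (1 / \<tau>) *\<^sub>R time_diff sn ?k x - ut (tm ?k) x) ?E + \<mu> * ip (divg \<Omega> (sn ?k)) (divg \<Omega> ?E)
      + (conv_form \<Omega> (extrap sn m) (sn ?k) ?E - ip (\<lambda>x. grad \<Omega> (u (tm ?k)) x *v u (tm ?k) x) ?E)
      + ip (\<lambda>x. p (tm ?k) x - \<pi> (tm ?k) x) (divg \<Omega> ?E)))"
    using \<tau>_pos unfolding eq[symmetric] by (simp add: field_simps)
  also have "\<dots> \<le> \<tau> * ((G * X + (1/2) * (S * Z)) * y + A * y + (Cc * W * \<delta> + real CARD('d) * W * B) * y + (\<mu> * (real CARD('d) * \<delta>) + Y) * z)"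
    using 1 2 3 4 \<tau>_pos by (intro mult_left_mono) linarith+
  finally have "4 * ip (time_diff e ?k) ?E + 4 * \<tau> * (\<nu> * g_err ?k + \<mu> * d_err ?k) \<le>
      \<tau> * (4 * (G * X * y) + 2 * (S * Z * y) + 4 * (R * y) + 4 * (\<mu> * (real CARD('d) * \<delta>) * z) + 4 * (Y * z))"
    by (simp add: R_def algebra_simps)
  also have "\<dots> \<le> \<tau> * (G * (2 * y\<^sup>2 + 12 * a_err m + 6 * a_err (m - 1)) + (18 / \<mu> * S\<^sup>2 * y\<^sup>2 + \<mu> / 18 * (6 * d_err m + 3 * d_err (m - 1)))
     + (y\<^sup>2 / T + 4 * T * R\<^sup>2) + (\<mu> * z\<^sup>2 + 4 * \<mu> * (real CARD('d) * \<delta>)\<^sup>2) + (\<mu> * z\<^sup>2 + 4 * Y\<^sup>2 / \<mu>))"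
    using i ii iii iv v \<tau>_pos by (intro mult_left_mono add_mono) auto
  finally show ?thesis using bdf unfolding y2 z2 by (simp add: algebra_simps)
qed

text \<open>Since \<open>e 0\<close> vanishes, no earlier error is propagated and no Gronwall
  argument enters. Multiplication by \<tau> leaves \<tau>^2 R^2, so a temporal residual of order
  \<tau> suffices for fourth order in the squared error.\<close>

lemma first_step:
  assumes A: "n2 (\<lambda>x. (1 / \<tau>) *\<^sub>R time_diff sn 1 x - ut (tm 1) x) \<le> A"
    and B1: "n2 (\<lambda>x. u (tm 1) x - u 0 x) \<le> B1"
    and B2: "\<bar>ip (\<lambda>x. u (tm 1) x - u 0 x) (\<lambda>x. grad \<Omega> (e 1) x *v u (tm 1) x)\<bar> \<le> B2 * n2 (e 1)"
    and Y: "n2 (\<lambda>x. p (tm 1) x - \<pi> (tm 1) x) \<le> Y"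
  defines "R \<equiv> A + Cc * W * \<delta> + real CARD('d) * W * B1 + B2"
  shows "a_err 1 + \<mu> * \<tau> * d_err 1 \<le> \<tau>\<^sup>2 * R\<^sup>2 + 2 * \<tau> * (\<mu> * (real CARD('d) * \<delta>)\<^sup>2 + Y\<^sup>2 / \<mu>)"
proof -
  have k: "1 \<le> N" "0 < N" using N_pos by auto
  have eV: "e 1 \<in> Vh" by (rule e_Vh[OF k(1)])
  have e2: "e 1 \<in> L2" by (rule Vh_facts(4)[OF eV])
  define y z where "y = n2 (e 1)" and "z = n2 (divg \<Omega> (e 1))"
  have nn: "y \<ge> 0" "z \<ge> 0" by (auto simp: y_def z_def)
  have td: "time_diff e 1 = e 1" by (simp add: time_diff_def[abs_def] e_0)
  have eq: "(1 / \<tau>) * a_err 1 + \<nu> * g_err 1 + \<mu> * d_err 1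
    = ip (\<lambda>x. (1 / \<tau>) *\<^sub>R time_diff sn 1 x - ut (tm 1) x) (e 1) + \<mu> * ip (divg \<Omega> (sn 1)) (divg \<Omega> (e 1))
      + (conv_form \<Omega> (sn 0) (sn 0) (e 1) - ip (\<lambda>x. grad \<Omega> (u (tm 1)) x *v u (tm 1) x) (e 1))
      + ip (\<lambda>x. p (tm 1) x - \<pi> (tm 1) x) (divg \<Omega> (e 1))"
    using error_equation[OF k(2)] unfolding add_0 td by (simp add: g_err_def d_err_def a_err_def L2_norm_sq_inner)
  have 1: "ip (\<lambda>x. (1 / \<tau>) *\<^sub>R time_diff sn 1 x - ut (tm 1) x) (e 1) \<le> A * y"
  proof -
    have "time_diff sn 1 \<in> L2" using k by (intro time_diff_L2 Vh_facts(4) sn_Vh) auto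
    then have "(\<lambda>x. (1 / \<tau>) *\<^sub>R time_diff sn 1 x - ut (tm 1) x) \<in> L2" by (intro L2_diff L2_scaleR ut_L2 tm_in k)
    from L2_Cauchy_Schwarz[OF this e2] show ?thesis using mult_right_mono[OF A L2_norm_nonneg[of \<Omega> "e 1"]] by (simp add: y_def)
  qed
  have 2: "conv_form \<Omega> (sn 0) (sn 0) (e 1) - ip (\<lambda>x. grad \<Omega> (u (tm 1)) x *v u (tm 1) x) (e 1)
      \<le> (Cc * W * \<delta> + real CARD('d) * W * B1 + B2) * y"
    using convection_residual_first[OF eV B1 B2] by (simp add: y_def)
  have 3: "\<mu> * ip (divg \<Omega> (sn 1)) (divg \<Omega> (e 1)) + ip (\<lambda>x. p (tm 1) x - \<pi> (tm 1) x) (divg \<Omega> (e 1)) \<le> (\<mu> * (real CARD('d) * \<delta>) + Y) * z"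
    using pressure_terms[OF k(1) Y] by (simp add: z_def)
  have g: "\<nu> * g_err 1 \<ge> 0" using \<nu>_pos by (simp add: g_err_def)
  have main: "(1 / \<tau>) * y\<^sup>2 + \<mu> * z\<^sup>2 \<le> R * y + \<mu> * (real CARD('d) * \<delta>) * z + Y * z"
    using eq 1 2 3 g by (simp add: R_def y_def z_def a_err_def d_err_def algebra_simps)
  have young: "2 * a * b \<le> c * a\<^sup>2 + b\<^sup>2 / c" if "c > 0" for a b c :: real
  proof -
    have "0 \<le> (c * a - b)\<^sup>2 / c" using that by simp
    also have "\<dots> = c * a\<^sup>2 + b\<^sup>2 / c - 2 * a * b" using that by (simp add: power2_eq_square field_simps)
    finally show ?thesis by simp
  qed
  have i: "2 * (R * y) \<le> \<tau> * R\<^sup>2 + (1 / \<tau>) * y\<^sup>2" using young[of \<tau> R y] \<tau>_pos by simp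
  have ii: "2 * (\<mu> * (real CARD('d) * \<delta>) * z) \<le> 2 * \<mu> * (real CARD('d) * \<delta>)\<^sup>2 + \<mu> * z\<^sup>2 / 2"
  proof -
    have "2 * (real CARD('d) * \<delta>) * z \<le> 2 * (real CARD('d) * \<delta>)\<^sup>2 + z\<^sup>2 / 2" by (rule young) simp
    from mult_left_mono[OF this, of \<mu>] \<mu>_pos show ?thesis by (simp add: algebra_simps)
  qed
  have iii: "2 * (Y * z) \<le> 2 * (Y\<^sup>2 / \<mu>) + \<mu> * z\<^sup>2 / 2"
  proof -
    have "2 * z * Y \<le> \<mu> / 2 * z\<^sup>2 + Y\<^sup>2 / (\<mu> / 2)" using \<mu>_pos by (intro young) auto
    then show ?thesis by (simp add: mult_ac)
  qed
  have "(1 / \<tau>) * y\<^sup>2 + \<mu> * z\<^sup>2 \<le> \<tau> * R\<^sup>2 + 2 * (\<mu> * (real CARD('d) * \<delta>)\<^sup>2 + Y\<^sup>2 / \<mu>)"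
    using main i ii iii by (simp add: algebra_simps)
  from mult_left_mono[OF this, of \<tau>] \<tau>_pos show ?thesis
    by (simp add: y_def z_def a_err_def d_err_def power2_eq_square algebra_simps)
qed

end

end

section \<open>Summation of the residuals over all time steps\<close>

lemma int_deriv_diff:
  assumes "int_deriv T x x'" "int_deriv T y y'"
  shows "int_deriv T (\<lambda>t. x t - y t) (\<lambda>t. x' t - y' t)"
  unfolding int_deriv_def
proof (intro conjI allI impI)
  have i: "integrable (lebesgue_on {0<..<T}) x'" "integrable (lebesgue_on {0<..<T}) y'"
    using assms by (auto simp: int_deriv_def)
  then show "integrable (lebesgue_on {0<..<T}) (\<lambda>t. x' t - y' t)" by simp
  fix s t assume st: "0 \<le> s \<and> s \<le> t \<and> t \<le> T"
  then have "integrable (lebesgue_on {s..t}) x'" "integrable (lebesgue_on {s..t}) y'"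
    using subinterval_integral(1)[OF i(1)] subinterval_integral(1)[OF i(2)] by auto
  then have "(LINT r|lebesgue_on {s..t}. x' r - y' r) = (LINT r|lebesgue_on {s..t}. x' r) - (LINT r|lebesgue_on {s..t}. y' r)"
    by simp
  moreover have "x t - x s = (LINT r|lebesgue_on {s..t}. x' r)" "y t - y s = (LINT r|lebesgue_on {s..t}. y' r)"
    using assms st by (auto simp: int_deriv_def)
  ultimately show "x t - y t - (x s - y s) = (LINT r|lebesgue_on {s..t}. x' r - y' r)" by simp
qed

text \<open>Meant for \<open>u\<close> and \<open>s\<close>: the increment of u - s is bounded
  through the derivative of the difference, which is small, rather than through the two derivatives
  separately.\<close>

lemma (in bounded_open_set) n2_difference_of_difference:
  fixes w w' v v' :: "real \<Rightarrow> real^'d \<Rightarrow> 'b::euclidean_space"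
  assumes w: "has_time_deriv T \<Omega> w w'" and v: "has_time_deriv T \<Omega> v v'" and b: "integrable (lebesgue_on {0<..<T}) b"
    and ae: "AE r in lebesgue_on {0<..<T}. n2 (\<lambda>x. w' r x - v' r x) \<le> b r" and nn: "\<And>r. b r \<ge> 0"
    and st: "0 \<le> s" "s \<le> t" "t \<le> T"
  shows "n2 (\<lambda>x. (w t x - v t x) - (w s x - v s x)) \<le> (LINT r|lebesgue_on {s..t}. b r)"
proof -
  let ?z = "\<lambda>x. (w t x - v t x) - (w s x - v s x)"
  have L: "w t \<in> L2" "w s \<in> L2" "v t \<in> L2" "v s \<in> L2" using time_deriv_L2[OF w] time_deriv_L2[OF v] st by auto
  have d: "(\<lambda>x. w t x - v t x) \<in> L2" "(\<lambda>x. w s x - v s x) \<in> L2" using L2_diff L by auto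
  have z: "?z \<in> L2" by (rule L2_diff[OF d])
  have ae': "AE r in lebesgue_on {0<..<T}. \<bar>ip (w' r) ?z - ip (v' r) ?z\<bar> \<le> n2 ?z * b r"
    using time_deriv_integrable_norm(1)[OF w] time_deriv_integrable_norm(1)[OF v] ae
  proof eventually_elim
    case (elim r)
    have "\<bar>ip (\<lambda>x. w' r x - v' r x) ?z\<bar> \<le> n2 (\<lambda>x. w' r x - v' r x) * n2 ?z"
      by (rule L2_Cauchy_Schwarz[OF L2_diff[OF elim(1,2)] z])
    also have "\<dots> \<le> b r * n2 ?z" using elim(3) by (intro mult_right_mono) auto
    finally show ?case by (simp add: L2_inner_diff_left[OF elim(1,2) z] mult.commute)
  qed
  show ?thesis
  proof (rule n2_le_by_duality[OF z])
    show "(LINT r|lebesgue_on {s..t}. b r) \<ge> 0" using nn by (intro integral_nonneg_AE) auto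
    have "\<bar>(ip (w t) ?z - ip (v t) ?z) - (ip (w s) ?z - ip (v s) ?z)\<bar> \<le> (LINT r|lebesgue_on {s..t}. n2 ?z * b r)"
      using b by (intro int_deriv_bound[OF int_deriv_diff[OF time_deriv_pairing(1)[OF w z] time_deriv_pairing(1)[OF v z]] _ ae' st]) auto
    moreover have "ip ?z ?z = (ip (w t) ?z - ip (v t) ?z) - (ip (w s) ?z - ip (v s) ?z)"
      by (simp only: L2_inner_diff_left[OF d z] L2_inner_diff_left[OF L(1,3) z] L2_inner_diff_left[OF L(2,4) z])
    ultimately show "\<bar>ip ?z ?z\<bar> \<le> (LINT r|lebesgue_on {s..t}. b r) * n2 ?z" by (simp add: mult.commute)
  qed
qed

lemma sq_sum4_le: "(a + b + c + d)\<^sup>2 \<le> 4 * (a\<^sup>2 + b\<^sup>2 + c\<^sup>2 + d\<^sup>2)" for a b c d :: real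
  using zero_le_power2[of "a - b"] zero_le_power2[of "a - c"] zero_le_power2[of "a - d"]
    zero_le_power2[of "b - c"] zero_le_power2[of "b - d"] zero_le_power2[of "c - d"]
  by (simp add: power2_eq_square algebra_simps)

lemma sq_sum5_le: "(a + b + c + d + e)\<^sup>2 \<le> 5 * (a\<^sup>2 + b\<^sup>2 + c\<^sup>2 + d\<^sup>2 + e\<^sup>2)" for a b c d e :: real
  using zero_le_power2[of "a - b"] zero_le_power2[of "a - c"] zero_le_power2[of "a - d"] zero_le_power2[of "a - e"]
    zero_le_power2[of "b - c"] zero_le_power2[of "b - d"] zero_le_power2[of "b - e"]
    zero_le_power2[of "c - d"] zero_le_power2[of "c - e"] zero_le_power2[of "d - e"]
  by (simp add: power2_eq_square algebra_simps)

lemma nonneg_subinterval_integral_le: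
  fixes F :: "real \<Rightarrow> real"
  assumes F: "integrable (lebesgue_on {0<..<T}) F" "\<And>r. F r \<ge> 0" and st: "0 \<le> s" "t \<le> T"
  shows "(LINT r|lebesgue_on {s..t}. F r) \<le> (LINT r|lebesgue_on {0<..<T}. F r)"
proof -
  have "(LINT r|lebesgue_on {s..t}. F r) = (LINT r|lebesgue_on {0<..<T}. indicat_real {s..t} r *\<^sub>R F r)"
    by (rule subinterval_integral(2)[OF F(1) st])
  also have "\<dots> \<le> (LINT r|lebesgue_on {0<..<T}. F r)"
    using F(2) by (intro integral_mono subinterval_integral(3)[OF F(1) st] F(1)) (auto simp: indicator_def)
  finally show ?thesis .
qed

context semi_implicit_error
begin

text \<open>Each window spans two steps, so each time is counted at most twice. In terms of the
  primitive the sum telescopes, with two terms left at either end.\<close>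

lemma sum_double_intervals:
  fixes F :: "real \<Rightarrow> real"
  assumes F: "integrable (lebesgue_on {0<..<T}) F" "\<And>r. F r \<ge> 0" and n: "n + 1 \<le> N"
  shows "(\<Sum>m=1..n. LINT r|lebesgue_on {tm (m - 1)..tm (m + 1)}. F r) \<le> 2 * (LINT r|lebesgue_on {0<..<T}. F r)"
proof -
  define \<Phi> where "\<Phi> j = (LINT r|lebesgue_on {0..tm j}. F r)" for j
  have mono: "tm i \<le> tm j" if "i \<le> j" for i j using that \<tau>_pos by (simp add: tm_def)
  have tm0: "tm 0 = 0" by (simp add: tm_def)
  have d: "(LINT r|lebesgue_on {tm i..tm j}. F r) = \<Phi> j - \<Phi> i" if "i \<le> j" "j \<le> N" for i j
    using subinterval_integral_add[OF F(1), of 0 "tm i" "tm j"] mono[OF that(1)] mono[of 0 i] tm_in[OF that(2)] tm0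
    by (simp add: \<Phi>_def)
  have bnd: "0 \<le> \<Phi> j" "\<Phi> j \<le> (LINT r|lebesgue_on {0<..<T}. F r)" if "j \<le> N" for j
  proof -
    show "0 \<le> \<Phi> j" unfolding \<Phi>_def using F(2) by (intro integral_nonneg_AE) auto
    show "\<Phi> j \<le> (LINT r|lebesgue_on {0<..<T}. F r)"
      unfolding \<Phi>_def using tm_in[OF that] by (intro nonneg_subinterval_integral_le F) auto
  qed
  have "(\<Sum>m=1..n. LINT r|lebesgue_on {tm (m - 1)..tm (m + 1)}. F r) = \<Phi> (n + 1) + \<Phi> n - \<Phi> 1 - \<Phi> 0"
    using n
  proof (induction n)
    case (Suc n)
    have "(\<Sum>m=1..Suc n. LINT r|lebesgue_on {tm (m - 1)..tm (m + 1)}. F r)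
       = (\<Sum>m=1..n. LINT r|lebesgue_on {tm (m - 1)..tm (m + 1)}. F r) + (LINT r|lebesgue_on {tm n..tm (Suc n + 1)}. F r)"
      by simp
    then show ?case using Suc d[of n "Suc n + 1"] by simp
  qed simp
  then show ?thesis using bnd[of "n + 1"] bnd[of n] bnd[of 1] bnd[of 0] n N_pos by linarith
qed

lemma sn_time_diff_split: "time_diff sn k x = time_diff (\<lambda>j. u (tm j)) k x - time_diff (\<lambda>j x. u (tm j) x - s (tm j) x) k x"
  by (simp add: time_diff_def sn_def algebra_simps)

text \<open>The bound is left in raw form. The bracket with the factor 9 stems from the Euler step,
  the rest from the BDF2 steps; \<delta>, Y and \<beta> still hide the powers of h.\<close>

lemma error_bound:
  fixes utt uttt st :: "real \<Rightarrow> real^'d \<Rightarrow> real^'d" and \<beta> :: "real \<Rightarrow> real"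
  assumes \<delta>: "\<And>t. t \<in> {0..T} \<Longrightarrow> H_norm 1 \<Omega> (\<lambda>x. u t x - s t x) \<le> \<delta>"
    and W: "\<And>t. t \<in> {0..T} \<Longrightarrow> ni (u t) \<le> W" "\<And>t j. t \<in> {0..T} \<Longrightarrow> ni (D j (u t)) \<le> W"
    and c1: "\<And>t. t \<in> {0..T} \<Longrightarrow> ni (s t) \<le> c1 * W" "\<And>t. t \<in> {0..T} \<Longrightarrow> ni (grad \<Omega> (s t)) \<le> c1 * W"
    and U0: "\<And>t. t \<in> {0..T} \<Longrightarrow> ni (u t) \<le> U0"
    and Y: "\<And>t. t \<in> {0..T} \<Longrightarrow> n2 (\<lambda>x. p t x - \<pi> t x) \<le> Y"
    and td: "has_time_deriv T \<Omega> u ut" "has_time_deriv T \<Omega> ut utt" "has_time_deriv T \<Omega> utt uttt"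
      "has_time_deriv T \<Omega> s st"
    and \<beta>: "\<beta> \<in> Lp_space 2 {0<..<T}" "\<And>r. \<beta> r \<ge> 0"
      "AE r in lebesgue_on {0<..<T}. n2 (\<lambda>x. ut r x - st r x) \<le> \<beta> r"
    and b2: "(\<lambda>r. n2 (utt r)) \<in> Lp_space 2 {0<..<T}" and b3: "(\<lambda>r. n2 (uttt r)) \<in> Lp_space 2 {0<..<T}"
    and M1: "M1 \<ge> 0" "AE r in lebesgue_on {0<..<T}. n2 (ut r) \<le> M1"
    and M2: "M2 \<ge> 0" "AE r in lebesgue_on {0<..<T}. n2 (utt r) \<le> M2"
    and MH: "MH \<ge> 0" "AE r in lebesgue_on {0<..<T}. ut r \<in> H1 \<and> H_norm 1 \<Omega> (ut r) \<le> MH"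
    and n: "1 \<le> n" "n + 1 \<le> N"
    and small: "\<And>j. 2 \<le> j \<Longrightarrow> j \<le> n + 1 \<Longrightarrow> \<tau> * (1 / T + stab_coeff \<Omega> \<mu> N sn j) \<le> 1 / 2"
  defines "dd \<equiv> real CARD('d)" and "CC \<equiv> 3 * c1 + 3/2 * real CARD('d) * c1 + 3 * real CARD('d)"
    and "B\<beta> \<equiv> LINT r|lebesgue_on {0<..<T}. (\<beta> r)\<^sup>2" and "B2 \<equiv> LINT r|lebesgue_on {0<..<T}. (n2 (utt r))\<^sup>2"
    and "B3 \<equiv> LINT r|lebesgue_on {0<..<T}. (n2 (uttt r))\<^sup>2"
  shows "(n2 (e (n + 1)))\<^sup>2 + (\<Sum>j=2..n + 1. \<nu> * \<tau> * (n2 (grad \<Omega> (e j)))\<^sup>2) + \<mu> * (\<Sum>j=2..n + 1. \<tau> * (n2 (divg \<Omega> (e j)))\<^sup>2)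
    \<le> exp (2 + 2 * T * Max (stab_coeff \<Omega> \<mu> N sn ` {2..n + 1})) *
      (9 * (5 * (\<tau> * B\<beta> + \<tau> ^ 4 * M2\<^sup>2 + \<tau>\<^sup>2 * (CC * W * \<delta>)\<^sup>2 + \<tau> ^ 4 * (dd * W * M1)\<^sup>2 + \<tau> ^ 4 * (U0 * dd * MH)\<^sup>2)
            + 2 * \<tau> * (\<mu> * (dd * \<delta>)\<^sup>2 + Y\<^sup>2 / \<mu>))
       + 4 * T * (36 * B\<beta> + 576 * \<tau> ^ 4 * B3 + 4 * T * (CC * W * \<delta>)\<^sup>2 + 64 * (dd * W)\<^sup>2 * \<tau> ^ 4 * B2)
       + 4 * T * (\<mu> * (dd * \<delta>)\<^sup>2 + Y\<^sup>2 / \<mu>))"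
proof -
  note ctx = \<delta> W(1) W(2) c1(1) c1(2)
  have CC: "Cc c1 = CC" unfolding CC_def by (rule Cc_def[OF ctx])
  have W0: "W \<ge> 0" by (rule W_nonneg[OF ctx])
  have U00: "U0 \<ge> 0" using U0[of 0] T_pos Linf_norm_nonneg[of \<Omega> "u 0"] by force
  have \<tau>0: "\<tau> > 0" by (rule \<tau>_pos)
  have tmS: "tm (Suc j) = tm j + \<tau>" for j by (simp add: tm_def algebra_simps)
  have li: "integrable (lebesgue_on {0<..<T}) f" "integrable (lebesgue_on {0<..<T}) (\<lambda>r. (f r)\<^sup>2)"
    if "f \<in> Lp_space 2 {0<..<T}" for f :: "real \<Rightarrow> real"
    using L2_locally_integrable(1)[OF _ _ that] that by (auto simp: Lp_space_2_iff)
  have uL2: "t \<in> {0..T} \<Longrightarrow> u t \<in> L2" for t using W1iD(4)[OF u_W1i] .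
  have sL2: "t \<in> {0..T} \<Longrightarrow> s t \<in> L2" for t using Vh_facts(4)[OF s_Vh[OF ctx]] .
  let ?I = "\<lambda>f m. LINT r|lebesgue_on {tm (m - 1)..tm (m + 1)}. f r"
  \<comment> \<open>In this order: the increments of u - s, that is, the spatial error of the time
    difference; the BDF2 truncation error; the spatial defect of the convective term; the
    extrapolation error.\<close>
  define R where "R m = 3 / (2 * \<tau>) * ?I \<beta> m + 6 * \<tau> * ?I (\<lambda>r. n2 (uttt r)) m + CC * W * \<delta>
      + dd * W * (2 * \<tau> * ?I (\<lambda>r. n2 (utt r)) m)" for m
  define r where "r m = 4 * T * (R m)\<^sup>2 + 4 * \<mu> * (dd * \<delta>)\<^sup>2 + 4 * Y\<^sup>2 / \<mu>" for m
  define G where "G i = (if i \<le> N then ni (grad \<Omega> (sn i)) else 0)" for i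
  have NN: "stab_coeff \<Omega> \<mu> N sn j = 4 * ((1/2) * G j + 9 / (2 * \<mu>) * (ni (sn j))\<^sup>2 + 3 * G (j + 1) + (3/2) * G (j + 2))" for j
    by (simp add: stab_coeff_def G_def)
  have step: "q_err (m + 1) + 4 * \<tau> * (\<nu> * g_err (m + 1) + \<mu> * d_err (m + 1)) \<le> q_err m
       + \<tau> * (G (m + 1) * (2 * a_err (m + 1) + 12 * a_err m + 6 * a_err (m - 1)) + 18 / \<mu> * (ni (sn (m + 1)))\<^sup>2 * a_err (m + 1)
              + \<mu> / 18 * (6 * d_err m + 3 * d_err (m - 1)))
       + \<tau> * (a_err (m + 1) / T + 2 * \<mu> * d_err (m + 1) + r m)" if m: "1 \<le> m" "m \<le> n" for m
  proof -
    have mN: "m < N" "m + 1 \<le> N" using m n by auto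
    define t where "t = tm (m - 1)"
    have tms: "tm m = t + \<tau>" "tm (m + 1) = t + 2 * \<tau>" "tm (m - 1) = t"
      using m tmS[of "m - 1"] tmS[of m] by (auto simp: t_def)
    have t: "0 \<le> t" "\<tau> \<ge> 0" "t + 2 * \<tau> \<le> T"
      using tm_in[of "m - 1"] tm_in[OF mN(2)] mN m \<tau>0 tms by auto
    have in0: "t \<in> {0..T}" "t + \<tau> \<in> {0..T}" "t + 2 * \<tau> \<in> {0..T}" using t by auto
    have idx: "m + 1 - 2 = m - 1" "m + 1 - 1 = m" by auto
    let ?w = "\<lambda>t x. u t x - s t x"
    have w2: "?w t \<in> L2" if "t \<in> {0..T}" for t using L2_diff[OF uL2[OF that] sL2[OF that]] .
    have A: "n2 (\<lambda>x. (1 / \<tau>) *\<^sub>R time_diff sn (m + 1) x - ut (tm (m + 1)) x)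
       \<le> 3 / (2 * \<tau>) * ?I \<beta> m + 6 * \<tau> * ?I (\<lambda>r. n2 (uttt r)) m"
    proof -
      let ?P = "\<lambda>x. (3/2) *\<^sub>R u (t + 2 * \<tau>) x - 2 *\<^sub>R u (t + \<tau>) x + (1/2) *\<^sub>R u t x - \<tau> *\<^sub>R ut (t + 2 * \<tau>) x"
      \<comment> \<open>The BDF2 difference of u - s equals 3/2 of its later increment minus 1/2 of
        its earlier one, so that only increments, hence integrals of \<beta>, occur.\<close>
      let ?d1 = "\<lambda>x. ?w (t + 2 * \<tau>) x - ?w (t + \<tau>) x" and ?d2 = "\<lambda>x. ?w (t + \<tau>) x - ?w t x"
      have P2: "?P \<in> L2" by (intro L2_add L2_diff L2_scaleR uL2 ut_L2 in0)
      have d12: "?d1 \<in> L2" "?d2 \<in> L2" by (rule L2_diff[OF w2[OF in0(3)] w2[OF in0(2)]], rule L2_diff[OF w2[OF in0(2)] w2[OF in0(1)]])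
      have P: "n2 ?P \<le> 6 * \<tau>\<^sup>2 * ?I (\<lambda>r. n2 (uttt r)) m"
        unfolding tms using li(1)[OF b3] by (intro n2_BDF2_consistency[OF td(1,2,3) _ _ _ t]) auto
      have D1: "n2 ?d1 \<le> (LINT r|lebesgue_on {t + \<tau>..t + 2 * \<tau>}. \<beta> r)"
        using t by (intro n2_difference_of_difference[OF td(1,4) li(1)[OF \<beta>(1)] \<beta>(3,2)]) auto
      have D2: "n2 ?d2 \<le> (LINT r|lebesgue_on {t..t + \<tau>}. \<beta> r)"
        using t by (intro n2_difference_of_difference[OF td(1,4) li(1)[OF \<beta>(1)] \<beta>(3,2)]) auto
      have "(LINT r|lebesgue_on {t + \<tau>..t + 2 * \<tau>}. \<beta> r) + (LINT r|lebesgue_on {t..t + \<tau>}. \<beta> r) = ?I \<beta> m"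
        unfolding tms using t subinterval_integral_add[OF li(1)[OF \<beta>(1)], of t "t + \<tau>" "t + 2 * \<tau>"] by simp
      moreover have "(LINT r|lebesgue_on {t..t + \<tau>}. \<beta> r) \<ge> 0" using \<beta>(2) by (intro integral_nonneg_AE) auto
      ultimately have Dsum: "3 / 2 * n2 ?d1 + 1 / 2 * n2 ?d2 \<le> 3 / 2 * ?I \<beta> m" using D1 D2 by linarith
      have eq: "(\<lambda>x. (1 / \<tau>) *\<^sub>R time_diff sn (m + 1) x - ut (tm (m + 1)) x)
         = (\<lambda>x. (1 / \<tau>) *\<^sub>R ?P x - (1 / \<tau>) *\<^sub>R ((3/2) *\<^sub>R ?d1 x - (1/2) *\<^sub>R ?d2 x))"
      proof
        fix x
        have td1: "time_diff (\<lambda>j. u (tm j)) (m + 1) x = ?P x + \<tau> *\<^sub>R ut (t + 2 * \<tau>) x"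
          using m by (simp add: time_diff_def idx tms tms[simplified])
        have td2: "time_diff (\<lambda>j x. u (tm j) x - s (tm j) x) (m + 1) x = (3/2) *\<^sub>R ?d1 x - (1/2) *\<^sub>R ?d2 x"
          using m by (simp add: time_diff_def idx tms tms[simplified] vec_eq_iff field_simps)
        show "(1 / \<tau>) *\<^sub>R time_diff sn (m + 1) x - ut (tm (m + 1)) x =
            (1 / \<tau>) *\<^sub>R ?P x - (1 / \<tau>) *\<^sub>R ((3/2) *\<^sub>R ?d1 x - (1/2) *\<^sub>R ?d2 x)"
          unfolding sn_time_diff_split td1 td2 tms(2) scaleR_diff_right[of "1 / \<tau>"] scaleR_add_right[of "1 / \<tau>"] using \<tau>0 by simp
      qed
      have Q2: "(\<lambda>x. (3/2) *\<^sub>R ?d1 x - (1/2) *\<^sub>R ?d2 x) \<in> L2" by (rule L2_diff[OF L2_scaleR[OF d12(1)] L2_scaleR[OF d12(2)]])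
      have "n2 (\<lambda>x. (1 / \<tau>) *\<^sub>R ?P x - (1 / \<tau>) *\<^sub>R ((3/2) *\<^sub>R ?d1 x - (1/2) *\<^sub>R ?d2 x)) \<le>
          n2 (\<lambda>x. (1 / \<tau>) *\<^sub>R ?P x) + n2 (\<lambda>x. (1 / \<tau>) *\<^sub>R ((3/2) *\<^sub>R ?d1 x - (1/2) *\<^sub>R ?d2 x))"
        by (rule L2_norm_triangle_diff[OF L2_scaleR[OF P2] L2_scaleR[OF Q2]])
      also have "\<dots> = (1 / \<tau>) * n2 ?P + (1 / \<tau>) * n2 (\<lambda>x. (3/2) *\<^sub>R ?d1 x - (1/2) *\<^sub>R ?d2 x)"
        using \<tau>0 by (simp only: L2_norm_scaleR) simp
      also have "\<dots> \<le> (1 / \<tau>) * (6 * \<tau>\<^sup>2 * ?I (\<lambda>r. n2 (uttt r)) m) + (1 / \<tau>) * (3 / 2 * ?I \<beta> m)"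
      proof (intro add_mono mult_left_mono P)
        have "n2 (\<lambda>x. (3/2) *\<^sub>R ?d1 x - (1/2) *\<^sub>R ?d2 x) \<le> n2 (\<lambda>x. (3/2) *\<^sub>R ?d1 x) + n2 (\<lambda>x. (1/2) *\<^sub>R ?d2 x)"
          by (rule L2_norm_triangle_diff[OF L2_scaleR[OF d12(1)] L2_scaleR[OF d12(2)]])
        then have "n2 (\<lambda>x. (3/2) *\<^sub>R ?d1 x - (1/2) *\<^sub>R ?d2 x) \<le> \<bar>3/2\<bar> * n2 ?d1 + \<bar>1/2\<bar> * n2 ?d2"
          by (simp only: L2_norm_scaleR)
        then show "n2 (\<lambda>x. (3/2) *\<^sub>R ?d1 x - (1/2) *\<^sub>R ?d2 x) \<le> 3 / 2 * ?I \<beta> m" using Dsum by simp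
      qed (use \<tau>0 in auto)
      also have "\<dots> = 3 / (2 * \<tau>) * ?I \<beta> m + 6 * \<tau> * ?I (\<lambda>r. n2 (uttt r)) m"
        using \<tau>0 by (simp add: field_simps power2_eq_square)
      finally show ?thesis unfolding eq .
    qed
    have B: "n2 (\<lambda>x. extrap (\<lambda>j. u (tm j)) m x - u (tm (m + 1)) x) \<le> 2 * \<tau> * ?I (\<lambda>r. n2 (utt r)) m"
    proof -
      have "n2 (\<lambda>x. u (t + 2 * \<tau>) x - 2 *\<^sub>R u (t + \<tau>) x + u t x) \<le> 2 * \<tau> * ?I (\<lambda>r. n2 (utt r)) m"
        unfolding tms using li(1)[OF b2] by (intro n2_second_difference[OF td(1,2) _ _ _ t]) auto
      moreover have "(\<lambda>x. extrap (\<lambda>j. u (tm j)) m x - u (tm (m + 1)) x) = (\<lambda>x. (-1) *\<^sub>R (u (t + 2 * \<tau>) x - 2 *\<^sub>R u (t + \<tau>) x + u t x))"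
        by (auto simp: extrap_def tms tms[simplified] fun_eq_iff algebra_simps)
      ultimately show ?thesis by (simp only: L2_norm_scaleR abs_minus_cancel abs_one mult_1)
    qed
    from energy_step[OF ctx m(1) mN(1) A B Y[OF tm_in[OF mN(2)]]]
    show ?thesis using mN(2) by (simp add: r_def R_def G_def CC dd_def add_ac)
  qed
  have energy: "a_err (n + 1) + (\<Sum>j=2..n + 1. \<nu> * \<tau> * g_err j) + \<mu> * (\<Sum>j=2..n + 1. \<tau> * d_err j)
     \<le> exp (2 + 2 * T * Max (stab_coeff \<Omega> \<mu> N sn ` {2..n + 1})) * (q_err 1 + 4 * a_err 1 + \<mu> * \<tau> * d_err 1 + \<tau> * (\<Sum>m=1..n. r m))"
    unfolding NN
  proof (rule discrete_energy_estimate[where a=a_err and q=q_err and g=g_err and d=d_err and S="\<lambda>j. ni (sn j)" and \<nu>=\<nu>, OF \<tau>0 T_pos \<mu>_pos \<nu>_pos])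
    show "real n * \<tau> \<le> T" using tm_in[of n] n by (simp add: tm_def)
    show "G j \<ge> 0" for j by (simp add: G_def Linf_norm_nonneg)
    show "r j \<ge> 0" for j using T_pos \<mu>_pos by (simp add: r_def)
    show "a_err 0 = 0" by (simp add: a_err_def e_0)
    have "divg \<Omega> (e 0) \<in> L2" using Vh_facts(7)[OF e_Vh] by simp
    have "(n2 (divg \<Omega> (e 0)))\<^sup>2 = 0"
      using ip_divg_e[of 0 "divg \<Omega> (e 0)"] \<open>divg \<Omega> (e 0) \<in> L2\<close> by (simp add: L2_norm_sq_inner uh_0)
    then show "d_err 0 = 0" by (simp add: d_err_def)
    show "\<tau> * (1 / T + 4 * (1 / 2 * G j + 9 / (2 * \<mu>) * (ni (sn j))\<^sup>2 + 3 * G (j + 1) + 3 / 2 * G (j + 2))) \<le> 1 / 2"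
      if "2 \<le> j" "j \<le> n + 1" for j using small[OF that] unfolding NN .
  qed (use step n in \<open>auto simp: a_err_def g_err_def d_err_def q_err_def\<close>)
  have residuals: "\<tau> * (\<Sum>m=1..n. r m) \<le> 4 * T * (36 * B\<beta> + 576 * \<tau> ^ 4 * B3 + 4 * T * (CC * W * \<delta>)\<^sup>2 + 64 * (dd * W)\<^sup>2 * \<tau> ^ 4 * B2)
       + 4 * T * (\<mu> * (dd * \<delta>)\<^sup>2 + Y\<^sup>2 / \<mu>)"
  proof -
    let ?J = "\<lambda>f m. LINT r|lebesgue_on {tm (m - 1)..tm (m + 1)}. (f r)\<^sup>2"
    \<comment> \<open>The windows have length 2 \<tau>. Trading the square of an integral for the
      integral of the square gains this factor, which turns \<tau>^3 into \<tau>^4 in the truncation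
      terms and cancels 1/\<tau> in the projection term.\<close>
    have CS: "(?I f m)\<^sup>2 \<le> 2 * \<tau> * ?J f m" if "f \<in> Lp_space 2 {0<..<T}" "1 \<le> m" "m \<le> n" for f :: "real \<Rightarrow> real" and m
    proof -
      have d: "tm (m + 1) - tm (m - 1) = 2 * \<tau>" using that(2) by (simp add: tm_def of_nat_diff algebra_simps)
      have "0 \<le> tm (m - 1)" "tm (m + 1) \<le> T" using tm_in[of "m - 1"] tm_in[of "m + 1"] that n by auto
      then show ?thesis using interval_Cauchy_Schwarz[OF that(1), of "tm (m - 1)" "tm (m + 1)"] d \<tau>0 by simp
    qed
    have one: "\<tau> * (R m)\<^sup>2 \<le> 18 * ?J \<beta> m + 288 * \<tau> ^ 4 * ?J (\<lambda>r. n2 (uttt r)) m + 4 * \<tau> * (CC * W * \<delta>)\<^sup>2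
        + 32 * (dd * W)\<^sup>2 * \<tau> ^ 4 * ?J (\<lambda>r. n2 (utt r)) m" if m: "1 \<le> m" "m \<le> n" for m
    proof -
      have "\<tau> * (R m)\<^sup>2 \<le> \<tau> * (4 * ((3 / (2 * \<tau>) * ?I \<beta> m)\<^sup>2 + (6 * \<tau> * ?I (\<lambda>r. n2 (uttt r)) m)\<^sup>2 + (CC * W * \<delta>)\<^sup>2
          + (dd * W * (2 * \<tau> * ?I (\<lambda>r. n2 (utt r)) m))\<^sup>2))"
        unfolding R_def using \<tau>0 by (intro mult_left_mono sq_sum4_le) auto
      also have "\<dots> = 9 / \<tau> * (?I \<beta> m)\<^sup>2 + 144 * \<tau> ^ 3 * (?I (\<lambda>r. n2 (uttt r)) m)\<^sup>2 + 4 * \<tau> * (CC * W * \<delta>)\<^sup>2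
          + 16 * (dd * W)\<^sup>2 * \<tau> ^ 3 * (?I (\<lambda>r. n2 (utt r)) m)\<^sup>2"
        using \<tau>0 by (simp add: power_mult_distrib power_divide field_simps power2_eq_square power3_eq_cube)
      also have "\<dots> \<le> 9 / \<tau> * (2 * \<tau> * ?J \<beta> m) + 144 * \<tau> ^ 3 * (2 * \<tau> * ?J (\<lambda>r. n2 (uttt r)) m) + 4 * \<tau> * (CC * W * \<delta>)\<^sup>2
          + 16 * (dd * W)\<^sup>2 * \<tau> ^ 3 * (2 * \<tau> * ?J (\<lambda>r. n2 (utt r)) m)"
        using CS[OF \<beta>(1) m] CS[OF b3 m] CS[OF b2 m] \<tau>0 by (intro add_mono mult_left_mono) auto
      also have "\<dots> = 18 * ?J \<beta> m + 288 * \<tau> ^ 4 * ?J (\<lambda>r. n2 (uttt r)) m + 4 * \<tau> * (CC * W * \<delta>)\<^sup>2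
        + 32 * (dd * W)\<^sup>2 * \<tau> ^ 4 * ?J (\<lambda>r. n2 (utt r)) m"
        using \<tau>0 by (simp add: eval_nat_numeral)
      finally show ?thesis .
    qed
    have n\<tau>: "real n * \<tau> \<le> T" using tm_in[of n] n by (simp add: tm_def)
    have "(\<Sum>m=1..n. \<tau> * (R m)\<^sup>2) \<le> (\<Sum>m=1..n. 18 * ?J \<beta> m + 288 * \<tau> ^ 4 * ?J (\<lambda>r. n2 (uttt r)) m + 4 * \<tau> * (CC * W * \<delta>)\<^sup>2
        + 32 * (dd * W)\<^sup>2 * \<tau> ^ 4 * ?J (\<lambda>r. n2 (utt r)) m)"
      using one by (intro sum_mono) auto
    also have "\<dots> = 18 * (\<Sum>m=1..n. ?J \<beta> m) + 288 * \<tau> ^ 4 * (\<Sum>m=1..n. ?J (\<lambda>r. n2 (uttt r)) m) + 4 * (CC * W * \<delta>)\<^sup>2 * (real n * \<tau>)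
        + 32 * (dd * W)\<^sup>2 * \<tau> ^ 4 * (\<Sum>m=1..n. ?J (\<lambda>r. n2 (utt r)) m)"
      by (simp add: sum.distrib sum_distrib_left mult_ac)
    also have "\<dots> \<le> 18 * (2 * B\<beta>) + 288 * \<tau> ^ 4 * (2 * B3) + 4 * (CC * W * \<delta>)\<^sup>2 * T + 32 * (dd * W)\<^sup>2 * \<tau> ^ 4 * (2 * B2)"
      unfolding B\<beta>_def B2_def B3_def using \<tau>0 n n\<tau>
      by (intro add_mono mult_left_mono sum_double_intervals li(2) \<beta>(1) b2 b3) auto
    finally have RS: "(\<Sum>m=1..n. \<tau> * (R m)\<^sup>2) \<le> 36 * B\<beta> + 576 * \<tau> ^ 4 * B3 + 4 * T * (CC * W * \<delta>)\<^sup>2 + 64 * (dd * W)\<^sup>2 * \<tau> ^ 4 * B2"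
      by (simp add: mult_ac)
    have "\<tau> * (\<Sum>m=1..n. r m) = 4 * T * (\<Sum>m=1..n. \<tau> * (R m)\<^sup>2) + (real n * \<tau>) * (4 * (\<mu> * (dd * \<delta>)\<^sup>2 + Y\<^sup>2 / \<mu>))"
      by (simp add: r_def sum.distrib sum_distrib_left algebra_simps)
    also have "\<dots> \<le> 4 * T * (36 * B\<beta> + 576 * \<tau> ^ 4 * B3 + 4 * T * (CC * W * \<delta>)\<^sup>2 + 64 * (dd * W)\<^sup>2 * \<tau> ^ 4 * B2)
       + T * (4 * (\<mu> * (dd * \<delta>)\<^sup>2 + Y\<^sup>2 / \<mu>))"
      using T_pos \<mu>_pos n\<tau> by (intro add_mono mult_left_mono mult_right_mono RS) auto
    finally show ?thesis by (simp add: mult_ac)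
  qed
  have first: "a_err 1 + \<mu> * \<tau> * d_err 1 \<le> 5 * (\<tau> * B\<beta> + \<tau> ^ 4 * M2\<^sup>2 + \<tau>\<^sup>2 * (CC * W * \<delta>)\<^sup>2 + \<tau> ^ 4 * (dd * W * M1)\<^sup>2 + \<tau> ^ 4 * (U0 * dd * MH)\<^sup>2)
            + 2 * \<tau> * (\<mu> * (dd * \<delta>)\<^sup>2 + Y\<^sup>2 / \<mu>)"
  proof -
    have tm1: "tm 1 = \<tau>" "tm 0 = 0" by (auto simp: tm_def)
    have \<tau>in: "\<tau> \<in> {0..T}" "0 \<in> {0..T}" using tm_in[of 1] N_pos tm1 T_pos by auto
    have st: "0 \<le> (0::real)" "0 \<le> \<tau>" "\<tau> \<le> T" using \<tau>in by auto
    define b where "b = (LINT r|lebesgue_on {0..\<tau>}. \<beta> r)"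
    have b: "b\<^sup>2 \<le> \<tau> * B\<beta>"
    proof -
      have "b\<^sup>2 \<le> (\<tau> - 0) * (LINT r|lebesgue_on {0..\<tau>}. (\<beta> r)\<^sup>2)" unfolding b_def by (rule interval_Cauchy_Schwarz[OF \<beta>(1) st])
      also have "\<dots> \<le> (\<tau> - 0) * B\<beta>"
        unfolding B\<beta>_def using st by (intro mult_left_mono nonneg_subinterval_integral_le li(2) \<beta>(1)) auto
      finally show ?thesis by simp
    qed
    let ?d = "\<lambda>x. (u \<tau> x - s \<tau> x) - (u 0 x - s 0 x)" and ?P = "\<lambda>x. u \<tau> x - u 0 x - (\<tau> - 0) *\<^sub>R ut \<tau> x"
    have d2: "?d \<in> L2" "?P \<in> L2" by (intro L2_diff L2_scaleR uL2 sL2 ut_L2 \<tau>in)+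
    have A: "n2 (\<lambda>x. (1 / \<tau>) *\<^sub>R time_diff sn 1 x - ut (tm 1) x) \<le> \<tau> * M2 + (1 / \<tau>) * b"
    proof -
      have P: "n2 ?P \<le> (\<tau> - 0) * (M2 * (\<tau> - 0))"
        using n2_first_order_consistency[OF td(1,2) interval_integrable_const M2(2) M2(1) st] unfolding interval_integral_const[OF st(2)] .
      have D: "n2 ?d \<le> b" unfolding b_def by (rule n2_difference_of_difference[OF td(1,4) li(1)[OF \<beta>(1)] \<beta>(3,2) st])
      have eq: "(\<lambda>x. (1 / \<tau>) *\<^sub>R time_diff sn 1 x - ut (tm 1) x) = (\<lambda>x. (1 / \<tau>) *\<^sub>R ?P x - (1 / \<tau>) *\<^sub>R ?d x)"
        using \<tau>0 by (auto simp: fun_eq_iff time_diff_def sn_def tm1 tm1[simplified] scaleR_diff_right)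
      have "n2 (\<lambda>x. (1 / \<tau>) *\<^sub>R ?P x - (1 / \<tau>) *\<^sub>R ?d x) \<le> n2 (\<lambda>x. (1 / \<tau>) *\<^sub>R ?P x) + n2 (\<lambda>x. (1 / \<tau>) *\<^sub>R ?d x)"
        by (rule L2_norm_triangle_diff[OF L2_scaleR[OF d2(2)] L2_scaleR[OF d2(1)]])
      also have "\<dots> = (1 / \<tau>) * n2 ?P + (1 / \<tau>) * n2 ?d" using \<tau>0 by (simp only: L2_norm_scaleR) simp
      also have "\<dots> \<le> (1 / \<tau>) * (\<tau> * (M2 * \<tau>)) + (1 / \<tau>) * b"
        using P D \<tau>0 by (intro add_mono mult_left_mono) auto
      finally show ?thesis unfolding eq using \<tau>0 by (simp add: mult.commute)
    qed
    have B1: "n2 (\<lambda>x. u (tm 1) x - u 0 x) \<le> \<tau> * M1"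
      using n2_difference_le[OF td(1) interval_integrable_const M1(2) M1(1) st] unfolding interval_integral_const[OF st(2)] by (simp add: tm1[simplified] mult.commute)
    have B2: "\<bar>ip (\<lambda>x. u (tm 1) x - u 0 x) (\<lambda>x. grad \<Omega> (e 1) x *v u (tm 1) x)\<bar> \<le> (\<tau> * (U0 * dd * MH)) * n2 (e 1)"
    proof -
      let ?z = "\<lambda>x. grad \<Omega> (e 1) x *v u \<tau> x"
      have eV: "e 1 \<in> Vh" using e_Vh N_pos by auto
      note u1 = W1iD(2)[OF u_W1i[OF \<tau>in(1)]]
      have e2: "e 1 \<in> L2" by (rule Vh_facts(4)[OF eV])
      have z: "?z \<in> L2" by (rule matrix_vector_L2(1)[OF Vh_facts(5)[OF eV] u1])
      \<comment> \<open>The gradient that was moved to the discrete function is moved back, onto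
        \<open>ut r\<close> at almost every time. Only after the increment of \<open>u\<close> has
        been written as a time integral does the bound on the first-order norm of \<open>ut\<close>
        apply.\<close>
      have ae: "AE r in lebesgue_on {0<..<T}. \<bar>ip (ut r) ?z\<bar> \<le> U0 * dd * MH * n2 (e 1)"
        using MH(2)
      proof eventually_elim
        case (elim r)
        then have H: "ut r \<in> H1" by simp
        have g: "grad \<Omega> (ut r) \<in> L2" by (rule grad_L2[OF H])
        have dv: "AE x in lebesgue_on \<Omega>. (0 :: real^'d) = divg \<Omega> (u \<tau>) x *\<^sub>R e 1 x" using u_div[OF \<tau>in(1)] by eventually_elim simp
        have "ip (\<lambda>x. divg \<Omega> (u \<tau>) x *\<^sub>R e 1 x) (ut r) = 0"
          using ip_cong[OF L2_zero H1_L2[OF H] dv] by (simp add: L2_inner_def)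
        then have "ip (ut r) ?z = - ip (\<lambda>x. grad \<Omega> (ut r) x *v u \<tau> x) (e 1)"
          using transport_by_parts[OF H Vh_H10[OF eV] Vh_facts(2,3)[OF eV] u_H10[OF \<tau>in(1)] u1]
          by (simp add: L2_inner_commute[of _ "ut r"])
        then have "\<bar>ip (ut r) ?z\<bar> \<le> n2 (\<lambda>x. grad \<Omega> (ut r) x *v u \<tau> x) * n2 (e 1)"
          using L2_Cauchy_Schwarz[OF matrix_vector_L2(1)[OF g u1] e2] by simp
        also have "\<dots> \<le> (U0 * (dd * MH)) * n2 (e 1)"
        proof (rule mult_right_mono)
          have "n2 (grad \<Omega> (ut r)) \<le> dd * H_norm 1 \<Omega> (ut r)" unfolding dd_def by (rule n2_grad_le[OF H])
          also have "\<dots> \<le> dd * MH" using elim by (intro mult_left_mono) (auto simp: dd_def)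
          finally have "ni (u \<tau>) * n2 (grad \<Omega> (ut r)) \<le> U0 * (dd * MH)" using U0[OF \<tau>in(1)] U00 by (intro mult_mono) auto
          then show "n2 (\<lambda>x. grad \<Omega> (ut r) x *v u \<tau> x) \<le> U0 * (dd * MH)" using matrix_vector_L2(2)[OF g u1] by linarith
        qed simp
        finally show ?case by (simp add: mult_ac)
      qed
      have "\<bar>ip (u \<tau>) ?z - ip (u 0) ?z\<bar> \<le> U0 * dd * MH * n2 (e 1) * (\<tau> - 0)"
        using int_deriv_bound[OF time_deriv_pairing(1)[OF td(1) z] interval_integrable_const ae st] unfolding interval_integral_const[OF st(2)] .
      then show ?thesis unfolding tm1 L2_inner_diff_left[OF uL2[OF \<tau>in(1)] uL2[OF \<tau>in(2)] z] by (simp add: mult_ac)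
    qed
    have Y1: "n2 (\<lambda>x. p (tm 1) x - \<pi> (tm 1) x) \<le> Y" using Y[OF \<tau>in(1)] by (simp only: tm1)
    let ?R = "\<tau> * M2 + (1 / \<tau>) * b + CC * W * \<delta> + dd * W * (\<tau> * M1) + \<tau> * (U0 * dd * MH)"
    have "\<tau>\<^sup>2 * ?R\<^sup>2 = (b + \<tau>\<^sup>2 * M2 + \<tau> * (CC * W * \<delta>) + \<tau>\<^sup>2 * (dd * W * M1) + \<tau>\<^sup>2 * (U0 * dd * MH))\<^sup>2"
    proof -
      have "\<tau> * ?R = b + \<tau>\<^sup>2 * M2 + \<tau> * (CC * W * \<delta>) + \<tau>\<^sup>2 * (dd * W * M1) + \<tau>\<^sup>2 * (U0 * dd * MH)"
        using \<tau>0 by (simp add: field_simps power2_eq_square)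
      then show ?thesis by (metis power_mult_distrib)
    qed
    also have "\<dots> \<le> 5 * (b\<^sup>2 + (\<tau>\<^sup>2 * M2)\<^sup>2 + (\<tau> * (CC * W * \<delta>))\<^sup>2 + (\<tau>\<^sup>2 * (dd * W * M1))\<^sup>2 + (\<tau>\<^sup>2 * (U0 * dd * MH))\<^sup>2)"
      by (rule sq_sum5_le)
    also have "\<dots> = 5 * (b\<^sup>2 + \<tau> ^ 4 * M2\<^sup>2 + \<tau>\<^sup>2 * (CC * W * \<delta>)\<^sup>2 + \<tau> ^ 4 * (dd * W * M1)\<^sup>2 + \<tau> ^ 4 * (U0 * dd * MH)\<^sup>2)"
      by (simp only: power_mult_distrib[of "\<tau>\<^sup>2"] power_mult_distrib[of \<tau>] power_mult[symmetric]) simp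
    also have "\<dots> \<le> 5 * (\<tau> * B\<beta> + \<tau> ^ 4 * M2\<^sup>2 + \<tau>\<^sup>2 * (CC * W * \<delta>)\<^sup>2 + \<tau> ^ 4 * (dd * W * M1)\<^sup>2 + \<tau> ^ 4 * (U0 * dd * MH)\<^sup>2)"
      using b by simp
    finally show ?thesis using first_step[OF ctx A B1 B2 Y1] unfolding CC dd_def[symmetric] by linarith
  qed
  have q1: "q_err 1 = 5 * a_err 1"
  proof -
    have "extrap e 1 = (\<lambda>x. 2 *\<^sub>R e 1 x)" by (simp add: extrap_def[abs_def] e_0)
    then show ?thesis by (simp add: q_err_def a_err_def L2_norm_scaleR power_mult_distrib)
  qed
  have d1: "\<mu> * \<tau> * d_err 1 \<ge> 0" unfolding d_err_def using \<mu>_pos \<tau>0 by simp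
  \<comment> \<open>9 = 5 + 4: since \<open>e 0\<close> vanishes, the extrapolated error at level 1
    is twice \<open>e 1\<close>, so \<open>q_err 1\<close> is five times
    \<open>a_err 1\<close>.\<close>
  have "q_err 1 + 4 * a_err 1 + \<mu> * \<tau> * d_err 1 \<le> 9 * (5 * (\<tau> * B\<beta> + \<tau> ^ 4 * M2\<^sup>2 + \<tau>\<^sup>2 * (CC * W * \<delta>)\<^sup>2 + \<tau> ^ 4 * (dd * W * M1)\<^sup>2 + \<tau> ^ 4 * (U0 * dd * MH)\<^sup>2)
            + 2 * \<tau> * (\<mu> * (dd * \<delta>)\<^sup>2 + Y\<^sup>2 / \<mu>))"
    unfolding q1 using first d1 by argo
  from add_mono[OF this residuals] have rhs: "q_err 1 + 4 * a_err 1 + \<mu> * \<tau> * d_err 1 + \<tau> * (\<Sum>m=1..n. r m) \<le>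
     9 * (5 * (\<tau> * B\<beta> + \<tau> ^ 4 * M2\<^sup>2 + \<tau>\<^sup>2 * (CC * W * \<delta>)\<^sup>2 + \<tau> ^ 4 * (dd * W * M1)\<^sup>2 + \<tau> ^ 4 * (U0 * dd * MH)\<^sup>2)
            + 2 * \<tau> * (\<mu> * (dd * \<delta>)\<^sup>2 + Y\<^sup>2 / \<mu>))
       + 4 * T * (36 * B\<beta> + 576 * \<tau> ^ 4 * B3 + 4 * T * (CC * W * \<delta>)\<^sup>2 + 64 * (dd * W)\<^sup>2 * \<tau> ^ 4 * B2)
       + 4 * T * (\<mu> * (dd * \<delta>)\<^sup>2 + Y\<^sup>2 / \<mu>)" by linarith
  show ?thesis
    using order_trans[OF energy mult_left_mono[OF rhs exp_ge_zero]] by (simp only: a_err_def d_err_def g_err_def)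
qed

end

section \<open>Comparison of the constants and conclusion\<close>

lemma final_estimate:
  fixes \<tau> T \<mu> dd CC cs cd cpi cp hk hl L C W U0 a1 a2 a3 b1 b2 b3 v1 v2 w :: real
  assumes pos: "0 \<le> \<tau>" "\<tau> \<le> T" "\<mu> > 0"
    and C: "C \<ge> 45" "C \<ge> 45 * dd\<^sup>2" "C \<ge> 2304" "C \<ge> 256 * dd\<^sup>2" "C \<ge> 189 * cs\<^sup>2" "C * L \<ge> 61 * CC\<^sup>2 * cs\<^sup>2 * cd\<^sup>2"
      "C \<ge> 22 * dd\<^sup>2 * cs\<^sup>2 * cd\<^sup>2" "C \<ge> 22 * cpi\<^sup>2 * cp\<^sup>2" and L: "L \<ge> 0"
  defines "B\<beta> \<equiv> (cs * hk)\<^sup>2 * v1\<^sup>2" and "\<delta> \<equiv> cs * hk * (cd * v2)" and "Y \<equiv> cpi * hl * (cp * w)"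
  defines "lhs \<equiv> 9 * (5 * (\<tau> * B\<beta> + \<tau> ^ 4 * a1\<^sup>2 + \<tau>\<^sup>2 * (CC * W * \<delta>)\<^sup>2 + \<tau> ^ 4 * (dd * W * a2)\<^sup>2 + \<tau> ^ 4 * (U0 * dd * a3)\<^sup>2)
            + 2 * \<tau> * (\<mu> * (dd * \<delta>)\<^sup>2 + Y\<^sup>2 / \<mu>))
       + 4 * T * (36 * B\<beta> + 576 * \<tau> ^ 4 * b1\<^sup>2 + 4 * T * (CC * W * \<delta>)\<^sup>2 + 64 * (dd * W)\<^sup>2 * \<tau> ^ 4 * b2\<^sup>2)
       + 4 * T * (\<mu> * (dd * \<delta>)\<^sup>2 + Y\<^sup>2 / \<mu>)"
    and "rhs \<equiv> (C * (a1\<^sup>2 + W\<^sup>2 * a2\<^sup>2 + U0\<^sup>2 * a3\<^sup>2) + T * (C * (b1\<^sup>2 + W\<^sup>2 * b2\<^sup>2 + U0\<^sup>2 * b3\<^sup>2))) * \<tau> ^ 4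
      + T * (C * (v1\<^sup>2 + (\<mu> + T * L * W\<^sup>2) * v2\<^sup>2) * hk\<^sup>2 + C / \<mu> * w\<^sup>2 * hl\<^sup>2)"
  shows "lhs \<le> rhs" "0 \<le> rhs"
proof -
  have T: "T \<ge> 0" and C0: "C \<ge> 0" using pos C by auto
  have \<tau>2: "\<tau>\<^sup>2 \<le> T\<^sup>2" using pos by (intro power_mono) auto
  show "0 \<le> rhs" unfolding rhs_def using pos T C0 L by (intro add_nonneg_nonneg mult_nonneg_nonneg divide_nonneg_nonneg) auto
  have B0: "B\<beta> \<ge> 0" by (simp add: B\<beta>_def)
  define Z where "Z = \<mu> * (dd * \<delta>)\<^sup>2 + Y\<^sup>2 / \<mu>"
  have Z0: "Z \<ge> 0" using pos by (simp add: Z_def)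
  have 1: "45 * (\<tau> * B\<beta>) \<le> 45 * (T * B\<beta>)" using pos B0 by (intro mult_left_mono mult_right_mono) auto
  have 2: "45 * (\<tau>\<^sup>2 * (CC * W * \<delta>)\<^sup>2) \<le> 45 * (T\<^sup>2 * (CC * W * \<delta>)\<^sup>2)" using \<tau>2 by (intro mult_left_mono mult_right_mono) auto
  have 3: "18 * (\<tau> * Z) \<le> 18 * (T * Z)"
    using pos Z0 by (intro mult_left_mono mult_right_mono) auto
  \<comment> \<open>With \<tau> <= T the spatial errors of the first step take on the same powers of
    T as those of the later ones and like terms are collected: 189 = 45 + 144, 61 = 45 + 16, 22 = 18
    + 4.\<close>
  have "lhs \<le> 189 * (T * B\<beta>) + 61 * (T\<^sup>2 * (CC * W * \<delta>)\<^sup>2) + 22 * (T * Z)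
     + 45 * (\<tau> ^ 4 * a1\<^sup>2) + 45 * (\<tau> ^ 4 * (dd * W * a2)\<^sup>2) + 45 * (\<tau> ^ 4 * (U0 * dd * a3)\<^sup>2)
     + 2304 * (T * (\<tau> ^ 4 * b1\<^sup>2)) + 256 * (T * ((dd * W)\<^sup>2 * \<tau> ^ 4 * b2\<^sup>2))"
    using 1 2 3 unfolding lhs_def Z_def[symmetric] by (simp add: algebra_simps power2_eq_square[of T])
  also have "\<dots> = 189 * cs\<^sup>2 * (T * hk\<^sup>2 * v1\<^sup>2) + 61 * CC\<^sup>2 * cs\<^sup>2 * cd\<^sup>2 * (T\<^sup>2 * W\<^sup>2 * hk\<^sup>2 * v2\<^sup>2)
     + 22 * dd\<^sup>2 * cs\<^sup>2 * cd\<^sup>2 * (T * \<mu> * hk\<^sup>2 * v2\<^sup>2) + 22 * cpi\<^sup>2 * cp\<^sup>2 * (T * hl\<^sup>2 * w\<^sup>2 / \<mu>)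
     + 45 * (\<tau> ^ 4 * a1\<^sup>2) + 45 * dd\<^sup>2 * (\<tau> ^ 4 * W\<^sup>2 * a2\<^sup>2) + 45 * dd\<^sup>2 * (\<tau> ^ 4 * U0\<^sup>2 * a3\<^sup>2)
     + 2304 * (T * \<tau> ^ 4 * b1\<^sup>2) + 256 * dd\<^sup>2 * (T * W\<^sup>2 * \<tau> ^ 4 * b2\<^sup>2)"
    unfolding Z_def B\<beta>_def \<delta>_def Y_def power_mult_distrib by (simp add: algebra_simps)
  \<comment> \<open>One premise on C for each coefficient. The convective one involves
    \<open>C * L\<close> because the target contains T L W^2, where L will be
    |\<Omega>|^(2/d).\<close>
  also have "\<dots> \<le> C * (T * hk\<^sup>2 * v1\<^sup>2) + C * L * (T\<^sup>2 * W\<^sup>2 * hk\<^sup>2 * v2\<^sup>2)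
     + C * (T * \<mu> * hk\<^sup>2 * v2\<^sup>2) + C * (T * hl\<^sup>2 * w\<^sup>2 / \<mu>)
     + C * (\<tau> ^ 4 * a1\<^sup>2) + C * (\<tau> ^ 4 * W\<^sup>2 * a2\<^sup>2) + C * (\<tau> ^ 4 * U0\<^sup>2 * a3\<^sup>2)
     + C * (T * \<tau> ^ 4 * b1\<^sup>2) + C * (T * W\<^sup>2 * \<tau> ^ 4 * b2\<^sup>2)"
    using pos T by (intro add_mono mult_right_mono C mult_nonneg_nonneg divide_nonneg_nonneg) auto
  also have "\<dots> \<le> C * (T * hk\<^sup>2 * v1\<^sup>2) + C * L * (T\<^sup>2 * W\<^sup>2 * hk\<^sup>2 * v2\<^sup>2)
     + C * (T * \<mu> * hk\<^sup>2 * v2\<^sup>2) + C * (T * hl\<^sup>2 * w\<^sup>2 / \<mu>)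
     + C * (\<tau> ^ 4 * a1\<^sup>2) + C * (\<tau> ^ 4 * W\<^sup>2 * a2\<^sup>2) + C * (\<tau> ^ 4 * U0\<^sup>2 * a3\<^sup>2)
     + C * (T * \<tau> ^ 4 * b1\<^sup>2) + C * (T * W\<^sup>2 * \<tau> ^ 4 * b2\<^sup>2) + C * (T * U0\<^sup>2 * b3\<^sup>2 * \<tau> ^ 4)"
    using C0 T by simp
  also have "\<dots> = rhs" unfolding rhs_def by (simp add: algebra_simps power2_eq_square[of T])
  finally show "lhs \<le> rhs" .
qed

text \<open>From ln x <= x - 1. The bound is uniform in h, so the logarithm in the sup-norm estimate
  costs only a constant depending on the size of \<Omega>.\<close>

lemma mult_ln_le:
  fixes h L :: real
  assumes "h > 0" "h < 1" "L > 0"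
  shows "h * ln (L / h) ^ (if P then 0 else 1) \<le> 1 + L"
proof -
  have "h * ln (L / h) \<le> h * (L / h - 1)" using assms by (intro mult_left_mono ln_le_minus_one) auto
  also have "\<dots> = L - h" using assms by (simp add: algebra_simps)
  finally show ?thesis using assms by auto
qed

lemma (in bounded_open_set) sobolev_W1i:
  assumes "v \<in> H1" "v \<in> sobolev_space 1 \<infinity> \<Omega>" shows "v \<in> W1i"
  using assms W_Li[OF assms(2)] W_wD(2)[OF assms(2), of "unit_mi _"] by (auto simp: W1i_def)

text \<open>Stability of the projection, deduced from its approximation bounds through s = u - (u -
  s). One constant \<open>c1\<close> serves values and gradients; its summand 1 covers
  \<open>u\<close> itself.\<close>

lemma (in bounded_open_set) stokes_projection_Linf:
  assumes u: "u \<in> W1i" and s: "s \<in> W1i" and W: "ni u \<le> W" "\<And>j. ni (D j u) \<le> W"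
    and us: "ni (\<lambda>x. u x - s x) \<le> c * a * ni (grad \<Omega> u)" and gus: "ni (grad \<Omega> (\<lambda>x. u x - s x)) \<le> c * ni (grad \<Omega> u)"
    and c: "c > 0" "a \<le> A" "A \<ge> 1"
  defines "c1 \<equiv> (1 + c) * A * real CARD('d) + 1"
  shows "ni s \<le> c1 * W" "ni (grad \<Omega> s) \<le> c1 * W"
proof -
  have W0: "W \<ge> 0" using W(1) Linf_norm_nonneg[of \<Omega> u] by linarith
  have gu: "ni (grad \<Omega> u) \<le> real CARD('d) * W"
    using grad_Li(2)[OF W1iD(1,3)[OF u]] sum_mono[of UNIV "\<lambda>j. ni (D j u)" "\<lambda>_. W"] W(2) by fastforce
  have d0: "real CARD('d) * W \<ge> 0" using W0 by simp
  have "s = (\<lambda>x. u x - (u x - s x))" by simp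
  then have "ni s \<le> ni u + ni (\<lambda>x. u x - s x)"
    using Li_diff(2)[OF W1iD(2)[OF u] Li_diff(1)[OF W1iD(2)[OF u] W1iD(2)[OF s]]] by simp
  also have "c * a * ni (grad \<Omega> u) \<le> c * A * (real CARD('d) * W)"
    using c gu d0 Linf_norm_nonneg[of \<Omega> "grad \<Omega> u"] by (meson less_imp_le mult_left_mono mult_mono mult_nonneg_nonneg mult_right_mono order_trans zero_le_one)
  then have "ni u + ni (\<lambda>x. u x - s x) \<le> W + c * A * (real CARD('d) * W)" using W(1) us by linarith
  also have "\<dots> \<le> c1 * W"
    using mult_nonneg_nonneg[OF _ d0, of A] c by (simp add: c1_def algebra_simps)
  finally show "ni s \<le> c1 * W" .
  have H: "(\<lambda>x. u x - s x) \<in> H1" by (rule H_diff[OF W1iD(1)[OF u] W1iD(1)[OF s]])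
  have ae: "AE x in lebesgue_on \<Omega>. grad \<Omega> u x - grad \<Omega> s x = grad \<Omega> (\<lambda>x. u x - s x) x"
    using grad_diff[OF W1iD(1)[OF u] W1iD(1)[OF s]] by eventually_elim simp
  have gd: "grad \<Omega> (\<lambda>x. u x - s x) \<in> Li" "ni (\<lambda>x. grad \<Omega> u x - grad \<Omega> s x) \<le> ni (grad \<Omega> (\<lambda>x. u x - s x))"
  proof -
    show g: "grad \<Omega> (\<lambda>x. u x - s x) \<in> Li" by (rule Li_cong(1)[OF Li_diff(1)[OF W1iD(6)[OF u] W1iD(6)[OF s]] ae])
    have "AE x in lebesgue_on \<Omega>. grad \<Omega> (\<lambda>x. u x - s x) x = grad \<Omega> u x - grad \<Omega> s x" using ae by eventually_elim simp
    from Li_cong(2)[OF g this] show "ni (\<lambda>x. grad \<Omega> u x - grad \<Omega> s x) \<le> ni (grad \<Omega> (\<lambda>x. u x - s x))" .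
  qed
  have "grad \<Omega> s = (\<lambda>x. grad \<Omega> u x - (grad \<Omega> u x - grad \<Omega> s x))" by simp
  then have "ni (grad \<Omega> s) \<le> ni (grad \<Omega> u) + ni (grad \<Omega> (\<lambda>x. u x - s x))"
    using Li_diff(2)[OF W1iD(6)[OF u] Li_diff(1)[OF W1iD(6)[OF u] W1iD(6)[OF s]]] gd(2) by simp
  also have "\<dots> \<le> (1 + c) * (real CARD('d) * W)" using gus mult_left_mono[OF gu, of "1 + c"] c by (simp add: algebra_simps)
  also have "\<dots> \<le> (1 + c) * (real CARD('d) * W) * A"
    using mult_left_mono[OF c(3), of "(1 + c) * (real CARD('d) * W)"] mult_nonneg_nonneg[OF _ d0, of "1 + c"] c by simp
  also have "\<dots> \<le> c1 * W" using W0 by (simp add: c1_def algebra_simps)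
  finally show "ni (grad \<Omega> s) \<le> c1 * W" .
qed

lemma time_norm_inf_nonneg: "time_norm \<infinity> T N w \<ge> 0"
  by (simp add: time_norm_def Linf_norm_nonneg)

theorem theorem2:
  fixes \<Omega> :: "(real^'d::finite) set"
    and k l :: nat
    and H :: "real set"
    and \<T> :: "real \<Rightarrow> (real^'d) set set"
    and V :: "real \<Rightarrow> (real^'d \<Rightarrow> real^'d) set"
    and Q :: "real \<Rightarrow> (real^'d \<Rightarrow> real) set"
    and \<sigma> \<beta>\<^sub>0 c_inv c_pi c_s c_inf h\<^sub>1 :: real
  assumes "CARD('d) = 2 \<or> CARD('d) = 3"
    and "polyhedral_lipschitz_domain \<Omega>"
    and "k \<ge> 1"
    and "\<sigma> > 0" "\<beta>\<^sub>0 > 0" "c_inv > 0" "c_pi > 0" "c_s > 0" "c_inf > 0" "h\<^sub>1 > 0"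
    and "fe_family \<Omega> k l H \<T> V Q \<sigma> \<beta>\<^sub>0 c_inv"
  shows "\<exists>C>0. \<forall>T \<nu> \<mu> f u0 u ut utt uttt p \<pi> s lh.
    T > 0 \<and> \<nu> > 0 \<and> \<mu> > 0 \<and>
    navier_stokes T \<Omega> \<nu> f u0 u ut p \<and>
    smooth_enough T \<Omega> k l u ut utt uttt p \<and>
    pressure_projection T \<Omega> l H \<T> Q c_pi p \<pi> \<and>
    stokes_projection T \<Omega> \<nu> H V Q f u ut p s lh \<and>
    stokes_projection_bounds T \<Omega> k H c_s c_inf h\<^sub>1 u ut s \<longrightarrow>
    (\<exists>h\<^sub>0>0. \<forall>h\<in>H. h < h\<^sub>0 \<longrightarrow>
      (\<forall>N uh ph. \<forall>n\<in>{1..N - 1}.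
        let \<Delta>t = T / real N;
            sn = (\<lambda>j. s h (real j * \<Delta>t));
            e = (\<lambda>j x. sn j x - uh j x);
            NN = stab_coeff \<Omega> \<mu> N sn
        in semi_implicit_method \<Omega> \<nu> \<mu> (V h) (Q h) f (sn 0) \<Delta>t N uh ph \<and>
           (\<forall>j\<in>{2..n + 1}. \<Delta>t * (1 / T + NN j) \<le> 1 / 2) \<longrightarrow>
           (L2_norm_on \<Omega> (e (n + 1)))\<^sup>2
           + (\<Sum>j=2..n + 1. \<nu> * \<Delta>t * (L2_norm_on \<Omega> (grad \<Omega> (e j)))\<^sup>2)
           + \<mu> * (\<Sum>j=2..n + 1. \<Delta>t * (L2_norm_on \<Omega> (divg \<Omega> (e j)))\<^sup>2)
           \<le> exp (8 + 2 * T * Max (NN ` {2..n + 1}))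
             * ((C0_sq C T \<Omega> u ut utt + T * C3_sq C T \<Omega> u utt uttt) * \<Delta>t ^ 4
                + T * (C1_sq C T \<Omega> k \<mu> u ut * h ^ (2 * k)
                       + C2_sq C T \<Omega> l \<mu> p * h ^ (2 * l + 2)))))"
proof -
  have \<Omega>: "open \<Omega>" "bounded \<Omega>" "\<Omega> \<noteq> {}" "negligible (frontier \<Omega>)"
    using assms(2) negligible_polyhedral_frontier by (auto simp: polyhedral_lipschitz_domain_def)
  interpret bounded_open_set \<Omega> by unfold_locales (rule \<Omega>)+
  have "measure lebesgue \<Omega> \<noteq> 0"
    using negligible_iff_measure0[OF lmeasurable_open[OF \<Omega>(2,1)]] open_not_negligible[OF \<Omega>(1,3)] by simp
  then have m0: "measure lebesgue \<Omega> > 0" by (simp add: zero_less_measure_iff)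
  define Ld where "Ld = measure lebesgue \<Omega> powr (1 / real CARD('d))"
  define L where "L = measure lebesgue \<Omega> powr (2 / real CARD('d))"
  have Lpos: "Ld > 0" "L > 0" using m0 by (auto simp: Ld_def L_def)
  define dd where "dd = real CARD('d)"
  define c1 where "c1 = (1 + c_inf) * (1 + Ld) * real CARD('d) + 1"
  define CC where "CC = 3 * c1 + 3/2 * real CARD('d) * c1 + 3 * real CARD('d)"
  define cd where "cd = sqrt (real (card {\<alpha> :: 'd \<Rightarrow> nat. mi_order \<alpha> \<le> k + 1}))"
  define cp where "cp = sqrt (real (card {\<alpha> :: 'd \<Rightarrow> nat. mi_order \<alpha> \<le> l + 1}))"
  \<comment> \<open>The sum of all lower bounds that \<open>final_estimate\<close> asks for, with
    2349 = 45 + 2304 and 301 = 45 + 256. It depends on the dimension, \<Omega>, k, l and the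
    constants of the projection bounds. Division by L is legitimate because a nonempty open set has
    positive measure.\<close>
  define C where "C = 2349 + 301 * dd\<^sup>2 + 189 * c_s\<^sup>2 + 61 * CC\<^sup>2 * c_s\<^sup>2 * cd\<^sup>2 / L + 22 * dd\<^sup>2 * c_s\<^sup>2 * cd\<^sup>2 + 22 * c_pi\<^sup>2 * cp\<^sup>2"
  have terms: "0 \<le> dd\<^sup>2" "0 \<le> c_s\<^sup>2" "0 \<le> 61 * CC\<^sup>2 * c_s\<^sup>2 * cd\<^sup>2 / L" "0 \<le> 22 * dd\<^sup>2 * c_s\<^sup>2 * cd\<^sup>2" "0 \<le> 22 * c_pi\<^sup>2 * cp\<^sup>2"
    using Lpos by (auto intro!: mult_nonneg_nonneg divide_nonneg_nonneg)
  have C: "C \<ge> 45" "C \<ge> 45 * dd\<^sup>2" "C \<ge> 2304" "C \<ge> 256 * dd\<^sup>2" "C \<ge> 189 * c_s\<^sup>2" "C \<ge> 61 * CC\<^sup>2 * c_s\<^sup>2 * cd\<^sup>2 / L"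
      "C \<ge> 22 * dd\<^sup>2 * c_s\<^sup>2 * cd\<^sup>2" "C \<ge> 22 * c_pi\<^sup>2 * cp\<^sup>2" "C > 0"
    unfolding C_def using terms by linarith+
  have CL: "C * L \<ge> 61 * CC\<^sup>2 * c_s\<^sup>2 * cd\<^sup>2" using C(6) Lpos by (simp add: pos_divide_le_eq)
  show ?thesis
  proof (rule exI[of _ C], intro conjI allI impI C(9))
    fix T \<nu> \<mu> :: real and f u ut utt uttt :: "real \<Rightarrow> real^'d \<Rightarrow> real^'d" and u0 :: "real^'d \<Rightarrow> real^'d"
      and p :: "real \<Rightarrow> real^'d \<Rightarrow> real" and \<pi> lh :: "real \<Rightarrow> real \<Rightarrow> real^'d \<Rightarrow> real"
      and s :: "real \<Rightarrow> real \<Rightarrow> real^'d \<Rightarrow> real^'d"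
    assume prem: "T > 0 \<and> \<nu> > 0 \<and> \<mu> > 0 \<and> navier_stokes T \<Omega> \<nu> f u0 u ut p \<and>
      smooth_enough T \<Omega> k l u ut utt uttt p \<and> pressure_projection T \<Omega> l H \<T> Q c_pi p \<pi> \<and>
      stokes_projection T \<Omega> \<nu> H V Q f u ut p s lh \<and> stokes_projection_bounds T \<Omega> k H c_s c_inf h\<^sub>1 u ut s"
    then have pos: "T > 0" "\<nu> > 0" "\<mu> > 0" and ns: "navier_stokes T \<Omega> \<nu> f u0 u ut p"
      and sm: "smooth_enough T \<Omega> k l u ut utt uttt p" and pp: "pressure_projection T \<Omega> l H \<T> Q c_pi p \<pi>"
      and sp: "stokes_projection T \<Omega> \<nu> H V Q f u ut p s lh" and sb: "stokes_projection_bounds T \<Omega> k H c_s c_inf h\<^sub>1 u ut s"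
      by blast+
    have td: "has_time_deriv T \<Omega> u ut" "has_time_deriv T \<Omega> ut utt" "has_time_deriv T \<Omega> utt uttt" and pc: "time_continuous_L2 T \<Omega> p"
      and uH: "\<And>t. t \<in> {0..T} \<Longrightarrow> u t \<in> H_space (k + 1) \<Omega>" and uW: "\<And>t. t \<in> {0..T} \<Longrightarrow> u t \<in> sobolev_space 1 \<infinity> \<Omega>"
      and pH: "\<And>t. t \<in> {0..T} \<Longrightarrow> p t \<in> H_space (l + 1) \<Omega>"
      and ts: "u \<in> time_space \<infinity> T (H_space (k + 1) \<Omega>) (H_norm (k + 1) \<Omega>)"
        "u \<in> time_space \<infinity> T (sobolev_space 1 \<infinity> \<Omega>) (sobolev_norm 1 \<infinity> \<Omega>)" "u \<in> time_space \<infinity> T Li ni"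
        "ut \<in> time_space \<infinity> T L2 n2" "ut \<in> time_space \<infinity> T H1 (H_norm 1 \<Omega>)"
        "utt \<in> time_space \<infinity> T L2 n2" "p \<in> time_space \<infinity> T (H_space (l + 1) \<Omega>) (H_norm (l + 1) \<Omega>)"
      and ts2: "ut \<in> time_space 2 T (H_space k \<Omega>) (H_norm k \<Omega>)" "utt \<in> time_space 2 T L2 n2" "uttt \<in> time_space 2 T L2 n2"
      using sm unfolding smooth_enough_def by blast+
    have fL: "\<And>t. t \<in> {0..T} \<Longrightarrow> f t \<in> L2" and uH10: "\<And>t. t \<in> {0..T} \<Longrightarrow> u t \<in> H10_space \<Omega>"
      and udiv: "\<And>t. t \<in> {0..T} \<Longrightarrow> AE x in lebesgue_on \<Omega>. divg \<Omega> (u t) x = 0"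
      using ns unfolding navier_stokes_def by blast+
    define W where "W = time_norm \<infinity> T (sobolev_norm 1 \<infinity> \<Omega>) u"
    define U0 where "U0 = time_norm \<infinity> T ni u"
    have uW1: "u t \<in> W1i" if "t \<in> {0..T}" for t by (rule sobolev_W1i[OF H10_H1[OF uH10[OF that]] uW[OF that]])
    note ucont = time_deriv_continuous_sequentially[OF td(1)]
    have Wb: "sobolev_norm 1 \<infinity> \<Omega> (u t) \<le> W" if "t \<in> {0..T}" for t
      unfolding W_def by (rule W_norm_time_bound[OF pos(1) ucont uW ts(2) that])
    have W1: "ni (u t) \<le> W" "ni (D j (u t)) \<le> W" if "t \<in> {0..T}" for t j
      using Li_le_W_norm[OF uW[OF that]] Li_wD_le[of "unit_mi j" 1 "u t"] Wb[OF that] by auto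
    have U0b: "ni (u t) \<le> U0" if "t \<in> {0..T}" for t
      unfolding U0_def by (rule Li_norm_time_bound[OF pos(1) ucont W_Li[OF uW] ts(3) that])
    have Hu: "H_norm (k + 1) \<Omega> (u t) \<le> cd * time_norm \<infinity> T (H_norm (k + 1) \<Omega>) u" if "t \<in> {0..T}" for t
      unfolding cd_def by (rule H_norm_time_bound[OF pos(1) ucont uH ts(1) that])
    have Hp: "H_norm (l + 1) \<Omega> (p t) \<le> cp * time_norm \<infinity> T (H_norm (l + 1) \<Omega>) p" if "t \<in> {0..T}" for t
      unfolding cp_def by (rule H_norm_time_bound[OF pos(1) time_continuous_sequentially[OF pc] pH ts(7) that])
    show "\<exists>h\<^sub>0>0. \<forall>h\<in>H. h < h\<^sub>0 \<longrightarrow>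
      (\<forall>N uh ph. \<forall>n\<in>{1..N - 1}.
        let \<Delta>t = T / real N;
            sn = (\<lambda>j. s h (real j * \<Delta>t));
            e = (\<lambda>j x. sn j x - uh j x);
            NN = stab_coeff \<Omega> \<mu> N sn
        in semi_implicit_method \<Omega> \<nu> \<mu> (V h) (Q h) f (sn 0) \<Delta>t N uh ph \<and>
           (\<forall>j\<in>{2..n + 1}. \<Delta>t * (1 / T + NN j) \<le> 1 / 2) \<longrightarrow>
           (L2_norm_on \<Omega> (e (n + 1)))\<^sup>2
           + (\<Sum>j=2..n + 1. \<nu> * \<Delta>t * (L2_norm_on \<Omega> (grad \<Omega> (e j)))\<^sup>2)
           + \<mu> * (\<Sum>j=2..n + 1. \<Delta>t * (L2_norm_on \<Omega> (divg \<Omega> (e j)))\<^sup>2)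
           \<le> exp (8 + 2 * T * Max (NN ` {2..n + 1}))
             * ((C0_sq C T \<Omega> u ut utt + T * C3_sq C T \<Omega> u utt uttt) * \<Delta>t ^ 4
                + T * (C1_sq C T \<Omega> k \<mu> u ut * h ^ (2 * k)
                       + C2_sq C T \<Omega> l \<mu> p * h ^ (2 * l + 2))))"
    proof (intro exI[of _ "min 1 h\<^sub>1"] conjI ballI allI impI)
      \<comment> \<open>Below \<open>h\<^sub>1\<close> the sup-norm bound on the projection is
        available, and below 1 its factor with the logarithm is bounded.\<close>
      show "0 < min 1 h\<^sub>1" using assms by simp
      fix h :: real and N n :: nat and uh :: "nat \<Rightarrow> real^'d \<Rightarrow> real^'d" and ph :: "nat \<Rightarrow> real^'d \<Rightarrow> real"
      assume h: "h \<in> H" "h < min 1 h\<^sub>1" and n: "n \<in> {1..N - 1}"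
      have fe: "h > 0" "mesh_partition \<Omega> (\<T> h)" "function_subspace (V h)" "V h \<subseteq> H10_space \<Omega>"
        "\<And>v. v \<in> V h \<Longrightarrow> piecewise_polynomial (\<T> h) k v" "function_subspace (Q h)" "Q h \<subseteq> L2_mean_zero \<Omega>"
        using assms(11) h(1) unfolding fe_family_def by blast+
      have VW: "v \<in> W1i" if "v \<in> V h" for v
        using piecewise_polynomial_Li[OF _ fe(2) fe(5)[OF that]] H10_H1 fe(4) that by (auto simp: W1i_def)
      have QL: "q \<in> L2" if "q \<in> Q h" for q using fe(7) that by (auto simp: L2_mean_zero_def)
      have st0: "discrete_stokes \<Omega> \<nu> (V h) (Q h)
        (\<lambda>x. f t x - ut t x - grad \<Omega> (u t) x *v u t x - grad_scalar \<Omega> (p t) x) (s h t) (lh h t)" if "t \<in> {0..T}" for t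
        using sp h(1) that unfolding stokes_projection_def by blast
      have sV: "s h t \<in> V h" if "t \<in> {0..T}" for t using st0[OF that] by (simp add: discrete_stokes_def)
      have \<pi>: "\<pi> h t \<in> Q h" "broken_H_norm (\<T> h) 0 (\<lambda>x. p t x - \<pi> h t x) \<le> c_pi * h ^ (l + 1) * H_norm (l + 1) \<Omega> (p t)"
        if "t \<in> {0..T}" for t
      proof -
        have "L2_projection \<Omega> (Q h) (p t) (\<pi> h t)"
          "\<forall>m\<le>1. broken_H_norm (\<T> h) m (\<lambda>x. p t x - \<pi> h t x) \<le> c_pi * h ^ (l + 1 - m) * H_norm (l + 1) \<Omega> (p t)"
          using pp h(1) that unfolding pressure_projection_def by blast+
        then show "\<pi> h t \<in> Q h" "broken_H_norm (\<T> h) 0 (\<lambda>x. p t x - \<pi> h t x) \<le> c_pi * h ^ (l + 1) * H_norm (l + 1) \<Omega> (p t)"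
          by (auto simp: L2_projection_def dest: spec[of _ 0])
      qed
      have sb': "n2 (\<lambda>x. u t x - s h t x) + h * H_norm 1 \<Omega> (\<lambda>x. u t x - s h t x) \<le> c_s * h ^ (k + 1) * H_norm (k + 1) \<Omega> (u t)"
        "ni (\<lambda>x. u t x - s h t x) \<le> c_inf * h * ln (Ld / h) ^ (if k = 1 then 0 else 1) * ni (grad \<Omega> (u t))"
        "ni (grad \<Omega> (\<lambda>x. u t x - s h t x)) \<le> c_inf * ni (grad \<Omega> (u t))" if "t \<in> {0..T}" for t
        using sb h that unfolding stokes_projection_bounds_def Ld_def by auto
      obtain st where st: "has_time_deriv T \<Omega> (s h) st"
        "AE t in lebesgue_on {0<..<T}. n2 (\<lambda>x. ut t x - st t x) \<le> c_s * h ^ k * H_norm k \<Omega> (ut t)"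
        using sb h(1) unfolding stokes_projection_bounds_def by blast
      let ?v1 = "time_norm 2 T (H_norm k \<Omega>) ut" and ?v2 = "time_norm \<infinity> T (H_norm (k + 1) \<Omega>) u"
        and ?w = "time_norm \<infinity> T (H_norm (l + 1) \<Omega>) p"
      define \<delta> where "\<delta> = c_s * h ^ k * (cd * ?v2)"
      define Y where "Y = c_pi * h ^ (l + 1) * (cp * ?w)"
      define \<beta> where "\<beta> r = c_s * h ^ k * H_norm k \<Omega> (ut r)" for r
      have \<delta>: "H_norm 1 \<Omega> (\<lambda>x. u t x - s h t x) \<le> \<delta>" if "t \<in> {0..T}" for t
      proof -
        have "h * H_norm 1 \<Omega> (\<lambda>x. u t x - s h t x) \<le> c_s * h ^ (k + 1) * H_norm (k + 1) \<Omega> (u t)"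
          using sb'(1)[OF that] L2_norm_nonneg[of \<Omega> "\<lambda>x. u t x - s h t x"] by linarith
        also have "\<dots> = h * (c_s * h ^ k * H_norm (k + 1) \<Omega> (u t))" by simp
        finally have "H_norm 1 \<Omega> (\<lambda>x. u t x - s h t x) \<le> c_s * h ^ k * H_norm (k + 1) \<Omega> (u t)" using fe(1) by simp
        also have "\<dots> \<le> \<delta>" unfolding \<delta>_def using Hu[OF that] assms(8) fe(1) by (intro mult_left_mono) auto
        finally show ?thesis .
      qed
      have c1b: "ni (s h t) \<le> c1 * W" "ni (grad \<Omega> (s h t)) \<le> c1 * W" if t: "t \<in> {0..T}" for t
        unfolding c1_def using mult_ln_le[OF fe(1) _ Lpos(1)] h(2) Lpos sb'(2,3)[OF t] assms(9)
        by (intro stokes_projection_Linf[OF uW1[OF t] VW[OF sV[OF t]] W1[OF t], where a="h * ln (Ld / h) ^ (if k = 1 then 0 else 1)"]; simp add: mult_ac)+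
      have Yb: "n2 (\<lambda>x. p t x - \<pi> h t x) \<le> Y" if t: "t \<in> {0..T}" for t
      proof -
        have "p t \<in> L2" using pc t by (simp add: time_continuous_L2_def)
        then have "(\<lambda>x. p t x - \<pi> h t x) \<in> L2" by (rule L2_diff[OF _ QL[OF \<pi>(1)[OF t]]])
        then have "n2 (\<lambda>x. p t x - \<pi> h t x) \<le> c_pi * h ^ (l + 1) * H_norm (l + 1) \<Omega> (p t)"
          using n2_le_broken_norm[OF _ fe(2) \<Omega>(4), of "\<lambda>x. p t x - \<pi> h t x"] \<pi>(2)[OF t] by linarith
        also have "\<dots> \<le> Y" unfolding Y_def using Hp[OF t] assms(7) fe(1) by (intro mult_left_mono) auto
        finally show ?thesis .
      qed
      have \<beta>L: "\<beta> \<in> Lp_space 2 {0<..<T}"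
        using L2_scaleR[OF time_space_2D(2)[OF ts2(1)], of "c_s * h ^ k"] by (simp add: \<beta>_def[abs_def])
      have \<beta>2: "(LINT r|lebesgue_on {0<..<T}. (\<beta> r)\<^sup>2) = (c_s * h ^ k)\<^sup>2 * ?v1\<^sup>2"
        by (simp only: \<beta>_def power_mult_distrib[of "c_s * h ^ k"] integral_mult_right_zero time_space_2D(3)[OF ts2(1)])
      define \<Delta>t where "\<Delta>t = T / real N"
      define sn where "sn j = s h (real j * \<Delta>t)" for j
      let ?e = "\<lambda>j x. sn j x - uh j x"
      have "(n2 (?e (n + 1)))\<^sup>2 + (\<Sum>j=2..n + 1. \<nu> * \<Delta>t * (n2 (grad \<Omega> (?e j)))\<^sup>2)
           + \<mu> * (\<Sum>j=2..n + 1. \<Delta>t * (n2 (divg \<Omega> (?e j)))\<^sup>2)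
           \<le> exp (8 + 2 * T * Max (stab_coeff \<Omega> \<mu> N sn ` {2..n + 1}))
             * ((C0_sq C T \<Omega> u ut utt + T * C3_sq C T \<Omega> u utt uttt) * \<Delta>t ^ 4
                + T * (C1_sq C T \<Omega> k \<mu> u ut * h ^ (2 * k) + C2_sq C T \<Omega> l \<mu> p * h ^ (2 * l + 2)))"
        if scheme: "semi_implicit_method \<Omega> \<nu> \<mu> (V h) (Q h) f (sn 0) \<Delta>t N uh ph"
          and small: "\<forall>j\<in>{2..n + 1}. \<Delta>t * (1 / T + stab_coeff \<Omega> \<mu> N sn j) \<le> 1 / 2"
      proof -
        \<comment> \<open>Membership of n in {1..N - 1} forces N >= 2, so the step size is a genuine
          quotient and the time level n + 1 exists.\<close>
        interpret E: semi_implicit_error \<Omega> "V h" "Q h" T \<nu> \<mu> f u ut p "\<pi> h" "s h" "lh h" N uh ph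
        proof unfold_locales
          show "N \<ge> 1" using n by auto
          show "semi_implicit_method \<Omega> \<nu> \<mu> (V h) (Q h) f (s h 0) (T / real N) N uh ph"
            using scheme by (simp add: sn_def \<Delta>t_def)
          show "p t \<in> H1" if "t \<in> {0..T}" for t by (rule H_space_mono[OF pH[OF that]]) simp
        qed (use fe VW QL pos fL time_deriv_L2[OF td(2)] uH10 uW1 udiv st0 \<pi> in auto)
        have E: "E.\<tau> = \<Delta>t" "E.sn = sn" "E.e = ?e"
          by (auto simp: E.\<tau>_def E.sn_def E.e_def E.tm_def \<Delta>t_def sn_def fun_eq_iff)
        have AE: "AE r in lebesgue_on {0<..<T}. n2 (ut r) \<le> time_norm \<infinity> T n2 ut"
          "AE r in lebesgue_on {0<..<T}. n2 (utt r) \<le> time_norm \<infinity> T n2 utt"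
          using time_space_inf_AE[OF ts(4)] time_space_inf_AE[OF ts(6)] by auto
        have n': "1 \<le> n" "n + 1 \<le> N" using n by auto
        have \<beta>0: "\<beta> r \<ge> 0" for r using assms(8) fe(1) by (simp add: \<beta>_def)
        note bound = E.error_bound[OF \<delta> W1 c1b U0b Yb td st(1) \<beta>L \<beta>0 st(2)[folded \<beta>_def]
           time_space_2D(2)[OF ts2(2)] time_space_2D(2)[OF ts2(3)] time_norm_inf_nonneg AE(1) time_norm_inf_nonneg AE(2)
           time_norm_inf_nonneg time_space_inf_AE[OF ts(5)] n',
           unfolded E \<beta>2 time_space_2D(3)[OF ts2(2), symmetric] time_space_2D(3)[OF ts2(3), symmetric]]
        have \<Delta>: "0 \<le> \<Delta>t" "\<Delta>t \<le> T" using pos n' by (auto simp: \<Delta>t_def field_simps)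
        let ?R = "(C0_sq C T \<Omega> u ut utt + T * C3_sq C T \<Omega> u utt uttt) * \<Delta>t ^ 4
                + T * (C1_sq C T \<Omega> k \<mu> u ut * h ^ (2 * k) + C2_sq C T \<Omega> l \<mu> p * h ^ (2 * l + 2))"
        have hp: "h ^ (2 * k) = (h ^ k)\<^sup>2" "h ^ (2 * l + 2) = (h ^ (l + 1))\<^sup>2"
          using power_even_eq[of h k] power_even_eq[of h "l + 1"] by simp_all
        note fin = final_estimate[OF \<Delta> pos(3) C(1-5) CL C(7,8) less_imp_le[OF Lpos(2)], where hk="h ^ k" and hl="h ^ (l + 1)"
          and ?v1.0="?v1" and ?v2.0="?v2" and w="?w" and W=W and ?U0.0=U0
          and ?a1.0="time_norm \<infinity> T n2 utt" and ?a2.0="time_norm \<infinity> T n2 ut" and ?a3.0="time_norm \<infinity> T (H_norm 1 \<Omega>) ut"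
          and ?b1.0="time_norm 2 T n2 uttt" and ?b2.0="time_norm 2 T n2 utt" and ?b3.0="time_norm 2 T (H_norm 1 \<Omega>) utt"]
        have R: "?R = (C * ((time_norm \<infinity> T n2 utt)\<^sup>2 + W\<^sup>2 * (time_norm \<infinity> T n2 ut)\<^sup>2 + U0\<^sup>2 * (time_norm \<infinity> T (H_norm 1 \<Omega>) ut)\<^sup>2)
            + T * (C * ((time_norm 2 T n2 uttt)\<^sup>2 + W\<^sup>2 * (time_norm 2 T n2 utt)\<^sup>2 + U0\<^sup>2 * (time_norm 2 T (H_norm 1 \<Omega>) utt)\<^sup>2))) * \<Delta>t ^ 4
           + T * (C * (?v1\<^sup>2 + (\<mu> + T * L * W\<^sup>2) * ?v2\<^sup>2) * (h ^ k)\<^sup>2 + C / \<mu> * ?w\<^sup>2 * (h ^ (l + 1))\<^sup>2)"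
          unfolding hp C0_sq_def C1_sq_def C2_sq_def C3_sq_def W_def[symmetric] U0_def[symmetric] L_def[symmetric] ..
        \<comment> \<open>Nonnegativity of \<open>?R\<close> allows the exponent to be raised from 2
          to the stated 8.\<close>
        have "exp (2 + 2 * T * Max (stab_coeff \<Omega> \<mu> N sn ` {2..n + 1})) * x \<le> exp (8 + 2 * T * Max (stab_coeff \<Omega> \<mu> N sn ` {2..n + 1})) * ?R"
          if "x \<le> ?R" for x
          by (rule order_trans[OF mult_left_mono[OF that] mult_right_mono[OF _ fin(2)[folded R]]]) simp_all
        note K = this[OF fin(1)[folded R], folded \<delta>_def Y_def, unfolded CC_def dd_def]
        show ?thesis by (rule order_trans[OF _ K], rule bound) (use small in simp_all)
      qed
      then show "let \<Delta>t = T / real N;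
            sn = (\<lambda>j. s h (real j * \<Delta>t));
            e = (\<lambda>j x. sn j x - uh j x);
            NN = stab_coeff \<Omega> \<mu> N sn
        in semi_implicit_method \<Omega> \<nu> \<mu> (V h) (Q h) f (sn 0) \<Delta>t N uh ph \<and>
           (\<forall>j\<in>{2..n + 1}. \<Delta>t * (1 / T + NN j) \<le> 1 / 2) \<longrightarrow>
           (L2_norm_on \<Omega> (e (n + 1)))\<^sup>2
           + (\<Sum>j=2..n + 1. \<nu> * \<Delta>t * (L2_norm_on \<Omega> (grad \<Omega> (e j)))\<^sup>2)
           + \<mu> * (\<Sum>j=2..n + 1. \<Delta>t * (L2_norm_on \<Omega> (divg \<Omega> (e j)))\<^sup>2)
           \<le> exp (8 + 2 * T * Max (NN ` {2..n + 1}))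
             * ((C0_sq C T \<Omega> u ut utt + T * C3_sq C T \<Omega> u utt uttt) * \<Delta>t ^ 4
                + T * (C1_sq C T \<Omega> k \<mu> u ut * h ^ (2 * k)
                       + C2_sq C T \<Omega> l \<mu> p * h ^ (2 * l + 2)))"
        unfolding Let_def sn_def[abs_def] \<Delta>t_def by blast
    qed
  qed
qed

end
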